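(* Let $(\mathcal T,d,m,\mathcal E,\mathcal F)$ be a uniform local tree Dirichlet space as described in the context, satisfying $\mathrm{UVG}(V)$, and let $\Psi$ be a scale function such that $\mathrm{HKE}(\Psi)$ holds. If the $L^q$-Riesz inequality $\mathrm R_q$ holds for some $q\in(1,2)$, or if the $L^p$-reverse Riesz inequality $\mathrm{RR}_p$ holds for some $p\in(2,\infty)$, then there exist $r_0\in(0,\infty)$ and $C\in(1,\infty)$ such that $$C^{-1}r\le V(r)\le Cr,\qquad C^{-1}r^2\le\Psi(r)\le Cr^2,\qquad\text{for all }r\in(0,r_0],$$ and $$C^{-1}\nu(A)\le m(A)\le C\nu(A)\quad\text{for every Borel set }A\subset\mathcal T,$$ where $\nu$ is regarded as a measure on $\mathcal T$ concentrated on $\mathcal S$.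
   Context: **Local trees.** $B(x,r)=\{y:d(x,y)<r\}$. A metric space $(\mathcal T,d)$ is a *real tree* if (i) for all $u,v$ there is a unique isometric embedding $\phi_{u,v}:[0,d(u,v)]\to\mathcal T$ with $\phi_{u,v}(0)=u$, $\phi_{u,v}(d(u,v))=v$, and (ii) every injective continuous $\kappa:[0,1]\to\mathcal T$ satisfies $\kappa([0,1])=\phi_{\kappa(0),\kappa(1)}([0,d(\kappa(0),\kappa(1))])$. It is a *uniform local tree* with constant $\iota\in(0,\mathrm{diam}(\mathcal T)]$ if every ball $B(x,\iota)$ with the restricted metric is a real tree. For $d(x,y)<\iota$, $[x,y]$ and $(x,y)$ denote the images under $\phi_{x,y}$ of $[0,d(x,y)]$ and $(0,d(x,y))$. The *skeleton* is $\mathcal S=\bigcup_{x\in\mathcal T}\bigcup_{y\in B(x,\iota)}(x,y)$. The *length measure* $\nu$ is the unique measure on the $\sigma$-field generated by these open arcs with $\nu((x,y))=d(x,y)$ whenever $x,y\in\mathcal S$, $0<d(x,y)<\iota$. A *local arc chart* is an isometric embedding $\gamma:[0,\ell]\to\mathcal T$, $\ell\in(0,\infty)$, with image in some ball $B(x,\iota)$. $\mathrm{AC}(\mathcal T)$ is the set of continuous $u:\mathcal T\to\mathbb R$ such that $u\circ\gamma$ is absolutely continuous on $[0,\ell]$ for every local arc chart $\gamma$. An *orientation* is a sequence $(\gamma_n)_{n\in\mathbb N}$ of local arc charts $\gamma_n:[0,\ell_n]\to\mathcal T$ with $\mathcal S=\bigcup_n\gamma_n((0,\ell_n))$; the weak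 gradient of $u\in\mathrm{AC}(\mathcal T)$ is $\partial u(z)=\sum_n 1_{A_n}(z)(u\circ\gamma_n)'(\gamma_n^{-1}(z))$ for $\nu$-a.e. $z\in\mathcal S$, where $A_n=\gamma_n((0,\ell_n))\setminus\bigcup_{j<n}\gamma_j((0,\ell_j))$. **Setting.** $(\mathcal T,d)$ is an unbounded, proper, geodesic, separable uniform local tree with constant $\iota$; an arbitrary orientation is fixed. $m$ is a Radon measure on $\mathcal T$ satisfying $\mathrm{UVG}(V)$: $V:[0,\infty)\to[0,\infty)$ is increasing and there is $C_V\ge1$ with $0<C_V^{-1}V(r)\le m(B(x,r))\le C_VV(r)<\infty$ and $V(2r)\le C_VV(r)$ for all $x\in\mathcal T$, $r\in(0,\infty)$. $\mathcal F$ is the set of $u\in L^2(\mathcal T,m)$ having an $m$-version $\tilde u\in\mathrm{AC}(\mathcal T)$ with $\partial\tilde u\in L^2(\mathcal S,\nu)$, and $\mathcal E(u,v)=\int_{\mathcal S}\partial\tilde u\,\partial\tilde v\,d\nu$; this is a strongly local regular symmetric Dirichlet form on $L^2(\mathcal T,m)$, independent of the orientation. Elements of $\mathcal F$ are represented by their $\mathrm{AC}$ versions. $\Delta$ is the associated non-positive self-adjoint operator on $L^2(\mathcal T,m)$, so $\mathcal F=\mathrm{Dom}((-\Delta)^{1/2})$, and $P_t=e^{t\Delta}$. The semigroup has a jointly continuous heat kernel $p_t(x,y)$. **Riesz transform.** $\mathrm{Ker}(-\Delta)=\{0\}$, $\mathrm{Dom}((-\Delta)^{-1/2})$ is dense in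 $L^2(\mathcal T,m)$, and $\|\partial(-\Delta)^{-1/2}f\|_{L^2(\mathcal S,\nu)}=\|f\|_{L^2(\mathcal T,m)}$ on it; $\mathcal R:L^2(\mathcal T,m)\to L^2(\mathcal S,\nu)$ is the unique linear isometry extending $\partial(-\Delta)^{-1/2}$. - $\mathrm R_p$: there is $C\in(0,\infty)$ with $\|\mathcal Rf\|_{L^p(\mathcal S,\nu)}\le C\|f\|_{L^p(\mathcal T,m)}$ for all $f\in L^p(\mathcal T,m)\cap L^2(\mathcal T,m)$. - $\mathrm{RR}_p$: there is $C\in(0,\infty)$ with $\|(-\Delta)^{1/2}f\|_{L^p(\mathcal T,m)}\le C\|\partial f\|_{L^p(\mathcal S,\nu)}$ for all $f\in\mathcal F$ (norms may be $+\infty$). **Heat kernel conditions.** A *scale function* is a continuous increasing bijection $\Psi:(0,\infty)\to(0,\infty)$ such that for some $C>1$, $1<\beta_1\le\beta_2<\infty$: $C^{-1}(R/r)^{\beta_1}\le\Psi(R)/\Psi(r)\le C(R/r)^{\beta_2}$ for $0<r\le R<\infty$. Put $\Phi(R,t)=\sup_{r>0}\big(\frac Rr-\frac t{\Psi(r)}\big)$. - $\mathrm{HKE}(\Psi)$: there are $C_1,c_2,\delta\in(0,\infty)$ such that for every $t>0$, $p_t(x,y)\le\frac{C_1}{m(B(x,\Psi^{-1}(t)))}\exp(-c_2\Phi(d(x,y),t))$ for $m\otimes m$-a.e. $(x,y)$, and $p_t(x,y)\ge\frac{C_1^{-1}}{m(B(x,\Psi^{-1}(t)))}$ for $m\otimes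 m$-a.e. $(x,y)$ with $d(x,y)\le\delta\Psi^{-1}(t)$. *)

theory Defs
  imports "HOL-Analysis.Analysis"
begin

text \<open>
  The space \<open>\<T>\<close> is the universe of a type of class \<open>metric_space\<close>; separability is the class
  \<open>second_countable_topology\<close>. Elements of \<open>L\<^sup>2\<close>-spaces are represented by functions, so
  all operators below are determined only up to equality almost everywhere.
\<close>

definition isometric_embedding :: "real set \<Rightarrow> (real \<Rightarrow> 'a::metric_space) \<Rightarrow> bool" where
  "isometric_embedding I \<phi> \<longleftrightarrow> (\<forall>s\<in>I. \<forall>t\<in>I. dist (\<phi> s) (\<phi> t) = dist s t)"

definition segment_param :: "'a::metric_space set \<Rightarrow> 'a \<Rightarrow> 'a \<Rightarrow> (real \<Rightarrow> 'a) \<Rightarrow> bool" where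
  "segment_param T u v \<phi> \<longleftrightarrow>
     \<phi> \<in> extensional {0..dist u v} \<and> \<phi> ` {0..dist u v} \<subseteq> T \<and>
     isometric_embedding {0..dist u v} \<phi> \<and> \<phi> 0 = u \<and> \<phi> (dist u v) = v"

definition the_segment :: "'a::metric_space set \<Rightarrow> 'a \<Rightarrow> 'a \<Rightarrow> real \<Rightarrow> 'a" where
  "the_segment T u v = (THE \<phi>. segment_param T u v \<phi>)"

text \<open>The subset \<open>T\<close> carries the restricted metric.\<close>

definition real_tree :: "'a::metric_space set \<Rightarrow> bool" where
  "real_tree T \<longleftrightarrow>
     (\<forall>u\<in>T. \<forall>v\<in>T. \<exists>!\<phi>. segment_param T u v \<phi>) \<and>
     (\<forall>\<kappa>::real \<Rightarrow> 'a. continuous_on {0..1} \<kappa> \<and> inj_on \<kappa> {0..1} \<and> \<kappa> ` {0..1} \<subseteq> T \<longrightarrow>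
        \<kappa> ` {0..1} = the_segment T (\<kappa> 0) (\<kappa> 1) ` {0..dist (\<kappa> 0) (\<kappa> 1)})"

text \<open>
  The constant \<open>\<iota>\<close> is an extended real: for an unbounded space the range \<open>(0, diam \<T>]\<close>
  contains \<open>\<infinity>\<close>.
\<close>

definition uniform_local_tree :: "'a::metric_space itself \<Rightarrow> ereal \<Rightarrow> bool" where
  "uniform_local_tree _ \<iota> \<longleftrightarrow>
     0 < \<iota> \<and> \<iota> \<le> (SUP (x, y)\<in>(UNIV :: ('a \<times> 'a) set). ereal (dist x y)) \<and>
     (\<forall>x::'a. real_tree (eball x \<iota>))"

definition proper_space :: "'a::metric_space itself \<Rightarrow> bool" where
  "proper_space _ \<longleftrightarrow> (\<forall>(x::'a) r. compact (cball x r))"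

definition geodesic_space :: "'a::metric_space itself \<Rightarrow> bool" where
  "geodesic_space _ \<longleftrightarrow> (\<forall>u v::'a. \<exists>\<phi>. segment_param UNIV u v \<phi>)"

definition open_arc :: "ereal \<Rightarrow> 'a::metric_space \<Rightarrow> 'a \<Rightarrow> 'a set" where
  "open_arc \<iota> x y = the_segment (eball x \<iota>) x y ` {0<..<dist x y}"

definition skeleton :: "ereal \<Rightarrow> 'a::metric_space set" where
  "skeleton \<iota> = (\<Union>x. \<Union>y\<in>eball x \<iota>. open_arc \<iota> x y)"

text \<open>
  For separable \<open>\<T>\<close> the \<open>\<sigma>\<close>-field below is the trace of the Borel \<open>\<sigma>\<close>-field on the skeleton, so
  \<open>A \<mapsto> \<nu> (A \<inter> skeleton \<iota>)\<close> is \<open>\<nu>\<close> regarded as a Borel measure on \<open>\<T>\<close>.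
\<close>

definition is_length_measure :: "ereal \<Rightarrow> 'a::metric_space measure \<Rightarrow> bool" where
  "is_length_measure \<iota> \<nu> \<longleftrightarrow>
     space \<nu> = skeleton \<iota> \<and>
     sets \<nu> = sigma_sets (skeleton \<iota>) {open_arc \<iota> x y |x y. y \<in> eball x \<iota>} \<and>
     (\<forall>x\<in>skeleton \<iota>. \<forall>y\<in>skeleton \<iota>. 0 < dist x y \<and> ereal (dist x y) < \<iota> \<longrightarrow>
        emeasure \<nu> (open_arc \<iota> x y) = ennreal (dist x y))"

definition local_arc_chart :: "ereal \<Rightarrow> (real \<Rightarrow> 'a::metric_space) \<Rightarrow> real \<Rightarrow> bool" where
  "local_arc_chart \<iota> \<gamma> l \<longleftrightarrow>
     0 < l \<and> isometric_embedding {0..l} \<gamma> \<and> (\<exists>x. \<gamma> ` {0..l} \<subseteq> eball x \<iota>)"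

definition abs_continuous_on_interval :: "real \<Rightarrow> real \<Rightarrow> (real \<Rightarrow> real) \<Rightarrow> bool" where
  "abs_continuous_on_interval a b f \<longleftrightarrow>
     (\<forall>\<epsilon>>0. \<exists>\<delta>>0. \<forall>(n::nat) s t.
        (\<forall>i<n. a \<le> s i \<and> s i \<le> t i \<and> t i \<le> b) \<and>
        disjoint_family_on (\<lambda>i. {s i<..<t i}) {..<n} \<and>
        (\<Sum>i<n. t i - s i) < \<delta> \<longrightarrow>
        (\<Sum>i<n. \<bar>f (t i) - f (s i)\<bar>) < \<epsilon>)"

definition AC :: "ereal \<Rightarrow> ('a::metric_space \<Rightarrow> real) set" where
  "AC \<iota> = {u. continuous_on UNIV u \<and>
     (\<forall>\<gamma> l. local_arc_chart \<iota> \<gamma> l \<longrightarrow> abs_continuous_on_interval 0 l (u \<circ> \<gamma>))}"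

definition orientation :: "ereal \<Rightarrow> (nat \<Rightarrow> real \<Rightarrow> 'a::metric_space) \<Rightarrow> (nat \<Rightarrow> real) \<Rightarrow> bool" where
  "orientation \<iota> \<gamma> l \<longleftrightarrow>
     (\<forall>n. local_arc_chart \<iota> (\<gamma> n) (l n)) \<and> skeleton \<iota> = (\<Union>n. \<gamma> n ` {0<..<l n})"

text \<open>
  \<open>u \<circ> \<gamma> n\<close> is differentiable only almost everywhere; on the exceptional null set \<^const>\<open>deriv\<close>
  takes an unspecified constant value.
\<close>

definition weak_grad ::
  "(nat \<Rightarrow> real \<Rightarrow> 'a::metric_space) \<Rightarrow> (nat \<Rightarrow> real) \<Rightarrow> ('a \<Rightarrow> real) \<Rightarrow> 'a \<Rightarrow> real" where
  "weak_grad \<gamma> l u z =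
     (\<Sum>n. indicator (\<gamma> n ` {0<..<l n} - (\<Union>j<n. \<gamma> j ` {0<..<l j})) z *
           deriv (u \<circ> \<gamma> n) (inv_into {0..l n} (\<gamma> n) z))"

definition Lp_norm :: "real \<Rightarrow> 'a measure \<Rightarrow> ('a \<Rightarrow> real) \<Rightarrow> ennreal" where
  "Lp_norm p M f =
     (let I = \<integral>\<^sup>+x. ennreal (\<bar>f x\<bar> powr p) \<partial>M
      in if I = \<infinity> then \<infinity> else ennreal (enn2real I powr (1 / p)))"

definition Lp :: "real \<Rightarrow> 'a measure \<Rightarrow> ('a \<Rightarrow> real) set" where
  "Lp p M = {f \<in> borel_measurable M. Lp_norm p M f < \<infinity>}"

definition inner_L2 :: "'a measure \<Rightarrow> ('a \<Rightarrow> real) \<Rightarrow> ('a \<Rightarrow> real) \<Rightarrow> real" where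
  "inner_L2 M f g = (\<integral>x. f x * g x \<partial>M)"

definition norm_L2 :: "'a measure \<Rightarrow> ('a \<Rightarrow> real) \<Rightarrow> real" where
  "norm_L2 M f = sqrt (inner_L2 M f f)"

text \<open>Operators are given by their graphs, which are closed under modification on null sets.\<close>

type_synonym 'a operator = "(('a \<Rightarrow> real) \<times> ('a \<Rightarrow> real)) set"

definition neg_operator :: "'a operator \<Rightarrow> 'a operator" where
  "neg_operator T = {(f, \<lambda>x. - g x) |f g. (f, g) \<in> T}"

definition dense_in_L2 :: "'a measure \<Rightarrow> ('a \<Rightarrow> real) set \<Rightarrow> bool" where
  "dense_in_L2 M D \<longleftrightarrow>
     D \<subseteq> Lp 2 M \<and> (\<forall>f\<in>Lp 2 M. \<forall>\<epsilon>>0. \<exists>h\<in>D. norm_L2 M (\<lambda>x. f x - h x) < \<epsilon>)"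

definition adjoint_operator :: "'a measure \<Rightarrow> 'a operator \<Rightarrow> 'a operator" where
  "adjoint_operator M T =
     {(f, g). f \<in> Lp 2 M \<and> g \<in> Lp 2 M \<and> (\<forall>(h, k)\<in>T. inner_L2 M k f = inner_L2 M h g)}"

definition self_adjoint :: "'a measure \<Rightarrow> 'a operator \<Rightarrow> bool" where
  "self_adjoint M T \<longleftrightarrow> dense_in_L2 M (Domain T) \<and> adjoint_operator M T = T"

text \<open>\<open>Q\<close> is \<open>A\<^sup>1\<^sup>/\<^sup>2\<close>: the non-negative self-adjoint operator with square \<open>A\<close>.\<close>

definition is_sqrt_operator :: "'a measure \<Rightarrow> 'a operator \<Rightarrow> 'a operator \<Rightarrow> bool" where
  "is_sqrt_operator M A Q \<longleftrightarrow>
     self_adjoint M Q \<and> (\<forall>(f, g)\<in>Q. 0 \<le> inner_L2 M f g) \<and> Q O Q = A"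

definition linear_L2 ::
  "'a measure \<Rightarrow> 'b measure \<Rightarrow> (('a \<Rightarrow> real) \<Rightarrow> 'b \<Rightarrow> real) \<Rightarrow> bool" where
  "linear_L2 M N L \<longleftrightarrow>
     (\<forall>f\<in>Lp 2 M. L f \<in> Lp 2 N) \<and>
     (\<forall>f\<in>Lp 2 M. \<forall>g\<in>Lp 2 M. \<forall>a b.
        AE y in N. L (\<lambda>x. a * f x + b * g x) y = a * L f y + b * L g y)"

text \<open>\<open>P t = e\<^sup>t\<^sup>G\<close>: the strongly continuous semigroup with infinitesimal generator \<open>G\<close>.\<close>

definition is_semigroup_of ::
  "'a measure \<Rightarrow> 'a operator \<Rightarrow> (real \<Rightarrow> ('a \<Rightarrow> real) \<Rightarrow> 'a \<Rightarrow> real) \<Rightarrow> bool" where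
  "is_semigroup_of M G P \<longleftrightarrow>
     (\<forall>t\<ge>0. linear_L2 M M (P t) \<and> (\<exists>K. \<forall>f\<in>Lp 2 M. norm_L2 M (P t f) \<le> K * norm_L2 M f)) \<and>
     (\<forall>f\<in>Lp 2 M. AE x in M. P 0 f x = f x) \<and>
     (\<forall>s\<ge>0. \<forall>t\<ge>0. \<forall>f\<in>Lp 2 M. AE x in M. P (s + t) f x = P s (P t f) x) \<and>
     (\<forall>f\<in>Lp 2 M. ((\<lambda>t. norm_L2 M (\<lambda>x. P t f x - f x)) \<longlongrightarrow> 0) (at_right 0)) \<and>
     G = {(f, g). f \<in> Lp 2 M \<and> g \<in> Lp 2 M \<and>
            ((\<lambda>t. norm_L2 M (\<lambda>x. (P t f x - f x) / t - g x)) \<longlongrightarrow> 0) (at_right 0)}"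

definition radon_measure :: "'a::metric_space measure \<Rightarrow> bool" where
  "radon_measure m \<longleftrightarrow>
     sets m = sets borel \<and>
     (\<forall>K. compact K \<longrightarrow> emeasure m K < \<infinity>) \<and>
     (\<forall>A\<in>sets borel. emeasure m A = (SUP K\<in>{K. compact K \<and> K \<subseteq> A}. emeasure m K))"

definition UVG :: "'a::metric_space measure \<Rightarrow> (real \<Rightarrow> real) \<Rightarrow> bool" where
  "UVG m V \<longleftrightarrow>
     (\<forall>r\<ge>0. 0 \<le> V r) \<and> mono_on {0..} V \<and>
     (\<exists>C\<ge>1. \<forall>r>0. 0 < V r / C \<and> V (2 * r) \<le> C * V r \<and>
        (\<forall>x. ennreal (V r / C) \<le> emeasure m (ball x r) \<and>
             emeasure m (ball x r) \<le> ennreal (C * V r)))"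

text \<open>The domain \<open>\<F>\<close>, each of its elements being represented by its version in \<^const>\<open>AC\<close>.\<close>

definition form_domain ::
  "ereal \<Rightarrow> 'a measure \<Rightarrow> (nat \<Rightarrow> real \<Rightarrow> 'a) \<Rightarrow> (nat \<Rightarrow> real) \<Rightarrow> 'a::metric_space measure
   \<Rightarrow> ('a \<Rightarrow> real) set" where
  "form_domain \<iota> \<nu> \<gamma> l m = {u \<in> AC \<iota>. u \<in> Lp 2 m \<and> weak_grad \<gamma> l u \<in> Lp 2 \<nu>}"

definition form ::
  "'a measure \<Rightarrow> (nat \<Rightarrow> real \<Rightarrow> 'a) \<Rightarrow> (nat \<Rightarrow> real) \<Rightarrow> ('a::metric_space \<Rightarrow> real)
   \<Rightarrow> ('a \<Rightarrow> real) \<Rightarrow> real" where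
  "form \<nu> \<gamma> l u v = (\<integral>z. weak_grad \<gamma> l u z * weak_grad \<gamma> l v z \<partial>\<nu>)"

text \<open>The operator \<open>\<Delta>\<close> associated with the form: \<open>\<E>(u, v) = - \<langle>\<Delta> u, v\<rangle>\<close> for all \<open>v \<in> \<F>\<close>.\<close>

definition laplacian ::
  "ereal \<Rightarrow> 'a measure \<Rightarrow> (nat \<Rightarrow> real \<Rightarrow> 'a) \<Rightarrow> (nat \<Rightarrow> real) \<Rightarrow> 'a::metric_space measure
   \<Rightarrow> 'a operator" where
  "laplacian \<iota> \<nu> \<gamma> l m =
     {(f, g). f \<in> Lp 2 m \<and> g \<in> Lp 2 m \<and>
        (\<exists>u\<in>form_domain \<iota> \<nu> \<gamma> l m. (AE x in m. f x = u x) \<and>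
           (\<forall>v\<in>form_domain \<iota> \<nu> \<gamma> l m. form \<nu> \<gamma> l u v = - inner_L2 m g v))}"

definition is_heat_kernel ::
  "'a::metric_space measure \<Rightarrow> (real \<Rightarrow> ('a \<Rightarrow> real) \<Rightarrow> 'a \<Rightarrow> real) \<Rightarrow> (real \<Rightarrow> 'a \<Rightarrow> 'a \<Rightarrow> real)
   \<Rightarrow> bool" where
  "is_heat_kernel m P p \<longleftrightarrow>
     continuous_on ({0<..} \<times> UNIV) (\<lambda>(t, x, y). p t x y) \<and>
     (\<forall>t>0. \<forall>f\<in>Lp 2 m. AE x in m.
        integrable m (\<lambda>y. p t x y * f y) \<and> P t f x = (\<integral>y. p t x y * f y \<partial>m))"

definition scale_function :: "(real \<Rightarrow> real) \<Rightarrow> bool" where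
  "scale_function \<Psi> \<longleftrightarrow>
     continuous_on {0<..} \<Psi> \<and> strict_mono_on {0<..} \<Psi> \<and> bij_betw \<Psi> {0<..} {0<..} \<and>
     (\<exists>C>1. \<exists>\<beta>1>1. \<exists>\<beta>2\<ge>\<beta>1. \<forall>r>0. \<forall>R\<ge>r.
        (R / r) powr \<beta>1 / C \<le> \<Psi> R / \<Psi> r \<and> \<Psi> R / \<Psi> r \<le> C * (R / r) powr \<beta>2)"

text \<open>The supremum is finite when \<open>\<Psi>\<close> is a scale function, because \<open>\<beta>1 > 1\<close>.\<close>

definition Phi :: "(real \<Rightarrow> real) \<Rightarrow> real \<Rightarrow> real \<Rightarrow> real" where
  "Phi \<Psi> R t = (SUP r\<in>{0<..}. R / r - t / \<Psi> r)"

definition HKE ::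
  "'a::metric_space measure \<Rightarrow> (real \<Rightarrow> 'a \<Rightarrow> 'a \<Rightarrow> real) \<Rightarrow> (real \<Rightarrow> real) \<Rightarrow> bool" where
  "HKE m p \<Psi> \<longleftrightarrow>
     (\<exists>C1>0. \<exists>c2>0. \<exists>\<delta>>0. \<forall>t>0.
        (AE (x, y) in m \<Otimes>\<^sub>M m.
           p t x y \<le> C1 / measure m (ball x (inv_into {0<..} \<Psi> t)) *
                     exp (- c2 * Phi \<Psi> (dist x y) t)) \<and>
        (AE (x, y) in m \<Otimes>\<^sub>M m.
           dist x y \<le> \<delta> * inv_into {0<..} \<Psi> t \<longrightarrow>
           p t x y \<ge> (1 / C1) / measure m (ball x (inv_into {0<..} \<Psi> t))))"

text \<open>
  \<open>Q\<close> stands for \<open>(-\<Delta>)\<^sup>1\<^sup>/\<^sup>2\<close>, and its converse relation for \<open>(-\<Delta>)\<^sup>-\<^sup>1\<^sup>/\<^sup>2\<close>. The latter takes values in \<open>\<F>\<close>,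
  up to the choice of the version in \<^const>\<open>AC\<close>.
\<close>

definition is_riesz_transform ::
  "ereal \<Rightarrow> 'a measure \<Rightarrow> (nat \<Rightarrow> real \<Rightarrow> 'a) \<Rightarrow> (nat \<Rightarrow> real) \<Rightarrow> 'a::metric_space measure
   \<Rightarrow> 'a operator \<Rightarrow> (('a \<Rightarrow> real) \<Rightarrow> 'a \<Rightarrow> real) \<Rightarrow> bool" where
  "is_riesz_transform \<iota> \<nu> \<gamma> l m Q R \<longleftrightarrow>
     linear_L2 m \<nu> R \<and>
     (\<forall>f\<in>Lp 2 m. norm_L2 \<nu> (R f) = norm_L2 m f) \<and>
     (\<forall>f g. (f, g) \<in> Q\<inverse> \<and> g \<in> form_domain \<iota> \<nu> \<gamma> l m \<longrightarrow> (AE z in \<nu>. R f z = weak_grad \<gamma> l g z))"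

definition Riesz_inequality ::
  "'a measure \<Rightarrow> 'a measure \<Rightarrow> (('a \<Rightarrow> real) \<Rightarrow> 'a \<Rightarrow> real) \<Rightarrow> real \<Rightarrow> bool" where
  "Riesz_inequality m \<nu> R p \<longleftrightarrow>
     (\<exists>C>0. \<forall>f\<in>Lp p m \<inter> Lp 2 m. Lp_norm p \<nu> (R f) \<le> ennreal C * Lp_norm p m f)"

definition reverse_Riesz_inequality ::
  "ereal \<Rightarrow> 'a measure \<Rightarrow> (nat \<Rightarrow> real \<Rightarrow> 'a) \<Rightarrow> (nat \<Rightarrow> real) \<Rightarrow> 'a::metric_space measure
   \<Rightarrow> 'a operator \<Rightarrow> real \<Rightarrow> bool" where
  "reverse_Riesz_inequality \<iota> \<nu> \<gamma> l m Q p \<longleftrightarrow>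
     (\<exists>C>0. \<forall>f\<in>form_domain \<iota> \<nu> \<gamma> l m. \<forall>g. (f, g) \<in> Q \<longrightarrow>
        Lp_norm p m g \<le> ennreal C * Lp_norm p \<nu> (weak_grad \<gamma> l f))"

end

theory Submission
  imports Defs
begin

text \<open>
  Let \<open>u\<close> be the average of \<open>P\<^sub>t 1\<^bsub>B(x,r)\<^esub>\<close> over \<open>\<Psi>(r) \<le> t \<le> \<Psi>(K r)\<close>; it belongs to the domain of \<open>\<Delta>\<close>.
  For small \<open>r\<close>, testing its equation with a tree cutoff of energy \<open>O(1/r)\<close> and comparing \<open>u(x)\<close> with \<open>u\<close> far
  away by Morrey's inequality \<open>|u(x) - u(y)|\<^sup>2 \<le> d(x,y) \<E>(u,u)\<close> yields \<open>\<Psi>(r) \<approx> r V(r)\<close> and \<open>\<E>(u,u) \<approx> 1/r\<close>,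
  and a test function supported near one arc yields \<open>|\<partial>u| \<le> C/r\<close>.
  With \<open>h = (-\<Delta>)\<^sup>1\<^sup>/\<^sup>2 u\<close>, the inequality \<open>\<E>(u,u)\<^sup>2 \<le> \<langle>h, u\<rangle> \<langle>-\<Delta>u, h\<rangle>\<close> bounds \<open>\<langle>h, u\<rangle>\<close> below by a
  multiple of \<open>(V(r)/r)\<^sup>1\<^sup>/\<^sup>2\<close>. Either Riesz hypothesis and Hoelder's inequality bound it above by
  \<open>C \<parallel>\<partial>u\<parallel>\<^sub>p \<parallel>u\<parallel>\<^sub>q\<close>, hence by a multiple of \<open>(V(r)/r)\<^bsup>1/q\<^esup>\<close>, where \<open>1/p + 1/q = 1\<close> and \<open>q < 2\<close>. Therefore
  \<open>V(r) \<ge> c r\<close>; disjoint balls along a geodesic give \<open>V(r) \<le> C r\<close>. Small balls centred on an arc then have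
  comparable \<open>m\<close>- and \<open>\<nu>\<close>-measure, and so have all Borel sets.
\<close>

section \<open>Absolutely continuous functions of a real variable\<close>

text \<open>The heat average is a time average because the difference quotient of the semigroup then
  telescopes: \<Delta> u is the difference of the heat flow at two times divided by the elapsed
  time, and K only has to make the later flow half the lower bound of the earlier one. With N^2 the
  energy of u, N^2 \<approx> 1/r and ||\<Delta> u|| \<le> C / (r V(r)^(1/2)) give <h, u> \<ge> N^3 /
  ||\<Delta> u|| \<ge> c (V(r)/r)^(1/2). Against the upper bound this reads (V/r)^(1/2) \<le> C
  (V/r)^(1/q), which bounds V/r below because 1/q > 1/2; at q = 2 it would say nothing. The data are
  weak: operators are relations, the semigroup has an operator bound for each time separately, and
  the kernel estimates hold almost everywhere. Positivity of the kernel is therefore derived from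
  truncation in the form, and bounds reach every point through continuity and the full support of m.
  The gradient is taken in overlapping charts; along another arc its sign may change from point to
  point, so only products of two gradients are transferred.\<close>

lemma abs_continuous_finite_family:
 assumes "abs_continuous_on_interval a b f" "0 < \<epsilon>"
 obtains \<delta> where "0 < \<delta>"
  "\<And>(X::'i set) s t. finite X \<Longrightarrow> (\<And>i. i \<in> X \<Longrightarrow> a \<le> s i \<and> s i \<le> t i \<and> t i \<le> b) \<Longrightarrow>
    disjoint_family_on (\<lambda>i. {s i<..<t i}) X \<Longrightarrow> (\<Sum>i\<in>X. t i - s i) < \<delta> \<Longrightarrow>
    (\<Sum>i\<in>X. \<bar>f (t i) - f (s i)\<bar>) < \<epsilon>"
proof -
 obtain \<delta> where d: "\<delta> > 0" and *: "\<And>(n::nat) s t.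
    (\<forall>i<n. a \<le> s i \<and> s i \<le> t i \<and> t i \<le> b) \<Longrightarrow>
    disjoint_family_on (\<lambda>i. {s i<..<t i}) {..<n} \<Longrightarrow>
    (\<Sum>i<n. t i - s i) < \<delta> \<Longrightarrow>
    (\<Sum>i<n. \<bar>f (t i) - f (s i)\<bar>) < \<epsilon>"
  using assms unfolding abs_continuous_on_interval_def by meson
 show thesis
 proof (rule that[OF d])
  fix X :: "'i set" and s t :: "'i \<Rightarrow> real"
  assume X: "finite X" "\<And>i. i \<in> X \<Longrightarrow> a \<le> s i \<and> s i \<le> t i \<and> t i \<le> b"
   "disjoint_family_on (\<lambda>i. {s i<..<t i}) X" "(\<Sum>i\<in>X. t i - s i) < \<delta>"
  obtain h where h: "bij_betw h {..<card X} X"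
   using X(1) ex_bij_betw_nat_finite[of X] by (auto simp: atLeast0LessThan)
  have s1: "(\<Sum>i<card X. \<bar>f (t (h i)) - f (s (h i))\<bar>) = (\<Sum>i\<in>X. \<bar>f (t i) - f (s i)\<bar>)"
   by (rule sum.reindex_bij_betw[OF h])
  have s2: "(\<Sum>i<card X. t (h i) - s (h i)) = (\<Sum>i\<in>X. t i - s i)"
   by (rule sum.reindex_bij_betw[OF h])
  have "disjoint_family_on (\<lambda>i. {s (h i)<..<t (h i)}) {..<card X}"
   using X(3) h unfolding disjoint_family_on_def bij_betw_def inj_on_def by blast
  moreover have "\<forall>i<card X. a \<le> s (h i) \<and> s (h i) \<le> t (h i) \<and> t (h i) \<le> b"
   using X(2) h unfolding bij_betw_def by blast
  ultimately show "(\<Sum>i\<in>X. \<bar>f (t i) - f (s i)\<bar>) < \<epsilon>"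
   using *[of "card X" "\<lambda>i. s (h i)" "\<lambda>i. t (h i)"] s1 s2 X(4) by simp
 qed
qed

lemma abs_continuous_pair:
 assumes "abs_continuous_on_interval a b f" "0 < \<epsilon>"
 obtains \<delta> where "0 < \<delta>"
  "\<And>s t. a \<le> s \<Longrightarrow> s \<le> t \<Longrightarrow> t \<le> b \<Longrightarrow> t - s < \<delta> \<Longrightarrow> \<bar>f t - f s\<bar> < \<epsilon>"
proof -
 obtain \<delta> where d: "\<delta> > 0" and *: "\<And>(X::unit set) s t. finite X \<Longrightarrow> (\<And>i. i \<in> X \<Longrightarrow> a \<le> s i \<and> s i \<le> t i \<and> t i \<le> b) \<Longrightarrow>
    disjoint_family_on (\<lambda>i. {s i<..<t i}) X \<Longrightarrow> (\<Sum>i\<in>X. t i - s i) < \<delta> \<Longrightarrow>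
    (\<Sum>i\<in>X. \<bar>f (t i) - f (s i)\<bar>) < \<epsilon>"
  by (rule abs_continuous_finite_family[OF assms, where 'i=unit]) auto
 show thesis
 proof (rule that[OF d])
  fix s t assume "a \<le> s" "s \<le> t" "t \<le> b" "t - s < \<delta>"
  then show "\<bar>f t - f s\<bar> < \<epsilon>"
   using *[of "{()}" "\<lambda>_. s" "\<lambda>_. t"] by (simp add: disjoint_family_on_def)
 qed
qed

lemma abs_continuous_imp_continuous_on:
 assumes "abs_continuous_on_interval a b f"
 shows "continuous_on {a..b} f"
 unfolding continuous_on_iff
proof (intro ballI allI impI)
 fix x e :: real assume x: "x \<in> {a..b}" and e: "0 < e"
 obtain \<delta> where d: "0 < \<delta>"
  and *: "\<And>s t. a \<le> s \<Longrightarrow> s \<le> t \<Longrightarrow> t \<le> b \<Longrightarrow> t - s < \<delta> \<Longrightarrow> \<bar>f t - f s\<bar> < e"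
  by (rule abs_continuous_pair[OF assms e]) auto
 show "\<exists>d>0. \<forall>x'\<in>{a..b}. dist x' x < d \<longrightarrow> dist (f x') (f x) < e"
 proof (intro exI[of _ \<delta>] conjI ballI impI d)
  fix x' assume "x' \<in> {a..b}" "dist x' x < \<delta>"
  then show "dist (f x') (f x) < e"
   using *[of x x'] *[of x' x] x by (cases "x \<le> x'") (auto simp: dist_real_def abs_if split: if_splits)
 qed
qed

section \<open>Finite families of disjoint intervals and Vitali coverings\<close>

abbreviation "covered F \<equiv> \<Union>I\<in>F. {fst I..snd I :: real}"

abbreviation "separated \<equiv> pairwise (\<lambda>I J. disjnt {fst I..snd I :: real} {fst J..snd J})"

abbreviation "nonoverlapping \<equiv> disjoint_family_on (\<lambda>I. {fst I<..<snd I :: real})"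

text \<open>Induction on the number of intervals: split off the one with the largest right end,
  \<open>P = (u, v)\<close>, fill \<open>{c..u}\<close> by induction and add the gap
  \<open>(v, d)\<close>. The equation is quantified over \<open>h\<close> after \<open>G\<close>, so
  that one family of gaps serves both for the identity, which measures lengths, and for the function
  under study.\<close>

lemma interval_gaps:
 fixes F :: "(real \<times> real) set"
 assumes "finite F" "c \<le> d"
  "\<And>u v. (u, v) \<in> F \<Longrightarrow> c \<le> u \<and> u < v \<and> v \<le> d"
  "separated F"
 shows "\<exists>G. finite G \<and> (\<forall>(u, v)\<in>G. c \<le> u \<and> u \<le> v \<and> v \<le> d) \<and>
  nonoverlapping G \<and>
  (\<forall>h::real \<Rightarrow> real. (\<Sum>I\<in>F. h (snd I) - h (fst I)) + (\<Sum>I\<in>G. h (snd I) - h (fst I)) = h d - h c)"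
 using assms
proof (induction "card F" arbitrary: F d rule: less_induct)
 case (less F)
 show ?case
 proof (cases "F = {}")
  case True
  then show ?thesis
   using less.prems by (intro exI[of _ "{(c, d)}"]) (auto simp: disjoint_family_on_def)
 next
  case False
  have fin: "finite (snd ` F)" "snd ` F \<noteq> {}" using less.prems(1) False by auto
  from Max_in[OF this] obtain P where P0: "P \<in> F" "snd P = Max (snd ` F)" by (metis imageE)
  have P: "P \<in> F" "\<And>J. J \<in> F \<Longrightarrow> snd J \<le> snd P"
   using P0 Max_ge[OF fin(1)] by auto
  obtain u v where uv: "P = (u, v)" by force
  have cuv: "c \<le> u" "u < v" "v \<le> d" using less.prems(3) P(1) uv by auto
  have lt: "snd J < u" if "J \<in> F - {P}" for J
  proof -
   obtain u' v' where J: "J = (u', v')" by force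
   have "disjnt {u'..v'} {u..v}"
    using less.prems(4) P(1) that J uv unfolding pairwise_def by force
   moreover have "v' \<le> v" "u' < v'" using P(2)[of J] that J uv less.prems(3)[of u' v'] by auto
   ultimately have "v' \<notin> {u..v}" unfolding disjnt_def by force
   then show ?thesis using \<open>v' \<le> v\<close> J by auto
  qed
  have "\<exists>G. finite G \<and> (\<forall>(u', v')\<in>G. c \<le> u' \<and> u' \<le> v' \<and> v' \<le> u) \<and>
   nonoverlapping G \<and>
   (\<forall>h::real \<Rightarrow> real. (\<Sum>I\<in>F-{P}. h (snd I) - h (fst I)) + (\<Sum>I\<in>G. h (snd I) - h (fst I)) = h u - h c)"
  proof (rule less.hyps[of "F - {P}" u])
   show "card (F - {P}) < card F" using P(1) less.prems(1) by (rule card_Diff1_less[rotated])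
   show "finite (F - {P})" using less.prems(1) by simp
   show "c \<le> u" by fact
   show "c \<le> u' \<and> u' < v' \<and> v' \<le> u" if "(u', v') \<in> F - {P}" for u' v'
    using lt[OF that] less.prems(3)[of u' v'] that by auto
   show "separated (F - {P})"
    using less.prems(4) by (rule pairwise_subset) auto
  qed
  then obtain G where G0: "finite G" "\<forall>(u', v')\<in>G. c \<le> u' \<and> u' \<le> v' \<and> v' \<le> u"
   "nonoverlapping G"
   "\<forall>h::real \<Rightarrow> real. (\<Sum>I\<in>F-{P}. h (snd I) - h (fst I)) + (\<Sum>I\<in>G. h (snd I) - h (fst I)) = h u - h c"
   by (elim exE conjE) (rule that)
  note G = G0(1) G0(1) G0(3)
  have G2: "c \<le> u' \<and> u' \<le> v' \<and> v' \<le> u" if "(u', v') \<in> G" for u' v'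
   using G0(2) that by fast
  have nG: "(v, d) \<notin> G" using G2[of v d] cuv by auto
  show ?thesis
  proof (intro exI[of _ "insert (v, d) G"] conjI allI)
   show "finite (insert (v, d) G)" using G by simp
   show "\<forall>(u, v)\<in>insert (v, d) G. c \<le> u \<and> u \<le> v \<and> v \<le> d"
    using G2 cuv by force
   show "nonoverlapping (insert (v, d) G)"
   proof (subst disjoint_family_on_insert[OF nG], intro conjI G(3))
    have "{v<..<d} \<inter> {fst I<..<snd I} = {}" if "I \<in> G" for I
     using G2[of "fst I" "snd I"] that cuv by auto
    then have "{v<..<d} \<inter> (\<Union>i\<in>G. {fst i<..<snd i}) = {}" by blast
    then show "{fst (v, d)<..<snd (v, d)} \<inter> (\<Union>i\<in>G. {fst i<..<snd i}) = {}" by simp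
   qed
   show "(\<Sum>I\<in>F. h (snd I) - h (fst I)) + (\<Sum>I\<in>insert (v, d) G. h (snd I) - h (fst I)) = h d - h c"
    for h :: "real \<Rightarrow> real"
   proof -
    have "(\<Sum>I\<in>F. h (snd I) - h (fst I)) = (h v - h u) + (\<Sum>I\<in>F-{P}. h (snd I) - h (fst I))"
     using P(1) less.prems(1) uv by (simp add: sum.remove)
    then show ?thesis using G0(4)[rule_format, of h] nG G(1) by simp
   qed
  qed
 qed
qed

text \<open>Vitali's theorem for balls gives a countable disjoint family that covers
  \<open>S\<close> up to a null set. As \<open>S\<close> has finite measure, continuity from above
  leaves finitely many members missing less than \<open>e\<close>.\<close>

lemma vitali_intervals:
 fixes \<J> :: "(real \<times> real) set"
 assumes S: "S \<in> lmeasurable" and e: "0 < e"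
  and fine: "\<And>x d. x \<in> S \<Longrightarrow> 0 < d \<Longrightarrow> \<exists>u v. (u, v) \<in> \<J> \<and> u < v \<and> u \<le> x \<and> x \<le> v \<and> v - u < d"
 obtains F where "finite F" "F \<subseteq> \<J>" "\<And>u v. (u, v) \<in> F \<Longrightarrow> u < v"
  "separated F"
  "measure lebesgue (S - covered F) < e"
proof -
 define K where "K = {I \<in> \<J>. fst I < snd I}"
 define a where "a = (\<lambda>I::real \<times> real. (fst I + snd I) / 2)"
 define r where "r = (\<lambda>I::real \<times> real. (snd I - fst I) / 2)"
 have cb: "cball (a I) (r I) = {fst I..snd I}" for I
  unfolding a_def r_def cball_eq_atLeastAtMost by (simp add: field_simps)
 obtain C where C: "countable C" "C \<subseteq> K"
   "pairwise (\<lambda>i j. disjnt (cball (a i) (r i)) (cball (a j) (r j))) C"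
   "negligible(S - (\<Union>i \<in> C. cball (a i) (r i)))"
 proof (rule Vitali_covering_theorem_cballs[of K r S a])
  show "0 < r i" if "i \<in> K" for i using that by (auto simp: K_def r_def)
  show "\<exists>i. i \<in> K \<and> x \<in> cball (a i) (r i) \<and> r i < d" if xd: "x \<in> S" "0 < d" for x d
  proof -
   obtain u v where "(u, v) \<in> \<J>" "u < v" "u \<le> x" "x \<le> v" "v - u < d" using fine[OF xd] by blast
   then show ?thesis
    unfolding cb by (intro exI[of _ "(u, v)"]) (auto simp: K_def r_def)
  qed
 qed blast
 show thesis
 proof (cases "finite C")
  case True
  show thesis
  proof (rule that[OF True])
   show "measure lebesgue (S - covered C) < e"
    using negligible_imp_measure0[OF C(4)] e by (simp add: cb)
   show "C \<subseteq> \<J>" using C(2) by (auto simp: K_def)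
   show "u < v" if "(u, v) \<in> C" for u v using C(2) that by (auto simp: K_def)
   show "separated C" using C(3) by (simp add: cb)
  qed
 next
  case False
  define D where "D = (\<lambda>n. from_nat_into C ` {..<n})"
  define A where "A = (\<lambda>n. S - covered (D n))"
  have ne: "C \<noteq> {}" using False by auto
  have DC: "D n \<subseteq> C" for n using from_nat_into[OF ne] by (auto simp: D_def)
  have Am: "A n \<in> lmeasurable" for n
   unfolding A_def D_def by (intro fmeasurable.Diff S fmeasurable.finite_UN) (auto)
  have "(\<lambda>n. measure lebesgue (A n)) \<longlonglongrightarrow> measure lebesgue (\<Inter>n. A n)"
  proof (rule Lim_measure_decseq)
   show "range A \<subseteq> sets lebesgue" using Am by auto
   have "D n \<subseteq> D k" if "n \<le> k" for n k using that unfolding D_def by (intro image_mono) auto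
   then show "decseq A" unfolding decseq_def A_def by blast
   show "emeasure lebesgue (A i) \<noteq> \<infinity>" for i using fmeasurableD2[OF Am[of i]] by simp
  qed
  moreover have "(\<Inter>n. A n) = S - covered C"
  proof -
   have "C = (\<Union>n. D n)"
   proof -
    have "(\<Union>n. D n) = range (from_nat_into C)" unfolding D_def by auto
    then show ?thesis using range_from_nat_into[OF ne C(1)] by simp
   qed
   then show ?thesis unfolding A_def by auto
  qed
  ultimately have "(\<lambda>n. measure lebesgue (A n)) \<longlonglongrightarrow> 0"
   using negligible_imp_measure0[OF C(4)] by (simp add: cb)
  from order_tendstoD(2)[OF this e]
  have "\<forall>\<^sub>F n in sequentially. measure lebesgue (A n) < e" .
  then obtain n where n: "measure lebesgue (A n) < e"
   using eventually_happens'[OF sequentially_bot] by blast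
  show thesis
  proof (rule that[of "D n"])
   show "separated (D n)"
    using pairwise_subset[OF C(3) DC[of n]] unfolding cb .
   show "measure lebesgue (S - covered (D n)) < e" using n unfolding A_def .
   show "finite (D n)" by (simp add: D_def)
   show "D n \<subseteq> \<J>" using DC[of n] C(2) by (auto simp: K_def)
   show "u < v" if "(u, v) \<in> D n" for u v using DC[of n] C(2) that by (auto simp: K_def)
  qed
 qed
qed

text \<open>Difference quotients over intervals straddling the point, rather than ending at it, make this set a \<open>G\<^sub>\<delta>\<close>.\<close>

definition straddle :: "real \<Rightarrow> real \<Rightarrow> (real \<Rightarrow> real) \<Rightarrow> real \<Rightarrow> real set" where
 "straddle a b f p = {x. a < x \<and> x < b \<and>
   (\<forall>d>0. \<exists>u v. a < u \<and> u < x \<and> x < v \<and> v < b \<and> v - u < d \<and> f v - f u < p * (v - u))}"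

lemma straddle_lmeasurable: "straddle a b f p \<in> lmeasurable"
proof -
 let ?U = "\<lambda>n::nat. \<Union>{{u<..<v} | u v. a < u \<and> v < b \<and> v - u < 1 / real (Suc n) \<and> f v - f u < p * (v - u)}"
 have "straddle a b f p = {a<..<b} \<inter> (\<Inter>n. ?U n)"
 proof (intro equalityI subsetI)
  fix x assume x: "x \<in> straddle a b f p"
  then have x1: "a < x" "x < b" by (auto simp: straddle_def)
  have "x \<in> ?U n" for n
  proof -
   have "0 < 1 / real (Suc n)" by simp
   then obtain u v where "a < u \<and> u < x \<and> x < v \<and> v < b \<and> v - u < 1 / real (Suc n) \<and> f v - f u < p * (v - u)"
    using x unfolding straddle_def by blast
   then show ?thesis by (intro UnionI[of "{u<..<v}"]) auto
  qed
  then show "x \<in> {a<..<b} \<inter> (\<Inter>n. ?U n)" using x1 by auto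
 next
  fix x assume x: "x \<in> {a<..<b} \<inter> (\<Inter>n. ?U n)"
  show "x \<in> straddle a b f p"
   unfolding straddle_def
  proof (intro CollectI conjI allI impI)
   fix d :: real assume "0 < d"
   then obtain n :: nat where n: "1 / real (Suc n) < d" using nat_approx_posE by blast
   have "x \<in> ?U n" using x by blast
   then obtain u v where "a < u \<and> v < b \<and> v - u < 1 / real (Suc n) \<and> f v - f u < p * (v - u)" "x \<in> {u<..<v}"
    by blast
   then show "\<exists>u v. a < u \<and> u < x \<and> x < v \<and> v < b \<and> v - u < d \<and> f v - f u < p * (v - u)"
    using n by (intro exI[of _ u] exI[of _ v]) auto
  qed (use x in auto)
 qed
 moreover have "open (?U n)" for n by (intro open_Union) auto
 then have "(\<Inter>n. ?U n) \<in> sets lebesgue" by (intro sets.countable_INT) (auto intro: lebesgue_openin)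
 ultimately show ?thesis
  by (simp add: fmeasurable_Int_fmeasurable)
qed

lemma disjoint_intervals_measure:
 fixes F :: "(real \<times> real) set"
 assumes "finite F" "\<And>u v. (u, v) \<in> F \<Longrightarrow> u < v"
  "separated F"
 shows "measure lebesgue (covered F) = (\<Sum>I\<in>F. snd I - fst I)"
proof -
 have "measure lebesgue (covered F) = (\<Sum>I\<in>F. measure lebesgue {fst I..snd I})"
 proof (rule measure_UNION'[OF assms(1)])
  show "pairwise (\<lambda>x y. disjnt {fst x..snd x} {fst y..snd y}) F" by (rule assms(3))
 qed auto
 also have "\<dots> = (\<Sum>I\<in>F. snd I - fst I)"
  using assms(2) by (intro sum.cong) (auto simp: less_imp_le)
 finally show ?thesis .
qed

lemma disjoint_intervals_open:
 fixes F :: "(real \<times> real) set"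
 assumes "separated F"
 shows "nonoverlapping F"
 unfolding disjoint_family_on_def
proof (intro ballI impI)
 fix I J assume "I \<in> F" "J \<in> F" "I \<noteq> J"
 then have "disjnt {fst I..snd I} {fst J..snd J}" using assms by (auto simp: pairwise_def)
 then show "{fst I<..<snd I} \<inter> {fst J<..<snd J} = {}" unfolding disjnt_def by force
qed

lemma abs_continuous_uminus:
 "abs_continuous_on_interval a b f \<Longrightarrow> abs_continuous_on_interval a b (\<lambda>x. - f x)"
 unfolding abs_continuous_on_interval_def by (simp add: abs_minus_commute)

text \<open>
 Vitali's theorem is used twice: disjoint intervals of slope below \<open>p\<close> fill the set, and inside them disjoint
 intervals of slope above \<open>q\<close> fill it again. The gaps left by the latter have small total length, so by absolute
 continuity \<open>f\<close> cannot make up for the difference of the slopes there.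
\<close>

lemma negligible_straddle_both:
 assumes ac: "abs_continuous_on_interval a b f" and pq: "p < q"
 shows "negligible (straddle a b f p \<inter> straddle a b (\<lambda>x. - f x) (- q))" (is "negligible ?S")
proof (rule ccontr)
 assume neg: "\<not> negligible ?S"
 have Sm: "?S \<in> lmeasurable"
  by (intro fmeasurable_Int_fmeasurable straddle_lmeasurable fmeasurableD)
 define c where "c = measure lebesgue ?S"
 have c: "c > 0" using neg Sm negligible_iff_measure0[OF Sm] unfolding c_def by (simp add: zero_less_measure_iff)
 have "(q - p) * c / 4 > 0" using c pq by simp
 from abs_continuous_finite_family[OF ac this, where 'i="(real\<times>real)\<times>(real\<times>real)"]
 obtain \<delta> where del: "0 < \<delta>" and acf:
  "\<And>(X::((real\<times>real)\<times>(real\<times>real)) set) s t. finite X \<Longrightarrow> (\<And>i. i \<in> X \<Longrightarrow> a \<le> s i \<and> s i \<le> t i \<and> t i \<le> b) \<Longrightarrow>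
    disjoint_family_on (\<lambda>i. {s i<..<t i}) X \<Longrightarrow> (\<Sum>i\<in>X. t i - s i) < \<delta> \<Longrightarrow>
    (\<Sum>i\<in>X. \<bar>f (t i) - f (s i)\<bar>) < (q - p) * c / 4" by blast
 \<comment> \<open>The gaps will have total length \<open>g \<le> 3 * e\<close>. The first bound
   puts this below \<delta>, the second gives \<open>L2 \<ge> 3 / 4 * c\<close>, and the third makes
   \<open>p * g\<close> at most a quarter of \<open>(q - p) * c\<close>.\<close>
 define e where "e = min (\<delta> / 4) (min (c / 8) ((q - p) * c / (16 * (\<bar>p\<bar> + 1))))"
 have e: "e > 0" "e \<le> \<delta> / 4" "e \<le> c / 8" "e \<le> (q - p) * c / (16 * (\<bar>p\<bar> + 1))"
 proof -
  show "e > 0" unfolding e_def using del c pq by (simp add: add_nonneg_pos)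
  show "e \<le> \<delta> / 4" unfolding e_def by (rule min.cobounded1)
  show "e \<le> c / 8" unfolding e_def by (rule min.coboundedI2[OF min.cobounded1])
  show "e \<le> (q - p) * c / (16 * (\<bar>p\<bar> + 1))" unfolding e_def by (rule min.coboundedI2[OF min.cobounded2])
 qed
 obtain U where U: "open U" "?S \<subseteq> U" "U - ?S \<in> lmeasurable" "emeasure lebesgue (U - ?S) < ennreal e"
  by (rule sets_lebesgue_outer_open[OF fmeasurableD[OF Sm] e(1)])
 have Um: "U \<in> lmeasurable" and mU: "measure lebesgue U < c + e"
 proof -
  have UU: "U = ?S \<union> (U - ?S)" using U(2) by blast
  show "U \<in> lmeasurable" by (subst UU) (intro fmeasurable.Un Sm U(3))
  have "measure lebesgue (U - ?S) < e"
   using U(4) e(1) by (simp add: emeasure_eq_measure2[OF U(3)] ennreal_less_iff)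
  moreover have "measure lebesgue U \<le> measure lebesgue ?S + measure lebesgue (U - ?S)"
   by (subst UU) (intro measure_Un_le fmeasurableD Sm U(3))
  ultimately show "measure lebesgue U < c + e" unfolding c_def by simp
 qed
 \<comment> \<open>Confined to \<open>U\<close>, disjoint intervals have total length below
   \<open>c + e\<close>: the outer intervals hardly exceed the set they cover.\<close>
 define J1 where "J1 = {(u, v). a < u \<and> u < v \<and> v < b \<and> {u..v} \<subseteq> U \<and> f v - f u < p * (v - u)}"
 obtain F1 where F1: "finite F1" "F1 \<subseteq> J1" "\<And>u v. (u, v) \<in> F1 \<Longrightarrow> u < v"
  "separated F1"
  "measure lebesgue (?S - covered F1) < e"
 proof (rule vitali_intervals[OF Sm e(1), of J1])
  fix x d :: real assume x: "x \<in> ?S" and d: "0 < d"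
  obtain r where r: "r > 0" "ball x r \<subseteq> U" using U(1,2) x openE by blast
  have "min d r > 0" using d r by simp
  then obtain u v where uv: "a < u" "u < x" "x < v" "v < b" "v - u < min d r" "f v - f u < p * (v - u)"
   using x unfolding straddle_def by blast
  have "{u..v} \<subseteq> ball x r" using uv by (auto simp: dist_real_def)
  then show "\<exists>u v. (u, v) \<in> J1 \<and> u < v \<and> u \<le> x \<and> x \<le> v \<and> v - u < d"
   using uv r(2) by (intro exI[of _ u] exI[of _ v]) (auto simp: J1_def)
 qed (rule that)
 have F1J: "a < fst I" "fst I < snd I" "snd I < b" "{fst I..snd I} \<subseteq> U"
   "f (snd I) - f (fst I) < p * (snd I - fst I)" if "I \<in> F1" for I
 proof -
  have "I \<in> J1" using F1(2) that by blast
  then show "a < fst I" "fst I < snd I" "snd I < b" "{fst I..snd I} \<subseteq> U"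
   "f (snd I) - f (fst I) < p * (snd I - fst I)" unfolding J1_def by (simp_all add: case_prod_beta)
 qed
 \<comment> \<open>The error \<open>e\<close> is shared equally among the outer intervals; the
   additional 1 keeps the divisor positive when there are none.\<close>
 define k where "k = real (card F1) + 1"
 have k: "k > 0" unfolding k_def by simp
 define Q where "Q I F \<longleftrightarrow> finite F \<and> (\<forall>J\<in>F. fst I < fst J \<and> fst J < snd J \<and> snd J < snd I \<and> f (snd J) - f (fst J) > q * (snd J - fst J)) \<and>
  separated F \<and>
  measure lebesgue (?S \<inter> {fst I<..<snd I} - covered F) < e / k" for I F
 have "\<exists>F. Q I F" if I: "I \<in> F1" for I
 proof -
  define J2 where "J2 = {(u, v). fst I < u \<and> u < v \<and> v < snd I \<and> f v - f u > q * (v - u)}"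
  have ek: "e / k > 0" using e k by simp
  have m: "?S \<inter> {fst I<..<snd I} \<in> lmeasurable" using Sm by (simp add: fmeasurable_Int_fmeasurable)
  obtain F2 where F2: "finite F2" "F2 \<subseteq> J2" "\<And>u v. (u, v) \<in> F2 \<Longrightarrow> u < v"
   "separated F2"
   "measure lebesgue (?S \<inter> {fst I<..<snd I} - covered F2) < e / k"
  proof (rule vitali_intervals[OF m ek, of J2])
   fix x d :: real assume x: "x \<in> ?S \<inter> {fst I<..<snd I}" and d: "0 < d"
   have "min d (min (x - fst I) (snd I - x)) > 0" using d x by simp
   then obtain u v where uv: "a < u" "u < x" "x < v" "v < b" "v - u < min d (min (x - fst I) (snd I - x))"
     "- f v - - f u < - q * (v - u)"
    using x unfolding straddle_def by blast
   then show "\<exists>u v. (u, v) \<in> J2 \<and> u < v \<and> u \<le> x \<and> x \<le> v \<and> v - u < d"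
    by (intro exI[of _ u] exI[of _ v]) (auto simp: J2_def)
  qed (rule that)
  then show ?thesis unfolding Q_def by (intro exI[of _ F2]) (auto simp: J2_def)
 qed
 then have "\<forall>I\<in>F1. \<exists>F. Q I F" by blast
 from bchoice[OF this] obtain F2 where F2Q: "\<forall>I\<in>F1. Q I (F2 I)" by blast
 have F2: "\<And>I. I \<in> F1 \<Longrightarrow> finite (F2 I)"
  "\<And>I J. I \<in> F1 \<Longrightarrow> J \<in> F2 I \<Longrightarrow> fst I < fst J \<and> fst J < snd J \<and> snd J < snd I \<and> f (snd J) - f (fst J) > q * (snd J - fst J)"
  "\<And>I. I \<in> F1 \<Longrightarrow> separated (F2 I)"
  "\<And>I. I \<in> F1 \<Longrightarrow> measure lebesgue (?S \<inter> {fst I<..<snd I} - covered (F2 I)) < e / k"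
  using F2Q unfolding Q_def by blast+
 have "\<exists>G. finite G \<and> (\<forall>(u, v)\<in>G. fst I \<le> u \<and> u \<le> v \<and> v \<le> snd I) \<and>
  nonoverlapping G \<and>
  (\<forall>h::real \<Rightarrow> real. (\<Sum>I\<in>F2 I. h (snd I) - h (fst I)) + (\<Sum>I\<in>G. h (snd I) - h (fst I)) = h (snd I) - h (fst I))"
  if I: "I \<in> F1" for I
 proof (rule interval_gaps[OF F2(1)[OF I] _ _ F2(3)[OF I]])
  show "fst I \<le> snd I" using F1J[OF I] by simp
  show "fst I \<le> u \<and> u < v \<and> v \<le> snd I" if "(u, v) \<in> F2 I" for u v using F2(2)[OF I that] by simp
 qed
 then obtain G where G0: "\<forall>I\<in>F1. finite (G I) \<and> (\<forall>(u, v)\<in>G I. fst I \<le> u \<and> u \<le> v \<and> v \<le> snd I) \<and>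
  nonoverlapping (G I) \<and>
  (\<forall>h::real \<Rightarrow> real. (\<Sum>I\<in>F2 I. h (snd I) - h (fst I)) + (\<Sum>I\<in>G I. h (snd I) - h (fst I)) = h (snd I) - h (fst I))"
  using bchoice[of F1 "\<lambda>I G. finite G \<and> (\<forall>(u, v)\<in>G. fst I \<le> u \<and> u \<le> v \<and> v \<le> snd I) \<and>
  nonoverlapping G \<and>
  (\<forall>h::real \<Rightarrow> real. (\<Sum>I\<in>F2 I. h (snd I) - h (fst I)) + (\<Sum>I\<in>G. h (snd I) - h (fst I)) = h (snd I) - h (fst I))"]
  by blast
 have G: "finite (G I)" "nonoverlapping (G I)"
  "\<And>h::real \<Rightarrow> real. (\<Sum>I\<in>F2 I. h (snd I) - h (fst I)) + (\<Sum>I\<in>G I. h (snd I) - h (fst I)) = h (snd I) - h (fst I)"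
  if "I \<in> F1" for I using G0 that by auto
 have G2: "fst I \<le> fst J \<and> fst J \<le> snd J \<and> snd J \<le> snd I" if "I \<in> F1" "J \<in> G I" for I J
  using G0 that by (cases J) auto
 define X where "X = Sigma F1 G"
 have finX: "finite X" unfolding X_def using F1(1) G(1) by auto
 have disjF1: "nonoverlapping F1" by (rule disjoint_intervals_open[OF F1(4)])
 have disjX: "disjoint_family_on (\<lambda>i. {fst (snd i)<..<snd (snd i)}) X"
  unfolding disjoint_family_on_def
 proof (intro ballI impI)
  fix i j assume ij: "i \<in> X" "j \<in> X" "i \<noteq> j"
  obtain I J where i: "i = (I, J)" by (rule prod.exhaust)
  obtain I' J' where j: "j = (I', J')" by (rule prod.exhaust)
  have m: "I \<in> F1" "J \<in> G I" "I' \<in> F1" "J' \<in> G I'" using ij i j by (auto simp: X_def)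
  show "{fst (snd i)<..<snd (snd i)} \<inter> {fst (snd j)<..<snd (snd j)} = {}"
  proof (cases "I = I'")
   case True
   then have "J \<noteq> J'" using ij i j by simp
   then show ?thesis using G(2)[OF m(1)] m True i j unfolding disjoint_family_on_def by simp
  next
   case False
   then have "{fst I<..<snd I} \<inter> {fst I'<..<snd I'} = {}"
    using disjF1 m unfolding disjoint_family_on_def by simp
   moreover have "{fst J<..<snd J} \<subseteq> {fst I<..<snd I}" "{fst J'<..<snd J'} \<subseteq> {fst I'<..<snd I'}"
    using G2[OF m(1,2)] G2[OF m(3,4)] by auto
   ultimately have "{fst J<..<snd J} \<inter> {fst J'<..<snd J'} = {}" by blast
   then show ?thesis using i j by simp
  qed
 qed
 have sumX: "(\<Sum>i\<in>X. h (snd i)) = (\<Sum>I\<in>F1. \<Sum>J\<in>G I. h J)" for h :: "real \<times> real \<Rightarrow> real"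
  unfolding X_def using F1(1) G(1) by (subst sum.Sigma) (auto simp: case_prod_beta)
 have tot: "(\<Sum>I\<in>F1. h (snd I) - h (fst I)) = (\<Sum>I\<in>F1. \<Sum>J\<in>F2 I. h (snd J) - h (fst J)) + (\<Sum>i\<in>X. h (snd (snd i)) - h (fst (snd i)))" for h :: "real \<Rightarrow> real"
 proof -
  have "(\<Sum>i\<in>X. h (snd (snd i)) - h (fst (snd i))) = (\<Sum>I\<in>F1. \<Sum>J\<in>G I. h (snd J) - h (fst J))"
   using sumX[of "\<lambda>J. h (snd J) - h (fst J)"] by simp
  then show ?thesis using G(3) by (simp add: sum.distrib[symmetric])
 qed
 define L1 where "L1 = (\<Sum>I\<in>F1. snd I - fst I)"
 define L2 where "L2 = (\<Sum>I\<in>F1. \<Sum>J\<in>F2 I. snd J - fst J)"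
 define g where "g = (\<Sum>i\<in>X. snd (snd i) - fst (snd i))"
 have L: "L1 = L2 + g" using tot[of "\<lambda>x. x"] by (simp add: L1_def L2_def g_def)
 have mF1: "covered F1 \<in> lmeasurable"
  using F1(1) by (intro fmeasurable.finite_UN) auto
 have L1U: "L1 < c + e"
 proof -
  have "L1 = measure lebesgue (covered F1)"
   unfolding L1_def by (rule disjoint_intervals_measure[symmetric, OF F1(1,3,4)])
  also have "\<dots> \<le> measure lebesgue U"
   using F1J(4) mF1 Um by (intro measure_mono_fmeasurable) (auto simp del: UN_simps)
  finally show ?thesis using mU by simp
 qed
 have L2c: "L2 \<ge> c - 2 * e"
 proof -
  have ek: "(\<Sum>I\<in>F1. e / k) \<le> e"
   using e(1) k unfolding k_def by (simp add: field_simps)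
  have mI: "?S \<inter> {fst I<..<snd I} \<in> lmeasurable" for I using Sm by (simp add: fmeasurable_Int_fmeasurable)
  have mF2: "(\<Union>J\<in>F2 I. {fst J..snd J}) \<in> lmeasurable" if "I \<in> F1" for I
   using F2(1)[OF that] by (intro fmeasurable.finite_UN) auto
  have b: "measure lebesgue (?S \<inter> {fst I<..<snd I}) \<le> e / k + (\<Sum>J\<in>F2 I. snd J - fst J)" if I: "I \<in> F1" for I
  proof -
   let ?A = "?S \<inter> {fst I<..<snd I}" and ?B = "\<Union>J\<in>F2 I. {fst J..snd J}"
   have "measure lebesgue ?A \<le> measure lebesgue ((?A - ?B) \<union> ?B)"
    using mI mF2[OF I] by (intro measure_mono_fmeasurable fmeasurable.Un fmeasurable.Diff fmeasurableD) auto
   also have "\<dots> \<le> measure lebesgue (?A - ?B) + measure lebesgue ?B"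
    using mI mF2[OF I] by (intro measure_Un_le fmeasurableD fmeasurable.Diff)
   also have "measure lebesgue ?B = (\<Sum>J\<in>F2 I. snd J - fst J)"
    by (rule disjoint_intervals_measure[OF F2(1)[OF I] _ F2(3)[OF I]]) (use F2(2)[OF I] in force)
   finally show ?thesis using F2(4)[OF I] by simp
  qed
  \<comment> \<open>The inner covering concerns the open outer intervals, since a point needs room
    on both sides. The endpoints left out are finitely many.\<close>
  let ?E = "(\<Union>I\<in>F1. {fst I, snd I})"
  have nE: "negligible ?E" using F1(1) by (intro negligible_finite) auto
  have mE: "?E \<in> lmeasurable" using nE negligible_iff_measure by blast
  let ?R = "?S - covered F1" and ?M = "\<Union>I\<in>F1. ?S \<inter> {fst I<..<snd I}"
  have mM: "?M \<in> lmeasurable" using F1(1) mI by (intro fmeasurable.finite_UN) auto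
  have mR: "?R \<in> lmeasurable" using Sm mF1 by (intro fmeasurable.Diff) auto
  have "c \<le> measure lebesgue ((?R \<union> ?M) \<union> ?E)"
   unfolding c_def
  proof (rule measure_mono_fmeasurable)
   show "?S \<subseteq> (?R \<union> ?M) \<union> ?E"
   proof
    fix x assume "x \<in> ?S"
    then show "x \<in> (?R \<union> ?M) \<union> ?E"
     by (cases "x \<in> covered F1") (auto simp del: Union_iff, force simp: less_eq_real_def)
   qed
  qed (use Sm mM mR mE in auto)
  also have "\<dots> \<le> measure lebesgue (?R \<union> ?M) + measure lebesgue ?E"
   using mM mR mE by (intro measure_Un_le) auto
  also have "measure lebesgue ?E = 0" using nE by (rule negligible_imp_measure0)
  also have "measure lebesgue (?R \<union> ?M) \<le> measure lebesgue ?R + measure lebesgue ?M"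
   using mM mR by (intro measure_Un_le) auto
  also have "measure lebesgue ?M \<le> (\<Sum>I\<in>F1. measure lebesgue (?S \<inter> {fst I<..<snd I}))"
   using F1(1) mI by (intro measure_UNION_le) auto
  also have "\<dots> \<le> (\<Sum>I\<in>F1. e / k + (\<Sum>J\<in>F2 I. snd J - fst J))"
   by (intro sum_mono b)
  also have "\<dots> = (\<Sum>I\<in>F1. e / k) + L2" unfolding L2_def by (rule sum.distrib)
  finally show ?thesis using F1(5) ek by simp
 qed
 have "(\<Sum>i\<in>X. \<bar>f (snd (snd i)) - f (fst (snd i))\<bar>) < (q - p) * c / 4"
 proof (rule acf[OF finX _ disjX])
  show "a \<le> fst (snd i) \<and> fst (snd i) \<le> snd (snd i) \<and> snd (snd i) \<le> b" if "i \<in> X" for i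
   using that G2[of "fst i" "snd i"] F1J(1,3)[of "fst i"] unfolding X_def by force
  show "(\<Sum>i\<in>X. snd (snd i) - fst (snd i)) < \<delta>" using L L1U L2c e del g_def by simp
 qed
 then have gap: "\<bar>\<Sum>i\<in>X. f (snd (snd i)) - f (fst (snd i))\<bar> < (q - p) * c / 4"
  using sum_abs[of "\<lambda>i. f (snd (snd i)) - f (fst (snd i))" X] by linarith
 have up: "(\<Sum>I\<in>F1. f (snd I) - f (fst I)) \<le> p * L1"
  unfolding L1_def sum_distrib_left using F1J(5) by (intro sum_mono) (simp add: less_imp_le)
 have low: "(\<Sum>I\<in>F1. \<Sum>J\<in>F2 I. f (snd J) - f (fst J)) \<ge> q * L2"
  unfolding L2_def sum_distrib_left using F2(2) by (intro sum_mono) (simp add: less_imp_le)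
 \<comment> \<open>The increments over the outer intervals are at most \<open>p * L1\<close>; they
   split into increments over the inner intervals, at least \<open>q * L2\<close>, and over the
   gaps, which absolute continuity makes small.\<close>
 have "q * L2 - (q - p) * c / 4 < p * L1"
  using tot[of f] up low gap by linarith
 then have "(q - p) * L2 < (q - p) * c / 4 + p * g" using L by (simp add: algebra_simps)
 moreover have "(q - p) * L2 \<ge> (q - p) * (c - 2 * e)" using L2c pq by (intro mult_left_mono) auto
 moreover have "(q - p) * (c - 2 * e) \<ge> (q - p) * (3 / 4 * c)" using e(3) pq by (intro mult_left_mono) auto
 moreover have "p * g \<le> (q - p) * c / 4"
 proof -
  have g: "0 \<le> g" "g \<le> 3 * e"
  proof -
   show "0 \<le> g" unfolding g_def using G2 by (intro sum_nonneg) (auto simp: X_def)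
   show "g \<le> 3 * e" using L L1U L2c by linarith
  qed
  have "p * g \<le> (\<bar>p\<bar> + 1) * (3 * e)" using g e(1) by (intro mult_mono) auto
  also have "\<dots> \<le> (\<bar>p\<bar> + 1) * (4 * e)" using e(1) by (intro mult_left_mono) auto
  also have "\<dots> \<le> (q - p) * c / 4" using e(4) by (simp add: field_simps)
  finally show ?thesis .
 qed
 moreover have "(q - p) * c > 0" using pq c by simp
 ultimately show False by (simp add: field_simps)
qed

text \<open>If the part of the set in a window of length \<open>\<delta> / 2\<close> had measure
  \<open>c > 0\<close>, disjoint intervals of slope below \<open>- n\<close> inside the window would
  have total length at least \<open>c / 2\<close> but less than \<delta>. The variation over them
  would be at least \<open>n * c / 2\<close>, which exceeds 1 for \<open>n > 2 / c\<close>.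
  Negligibility is a local property, so windows suffice.\<close>

lemma negligible_straddle_infinite:
 assumes ac: "abs_continuous_on_interval a b f"
 shows "negligible (\<Inter>n::nat. straddle a b f (- real n))" (is "negligible ?S")
proof -
 from abs_continuous_finite_family[OF ac zero_less_one, where 'i="real\<times>real"]
 obtain \<delta> where del: "0 < \<delta>" and acf:
  "\<And>(X::(real\<times>real) set) s t. finite X \<Longrightarrow> (\<And>i. i \<in> X \<Longrightarrow> a \<le> s i \<and> s i \<le> t i \<and> t i \<le> b) \<Longrightarrow>
    disjoint_family_on (\<lambda>i. {s i<..<t i}) X \<Longrightarrow> (\<Sum>i\<in>X. t i - s i) < \<delta> \<Longrightarrow>
    (\<Sum>i\<in>X. \<bar>f (t i) - f (s i)\<bar>) < 1" by blast
 have Sm: "?S \<in> lmeasurable"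
 proof -
  have "?S \<in> sets lebesgue" by (intro sets.countable_INT) (auto intro: fmeasurableD straddle_lmeasurable)
  moreover have "?S \<subseteq> straddle a b f (- real 0)" by blast
  ultimately show ?thesis
   using fmeasurableI2[OF straddle_lmeasurable] by blast
 qed
 have neg: "negligible (?S \<inter> {z - \<delta> / 4<..<z + \<delta> / 4})" (is "negligible ?T") for z
 proof (rule ccontr)
  assume neg: "\<not> negligible ?T"
  have Tm: "?T \<in> lmeasurable" using Sm by (intro fmeasurable_Int_fmeasurable) auto
  define c where "c = measure lebesgue ?T"
  have c: "c > 0" using neg Tm negligible_iff_measure0[OF Tm] unfolding c_def by (simp add: zero_less_measure_iff)
  obtain n :: nat where n: "real n > 2 / c" using reals_Archimedean2 by blast
  define J where "J = {(u, v). a < u \<and> u < v \<and> v < b \<and> z - \<delta> / 4 < u \<and> v < z + \<delta> / 4 \<and> f v - f u < - real n * (v - u)}"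
  have c2: "c / 2 > 0" using c by simp
  obtain F where F: "finite F" "F \<subseteq> J" "\<And>u v. (u, v) \<in> F \<Longrightarrow> u < v"
   "separated F"
   "measure lebesgue (?T - covered F) < c / 2"
  proof (rule vitali_intervals[OF Tm c2, of J])
   fix x d :: real assume x: "x \<in> ?T" and d: "0 < d"
   have x': "x \<in> straddle a b f (- real n)" using x by blast
   have "min d (min (x - (z - \<delta> / 4)) (z + \<delta> / 4 - x)) > 0" using d x by simp
   then obtain u v where uv: "a < u" "u < x" "x < v" "v < b" "v - u < min d (min (x - (z - \<delta> / 4)) (z + \<delta> / 4 - x))"
     "f v - f u < - real n * (v - u)"
    using x' unfolding straddle_def by blast
   then show "\<exists>u v. (u, v) \<in> J \<and> u < v \<and> u \<le> x \<and> x \<le> v \<and> v - u < d"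
    by (intro exI[of _ u] exI[of _ v]) (auto simp: J_def)
  qed (rule that)
  have FJ: "a < fst I" "fst I < snd I" "snd I < b" "z - \<delta> / 4 < fst I" "snd I < z + \<delta> / 4"
   "f (snd I) - f (fst I) < - real n * (snd I - fst I)" if "I \<in> F" for I
  proof -
   have "I \<in> J" using F(2) that by blast
   then show "a < fst I" "fst I < snd I" "snd I < b" "z - \<delta> / 4 < fst I" "snd I < z + \<delta> / 4"
    "f (snd I) - f (fst I) < - real n * (snd I - fst I)" unfolding J_def by (simp_all add: case_prod_beta)
  qed
  have mF: "covered F \<in> lmeasurable"
   using F(1) by (intro fmeasurable.finite_UN) auto
  have meq: "measure lebesgue (covered F) = (\<Sum>I\<in>F. snd I - fst I)"
   by (rule disjoint_intervals_measure[OF F(1,3,4)])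
  have "measure lebesgue (covered F) \<le> measure lebesgue {z - \<delta> / 4..z + \<delta> / 4}"
  proof (rule measure_mono_fmeasurable)
   show "covered F \<subseteq> {z - \<delta> / 4..z + \<delta> / 4}"
   proof
    fix x assume "x \<in> covered F"
    then obtain I where "I \<in> F" "fst I \<le> x" "x \<le> snd I" by auto
    then show "x \<in> {z - \<delta> / 4..z + \<delta> / 4}" using FJ(4,5)[of I] by auto
   qed
  qed (use mF in auto)
  then have len: "(\<Sum>I\<in>F. snd I - fst I) < \<delta>" using meq del by simp
  have "c \<le> measure lebesgue ((?T - covered F) \<union> covered F)"
   unfolding c_def using Tm mF by (intro measure_mono_fmeasurable) auto
  also have "\<dots> \<le> measure lebesgue (?T - covered F) + measure lebesgue (covered F)"
   using Tm mF by (intro measure_Un_le) auto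
  finally have low: "c / 2 \<le> (\<Sum>I\<in>F. snd I - fst I)" using F(5) meq by simp
  have "real n * (c / 2) \<le> real n * (\<Sum>I\<in>F. snd I - fst I)" using low by (intro mult_left_mono) auto
  also have "\<dots> = (\<Sum>I\<in>F. real n * (snd I - fst I))" by (rule sum_distrib_left)
  also have "\<dots> \<le> (\<Sum>I\<in>F. \<bar>f (snd I) - f (fst I)\<bar>)"
   using FJ(6) by (intro sum_mono) fastforce
  also have "\<dots> < 1"
  proof (rule acf[OF F(1) _ disjoint_intervals_open[OF F(4)] len])
   show "a \<le> fst i \<and> fst i \<le> snd i \<and> snd i \<le> b" if "i \<in> F" for i using FJ(1-3)[OF that] by simp
  qed
  finally have "real n * c < 2" by simp
  then show False using n c by (simp add: field_simps)
 qed
 show ?thesis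
 proof (subst locally_negligible_alt, intro ballI)
  fix z assume z: "z \<in> ?S"
  show "\<exists>U. openin (top_of_set ?S) U \<and> z \<in> U \<and> negligible U"
   using neg[of z] z del by (intro exI[of _ "?S \<inter> {z - \<delta> / 4<..<z + \<delta> / 4}"]) (auto intro: openin_open_Int)
 qed
qed

section \<open>Differentiability almost everywhere and the fundamental theorem of calculus\<close>

lemma straddle_limit_imp_derivative:
 assumes cont: "isCont f x" and ab: "a < x" "x < b"
  and lim: "\<And>e. 0 < e \<Longrightarrow> \<exists>d>0. \<forall>u v. a < u \<longrightarrow> u < x \<longrightarrow> x < v \<longrightarrow> v < b \<longrightarrow> v - u < d \<longrightarrow> \<bar>f v - f u - L * (v - u)\<bar> \<le> e * (v - u)"
 shows "(f has_real_derivative L) (at x)"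
 unfolding has_field_derivative_def has_derivative_at_alt
proof (intro conjI allI impI)
 fix e :: real assume "0 < e"
 from lim[OF this] obtain d where d: "d > 0" and
  *: "\<And>u v. a < u \<Longrightarrow> u < x \<Longrightarrow> x < v \<Longrightarrow> v < b \<Longrightarrow> v - u < d \<Longrightarrow> \<bar>f v - f u - L * (v - u)\<bar> \<le> e * (v - u)" by blast
 define D where "D = min d (min (x - a) (b - x))"
 have D: "D > 0" unfolding D_def using d ab by simp
 \<comment> \<open>Straddling quotients say nothing directly about intervals that end at
   \<open>x\<close>. By continuity the near endpoint may tend to \<open>x\<close> while the other
   stays fixed.\<close>
 have tl: "(f \<longlongrightarrow> f x) (at_left x)" and tr: "(f \<longlongrightarrow> f x) (at_right x)"
  using cont unfolding isCont_def filterlim_at_split by auto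
 show "\<exists>d>0. \<forall>y. norm (y - x) < d \<longrightarrow> norm (f y - f x - L * (y - x)) \<le> e * norm (y - x)"
 proof (intro exI[of _ D] conjI D allI impI)
  fix y assume y: "norm (y - x) < D"
  consider "y = x" | "y > x" | "y < x" by linarith
  then show "norm (f y - f x - L * (y - x)) \<le> e * norm (y - x)"
  proof cases
   case 2
   have "\<forall>\<^sub>F u in at_left x. \<bar>f y - f u - L * (y - u)\<bar> \<le> e * (y - u)"
   proof -
    have "\<forall>\<^sub>F u in at_left x. u \<in> {max a (y - d)<..<x}"
     using 2 y ab by (intro eventually_at_leftI[of "max a (y - d)"]) (auto simp: D_def)
    then show ?thesis
     by eventually_elim (intro *, use 2 y in \<open>auto simp: D_def\<close>)
   qed
   moreover have "((\<lambda>u. \<bar>f y - f u - L * (y - u)\<bar>) \<longlongrightarrow> \<bar>f y - f x - L * (y - x)\<bar>) (at_left x)"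
    by (intro tendsto_intros tl)
   moreover have "((\<lambda>u. e * (y - u)) \<longlongrightarrow> e * (y - x)) (at_left x)" by (intro tendsto_intros)
   ultimately have "\<bar>f y - f x - L * (y - x)\<bar> \<le> e * (y - x)"
    using tendsto_le[of "at_left x"] trivial_limit_at_left_real by blast
   then show ?thesis using 2 by simp
  next
   case 3
   have "\<forall>\<^sub>F v in at_right x. \<bar>f v - f y - L * (v - y)\<bar> \<le> e * (v - y)"
   proof -
    have "\<forall>\<^sub>F v in at_right x. v \<in> {x<..<min b (y + d)}"
     using 3 y ab by (intro eventually_at_rightI[of x "min b (y + d)"]) (auto simp: D_def)
    then show ?thesis
     by eventually_elim (intro *, use 3 y in \<open>auto simp: D_def\<close>)
   qed
   moreover have "((\<lambda>v. \<bar>f v - f y - L * (v - y)\<bar>) \<longlongrightarrow> \<bar>f x - f y - L * (x - y)\<bar>) (at_right x)"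
    by (intro tendsto_intros tr)
   moreover have "((\<lambda>v. e * (v - y)) \<longlongrightarrow> e * (x - y)) (at_right x)" by (intro tendsto_intros)
   ultimately have "\<bar>f x - f y - L * (x - y)\<bar> \<le> e * (x - y)"
    using tendsto_le[of "at_right x"] trivial_limit_at_right_real by blast
   moreover have "f y - f x - L * (y - x) = - (f x - f y - L * (x - y))" by (simp add: algebra_simps)
   ultimately show ?thesis using 3 by (simp only: real_norm_def abs_minus_cancel) simp
  qed simp
 qed
qed (simp add: bounded_linear_mult_right)

text \<open>In the proof \<open>?A p\<close> says that slopes below \<open>p\<close>, and
  \<open>?B q\<close> that slopes above \<open>q\<close>, occur on arbitrarily short intervals
  around \<open>x\<close>. Off \<open>N1\<close> they never hold together for \<open>p < q\<close>;
  off \<open>N2\<close> and \<open>N3\<close> the slopes are bounded near \<open>x\<close>. So the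
  supremum \<open>L\<close> of all \<open>q\<close> with \<open>?B q\<close> is finite and separates
  the two conditions, hence is the derivative.\<close>

theorem abs_continuous_differentiable_ae:
 assumes ac: "abs_continuous_on_interval a b f"
 obtains N where "negligible N" "\<And>x. a < x \<Longrightarrow> x < b \<Longrightarrow> x \<notin> N \<Longrightarrow> f differentiable (at x)"
proof -
 let ?g = "\<lambda>x. - f x"
 have acg: "abs_continuous_on_interval a b ?g" by (rule abs_continuous_uminus[OF ac])
 define N1 where "N1 = (\<Union>(p, q)\<in>{(p, q). p \<in> \<rat> \<and> q \<in> \<rat> \<and> p < q}. straddle a b f p \<inter> straddle a b ?g (- q))"
 define N2 where "N2 = (\<Inter>n::nat. straddle a b f (- real n))"
 define N3 where "N3 = (\<Inter>n::nat. straddle a b ?g (- real n))"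
 have "countable {(p::real, q). p \<in> \<rat> \<and> q \<in> \<rat> \<and> p < q}"
  by (rule countable_subset[of _ "\<rat> \<times> \<rat>"]) (auto intro: countable_rat)
 then have n1: "negligible N1" unfolding N1_def
  using negligible_straddle_both[OF ac] by (intro negligible_countable_Union countable_image) auto
 have n2: "negligible N2" "negligible N3" unfolding N2_def N3_def
  by (rule negligible_straddle_infinite[OF ac], rule negligible_straddle_infinite[OF acg])
 show thesis
 proof (rule that[of "N1 \<union> N2 \<union> N3"])
  show "negligible (N1 \<union> N2 \<union> N3)" using n1 n2 by (intro negligible_Un)
  fix x assume x: "a < x" "x < b" "x \<notin> N1 \<union> N2 \<union> N3"
  let ?A = "\<lambda>p. x \<in> straddle a b f p" and ?B = "\<lambda>q. x \<in> straddle a b ?g (- q)"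
  \<comment> \<open>\<open>N1\<close> is a countable union over rational slopes; \<open>?A\<close>
    is monotone and \<open>?B\<close> antitone, so real slopes can be moved to rational ones between
    them.\<close>
  have AB: "\<not> (?A p \<and> ?B q)" if pq: "p < q" for p q
  proof
   assume H: "?A p \<and> ?B q"
   obtain p' where p': "p' \<in> \<rat>" "p < p'" "p' < q" using Rats_dense_in_real[OF pq] by blast
   obtain q' where q': "q' \<in> \<rat>" "p' < q'" "q' < q" using Rats_dense_in_real[OF p'(3)] by blast
   have "?A p'" using H p'(2) unfolding straddle_def
    by simp (meson less_trans mult_strict_right_mono diff_gt_0_iff_gt less_trans)
   moreover have "?B q'" using H q'(3) unfolding straddle_def
    by simp (smt (verit) mult_strict_right_mono)
   ultimately have "x \<in> N1" unfolding N1_def using p' q' by auto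
   then show False using x by blast
  qed
  have notA: "\<exists>d>0. \<forall>u v. a < u \<longrightarrow> u < x \<longrightarrow> x < v \<longrightarrow> v < b \<longrightarrow> v - u < d \<longrightarrow> p * (v - u) \<le> f v - f u" if "\<not> ?A p" for p
  proof -
   from that x(1,2) obtain d where d: "d > 0" "\<not> (\<exists>u v. a < u \<and> u < x \<and> x < v \<and> v < b \<and> v - u < d \<and> f v - f u < p * (v - u))"
    unfolding straddle_def by blast
   show ?thesis
   proof (intro exI[of _ d] conjI allI impI)
    fix u v assume "a < u" "u < x" "x < v" "v < b" "v - u < d"
    then have "\<not> f v - f u < p * (v - u)" using d(2) by blast
    then show "p * (v - u) \<le> f v - f u" by simp
   qed (fact d)
  qed
  have notB: "\<exists>d>0. \<forall>u v. a < u \<longrightarrow> u < x \<longrightarrow> x < v \<longrightarrow> v < b \<longrightarrow> v - u < d \<longrightarrow> f v - f u \<le> q * (v - u)" if "\<not> ?B q" for q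
  proof -
   from that x(1,2) obtain d where d: "d > 0" "\<not> (\<exists>u v. a < u \<and> u < x \<and> x < v \<and> v < b \<and> v - u < d \<and> - f v - - f u < - q * (v - u))"
    unfolding straddle_def by blast
   show ?thesis
   proof (intro exI[of _ d] conjI allI impI)
    fix u v assume "a < u" "u < x" "x < v" "v < b" "v - u < d"
    then have "\<not> - f v - - f u < - q * (v - u)" using d(2) by blast
    then show "f v - f u \<le> q * (v - u)" by simp
   qed (fact d)
  qed
  obtain n where n: "\<not> ?A (- real n)" using x(3) unfolding N2_def by auto
  obtain k where k: "\<not> ?B (real k)" using x(3) unfolding N3_def by auto
  have ABor: "?A p \<or> ?B q" if "q < p" for p q
  proof (rule ccontr)
   assume H: "\<not> (?A p \<or> ?B q)"
   obtain d1 where d1: "d1 > 0" "\<forall>u v. a < u \<longrightarrow> u < x \<longrightarrow> x < v \<longrightarrow> v < b \<longrightarrow> v - u < d1 \<longrightarrow> p * (v - u) \<le> f v - f u"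
    using notA H by blast
   obtain d2 where d2: "d2 > 0" "\<forall>u v. a < u \<longrightarrow> u < x \<longrightarrow> x < v \<longrightarrow> v < b \<longrightarrow> v - u < d2 \<longrightarrow> f v - f u \<le> q * (v - u)"
    using notB H by blast
   define m where "m = min (min d1 d2) (min (x - a) (b - x))"
   have m: "m > 0" "m \<le> d1" "m \<le> d2" "m \<le> x - a" "m \<le> b - x" unfolding m_def using d1 d2 x by auto
   define e where "e = m / 3"
   have e: "e > 0" "e < x - a" "e < b - x" "2 * e < d1" "2 * e < d2" unfolding e_def using m by auto
   have "p * ((x + e) - (x - e)) \<le> f (x + e) - f (x - e)" by (rule d1(2)[rule_format]) (use e in auto)
   moreover have "f (x + e) - f (x - e) \<le> q * ((x + e) - (x - e))" by (rule d2(2)[rule_format]) (use e in auto)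
   ultimately have "p * (2 * e) \<le> q * (2 * e)" by simp
   then show False using e(1) that by simp
  qed
  define L where "L = Sup {q. ?B q}"
  have "?B (- real n - 1)" using ABor[of "- real n - 1" "- real n"] n by linarith
  then have ne: "{q. ?B q} \<noteq> {}" by blast
  have bd: "q \<le> real k + 1" if "?B q" for q
  proof (rule ccontr)
   assume "\<not> q \<le> real k + 1"
   then have "\<not> ?A (real k + 1)" using AB[of "real k + 1" q] that by auto
   then show False using ABor[of "real k" "real k + 1"] k by auto
  qed
  then have bdd: "bdd_above {q. ?B q}" unfolding bdd_above_def by blast
  have "(f has_real_derivative L) (at x)"
  proof (rule straddle_limit_imp_derivative[OF _ x(1,2)])
   show "isCont f x"
    using abs_continuous_imp_continuous_on[OF ac] x(1,2) by (intro continuous_on_interior[of "{a..b}"]) auto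
   fix e :: real assume e: "0 < e"
   have "\<not> ?B (L + e)" using cSup_upper[OF _ bdd, of "L + e"] e unfolding L_def by auto
   from notB[OF this] obtain d1 where d1: "d1 > 0" "\<forall>u v. a < u \<longrightarrow> u < x \<longrightarrow> x < v \<longrightarrow> v < b \<longrightarrow> v - u < d1 \<longrightarrow> f v - f u \<le> (L + e) * (v - u)"
    by blast
   obtain q where "?B q" "q > L - e" using less_cSup_iff[OF ne bdd, of "L - e"] e unfolding L_def by auto
   then have "\<not> ?A (L - e)" using AB by blast
   from notA[OF this] obtain d2 where d2: "d2 > 0" "\<forall>u v. a < u \<longrightarrow> u < x \<longrightarrow> x < v \<longrightarrow> v < b \<longrightarrow> v - u < d2 \<longrightarrow> (L - e) * (v - u) \<le> f v - f u"
    by blast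
   show "\<exists>d>0. \<forall>u v. a < u \<longrightarrow> u < x \<longrightarrow> x < v \<longrightarrow> v < b \<longrightarrow> v - u < d \<longrightarrow> \<bar>f v - f u - L * (v - u)\<bar> \<le> e * (v - u)"
   proof (intro exI[of _ "min d1 d2"] conjI allI impI)
    show "0 < min d1 d2" using d1 d2 by simp
    fix u v assume uv: "a < u" "u < x" "x < v" "v < b" "v - u < min d1 d2"
    have "f v - f u \<le> (L + e) * (v - u)" using d1(2) uv by auto
    moreover have "(L - e) * (v - u) \<le> f v - f u" using d2(2) uv by auto
    ultimately show "\<bar>f v - f u - L * (v - u)\<bar> \<le> e * (v - u)" by (simp add: abs_le_iff algebra_simps)
   qed
  qed
  then show "f differentiable (at x)" by (auto simp: real_differentiable_def)
 qed
qed

text \<open>A gauge argument. At a tag off the null set \<open>N\<close> differentiability makes the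
  error \<open>e / 2\<close> times the length of the interval. At tags in \<open>N\<close> the
  integrand is replaced by 0 and the gauge is an open set of measure below \<delta> around
  \<open>N\<close>, so these intervals are short in total and absolute continuity bounds the
  increments of \<open>f\<close> over them. The endpoints belong to \<open>N\<close> because
  differentiability is known only between them.\<close>

theorem abs_continuous_has_integral_deriv:
 assumes ac: "abs_continuous_on_interval a b f" and ab: "a \<le> b"
 shows "(deriv f has_integral (f b - f a)) {a..b}"
proof (cases "a = b")
 case True
 then show ?thesis using has_integral_refl(2)[of "deriv f" b] by simp
next
 case False
 with ab have ab: "a < b" by simp
 obtain N0 where N0: "negligible N0" "\<And>x. a < x \<Longrightarrow> x < b \<Longrightarrow> x \<notin> N0 \<Longrightarrow> f differentiable (at x)"
  using abs_continuous_differentiable_ae[OF ac] by blast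
 define N where "N = N0 \<union> {a, b}"
 have N: "negligible N" unfolding N_def using N0(1) by simp
 define g where "g = (\<lambda>x. if x \<in> N then 0 else deriv f x)"
 have "(g has_integral (f b - f a)) {a..b}"
  unfolding has_integral_factor_content_real
 proof (intro allI impI)
  fix e :: real assume e: "0 < e"
  then have e2: "e * (b - a) / 2 > 0" using ab by simp
  from abs_continuous_finite_family[OF ac this, where 'i="real\<times>real set"]
  obtain \<delta> where del: "0 < \<delta>" and acf:
   "\<And>(X::(real\<times>real set) set) s t. finite X \<Longrightarrow> (\<And>i. i \<in> X \<Longrightarrow> a \<le> s i \<and> s i \<le> t i \<and> t i \<le> b) \<Longrightarrow>
    disjoint_family_on (\<lambda>i. {s i<..<t i}) X \<Longrightarrow> (\<Sum>i\<in>X. t i - s i) < \<delta> \<Longrightarrow>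
    (\<Sum>i\<in>X. \<bar>f (t i) - f (s i)\<bar>) < e * (b - a) / 2" by blast
  have Nl: "N \<in> sets lebesgue" using N by (simp add: negligible_imp_sets)
  obtain U where U: "open U" "N \<subseteq> U" "U - N \<in> lmeasurable" "emeasure lebesgue (U - N) < ennreal \<delta>"
   by (rule sets_lebesgue_outer_open[OF Nl del])
  have Nm: "N \<in> lmeasurable" "measure lebesgue N = 0"
   using N negligible_iff_measure by blast+
  have UU: "U = N \<union> (U - N)" using U(2) by blast
  have Um: "U \<in> lmeasurable" by (subst UU) (intro fmeasurable.Un Nm U(3))
  have mU: "measure lebesgue U < \<delta>"
  proof -
   have "measure lebesgue (U - N) < \<delta>"
    using U(4) del by (simp add: emeasure_eq_measure2[OF U(3)] ennreal_less_iff)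
   moreover have "measure lebesgue U \<le> measure lebesgue N + measure lebesgue (U - N)"
    by (subst UU) (intro measure_Un_le fmeasurableD Nm U(3))
   ultimately show ?thesis using Nm by simp
  qed
  have "\<exists>d>0. x \<in> {a..b} - N \<longrightarrow> (\<forall>y. norm (y - x) < d \<longrightarrow> norm (f y - f x - g x * (y - x)) \<le> e / 2 * norm (y - x))" for x
  proof (cases "x \<in> {a..b} - N")
   case True
   then have "a < x" "x < b" "x \<notin> N0" by (auto simp: N_def less_eq_real_def)
   then have "(f has_real_derivative deriv f x) (at x)"
    using N0(2) by (simp add: DERIV_deriv_iff_real_differentiable)
   then have "(f has_derivative (\<lambda>h. g x * h)) (at x)"
    using True by (simp add: g_def has_field_derivative_def)
   moreover have "e / 2 > 0" using e by simp
   ultimately obtain d where "d > 0" "\<forall>y. norm (y - x) < d \<longrightarrow> norm (f y - f x - g x * (y - x)) \<le> e / 2 * norm (y - x)"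
    unfolding has_derivative_at_alt by meson
   then show ?thesis by blast
  qed (auto intro: exI[of _ 1])
  then have "\<forall>x. \<exists>d>0. x \<in> {a..b} - N \<longrightarrow> (\<forall>y. norm (y - x) < d \<longrightarrow> norm (f y - f x - g x * (y - x)) \<le> e / 2 * norm (y - x))"
   by blast
  from choice[OF this] obtain d where d: "\<And>x. d x > 0"
   "\<And>x y. x \<in> {a..b} - N \<Longrightarrow> norm (y - x) < d x \<Longrightarrow> norm (f y - f x - g x * (y - x)) \<le> e / 2 * norm (y - x)"
   by blast
  define \<gamma> where "\<gamma> = (\<lambda>x. if x \<in> N then U else ball x (d x))"
  show "\<exists>d. gauge d \<and> (\<forall>p. p tagged_division_of {a..b} \<and> d fine p \<longrightarrow>
   norm ((\<Sum>(x, k)\<in>p. measure lborel k *\<^sub>R g x) - (f b - f a)) \<le> e * measure lborel {a..b})"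
  proof (intro exI[of _ \<gamma>] conjI allI impI)
   show "gauge \<gamma>" unfolding gauge_def \<gamma>_def using U(1,2) d(1) by auto
   fix p assume p: "p tagged_division_of {a..b} \<and> \<gamma> fine p"
   then have ptag: "p tagged_division_of {a..b}" and pfine: "\<gamma> fine p" by auto
   have fin: "finite p" using ptag by auto
   have K: "\<exists>u v. snd P = {u..v} \<and> u \<le> fst P \<and> fst P \<le> v \<and> a \<le> u \<and> v \<le> b \<and> Inf (snd P) = u \<and> Sup (snd P) = v \<and> {u..v} \<subseteq> \<gamma> (fst P)" if "P \<in> p" for P
   proof -
    obtain x K where P: "P = (x, K)" by (rule prod.exhaust)
    have "x \<in> K" "K \<subseteq> {a..b}" "\<exists>u v. K = cbox u v" using tagged_division_ofD(2,3,4)[OF ptag] that P by blast+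
    then obtain u v where "K = {u..v}" by auto
    moreover have "K \<subseteq> \<gamma> x" using pfine that P unfolding fine_def by blast
    ultimately show ?thesis using P \<open>x \<in> K\<close> \<open>K \<subseteq> {a..b}\<close> by (intro exI[of _ u] exI[of _ v]) auto
   qed
   define s where "s = (\<lambda>P::real \<times> real set. Inf (snd P))"
   define t where "t = (\<lambda>P::real \<times> real set. Sup (snd P))"
   have st: "snd P = {s P..t P}" "s P \<le> fst P" "fst P \<le> t P" "a \<le> s P" "t P \<le> b" "{s P..t P} \<subseteq> \<gamma> (fst P)" if "P \<in> p" for P
    using K[OF that] unfolding s_def t_def by auto
   have fba: "f b - f a = (\<Sum>P\<in>p. f (t P) - f (s P))"
    using additive_tagged_division_1[OF less_imp_le[OF ab] ptag, of f] by (simp add: s_def t_def case_prod_beta)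
   have ba: "b - a = (\<Sum>P\<in>p. t P - s P)"
    using additive_tagged_division_1[OF less_imp_le[OF ab] ptag, of "\<lambda>x. x"] by (simp add: s_def t_def case_prod_beta)
   define p1 where "p1 = {P \<in> p. fst P \<in> N}"
   define p2 where "p2 = {P \<in> p. fst P \<notin> N}"
   have pp: "p = p1 \<union> p2" "p1 \<inter> p2 = {}" "finite p1" "finite p2" unfolding p1_def p2_def using fin by auto
   have "(\<Sum>(x, k)\<in>p. measure lborel k *\<^sub>R g x) - (f b - f a) = (\<Sum>P\<in>p. (t P - s P) * g (fst P) - (f (t P) - f (s P)))"
   proof -
    have "(\<Sum>(x, k)\<in>p. measure lborel k *\<^sub>R g x) = (\<Sum>P\<in>p. (t P - s P) * g (fst P))"
    proof (rule sum.cong[OF refl])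
     fix P assume P: "P \<in> p"
     have "measure lborel (snd P) = t P - s P"
      using st(2,3)[OF P] by (subst st(1)[OF P]) simp
     then show "(case P of (x, k) \<Rightarrow> measure lborel k *\<^sub>R g x) = (t P - s P) * g (fst P)" by (simp add: case_prod_beta)
    qed
    then show ?thesis unfolding fba by (simp add: sum_subtractf)
   qed
   also have "\<dots> = (\<Sum>P\<in>p1. (t P - s P) * g (fst P) - (f (t P) - f (s P))) + (\<Sum>P\<in>p2. (t P - s P) * g (fst P) - (f (t P) - f (s P)))"
    using pp by (simp add: sum.union_disjoint)
   also have "norm \<dots> \<le> e * (b - a) / 2 + e / 2 * (b - a)"
   proof (intro order_trans[OF norm_triangle_ineq] add_mono)
    have dis: "disjoint_family_on (\<lambda>P. {s P<..<t P}) p1"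
     unfolding disjoint_family_on_def
    proof (intro ballI impI)
     fix P P' assume H: "P \<in> p1" "P' \<in> p1" "P \<noteq> P'"
     then have pp': "P \<in> p" "P' \<in> p" by (auto simp: p1_def)
     have "interior (snd P) \<inter> interior (snd P') = {}"
      using tagged_division_ofD(5)[OF ptag, of "fst P" "snd P" "fst P'" "snd P'"] pp' H(3) by (simp add: prod_eq_iff)
     then show "{s P<..<t P} \<inter> {s P'<..<t P'} = {}"
      by (subst (asm) st(1)[OF pp'(1)], subst (asm) st(1)[OF pp'(2)]) simp
    qed
    have "norm (\<Sum>P\<in>p1. (t P - s P) * g (fst P) - (f (t P) - f (s P))) \<le> (\<Sum>P\<in>p1. \<bar>f (t P) - f (s P)\<bar>)"
     by (rule order_trans[OF norm_sum]) (intro sum_mono, auto simp: p1_def g_def)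
    also have "\<dots> \<le> e * (b - a) / 2"
    proof (rule less_imp_le[OF acf[OF pp(3) _ dis]])
     show "a \<le> s i \<and> s i \<le> t i \<and> t i \<le> b" if "i \<in> p1" for i using that st(2-5)[of i] by (auto simp: p1_def)
     have "(\<Sum>i\<in>p1. t i - s i) = (\<Sum>i\<in>p1. measure lebesgue {s i<..<t i})"
      using st(2,3) by (intro sum.cong) (fastforce simp: p1_def)+
     also have "\<dots> = measure lebesgue (\<Union>i\<in>p1. {s i<..<t i})"
     proof (rule measure_UNION'[OF pp(3), symmetric])
      show "pairwise (\<lambda>x y. disjnt {s x<..<t x} {s y<..<t y}) p1"
       using dis unfolding disjoint_family_on_def pairwise_def disjnt_def by blast
     qed auto
     also have "\<dots> \<le> measure lebesgue U"
     proof (rule measure_mono_fmeasurable)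
      have "{s P<..<t P} \<subseteq> U" if "P \<in> p1" for P
      proof -
       have "{s P..t P} \<subseteq> U" using st(6)[of P] that unfolding p1_def \<gamma>_def by auto
       then show ?thesis by (meson greaterThanLessThan_subseteq_atLeastAtMost_iff order_refl subset_trans)
      qed
      then show "(\<Union>i\<in>p1. {s i<..<t i}) \<subseteq> U" by blast
      show "(\<Union>i\<in>p1. {s i<..<t i}) \<in> sets lebesgue" using pp(3) by (intro sets.finite_UN) auto
     qed (fact Um)
     finally show "(\<Sum>i\<in>p1. t i - s i) < \<delta>" using mU by simp
    qed
    finally show "norm (\<Sum>P\<in>p1. (t P - s P) * g (fst P) - (f (t P) - f (s P))) \<le> e * (b - a) / 2" .
    have "norm (\<Sum>P\<in>p2. (t P - s P) * g (fst P) - (f (t P) - f (s P))) \<le> (\<Sum>P\<in>p2. e / 2 * (t P - s P))"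
    proof (rule order_trans[OF norm_sum], rule sum_mono)
     fix P assume "P \<in> p2"
     then have P: "P \<in> p" "fst P \<notin> N" by (auto simp: p2_def)
     have x: "fst P \<in> {a..b} - N" using st(2-5)[OF P(1)] P(2) by auto
     have sub: "{s P..t P} \<subseteq> ball (fst P) (d (fst P))" using st(6)[OF P(1)] P(2) by (simp add: \<gamma>_def)
     have "t P \<in> {s P..t P}" "s P \<in> {s P..t P}" using st(2,3)[OF P(1)] by auto
     then have "norm (t P - fst P) < d (fst P)" "norm (s P - fst P) < d (fst P)"
      using sub by (auto simp: dist_real_def abs_minus_commute)
     from d(2)[OF x this(1)] d(2)[OF x this(2)]
     have "\<bar>f (t P) - f (fst P) - g (fst P) * (t P - fst P)\<bar> \<le> e / 2 * (t P - fst P)"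
       "\<bar>f (s P) - f (fst P) - g (fst P) * (s P - fst P)\<bar> \<le> e / 2 * (fst P - s P)"
      using st(2,3)[OF P(1)] by (auto simp: abs_if split: if_splits)
     then show "norm ((t P - s P) * g (fst P) - (f (t P) - f (s P))) \<le> e / 2 * (t P - s P)"
      unfolding real_norm_def abs_le_iff by (simp add: algebra_simps)
    qed
    also have "\<dots> = e / 2 * (\<Sum>P\<in>p2. t P - s P)" by (rule sum_distrib_left[symmetric])
    also have "\<dots> \<le> e / 2 * (b - a)"
    proof -
     have "(\<Sum>P\<in>p2. t P - s P) \<le> (\<Sum>P\<in>p. t P - s P)"
      using fin st(2,3) by (intro sum_mono2) (fastforce simp: p2_def)+
     then show ?thesis using e ba by simp
    qed
    finally show "norm (\<Sum>P\<in>p2. (t P - s P) * g (fst P) - (f (t P) - f (s P))) \<le> e / 2 * (b - a)" .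
   qed
   finally show "norm ((\<Sum>(x, k)\<in>p. measure lborel k *\<^sub>R g x) - (f b - f a)) \<le> e * measure lborel {a..b}"
    using ab by (simp add: field_simps)
  qed
 qed
 then show ?thesis
  by (rule has_integral_spike[OF N, rotated]) (simp add: g_def)
qed

lemma lipschitz_imp_abs_continuous:
 assumes "\<And>s t. a \<le> s \<Longrightarrow> s \<le> t \<Longrightarrow> t \<le> b \<Longrightarrow> \<bar>f t - f s\<bar> \<le> L * (t - s)" "0 \<le> L"
 shows "abs_continuous_on_interval a b f"
 unfolding abs_continuous_on_interval_def
proof (intro allI impI)
 fix e :: real assume e: "0 < e"
 show "\<exists>\<delta>>0. \<forall>(n::nat) s t. (\<forall>i<n. a \<le> s i \<and> s i \<le> t i \<and> t i \<le> b) \<and>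
    disjoint_family_on (\<lambda>i. {s i<..<t i}) {..<n} \<and>
    (\<Sum>i<n. t i - s i) < \<delta> \<longrightarrow> (\<Sum>i<n. \<bar>f (t i) - f (s i)\<bar>) < e"
 proof (intro exI[of _ "e / (L + 1)"] conjI allI impI)
  show "e / (L + 1) > 0" using e assms(2) by simp
  fix n :: nat and s t
  assume H: "(\<forall>i<n. a \<le> s i \<and> s i \<le> t i \<and> t i \<le> b) \<and>
    disjoint_family_on (\<lambda>i. {s i<..<t i}) {..<n} \<and> (\<Sum>i<n. t i - s i) < e / (L + 1)"
  have "(\<Sum>i<n. \<bar>f (t i) - f (s i)\<bar>) \<le> (\<Sum>i<n. (L + 1) * (t i - s i))"
  proof (rule sum_mono)
   fix i assume "i \<in> {..<n}"
   then have i: "a \<le> s i" "s i \<le> t i" "t i \<le> b" using H by auto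
   have "L * (t i - s i) \<le> (L + 1) * (t i - s i)" using i by (intro mult_right_mono) auto
   then show "\<bar>f (t i) - f (s i)\<bar> \<le> (L + 1) * (t i - s i)" using assms(1)[OF i] by linarith
  qed
  also have "\<dots> = (L + 1) * (\<Sum>i<n. t i - s i)" by (rule sum_distrib_left[symmetric])
  also have "\<dots> < (L + 1) * (e / (L + 1))" using H assms(2) by (intro mult_strict_left_mono) auto
  also have "\<dots> = e" using assms(2) by simp
  finally show "(\<Sum>i<n. \<bar>f (t i) - f (s i)\<bar>) < e" .
 qed
qed

text \<open>Differentiability is the Cauchy condition for difference quotients as the step tends to
  0. For fixed tolerances it cuts out a closed set \<open>E k j\<close>, since each quotient is
  continuous in \<open>x\<close>; so the set \<open>D\<close> of differentiability is Borel, and on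
  it the derivative is a limit of continuous functions.\<close>

lemma borel_measurable_deriv:
 fixes f :: "real \<Rightarrow> real"
 assumes cont: "continuous_on UNIV f"
 shows "deriv f \<in> borel_measurable borel"
proof -
 define q where "q = (\<lambda>h x. (f (x + h) - f x) / h)"
 define D where "D = {x. f differentiable (at x)}"
 have fm: "continuous_on UNIV (\<lambda>x. f (x + h))" for h
  by (rule continuous_on_compose2[OF cont]) (auto intro!: continuous_intros)
 have qc: "continuous_on UNIV (q h)" for h
 proof (cases "h = 0")
  case False
  then show ?thesis unfolding q_def by (intro continuous_intros fm cont) auto
 qed (simp add: q_def)
 define E where "E = (\<lambda>(k::nat) (j::nat). {x. \<forall>h h'. h \<noteq> 0 \<longrightarrow> h' \<noteq> 0 \<longrightarrow> \<bar>h\<bar> < 1 / real (Suc j) \<longrightarrow> \<bar>h'\<bar> < 1 / real (Suc j) \<longrightarrow> \<bar>q h x - q h' x\<bar> \<le> 1 / real (Suc k)})"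
 have Ecl: "closed (E k j)" for k j
  unfolding E_def
  by (intro closed_Collect_all closed_Collect_imp open_Collect_const closed_Collect_le continuous_intros)
    (auto intro: qc continuous_on_subset)
 have "D = (\<Inter>k. \<Union>j. E k j)"
 proof (intro equalityI subsetI)
  fix x assume "x \<in> D"
  then obtain L where L: "(f has_real_derivative L) (at x)" unfolding D_def by (auto simp: real_differentiable_def)
  then have lim: "((\<lambda>h. q h x) \<longlongrightarrow> L) (at 0)" unfolding DERIV_def q_def .
  show "x \<in> (\<Inter>k. \<Union>j. E k j)"
  proof
   fix k :: nat
   have "1 / (2 * real (Suc k)) > 0" by simp
   then obtain d where d: "d > 0" "\<And>h. h \<noteq> 0 \<Longrightarrow> \<bar>h\<bar> < d \<Longrightarrow> \<bar>q h x - L\<bar> < 1 / (2 * real (Suc k))"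
    using LIM_D[OF lim] by (metis diff_zero real_norm_def)
   obtain j :: nat where j: "1 / real (Suc j) < d" using d(1) nat_approx_posE by blast
   have "x \<in> E k j"
    unfolding E_def
   proof (intro CollectI allI impI)
    fix h h' :: real assume h: "h \<noteq> 0" "h' \<noteq> 0" "\<bar>h\<bar> < 1 / real (Suc j)" "\<bar>h'\<bar> < 1 / real (Suc j)"
    have "\<bar>q h x - L\<bar> < 1 / (2 * real (Suc k))" "\<bar>q h' x - L\<bar> < 1 / (2 * real (Suc k))" using d(2) h j by auto
    then have "\<bar>q h x - q h' x\<bar> < 1 / (2 * real (Suc k)) + 1 / (2 * real (Suc k))" by linarith
    also have "\<dots> = 1 / real (Suc k)" by (simp add: field_simps)
    finally show "\<bar>q h x - q h' x\<bar> \<le> 1 / real (Suc k)" by simp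
   qed
   then show "x \<in> (\<Union>j. E k j)" by blast
  qed
 next
  fix x assume x: "x \<in> (\<Inter>k. \<Union>j. E k j)"
  define r where "r = (\<lambda>n. q (1 / real (Suc n)) x)"
  have bnd: "\<exists>j. \<forall>h h'. h \<noteq> 0 \<longrightarrow> h' \<noteq> 0 \<longrightarrow> \<bar>h\<bar> < 1 / real (Suc j) \<longrightarrow> \<bar>h'\<bar> < 1 / real (Suc j) \<longrightarrow> \<bar>q h x - q h' x\<bar> < e" if e: "e > 0" for e
  proof -
   obtain k :: nat where k: "1 / real (Suc k) < e" using e nat_approx_posE by blast
   obtain j where "x \<in> E k j" using x by blast
   then show ?thesis using k unfolding E_def by (intro exI[of _ j]) fastforce
  qed
  have small: "\<bar>1 / real (Suc n)\<bar> < 1 / real (Suc j)" if "n \<ge> Suc j" for n j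
   using that by (simp add: frac_less2)
  have "Cauchy r"
  proof (rule metric_CauchyI)
   fix e :: real assume "e > 0"
   from bnd[OF this] obtain j where j: "\<And>h h'. h \<noteq> 0 \<Longrightarrow> h' \<noteq> 0 \<Longrightarrow> \<bar>h\<bar> < 1 / real (Suc j) \<Longrightarrow> \<bar>h'\<bar> < 1 / real (Suc j) \<Longrightarrow> \<bar>q h x - q h' x\<bar> < e" by blast
   show "\<exists>M. \<forall>m\<ge>M. \<forall>n\<ge>M. dist (r m) (r n) < e"
   proof (intro exI[of _ "Suc j"] allI impI)
    fix m n assume "m \<ge> Suc j" "n \<ge> Suc j"
    then show "dist (r m) (r n) < e"
     unfolding r_def dist_real_def using small by (intro j) auto
   qed
  qed
  then obtain L where rL: "r \<longlonglongrightarrow> L" using Cauchy_convergent convergent_def by blast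
  have "((\<lambda>h. q h x) \<longlongrightarrow> L) (at 0)"
  proof (rule LIM_I)
   fix e :: real assume e: "e > 0"
   then have "e / 2 > 0" by simp
   from bnd[OF this] obtain j where j: "\<And>h h'. h \<noteq> 0 \<Longrightarrow> h' \<noteq> 0 \<Longrightarrow> \<bar>h\<bar> < 1 / real (Suc j) \<Longrightarrow> \<bar>h'\<bar> < 1 / real (Suc j) \<Longrightarrow> \<bar>q h x - q h' x\<bar> < e / 2" by blast
   show "\<exists>s>0. \<forall>h. h \<noteq> 0 \<and> norm (h - 0) < s \<longrightarrow> norm (q h x - L) < e"
   proof (intro exI[of _ "1 / real (Suc j)"] conjI allI impI)
    fix h :: real assume h: "h \<noteq> 0 \<and> norm (h - 0) < 1 / real (Suc j)"
    have "(\<lambda>n. \<bar>q h x - r n\<bar>) \<longlonglongrightarrow> \<bar>q h x - L\<bar>" by (intro tendsto_intros rL)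
    moreover have "\<forall>\<^sub>F n in sequentially. \<bar>q h x - r n\<bar> \<le> e / 2"
    proof (rule eventually_sequentiallyI[of "Suc j"])
     fix n assume "Suc j \<le> n"
     then have "\<bar>q h x - r n\<bar> < e / 2" unfolding r_def using h small by (intro j) auto
     then show "\<bar>q h x - r n\<bar> \<le> e / 2" by simp
    qed
    ultimately have "\<bar>q h x - L\<bar> \<le> e / 2" by (intro tendsto_upperbound[of _ _ sequentially]) auto
    then show "norm (q h x - L) < e" using e by simp
   qed simp
  qed
  then show "x \<in> D" unfolding D_def q_def by (auto simp: real_differentiable_def DERIV_def)
 qed
 moreover have "(\<Inter>k. \<Union>j. E k j) \<in> sets borel"
  using Ecl by (intro sets.countable_INT'' sets.countable_UN) auto
 ultimately have Dm: "D \<in> sets borel" by simp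
 \<comment> \<open>Where there is no derivative, \<open>deriv\<close> chooses from the empty
   predicate, hence takes the same value at all such points.\<close>
 define c where "c = (SOME D::real. False)"
 have nd: "deriv f x = c" if "x \<notin> D" for x
 proof -
  have "\<not> (f has_real_derivative y) (at x)" for y using that unfolding D_def real_differentiable_def by blast
  then show ?thesis unfolding deriv_def c_def by simp
 qed
 define d where "d = (\<lambda>x. lim (\<lambda>n. q (1 / real (Suc n)) x))"
 have "d \<in> borel_measurable borel"
  unfolding d_def by (intro borel_measurable_lim_metric borel_measurable_continuous_onI qc)
 then have "(\<lambda>x. if x \<in> D then d x else c) \<in> borel_measurable borel"
  using Dm by (intro measurable_If_set) auto
 moreover have "deriv f = (\<lambda>x. if x \<in> D then d x else c)"
 proof
  fix x
  show "deriv f x = (if x \<in> D then d x else c)"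
  proof (cases "x \<in> D")
   case True
   then have "(f has_real_derivative deriv f x) (at x)" unfolding D_def by (simp add: DERIV_deriv_iff_real_differentiable)
   then have lim: "((\<lambda>h. q h x) \<longlongrightarrow> deriv f x) (at 0)" unfolding DERIV_def q_def .
   have "(\<lambda>n. q (1 / real (Suc n)) x) \<longlonglongrightarrow> deriv f x"
   proof (rule filterlim_compose[OF lim])
    show "filterlim (\<lambda>n. 1 / real (Suc n)) (at 0) sequentially"
     unfolding filterlim_at using LIMSEQ_inverse_real_of_nat by (simp add: inverse_eq_divide)
   qed
   then show ?thesis using True unfolding d_def by (simp add: limI)
  qed (simp add: nd)
 qed
 ultimately show ?thesis by simp
qed

section \<open>Lebesgue spaces\<close>

lemma Lp_norm_finite_iff: "Lp_norm p M f < \<infinity> \<longleftrightarrow> (\<integral>\<^sup>+x. ennreal (\<bar>f x\<bar> powr p) \<partial>M) < \<infinity>"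
 unfolding Lp_norm_def Let_def by (auto simp: less_top)

lemma Lp_iff:
 "f \<in> Lp p M \<longleftrightarrow> f \<in> borel_measurable M \<and> integrable M (\<lambda>x. \<bar>f x\<bar> powr p)"
 unfolding Lp_def mem_Collect_eq Lp_norm_finite_iff
 by (auto simp: integrable_iff_bounded)

lemma Lp_norm_eq:
 assumes "f \<in> Lp p M"
 shows "Lp_norm p M f = ennreal ((\<integral>x. \<bar>f x\<bar> powr p \<partial>M) powr (1 / p))"
proof -
 have "(\<integral>\<^sup>+x. ennreal (\<bar>f x\<bar> powr p) \<partial>M) = ennreal (\<integral>x. \<bar>f x\<bar> powr p \<partial>M)"
  using assms by (intro nn_integral_eq_integral) (auto simp: Lp_iff)
 then show ?thesis unfolding Lp_norm_def Let_def by (simp add: integral_nonneg_AE)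
qed

lemma Lp2_iff: "f \<in> Lp 2 M \<longleftrightarrow> f \<in> borel_measurable M \<and> integrable M (\<lambda>x. (f x)\<^sup>2)"
 unfolding Lp_iff by (simp add: powr_numeral)

lemma Lp2_measurable: "f \<in> Lp 2 M \<Longrightarrow> f \<in> borel_measurable M"
 by (simp add: Lp2_iff)

lemma Lp2_integrable_mult:
 assumes "f \<in> Lp 2 M" "g \<in> Lp 2 M"
 shows "integrable M (\<lambda>x. f x * g x)"
proof (rule Bochner_Integration.integrable_bound)
 show "integrable M (\<lambda>x. (f x)\<^sup>2 + (g x)\<^sup>2)" using assms by (auto simp: Lp2_iff)
 show "(\<lambda>x. f x * g x) \<in> borel_measurable M" using assms by (auto simp: Lp2_iff)
 have "\<bar>f x * g x\<bar> \<le> (f x)\<^sup>2 + (g x)\<^sup>2" for x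
 proof -
  have "0 \<le> (\<bar>f x\<bar> - \<bar>g x\<bar>)\<^sup>2" "0 \<le> (f x)\<^sup>2 + (g x)\<^sup>2" by auto
  then have "2 * (\<bar>f x\<bar> * \<bar>g x\<bar>) \<le> (f x)\<^sup>2 + (g x)\<^sup>2" by (simp add: power2_diff)
  moreover have "0 \<le> \<bar>f x\<bar> * \<bar>g x\<bar>" by (intro mult_nonneg_nonneg) auto
  ultimately show ?thesis unfolding abs_mult by linarith
 qed
 then show "AE x in M. norm (f x * g x) \<le> norm ((f x)\<^sup>2 + (g x)\<^sup>2)" by simp
qed

lemma Lp2_add:
 assumes "f \<in> Lp 2 M" "g \<in> Lp 2 M"
 shows "(\<lambda>x. a * f x + b * g x) \<in> Lp 2 M"
proof -
 have e: "(a * f x + b * g x)\<^sup>2 = a\<^sup>2 * (f x)\<^sup>2 + 2 * a * b * (f x * g x) + b\<^sup>2 * (g x)\<^sup>2" for x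
  by (simp add: power2_eq_square algebra_simps)
 show ?thesis unfolding Lp2_iff e using assms Lp2_integrable_mult[OF assms]
  by (auto simp: Lp2_iff)
qed

lemma Lp2_scale: "f \<in> Lp 2 M \<Longrightarrow> (\<lambda>x. c * f x) \<in> Lp 2 M"
 using Lp2_add[of f M f c 0] by simp

lemma Lp2_diff: "f \<in> Lp 2 M \<Longrightarrow> g \<in> Lp 2 M \<Longrightarrow> (\<lambda>x. f x - g x) \<in> Lp 2 M"
 using Lp2_add[of f M g 1 "-1"] by simp

lemma Lp2_cong_AE:
 assumes "f \<in> Lp 2 M" "g \<in> borel_measurable M" "AE x in M. f x = g x"
 shows "g \<in> Lp 2 M"
 unfolding Lp2_iff
proof
 show "integrable M (\<lambda>x. (g x)\<^sup>2)"
  using assms by (subst integrable_cong_AE[of _ _ "\<lambda>x. (f x)\<^sup>2"]) (auto simp: Lp2_iff)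
qed (fact assms(2))

lemma Lp2_bound:
 assumes "f \<in> Lp 2 M" "g \<in> borel_measurable M" "AE x in M. \<bar>g x\<bar> \<le> \<bar>f x\<bar>"
 shows "g \<in> Lp 2 M"
 unfolding Lp2_iff
proof
 show "integrable M (\<lambda>x. (g x)\<^sup>2)"
 proof (rule Bochner_Integration.integrable_bound)
  show "integrable M (\<lambda>x. (f x)\<^sup>2)" using assms by (simp add: Lp2_iff)
  show "AE x in M. norm ((g x)\<^sup>2) \<le> norm ((f x)\<^sup>2)" using assms(3) by (auto simp: abs_le_square_iff)
 qed (use assms in auto)
qed (fact assms(2))

lemma Lp2_sqr_integral_nonneg: "0 \<le> (\<integral>x. (f x :: real)\<^sup>2 \<partial>M)"
 by (simp add: integral_nonneg_AE)

lemma norm_L2_sqr: "(norm_L2 M f)\<^sup>2 = (\<integral>x. (f x)\<^sup>2 \<partial>M)"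
 unfolding norm_L2_def inner_L2_def power2_eq_square[symmetric]
 by (rule real_sqrt_pow2) (rule Lp2_sqr_integral_nonneg)

lemma norm_L2_nonneg: "0 \<le> norm_L2 M f"
 unfolding norm_L2_def inner_L2_def by (simp add: integral_nonneg_AE)

lemma norm_L2_eq: "norm_L2 M f = sqrt (\<integral>x. (f x)\<^sup>2 \<partial>M)"
 unfolding norm_L2_def inner_L2_def by (simp add: power2_eq_square)

lemma inner_L2_commute: "inner_L2 M f g = inner_L2 M g f"
 unfolding inner_L2_def by (simp add: mult.commute)

lemma inner_L2_add_left:
 assumes "f \<in> Lp 2 M" "g \<in> Lp 2 M" "h \<in> Lp 2 M"
 shows "inner_L2 M (\<lambda>x. a * f x + b * g x) h = a * inner_L2 M f h + b * inner_L2 M g h"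
proof -
 have "(\<lambda>x. (a * f x + b * g x) * h x) = (\<lambda>x. a * (f x * h x) + b * (g x * h x))"
  by (auto simp: algebra_simps)
 then show ?thesis unfolding inner_L2_def
  using Lp2_integrable_mult[OF assms(1,3)] Lp2_integrable_mult[OF assms(2,3)] by simp
qed

lemma inner_L2_add_right:
 assumes "f \<in> Lp 2 M" "g \<in> Lp 2 M" "h \<in> Lp 2 M"
 shows "inner_L2 M h (\<lambda>x. a * f x + b * g x) = a * inner_L2 M h f + b * inner_L2 M h g"
 using inner_L2_add_left[OF assms] by (simp add: inner_L2_commute)

lemma inner_L2_cong_AE:
 assumes "f \<in> borel_measurable M" "f' \<in> borel_measurable M" "g \<in> borel_measurable M" "g' \<in> borel_measurable M"
  "AE x in M. f x = f' x" "AE x in M. g x = g' x"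
 shows "inner_L2 M f g = inner_L2 M f' g'"
 unfolding inner_L2_def
proof (rule integral_cong_AE)
 show "AE x in M. f x * g x = f' x * g' x" using assms(5,6) by eventually_elim simp
qed (use assms in auto)

lemma norm_L2_add_sqr:
 assumes "f \<in> Lp 2 M" "g \<in> Lp 2 M"
 shows "(norm_L2 M (\<lambda>x. a * f x + b * g x))\<^sup>2 = a\<^sup>2 * (norm_L2 M f)\<^sup>2 + 2 * a * b * inner_L2 M f g + b\<^sup>2 * (norm_L2 M g)\<^sup>2"
proof -
 have e: "(a * f x + b * g x)\<^sup>2 = a\<^sup>2 * (f x)\<^sup>2 + 2 * a * b * (f x * g x) + b\<^sup>2 * (g x)\<^sup>2" for x
  by (simp add: power2_eq_square algebra_simps)
 show ?thesis unfolding norm_L2_sqr e inner_L2_def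
  using assms Lp2_integrable_mult[OF assms] by (simp add: Lp2_iff)
qed

text \<open>Serves both the Cauchy-Schwarz inequality and the moment inequality for the square root;
  in both the leading coefficient may vanish, and then \<open>B\<close> must vanish as well.\<close>

lemma quadratic_nonneg_imp_discriminant:
 fixes A B C :: real
 assumes "\<And>s. 0 \<le> A + 2 * s * B + s\<^sup>2 * C" "0 \<le> C"
 shows "B\<^sup>2 \<le> A * C"
proof (cases "C = 0")
 case True
 have "B = 0"
 proof (rule ccontr)
  assume "B \<noteq> 0"
  have "0 \<le> A + 2 * (- (A + 1) / (2 * B)) * B" using assms(1)[of "- (A + 1) / (2 * B)"] True by simp
  also have "\<dots> = -1" using \<open>B \<noteq> 0\<close> by (simp add: field_simps)
  finally show False by simp
 qed
 then show ?thesis using True by simp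
next
 case False
 then have C: "C > 0" using assms(2) by simp
 have "0 \<le> A + 2 * (- B / C) * B + (- B / C)\<^sup>2 * C" by (rule assms(1))
 also have "\<dots> = A - B\<^sup>2 / C" using C by (simp add: field_simps power2_eq_square)
 finally show ?thesis using C by (simp add: field_simps)
qed

lemma Cauchy_Schwarz_L2:
 assumes "f \<in> Lp 2 M" "g \<in> Lp 2 M"
 shows "\<bar>inner_L2 M f g\<bar> \<le> norm_L2 M f * norm_L2 M g"
proof -
 have "(inner_L2 M f g)\<^sup>2 \<le> (norm_L2 M f)\<^sup>2 * (norm_L2 M g)\<^sup>2"
 proof (rule quadratic_nonneg_imp_discriminant)
  fix s
  have "0 \<le> (norm_L2 M (\<lambda>x. 1 * f x + s * g x))\<^sup>2" by simp
  then show "0 \<le> (norm_L2 M f)\<^sup>2 + 2 * s * inner_L2 M f g + s\<^sup>2 * (norm_L2 M g)\<^sup>2"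
   unfolding norm_L2_add_sqr[OF assms] by simp
 qed simp
 then show ?thesis
  using abs_le_square_iff[of "inner_L2 M f g" "norm_L2 M f * norm_L2 M g"]
  by (simp add: power_mult_distrib abs_mult norm_L2_nonneg)
qed

lemma norm_L2_triangle:
 assumes "f \<in> Lp 2 M" "g \<in> Lp 2 M"
 shows "norm_L2 M (\<lambda>x. f x + g x) \<le> norm_L2 M f + norm_L2 M g"
proof (rule power2_le_imp_le)
 have "(norm_L2 M (\<lambda>x. 1 * f x + 1 * g x))\<^sup>2 = (norm_L2 M f)\<^sup>2 + 2 * inner_L2 M f g + (norm_L2 M g)\<^sup>2"
  unfolding norm_L2_add_sqr[OF assms] by simp
 also have "\<dots> \<le> (norm_L2 M f + norm_L2 M g)\<^sup>2"
  using Cauchy_Schwarz_L2[OF assms] by (simp add: power2_sum)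
 finally show "(norm_L2 M (\<lambda>x. f x + g x))\<^sup>2 \<le> (norm_L2 M f + norm_L2 M g)\<^sup>2" by simp
qed (simp add: norm_L2_nonneg)

lemma norm_L2_scale: "norm_L2 M (\<lambda>x. c * f x) = \<bar>c\<bar> * norm_L2 M f"
 unfolding norm_L2_eq by (simp add: power_mult_distrib real_sqrt_mult)

lemma norm_L2_cong_AE:
 assumes "f \<in> borel_measurable M" "g \<in> borel_measurable M" "AE x in M. f x = g x"
 shows "norm_L2 M f = norm_L2 M g"
 unfolding norm_L2_def using inner_L2_cong_AE[OF assms(1,2,1,2,3,3)] by simp

lemma norm_L2_eq_0:
 assumes "f \<in> Lp 2 M" "norm_L2 M f = 0"
 shows "AE x in M. f x = 0"
proof -
 have "(\<integral>x. (f x)\<^sup>2 \<partial>M) = 0" using norm_L2_sqr[of M f] assms(2) by simp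
 then have "AE x in M. (f x)\<^sup>2 = 0"
  using assms(1) by (subst integral_nonneg_eq_0_iff_AE[symmetric]) (auto simp: Lp2_iff)
 then show ?thesis by simp
qed

lemma norm_L2_mono_AE:
 assumes "f \<in> borel_measurable M" "g \<in> Lp 2 M" "AE x in M. \<bar>f x\<bar> \<le> \<bar>g x\<bar>"
 shows "norm_L2 M f \<le> norm_L2 M g"
 unfolding norm_L2_eq
proof (intro real_sqrt_le_mono integral_mono_AE)
 show "integrable M (\<lambda>x. (f x)\<^sup>2)" using Lp2_bound[OF assms(2,1,3)] by (simp add: Lp2_iff)
 show "AE x in M. (f x)\<^sup>2 \<le> (g x)\<^sup>2" using assms(3) by (auto simp: abs_le_square_iff)
qed (use assms in \<open>simp add: Lp2_iff\<close>)

lemma norm_L2_indicator: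
 assumes "A \<in> sets M" "emeasure M A < \<infinity>"
 shows "(\<lambda>x. indicator A x) \<in> Lp 2 M" "(norm_L2 M (\<lambda>x. indicator A x))\<^sup>2 = measure M A"
proof -
 have e: "(indicator A x :: real)\<^sup>2 = indicator A x" for x by (simp add: indicator_def)
 show "(\<lambda>x. indicator A x) \<in> Lp 2 M" unfolding Lp2_iff e using assms by (simp add: integrable_indicator_iff)
 show "(norm_L2 M (\<lambda>x. indicator A x))\<^sup>2 = measure M A" unfolding norm_L2_sqr e
  using assms sets.sets_into_space[OF assms(1)] by (simp add: Int_absorb2)
qed

text \<open>Young's inequality for the functions divided by their norms; if a norm is 0 the product
  vanishes almost everywhere.\<close>

lemma Holder_inequality_Lp:
 assumes f: "f \<in> Lp p M" and g: "g \<in> Lp q M" and pq: "1 < p" "1 < q" "1 / p + 1 / q = 1"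
 shows "integrable M (\<lambda>x. f x * g x)"
  "\<bar>\<integral>x. f x * g x \<partial>M\<bar> \<le> (\<integral>x. \<bar>f x\<bar> powr p \<partial>M) powr (1 / p) * (\<integral>x. \<bar>g x\<bar> powr q \<partial>M) powr (1 / q)"
proof -
 have fi: "integrable M (\<lambda>x. \<bar>f x\<bar> powr p)" "f \<in> borel_measurable M" and gi: "integrable M (\<lambda>x. \<bar>g x\<bar> powr q)" "g \<in> borel_measurable M"
  using f g by (auto simp: Lp_iff)
 have young: "\<bar>a * b\<bar> \<le> \<bar>a\<bar> powr p / p + \<bar>b\<bar> powr q / q" for a b :: real
  using Youngs_inequality[OF pq(1,2,3), of "\<bar>a\<bar>" "\<bar>b\<bar>"] by (simp add: abs_mult)
 show int: "integrable M (\<lambda>x. f x * g x)"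
 proof (rule Bochner_Integration.integrable_bound)
  show "integrable M (\<lambda>x. \<bar>f x\<bar> powr p / p + \<bar>g x\<bar> powr q / q)" using fi gi by simp
  show "AE x in M. norm (f x * g x) \<le> norm (\<bar>f x\<bar> powr p / p + \<bar>g x\<bar> powr q / q)"
   using young by (intro AE_I2) (metis abs_of_nonneg order_trans abs_ge_self real_norm_def)
 qed (use fi gi in auto)
 define A where "A = (\<integral>x. \<bar>f x\<bar> powr p \<partial>M)"
 define B where "B = (\<integral>x. \<bar>g x\<bar> powr q \<partial>M)"
 have AB: "0 \<le> A" "0 \<le> B" unfolding A_def B_def by (simp_all add: integral_nonneg_AE)
 have zero: "(\<integral>x. f x * g x \<partial>M) = 0" if "A = 0 \<or> B = 0"
 proof -
  have "(AE x in M. \<bar>f x\<bar> powr p = 0) \<or> (AE x in M. \<bar>g x\<bar> powr q = 0)"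
   using that integral_nonneg_eq_0_iff_AE[OF fi(1)] integral_nonneg_eq_0_iff_AE[OF gi(1)] unfolding A_def B_def by auto
  then have "AE x in M. f x * g x = 0" by (auto elim: eventually_mono)
  then show ?thesis by (rule integral_eq_zero_AE)
 qed
 show "\<bar>\<integral>x. f x * g x \<partial>M\<bar> \<le> A powr (1 / p) * B powr (1 / q)"
 proof (cases "A = 0 \<or> B = 0")
  case True
  then show ?thesis using zero by simp
 next
  case False
  then have pos: "A > 0" "B > 0" using AB by auto
  define a where "a = A powr (1 / p)"
  define b where "b = B powr (1 / q)"
  have ab: "a > 0" "b > 0" "a powr p = A" "b powr q = B"
   unfolding a_def b_def using pos pq by (simp_all add: powr_powr)
  have "\<bar>\<integral>x. f x * g x \<partial>M\<bar> \<le> (\<integral>x. \<bar>f x * g x\<bar> \<partial>M)"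
   using integral_norm_bound[of M "\<lambda>x. f x * g x"] by simp
  also have "\<dots> \<le> (\<integral>x. a * b * (\<bar>f x\<bar> powr p / (A * p) + \<bar>g x\<bar> powr q / (B * q)) \<partial>M)"
  proof (rule integral_mono)
   show "integrable M (\<lambda>x. \<bar>f x * g x\<bar>)" using int by simp
   show "integrable M (\<lambda>x. a * b * (\<bar>f x\<bar> powr p / (A * p) + \<bar>g x\<bar> powr q / (B * q)))" using fi gi by simp
   fix x
   have "\<bar>f x / a * (g x / b)\<bar> \<le> \<bar>f x / a\<bar> powr p / p + \<bar>g x / b\<bar> powr q / q" by (rule young)
   also have "\<bar>f x / a\<bar> powr p = \<bar>f x\<bar> powr p / A" using ab by (simp add: powr_divide)
   also have "\<bar>g x / b\<bar> powr q = \<bar>g x\<bar> powr q / B" using ab by (simp add: powr_divide)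
   finally have "a * b * \<bar>f x / a * (g x / b)\<bar> \<le> a * b * (\<bar>f x\<bar> powr p / (A * p) + \<bar>g x\<bar> powr q / (B * q))"
    using ab by (intro mult_left_mono) simp_all
   moreover have "a * b * \<bar>f x / a * (g x / b)\<bar> = \<bar>f x * g x\<bar>" using ab by (simp add: abs_mult)
   ultimately show "\<bar>f x * g x\<bar> \<le> a * b * (\<bar>f x\<bar> powr p / (A * p) + \<bar>g x\<bar> powr q / (B * q))" by simp
  qed
  also have "\<dots> = a * b * (A / (A * p) + B / (B * q))"
   using fi gi by (simp add: A_def B_def)
  also have "\<dots> = a * b" using pos pq by simp
  finally show ?thesis unfolding a_def b_def .
 qed
qed

section \<open>Geodesics in a local tree\<close>

text \<open>In a tree this Gromov product is the distance from \<open>b\<close> at which the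
  segments to \<open>x\<close> and \<open>y\<close> separate. Thus the projection of
  \<open>z\<close> to [b, w] is the point at distance \<open>gromov b z w\<close> from
  \<open>b\<close>, and every cutoff below is a function of such products.\<close>

definition gromov :: "'a::metric_space \<Rightarrow> 'a \<Rightarrow> 'a \<Rightarrow> real" where
 "gromov b x y = (dist b x + dist b y - dist x y) / 2"

lemma gromov_commute: "gromov b x y = gromov b y x"
 by (simp add: gromov_def dist_commute)

lemma gromov_nonneg: "0 \<le> gromov b x y"
 using dist_triangle[of x y b] by (simp add: gromov_def dist_commute)

lemma gromov_le:
 "gromov b x y \<le> dist b x" "gromov b x y \<le> dist b y"
 using dist_triangle[of b y x] dist_triangle[of b x y] by (simp_all add: gromov_def dist_commute)

lemma gromov_lipschitz:
 "\<bar>gromov b x w - gromov b y w\<bar> \<le> dist x y"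
proof -
 have "dist b x \<le> dist b y + dist x y" "dist b y \<le> dist b x + dist x y"
  "dist x w \<le> dist x y + dist y w" "dist y w \<le> dist x y + dist x w"
  using dist_triangle[of b x y] dist_triangle[of b y x] dist_triangle[of x w y] dist_triangle[of y w x]
  by (simp_all add: dist_commute)
 then show ?thesis unfolding gromov_def by (simp add: abs_le_iff field_simps)
qed

text \<open>Neither extensional nor tied to a subset, unlike \<open>segment_param\<close>, so that
  initial pieces and shifts of geodesics are again geodesics.\<close>

definition geodesic :: "(real \<Rightarrow> 'a::metric_space) \<Rightarrow> 'a \<Rightarrow> 'a \<Rightarrow> bool" where
 "geodesic h u v \<longleftrightarrow> isometric_embedding {0..dist u v} h \<and> h 0 = u \<and> h (dist u v) = v"

lemma isometric_embeddingD:
 "isometric_embedding I h \<Longrightarrow> s \<in> I \<Longrightarrow> t \<in> I \<Longrightarrow> dist (h s) (h t) = \<bar>s - t\<bar>"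
 by (simp add: isometric_embedding_def dist_real_def)

lemma isometric_embedding_subset:
 "isometric_embedding I h \<Longrightarrow> J \<subseteq> I \<Longrightarrow> isometric_embedding J h"
 by (auto simp: isometric_embedding_def)

lemma isometric_embedding_inj_on: "isometric_embedding I h \<Longrightarrow> inj_on h I"
 by (rule inj_onI) (metis dist_eq_0_iff isometric_embedding_def)

lemma isometric_embedding_continuous_on: "isometric_embedding I h \<Longrightarrow> continuous_on I h"
 unfolding continuous_on_iff isometric_embedding_def by (metis dist_commute)

lemma geodesic_dist:
 assumes "geodesic h u v" "0 \<le> s" "s \<le> dist u v"
 shows "dist u (h s) = s" "dist (h s) v = dist u v - s"
proof -
 have i: "isometric_embedding {0..dist u v} h" "h 0 = u" "h (dist u v) = v"
  using assms(1) by (auto simp: geodesic_def)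
 show "dist u (h s) = s" using isometric_embeddingD[OF i(1), of 0 s] i(2) assms by simp
 show "dist (h s) v = dist u v - s" using isometric_embeddingD[OF i(1), of s "dist u v"] i(3) assms by simp
qed

lemma geodesic_initial:
 assumes "geodesic h u v" "0 \<le> s" "s \<le> dist u v"
 shows "geodesic h u (h s)"
 using assms geodesic_dist(1)[OF assms] unfolding geodesic_def
 by (auto intro: isometric_embedding_subset)

lemma geodesic_subarc:
 assumes "isometric_embedding {0..d} q" "0 \<le> s" "s \<le> t" "t \<le> d"
 shows "dist (q s) (q t) = t - s" "geodesic (\<lambda>r. q (s + r)) (q s) (q t)"
proof -
 show d: "dist (q s) (q t) = t - s" using isometric_embeddingD[OF assms(1), of s t] assms by simp
 show "geodesic (\<lambda>r. q (s + r)) (q s) (q t)"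
  unfolding geodesic_def d using assms by (auto simp: isometric_embedding_def dist_real_def)
qed

text \<open>Since \<open>\<iota>\<close> may be infinite, all estimates refer to a real number \<open>e \<le> \<iota>\<close>.\<close>

locale local_tree =
 fixes \<iota> :: ereal and e :: real and ty :: "'a::{metric_space, second_countable_topology} itself"
 assumes unbounded: "\<not> bounded (UNIV :: 'a set)"
  and proper: "proper_space TYPE('a)"
  and geodesic: "geodesic_space TYPE('a)"
  and tree: "uniform_local_tree TYPE('a) \<iota>"
  and e_pos: "0 < e" and e_le: "ereal e \<le> \<iota>"
begin

lemma real_tree_eball: "real_tree (eball (x::'a) \<iota>)"
 using tree by (simp add: uniform_local_tree_def)

lemma mem_eballI: "dist x y < e \<Longrightarrow> y \<in> eball (x::'a) \<iota>"
 using e_le order_less_le_trans[of "ereal (dist x y)" "ereal e" \<iota>] by (simp add: eball_def)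

lemma geodesic_exists: "\<exists>h. geodesic h (u::'a) v"
 using geodesic unfolding geodesic_space_def segment_param_def geodesic_def by blast

lemma segment_param_restrict:
 assumes "geodesic h (u::'a) v" "h ` {0..dist u v} \<subseteq> T"
 shows "segment_param T u v (restrict h {0..dist u v})"
 using assms unfolding segment_param_def geodesic_def isometric_embedding_def by auto

lemma geodesic_subset_eball:
 assumes "geodesic h (u::'a) v" "dist u v < e"
 shows "h ` {0..dist u v} \<subseteq> eball u \<iota>"
 using geodesic_dist(1)[OF assms(1)] assms(2) by (auto intro!: mem_eballI)

lemma the_segment_eq:
 assumes "geodesic h (u::'a) v" "real_tree T" "h ` {0..dist u v} \<subseteq> T"
 shows "the_segment T u v = restrict h {0..dist u v}"
proof -
 have uv: "u \<in> T" "v \<in> T" using assms(1,3) unfolding geodesic_def by (metis atLeastAtMost_iff image_subset_iff order_refl zero_le_dist)+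
 then have ex1: "\<exists>!h. segment_param T u v h" using assms(2) by (simp add: real_tree_def)
 have sp: "segment_param T u v (restrict h {0..dist u v})" by (rule segment_param_restrict[OF assms(1,3)])
 show ?thesis unfolding the_segment_def
  by (rule the_equality[where P="segment_param T u v", OF sp]) (use ex1 sp in blast)
qed

lemma geodesic_unique:
 assumes "geodesic h (u::'a) v" "geodesic f u v" "dist u v < e" "0 \<le> s" "s \<le> dist u v"
 shows "h s = f s"
proof -
 have "restrict h {0..dist u v} = restrict f {0..dist u v}"
  using the_segment_eq[OF assms(1) real_tree_eball geodesic_subset_eball[OF assms(1,3)]]
   the_segment_eq[OF assms(2) real_tree_eball geodesic_subset_eball[OF assms(2,3)]] by simp
 then have "restrict h {0..dist u v} s = restrict f {0..dist u v} s" by simp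
 then show ?thesis using assms(4,5) by simp
qed

text \<open>By the second tree axiom the path has the same image as the segment between its ends,
  and along a segment distances add.\<close>

lemma injective_path_between:
 assumes k: "continuous_on {0..1} \<kappa>" "inj_on \<kappa> {0..1}" "\<kappa> ` {0..1} \<subseteq> eball x \<iota>"
  and t: "t \<in> {0..1}"
 shows "dist (\<kappa> 0) (\<kappa> 1) = dist (\<kappa> 0) (\<kappa> t) + dist (\<kappa> t) (\<kappa> (1::real) :: 'a)"
proof -
 let ?T = "eball x \<iota>" and ?u = "\<kappa> 0" and ?v = "\<kappa> 1"
 have uv: "?u \<in> ?T" "?v \<in> ?T" by (rule subsetD[OF k(3)], simp)+
 then have ex: "\<exists>!h. segment_param ?T ?u ?v h" using real_tree_eball by (simp add: real_tree_def)
 have seg: "segment_param ?T ?u ?v (the_segment ?T ?u ?v)"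
  unfolding the_segment_def by (rule theI'[OF ex])
 have "\<kappa> ` {0..1} = the_segment ?T ?u ?v ` {0..dist ?u ?v}"
  using real_tree_eball[of x] k unfolding real_tree_def by blast
 moreover have "\<kappa> t \<in> \<kappa> ` {0..1}" using t by (rule imageI)
 ultimately obtain s where s: "s \<in> {0..dist ?u ?v}" "\<kappa> t = the_segment ?T ?u ?v s" by blast
 have "geodesic (the_segment ?T ?u ?v) ?u ?v"
  using seg by (simp add: segment_param_def geodesic_def)
 from geodesic_dist[OF this, of s] s show ?thesis by simp
qed

text \<open>Beyond their last common point the two geodesics form an injective path from \<open>x\<close> to \<open>y\<close>, hence a segment.\<close>

lemma geodesics_agree_iff:
 assumes h: "geodesic h (b::'a) x" and j: "geodesic j b y"
  and near: "dist b x < e / 2" "dist b y < e / 2"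
  and s: "0 \<le> s" "s \<le> dist b x" "s \<le> dist b y"
 shows "h s = j s \<longleftrightarrow> s \<le> gromov b x y"
proof
 assume eq: "h s = j s"
 have "dist x y \<le> dist (h s) x + dist (j s) y" unfolding eq by (rule dist_triangle3)
 then show "s \<le> gromov b x y"
  using geodesic_dist(2)[OF h s(1,2)] geodesic_dist(2)[OF j s(1,3)]
  by (simp add: gromov_def)
next
 assume le: "s \<le> gromov b x y"
 define m where "m = min (dist b x) (dist b y)"
 define S where "S = {s \<in> {0..m}. h s = j s}"
 have hc: "continuous_on {0..dist b x} h" and jc: "continuous_on {0..dist b y} j"
  using h j by (auto simp: geodesic_def intro: isometric_embedding_continuous_on)
 have "closed S"
 proof -
  have "continuous_on {0..m} (\<lambda>s. dist (h s) (j s))"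
   by (intro continuous_on_dist continuous_on_subset[OF hc] continuous_on_subset[OF jc]) (auto simp: m_def)
  then have "closed {s \<in> {0..m}. dist (h s) (j s) = 0}"
   by (rule continuous_closed_preimage_constant) auto
  then show ?thesis by (simp add: S_def)
 qed
 moreover have "0 \<in> S" using h j by (simp add: S_def m_def geodesic_def)
 moreover have bdd: "bdd_above S" unfolding S_def by (rule bdd_above_mono[of "{0..m}"]) auto
 ultimately have "Sup S \<in> S" using closed_contains_Sup by blast
 define c where "c = Sup S"
 have c: "0 \<le> c" "c \<le> dist b x" "c \<le> dist b y" "h c = j c"
  using \<open>Sup S \<in> S\<close> unfolding c_def S_def m_def by auto
 have cmax: "t \<le> c" if "0 \<le> t" "t \<le> dist b x" "t \<le> dist b y" "h t = j t" for t
  unfolding c_def using that by (intro cSup_upper[OF _ bdd]) (auto simp: S_def m_def)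
 have "gromov b x y \<le> c"
 proof (cases "c = dist b x \<or> c = dist b y")
  case True
  then show ?thesis using gromov_le[of b x y] by auto
 next
  case False
  then have lt: "c < dist b x" "c < dist b y" using c by auto
  define p where "p = dist b x - c"
  define q where "q = dist b y - c"
  have pq: "p > 0" "q > 0" using lt by (auto simp: p_def q_def)
  \<comment> \<open>From \<open>x\<close> back along \<open>h\<close> to the last common point
    \<open>h c\<close>, then along \<open>j\<close> to \<open>y\<close>; \<open>k\<close> is this
    path rescaled to the unit interval.\<close>
  define f where "f = (\<lambda>r. if r \<le> 0 then h (c - r) else j (c + r))"
  define k where "k = (\<lambda>t. f ((p + q) * t - p))"
  have fc: "continuous_on {-p..q} f"
  proof -
   have "continuous_on ({-p..0} \<union> {0..q}) f"
    unfolding f_def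
   proof (rule continuous_on_If)
    show "continuous_on {-p..0} (\<lambda>r. h (c - r))"
     by (rule continuous_on_compose2[OF hc]) (use c in \<open>auto intro!: continuous_intros simp: p_def\<close>)
    show "continuous_on {0..q} (\<lambda>r. j (c + r))"
     by (rule continuous_on_compose2[OF jc]) (use c in \<open>auto intro!: continuous_intros simp: q_def\<close>)
   qed (use c in auto)
   moreover have "{-p..0} \<union> {0..q} = {-p..q}" using pq by auto
   ultimately show ?thesis by simp
  qed
  have range: "(p + q) * t - p \<in> {-p..q}" if "t \<in> {0..1}" for t
  proof -
   have "(p + q) * t \<le> (p + q) * 1" using that pq by (intro mult_left_mono) auto
   moreover have "0 \<le> (p + q) * t" using that pq by simp
   ultimately show ?thesis by simp
  qed
  have finj: "r = r'" if r: "r \<in> {-p..q}" "r' \<in> {-p..q}" "f r = f r'" for r r'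
  proof -
   have ih: "inj_on h {0..dist b x}" and ij: "inj_on j {0..dist b y}"
    using h j by (auto simp: geodesic_def intro: isometric_embedding_inj_on)
   \<comment> \<open>Points of the two branches that coincide have the same distance from
     \<open>b\<close>, hence the same parameter on \<open>h\<close> and \<open>j\<close>, and would
     be a common point beyond \<open>c\<close>.\<close>
   have cross: False if "r1 \<in> {-p..q}" "r2 \<in> {-p..q}" "r1 \<le> 0" "0 < r2" "f r1 = f r2" for r1 r2
   proof -
    have eq: "h (c - r1) = j (c + r2)" using that by (simp add: f_def)
    have "c - r1 = dist b (h (c - r1))"
     by (rule geodesic_dist(1)[OF h, symmetric]) (use that c in \<open>auto simp: p_def\<close>)
    also have "\<dots> = c + r2" unfolding eq
     by (rule geodesic_dist(1)[OF j]) (use that c in \<open>auto simp: q_def\<close>)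
    finally have "c - r1 = c + r2" .
    then have "h (c + r2) = j (c + r2)" "c + r2 \<le> dist b x" using eq that by (auto simp: p_def)
    then have "c + r2 \<le> c" using that c by (intro cmax) (auto simp: q_def)
    then show False using that by simp
   qed
   consider "r \<le> 0" "r' \<le> 0" | "0 < r" "0 < r'" | "r \<le> 0" "0 < r'" | "r' \<le> 0" "0 < r" by linarith
   then show ?thesis
   proof cases
    case 1
    then have "c - r = c - r'" using r c by (intro inj_onD[OF ih]) (auto simp: f_def p_def)
    then show ?thesis by simp
   next
    case 2
    then have "c + r = c + r'" using r c by (intro inj_onD[OF ij]) (auto simp: f_def q_def)
    then show ?thesis by simp
   next
    case 3
    then show ?thesis using cross[of r r'] r by simp
   next
    case 4
    then show ?thesis using cross[of r' r] r by simp
   qed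
  qed
  have k1: "continuous_on {0..1} k"
   unfolding k_def by (rule continuous_on_compose2[OF fc]) (use range in \<open>auto intro!: continuous_intros\<close>)
  have k2: "inj_on k {0..1}"
  proof (rule inj_onI)
   fix t t' :: real assume tt: "t \<in> {0..1}" "t' \<in> {0..1}" "k t = k t'"
   then have "(p + q) * t - p = (p + q) * t' - p"
    using range unfolding k_def by (intro finj) auto
   then show "t = t'" using pq by simp
  qed
  have k3: "k ` {0..1} \<subseteq> eball b \<iota>"
  proof (rule image_subsetI, rule mem_eballI)
   fix t :: real assume "t \<in> {0..1}"
   from range[OF this] have r: "(p + q) * t - p \<in> {-p..q}" .
   define r where "r = (p + q) * t - p"
   have rr: "-p \<le> r" "r \<le> q" using r unfolding r_def by auto
   have "dist b (f r) < e"
   proof (cases "r \<le> 0")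
    case True
    then have "dist b (f r) = c - r" unfolding f_def
     using geodesic_dist(1)[OF h, of "c - r"] rr c by (simp add: p_def)
    then show ?thesis using rr near e_pos by (simp add: p_def)
   next
    case False
    then have "dist b (f r) = c + r" unfolding f_def
     using geodesic_dist(1)[OF j, of "c + r"] rr c by (simp add: q_def)
    then show ?thesis using rr near e_pos by (simp add: q_def)
   qed
   then show "dist b (k t) < e" by (simp add: k_def r_def)
  qed
  have t: "p / (p + q) \<in> {0..1}" using pq by simp
  have "k 0 = x" "k 1 = y" "k (p / (p + q)) = h c"
   using pq h j by (simp_all add: k_def f_def p_def q_def geodesic_def)
  then have "dist x y = dist x (h c) + dist (h c) y"
   using injective_path_between[OF k1 k2 k3 t] by simp
  also have "\<dots> = (dist b x - c) + (dist b y - c)"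
   using geodesic_dist(2)[OF h c(1,2)] geodesic_dist(2)[OF j c(1,3)] c(4)
   by (simp add: dist_commute)
  finally show ?thesis by (simp add: gromov_def)
 qed
 then have sc: "s \<le> c" using le by simp
 \<comment> \<open>Up to the last common point both curves are geodesics with the same ends, shorter
   than \<open>e\<close>, so they agree by uniqueness.\<close>
 have g1: "geodesic h b (h c)" by (rule geodesic_initial[OF h c(1,2)])
 have g2: "geodesic j b (h c)" unfolding c(4) by (rule geodesic_initial[OF j c(1,3)])
 have dc: "dist b (h c) = c" by (rule geodesic_dist(1)[OF h c(1,2)])
 show "h s = j s"
  by (rule geodesic_unique[OF g1 g2]) (use dc c near s sc e_pos in auto)
qed

text \<open>Up to the smaller product the first geodesic agrees with the second and the second with
  the third, hence the first with the third: the tree is 0-hyperbolic.\<close>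

lemma gromov_hyperbolic:
 assumes "dist (b::'a) x < e / 2" "dist b y < e / 2" "dist b z < e / 2"
 shows "min (gromov b x y) (gromov b y z) \<le> gromov b x z"
proof -
 obtain h f j where g: "geodesic h b x" "geodesic f b y" "geodesic j b z"
  using geodesic_exists by blast
 define s where "s = min (gromov b x y) (gromov b y z)"
 have s: "0 \<le> s" "s \<le> gromov b x y" "s \<le> gromov b y z"
  by (auto simp: s_def gromov_nonneg)
 have d: "s \<le> dist b x" "s \<le> dist b y" "s \<le> dist b z"
  using s(2,3) gromov_le[of b x y] gromov_le[of b y z] by auto
 have "h s = f s" using geodesics_agree_iff[OF g(1,2) assms(1,2) s(1) d(1,2)] s by simp
 moreover have "f s = j s" using geodesics_agree_iff[OF g(2,3) assms(2,3) s(1) d(2,3)] s by simp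
 ultimately show ?thesis using geodesics_agree_iff[OF g(1,3) assms(1,3) s(1) d(1,3)] s_def by simp
qed

text \<open>If the product is the full distance from \<open>b\<close> to \<open>z\<close>, the
  segment to \<open>z\<close> does not leave the segment to \<open>w\<close>, so \<open>z\<close>
  lies on it.\<close>

lemma on_geodesic:
 assumes "geodesic h (b::'a) w" "dist b w < e / 2" "gromov b z w = dist b z"
 shows "z = h (dist b z)" "dist b z \<le> dist b w"
proof -
 show d: "dist b z \<le> dist b w" using gromov_le(2)[of b z w] assms(3) by simp
 obtain f where f: "geodesic f b z" using geodesic_exists by blast
 have "f (dist b z) = h (dist b z)"
  using geodesics_agree_iff[OF f assms(1) _ assms(2), of "dist b z"] d assms(2,3) by simp
 then show "z = h (dist b z)" using f by (simp add: geodesic_def)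
qed

text \<open>Off the segment [b, w] the projection to it is locally constant: \<open>z\<close> and
  \<open>z'\<close> separate later than \<open>z\<close> and \<open>w\<close> do, and hyperbolicity
  applied both ways forces equal products. This is why gradients of functions of such products
  vanish off the segment.\<close>

lemma gromov_locally_constant:
 assumes "dist (b::'a) w < e / 2" "dist b z < e / 2" "dist b z' < e / 2"
  and "dist z z' < dist b z - gromov b z w"
 shows "gromov b z' w = gromov b z w"
proof -
 have "dist b z \<le> dist b z' + dist z z'" using dist_triangle[of b z z'] by (simp add: dist_commute)
 then have gz: "gromov b z z' \<ge> dist b z - dist z z'"
  by (simp add: gromov_def field_simps)
 then have lt: "gromov b z w < gromov b z z'" using assms(4) by simp
 have "min (gromov b z z') (gromov b z' w) \<le> gromov b z w"
  by (rule gromov_hyperbolic) (use assms in auto)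
 moreover have "min (gromov b z' z) (gromov b z w) \<le> gromov b z' w"
  by (rule gromov_hyperbolic) (use assms in auto)
 ultimately show ?thesis using lt gromov_commute[of b z z'] by simp
qed

lemma point_at_distance:
 assumes "0 \<le> r"
 shows "\<exists>y. dist (x::'a) y = r"
proof -
 obtain w where w: "r < dist x w"
 proof (rule ccontr)
  assume "\<not> thesis"
  then have "dist x w \<le> r" for w using that not_le by blast
  then have "bounded (UNIV::'a set)" unfolding bounded_def by blast
  then show False using unbounded by simp
 qed
 obtain h where "geodesic h x w" using geodesic_exists by blast
 then have "dist x (h r) = r" using geodesic_dist(1) assms w by (metis less_imp_le)
 then show ?thesis by blast
qed

end

section \<open>The length measure on arcs\<close>

locale length_space = local_tree \<iota> e ty
 for \<iota> e and ty :: "'a::{metric_space, second_countable_topology} itself" +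
 fixes \<nu> :: "'a measure" and \<gamma> :: "nat \<Rightarrow> real \<Rightarrow> 'a" and l :: "nat \<Rightarrow> real"
 assumes length_measure: "is_length_measure \<iota> \<nu>" and orientation: "orientation \<iota> \<gamma> l"
begin

text \<open>Arcs may be arbitrarily long, so that they include the charts of the orientation; an arc
  of length below \<open>e\<close> is itself a local arc chart.\<close>

definition arc :: "(real \<Rightarrow> 'a) \<Rightarrow> real \<Rightarrow> bool" where
 "arc q d \<longleftrightarrow> 0 < d \<and> isometric_embedding {0..d} q"

abbreviation "S \<equiv> skeleton \<iota> :: 'a set"

lemma arc_chart: "arc (\<gamma> n) (l n)"
 using orientation by (simp add: orientation_def local_arc_chart_def arc_def)

lemma skeleton_eq: "S = (\<Union>n. \<gamma> n ` {0<..<l n})"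
 using orientation by (simp add: orientation_def)

lemma space_nu: "space \<nu> = S"
 using length_measure by (simp add: is_length_measure_def)

lemma open_arc_eq:
 assumes "arc q d" "0 \<le> s" "s < t" "t \<le> d" "t - s < e"
 shows "open_arc \<iota> (q s) (q t) = q ` {s<..<t}" "q t \<in> eball (q s) \<iota>" "dist (q s) (q t) = t - s"
proof -
 have iso: "isometric_embedding {0..d} q" using assms(1) by (simp add: arc_def)
 have d: "dist (q s) (q t) = t - s" and g: "geodesic (\<lambda>r. q (s + r)) (q s) (q t)"
  using geodesic_subarc[OF iso, of s t] assms by auto
 show "dist (q s) (q t) = t - s" by (rule d)
 show "q t \<in> eball (q s) \<iota>" using d assms by (intro mem_eballI) simp
 have "the_segment (eball (q s) \<iota>) (q s) (q t) = restrict (\<lambda>r. q (s + r)) {0..t - s}"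
  using the_segment_eq[OF g real_tree_eball geodesic_subset_eball[OF g]] d assms(5) by simp
 then have "open_arc \<iota> (q s) (q t) = (\<lambda>r. q (s + r)) ` {0<..<t - s}"
  unfolding open_arc_def d by auto
 also have "\<dots> = q ` {s<..<t}"
 proof -
  have "{s<..<t} = (\<lambda>r. s + r) ` {0<..<t - s}"
  proof (intro equalityI subsetI)
   fix x assume "x \<in> {s<..<t}"
   then show "x \<in> (\<lambda>r. s + r) ` {0<..<t - s}" by (intro image_eqI[of _ _ "x - s"]) auto
  qed auto
  then show ?thesis by (simp add: image_image)
 qed
 finally show "open_arc \<iota> (q s) (q t) = q ` {s<..<t}" .
qed

lemma arc_in_skeleton:
 assumes "arc q d" "0 < s" "s < d"
 shows "q s \<in> S"
proof -
 define h where "h = min (e / 4) (min s (d - s))"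
 have h: "0 < h" "h \<le> e / 4" "h \<le> s" "h \<le> d - s" using e_pos assms by (auto simp: h_def min_def)
 have H: "0 \<le> s - h" "s - h < s + h" "s + h \<le> d" "(s + h) - (s - h) < e" using h e_pos by auto
 have "q s \<in> open_arc \<iota> (q (s - h)) (q (s + h))"
  using open_arc_eq(1)[OF assms(1) H] h by auto
 moreover have "q (s + h) \<in> eball (q (s - h)) \<iota>" by (rule open_arc_eq(2)[OF assms(1) H])
 ultimately show ?thesis unfolding skeleton_def by blast
qed

section \<open>Arcs and the measurable sets of the length measure\<close>

lemma arc_continuous_on: "arc q d \<Longrightarrow> continuous_on {0..d} q"
 by (simp add: arc_def isometric_embedding_continuous_on)

lemma arc_dist: "arc q d \<Longrightarrow> s \<in> {0..d} \<Longrightarrow> t \<in> {0..d} \<Longrightarrow> dist (q s) (q t) = \<bar>s - t\<bar>"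
 using isometric_embeddingD[of "{0..d}" q s t] by (simp add: arc_def)

lemma arc_inverse: "arc q d \<Longrightarrow> s \<in> {0..d} \<Longrightarrow> dist (q 0) (q s) = s"
 using arc_dist[of q d 0 s] by (auto simp: arc_def)

lemma arc_open_borel:
 assumes "arc q d" "0 \<le> s" "t \<le> d"
 shows "q ` {s<..<t} \<in> sets borel"
proof (cases "s < t")
 case True
 have inj: "inj_on q {0..d}" using assms(1) by (simp add: arc_def isometric_embedding_inj_on)
 have "q ` {s<..<t} = q ` {s..t} - {q s, q t}"
 proof (intro equalityI subsetI)
  fix x assume "x \<in> q ` {s<..<t}"
  then obtain r where r: "s < r" "r < t" "x = q r" by auto
  have "r \<in> {0..d}" "s \<in> {0..d}" "t \<in> {0..d}" using r assms True by auto
  then have "q r \<noteq> q s" "q r \<noteq> q t" using inj r by (auto dest: inj_onD)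
  then show "x \<in> q ` {s..t} - {q s, q t}" using r by auto
 qed (auto simp: less_eq_real_def)
 moreover have "compact (q ` {s..t})"
  using assms by (intro compact_continuous_image continuous_on_subset[OF arc_continuous_on[OF assms(1)]]) auto
 then have "closed (q ` {s..t})" by (rule compact_imp_closed)
 ultimately show ?thesis by auto
qed auto

lemma skeleton_borel: "S \<in> sets borel"
 unfolding skeleton_eq using arc_chart by (intro sets.countable_UN) (auto intro: arc_open_borel)

lemma arc_open_sets_nu_short:
 assumes "arc q d" "0 \<le> s" "t \<le> d" "t - s < e"
 shows "q ` {s<..<t} \<in> sets \<nu>"
proof (cases "s < t")
 case True
 have "q ` {s<..<t} \<in> {open_arc \<iota> x y |x y. y \<in> eball x \<iota>}"
  using open_arc_eq(2)[OF assms(1,2) True assms(3,4)]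
  unfolding open_arc_eq(1)[OF assms(1,2) True assms(3,4), symmetric] by blast
 then show ?thesis using length_measure unfolding is_length_measure_def by (auto intro: sigma_sets.Basic)
qed auto

lemma arc_preimage_open:
 assumes "arc q d" "open U"
 shows "open {s \<in> {0<..<d}. q s \<in> U}"
proof -
 have "continuous_on {0<..<d} q" by (rule continuous_on_subset[OF arc_continuous_on[OF assms(1)]]) auto
 then have "open (q -` U \<inter> {0<..<d})" using assms(2) continuous_on_open_vimage[of "{0<..<d}" q] by auto
 then show ?thesis by (simp add: vimage_def Int_def conj_commute)
qed

text \<open>The generators of the \<sigma>-field are open arcs inside small balls. An open parameter
  set is a countable union of rational intervals shorter than \<open>e\<close>, whose images are
  generators.\<close>

lemma arc_open_sets_nu:
 assumes "arc q d" "open W"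
 shows "q ` (W \<inter> {0<..<d}) \<in> sets \<nu>"
proof -
 let ?I = "{(s, t). s \<in> \<rat> \<and> t \<in> \<rat> \<and> 0 < s \<and> t < d \<and> t - s < e \<and> {s<..<t} \<subseteq> W}"
 have "countable ?I" by (rule countable_subset[of _ "\<rat> \<times> \<rat>"]) (auto intro: countable_rat)
 moreover have "q ` (W \<inter> {0<..<d}) = (\<Union>(s, t)\<in>?I. q ` {s<..<t})"
 proof (intro equalityI subsetI)
  fix x assume "x \<in> q ` (W \<inter> {0<..<d})"
  then obtain r where r: "r \<in> W" "0 < r" "r < d" "x = q r" by auto
  obtain \<delta> where \<delta>: "\<delta> > 0" "ball r \<delta> \<subseteq> W" using assms(2) r(1) openE by blast
  define h where "h = min (min \<delta> (e / 2)) (min r (d - r))"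
  have h: "h > 0" "h \<le> \<delta>" "h \<le> e / 2" "h \<le> r" "h \<le> d - r" using \<delta> e_pos r by (auto simp: h_def min_def)
  obtain s where s: "s \<in> \<rat>" "r - h < s" "s < r" using Rats_dense_in_real[of "r - h" r] h by auto
  obtain t where t: "t \<in> \<rat>" "r < t" "t < r + h" using Rats_dense_in_real[of r "r + h"] h by auto
  have "{s<..<t} \<subseteq> ball r \<delta>" using s t h by (auto simp: dist_real_def)
  then have "(s, t) \<in> ?I" using s t h \<delta>(2) by auto
  moreover have "x \<in> q ` {s<..<t}" using r s t by auto
  ultimately show "x \<in> (\<Union>(s, t)\<in>?I. q ` {s<..<t})" by blast
 next
  fix x assume "x \<in> (\<Union>(s, t)\<in>?I. q ` {s<..<t})"
  then show "x \<in> q ` (W \<inter> {0<..<d})" by fastforce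
 qed
 moreover have "q ` {s<..<t} \<in> sets \<nu>" if "(s, t) \<in> ?I" for s t
  using that by (intro arc_open_sets_nu_short[OF assms(1)]) auto
 ultimately show ?thesis by (auto intro!: sets.countable_UN')
qed

lemma id_measurable_nu: "(\<lambda>z. z) \<in> measurable \<nu> borel"
proof (rule borel_measurableI)
 fix U :: "'a set" assume U: "open U"
 have "(\<lambda>z. z) -` U \<inter> space \<nu> = (\<Union>n. \<gamma> n ` ({s \<in> {0<..<l n}. \<gamma> n s \<in> U} \<inter> {0<..<l n}))"
  unfolding space_nu skeleton_eq by auto
 moreover have "\<gamma> n ` ({s \<in> {0<..<l n}. \<gamma> n s \<in> U} \<inter> {0<..<l n}) \<in> sets \<nu>" for n
  by (rule arc_open_sets_nu[OF arc_chart arc_preimage_open[OF arc_chart U]])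
 ultimately show "(\<lambda>z. z) -` U \<inter> space \<nu> \<in> sets \<nu>" by auto
qed

text \<open>The \<sigma>-field of \<nu> is the Borel trace on the skeleton. An open set meets the
  skeleton in countably many chart images of open parameter sets; conversely an open arc is a
  compact arc without its two ends.\<close>

lemma sets_nu: "A \<in> sets \<nu> \<longleftrightarrow> A \<in> sets borel \<and> A \<subseteq> S"
proof
 assume A: "A \<in> sets borel \<and> A \<subseteq> S"
 then have "(\<lambda>z. z) -` A \<inter> space \<nu> \<in> sets \<nu>" by (intro measurable_sets[OF id_measurable_nu]) simp
 then show "A \<in> sets \<nu>" using A by (simp add: space_nu Int_absorb2)
next
 assume A: "A \<in> sets \<nu>"
 have "open_arc \<iota> x y \<in> sets borel" if "y \<in> eball x \<iota>" for x y :: 'a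
 proof (cases "x = y")
  case True
  then show ?thesis by (simp add: open_arc_def)
 next
  case False
  have "real_tree (eball x \<iota>)" by (rule real_tree_eball)
  moreover have "x \<in> eball x \<iota>" using e_pos by (intro mem_eballI) simp
  ultimately have "\<exists>!h. segment_param (eball x \<iota>) x y h" using that by (simp add: real_tree_def)
  then have "segment_param (eball x \<iota>) x y (the_segment (eball x \<iota>) x y)"
   unfolding the_segment_def by (rule theI')
  then have "arc (the_segment (eball x \<iota>) x y) (dist x y)" using False by (simp add: arc_def segment_param_def)
  from arc_open_borel[OF this, of 0 "dist x y"] show ?thesis unfolding open_arc_def by simp
 qed
 then have "{open_arc \<iota> x y |x y. y \<in> eball x \<iota>} \<subseteq> sets (borel :: 'a measure)" by blast
 moreover have "A \<in> sigma_sets S {open_arc \<iota> x y |x y. y \<in> eball x \<iota>}"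
  using A length_measure by (simp add: is_length_measure_def)
 ultimately have "A \<in> sets borel"
 proof (induction rule: sigma_sets.induct[OF \<open>A \<in> sigma_sets _ _\<close>])
  case (3 a)
  then show ?case using skeleton_borel by auto
 qed (auto intro!: sets.countable_UN)
 then show "A \<in> sets borel \<and> A \<subseteq> S" using sets.sets_into_space[OF A] space_nu by simp
qed

lemma borel_measurable_nu: "f \<in> borel_measurable borel \<Longrightarrow> f \<in> borel_measurable \<nu>"
 by (rule measurable_compose[OF id_measurable_nu])

section \<open>The length measure on an arc is Lebesgue measure\<close>

lemma nu_arc_open_short_interior:
 assumes "arc q d" "0 < s" "s < t" "t < d" "t - s < e"
 shows "emeasure \<nu> (q ` {s<..<t}) = ennreal (t - s)"
proof -
 have st: "0 \<le> s" "t \<le> d" using assms by auto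
 note oa = open_arc_eq[OF assms(1) st(1) assms(3) st(2) assms(5)]
 have "q s \<in> S" "q t \<in> S" using assms by (auto intro: arc_in_skeleton)
 moreover have "ereal (dist (q s) (q t)) < \<iota>" using oa(2) by (simp add: eball_def)
 moreover have "\<forall>x\<in>S. \<forall>y\<in>S. 0 < dist x y \<and> ereal (dist x y) < \<iota> \<longrightarrow>
    emeasure \<nu> (open_arc \<iota> x y) = ennreal (dist x y)"
  using length_measure by (simp add: is_length_measure_def)
 moreover have "0 < dist (q s) (q t)" using oa(3) assms(3) by simp
 ultimately have "emeasure \<nu> (open_arc \<iota> (q s) (q t)) = ennreal (dist (q s) (q t))" by blast
 then show ?thesis unfolding oa(1,3) .
qed

text \<open>An end of the arc may be a leaf outside the skeleton, where the length of open arcs is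
  not prescribed. The arc is exhausted by subarcs whose ends are interior, hence in the
  skeleton.\<close>

lemma nu_arc_open_short:
 assumes "arc q d" "0 \<le> s" "s < t" "t \<le> d" "t - s < e"
 shows "emeasure \<nu> (q ` {s<..<t}) = ennreal (t - s)"
proof -
 define h where "h = (\<lambda>n. (t - s) / 3 * inverse (real (Suc n)))"
 have hlim: "h \<longlonglongrightarrow> 0" unfolding h_def
  by (rule tendsto_mult_right_zero[OF LIMSEQ_inverse_real_of_nat])
 have h: "0 < h n" "3 * h n \<le> t - s" for n
 proof -
  show "0 < h n" unfolding h_def using assms(3) by simp
  have "inverse (real (Suc n)) \<le> 1" by (simp add: inverse_le_1_iff)
  then have "(t - s) * inverse (real (Suc n)) \<le> (t - s) * 1" using assms(3) by (intro mult_left_mono) auto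
  then show "3 * h n \<le> t - s" unfolding h_def by simp
 qed
 have hdec: "h n \<le> h m" if "m \<le> n" for m n
  unfolding h_def using that assms(3) by (intro mult_left_mono) (auto simp: le_imp_inverse_le)
 define A where "A = (\<lambda>n. q ` {s + h n<..<t - h n})"
 have inc: "incseq A" unfolding incseq_def A_def
 proof (intro allI impI image_mono)
  fix m n :: nat assume "m \<le> n"
  from hdec[OF this] show "{s + h m<..<t - h m} \<subseteq> {s + h n<..<t - h n}" by auto
 qed
 have UA: "(\<Union>n. A n) = q ` {s<..<t}"
 proof (intro equalityI subsetI)
  fix x assume "x \<in> (\<Union>n. A n)"
  then obtain n r where "s + h n < r" "r < t - h n" "x = q r" unfolding A_def by auto
  then show "x \<in> q ` {s<..<t}" using h(1)[of n] by auto
 next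
  fix x assume "x \<in> q ` {s<..<t}"
  then obtain r where r: "s < r" "r < t" "x = q r" by auto
  then have "0 < min (r - s) (t - r)" by simp
  from order_tendstoD(2)[OF hlim this] obtain n where "h n < min (r - s) (t - r)"
   using eventually_happens'[OF sequentially_bot] by blast
  then have "x \<in> A n" unfolding A_def using r by (intro image_eqI[of _ _ r]) auto
  then show "x \<in> (\<Union>n. A n)" by blast
 qed
 have Am: "emeasure \<nu> (A n) = ennreal (t - s - 2 * h n)" "A n \<in> sets \<nu>" for n
 proof -
  have *: "0 < s + h n" "s + h n < t - h n" "t - h n < d" "(t - h n) - (s + h n) < e"
   using h[of n] assms by auto
  have "emeasure \<nu> (A n) = ennreal ((t - h n) - (s + h n))"
   unfolding A_def by (rule nu_arc_open_short_interior[OF assms(1) *])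
  then show "emeasure \<nu> (A n) = ennreal (t - s - 2 * h n)" by (simp add: algebra_simps)
  show "A n \<in> sets \<nu>" unfolding A_def
   by (rule arc_open_sets_nu_short[OF assms(1)]) (use * in auto)
 qed
 have "(\<lambda>n. emeasure \<nu> (A n)) \<longlonglongrightarrow> emeasure \<nu> (\<Union>n. A n)"
  using Am(2) inc by (intro Lim_emeasure_incseq) auto
 moreover have "(\<lambda>n. emeasure \<nu> (A n)) \<longlonglongrightarrow> ennreal (t - s - 2 * 0)"
  unfolding Am(1) by (intro tendsto_ennrealI tendsto_intros hlim)
 ultimately have "emeasure \<nu> (\<Union>n. A n) = ennreal (t - s - 2 * 0)" by (rule LIMSEQ_unique)
 then show ?thesis unfolding UA by simp
qed

lemma interval_generator_short:
 assumes "0 < (r::real)"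
 shows "sets borel = sigma_sets UNIV {{a<..<b} | a b. b - a < r}"
proof -
 have "sets (borel :: real measure) = sigma_sets UNIV {{a<..<b} | a b. b - a < r}" (is "_ = ?R")
 proof
  have "{{a<..<b} | a b :: real. b - a < r} \<subseteq> sets borel" by auto
  then show "?R \<subseteq> sets borel" using sets.sigma_sets_subset[of _ borel] by (simp add: space_borel)
  have opn: "U \<in> ?R" if U: "open U" for U :: "real set"
  proof -
   let ?I = "{(s, t). s \<in> \<rat> \<and> t \<in> \<rat> \<and> t - s < r \<and> {s<..<t} \<subseteq> U}"
   have c: "countable ?I" by (rule countable_subset[of _ "\<rat> \<times> \<rat>"]) (auto intro: countable_rat)
   have "U = (\<Union>(s, t)\<in>?I. {s<..<t})"
   proof (intro equalityI subsetI)
    fix x assume "x \<in> U"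
    then obtain \<delta> where \<delta>: "\<delta> > 0" "ball x \<delta> \<subseteq> U" using U openE by blast
    define h where "h = min \<delta> (r / 2)"
    have h: "h > 0" "h \<le> \<delta>" "2 * h \<le> r" using \<delta> assms by (auto simp: h_def)
    obtain s where s: "s \<in> \<rat>" "x - h < s" "s < x" using Rats_dense_in_real[of "x - h" x] h by auto
    obtain t where t: "t \<in> \<rat>" "x < t" "t < x + h" using Rats_dense_in_real[of x "x + h"] h by auto
    have "{s<..<t} \<subseteq> ball x \<delta>" using s t h by (auto simp: dist_real_def)
    then have "(s, t) \<in> ?I" using s t h \<delta>(2) by auto
    moreover have "x \<in> {s<..<t}" using s t by auto
    ultimately show "x \<in> (\<Union>(s, t)\<in>?I. {s<..<t})" by blast
   qed auto
   moreover have "(\<Union>(s, t)\<in>?I. {s<..<t}) \<in> ?R"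
   proof (rule sigma_sets_UNION)
    show "countable ((\<lambda>(s, t). {s<..<t}) ` ?I)" using c by simp
    show "B \<in> ?R" if "B \<in> (\<lambda>(s, t). {s<..<t}) ` ?I" for B using that by (auto intro!: sigma_sets.Basic)
   qed
   ultimately show ?thesis by simp
  qed
  have "sigma_sets UNIV {U::real set. open U} \<subseteq> ?R"
   by (rule sigma_sets_mono) (use opn in auto)
  then show "sets borel \<subseteq> ?R" by (simp add: borel_def)
 qed
 then show ?thesis .
qed

text \<open>On the arc the distance from \<open>q 0\<close> inverts \<open>q\<close>. Lengths are
  known at first only for subarcs shorter than \<open>e\<close>; short intervals are stable under
  intersection and generate the Borel sets, so they determine the measure.\<close>

lemma distr_nu_arc:
 assumes "arc q d"
 shows "distr (restrict_space \<nu> (q ` {0<..<d})) borel (dist (q 0)) = density lborel (indicator {0<..<d})"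
  (is "?D = ?L")
proof -
 let ?A = "q ` {0<..<d}"
 have d: "0 < d" using assms by (simp add: arc_def)
 have A: "?A \<in> sets \<nu>" using arc_open_sets_nu[OF assms open_UNIV] by simp
 have As: "?A \<inter> space \<nu> \<in> sets \<nu>" using A by (metis sets.Int_space_eq2)
 have meas: "dist (q 0) \<in> measurable (restrict_space \<nu> ?A) borel"
  by (intro measurable_restrict_space1 borel_measurable_nu borel_measurable_continuous_onI continuous_intros)
 have emD: "emeasure ?D B = emeasure \<nu> (q ` {s \<in> {0<..<d}. s \<in> B})" if B: "B \<in> sets borel" for B
 proof -
  have "emeasure ?D B = emeasure (restrict_space \<nu> ?A) (dist (q 0) -` B \<inter> space (restrict_space \<nu> ?A))"
   by (rule emeasure_distr[OF meas B])
  also have "\<dots> = emeasure \<nu> (dist (q 0) -` B \<inter> space (restrict_space \<nu> ?A))"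
   using As by (intro emeasure_restrict_space) (auto simp: space_restrict_space)
  also have "dist (q 0) -` B \<inter> space (restrict_space \<nu> ?A) = q ` {s \<in> {0<..<d}. s \<in> B}"
  proof -
   have "?A \<subseteq> space \<nu>" using A sets.sets_into_space by blast
   then have "space (restrict_space \<nu> ?A) = ?A" by (auto simp: space_restrict_space)
   moreover have "dist (q 0) (q s) = s" if "s \<in> {0<..<d}" for s using arc_inverse[OF assms, of s] that by auto
   ultimately show ?thesis by auto
  qed
  finally show ?thesis .
 qed
 show ?thesis
 proof (rule measure_eqI_generator_eq)
  let ?E = "{{a<..<b} | a b :: real. b - a < e}"
  show "Int_stable ?E"
  proof (rule Int_stableI)
   fix X Y assume "X \<in> ?E" "Y \<in> ?E"
   then obtain a b c f where "X = {a<..<b}" "Y = {c<..<f}" "b - a < e" "f - c < e" by blast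
   then have "X \<inter> Y = {max a c<..<min b f}" "min b f - max a c < e" by auto
   then show "X \<inter> Y \<in> ?E" by blast
  qed
  show "?E \<subseteq> Pow UNIV" by simp
  show "sets ?D = sigma_sets UNIV ?E" "sets ?L = sigma_sets UNIV ?E"
   using interval_generator_short[OF e_pos] by simp_all
  show "emeasure ?D X = emeasure ?L X" if "X \<in> ?E" for X
  proof -
   obtain a b where X: "X = {a<..<b}" "b - a < e" using \<open>X \<in> ?E\<close> by blast
   have XB: "X \<in> sets borel" unfolding X by simp
   have eqs: "{s \<in> {0<..<d}. s \<in> X} = {max a 0<..<min b d}" unfolding X by auto
   have "emeasure ?L X = emeasure lborel ({0<..<d} \<inter> X)"
    using XB by (subst emeasure_density) (auto simp: indicator_inter_arith[symmetric])
   also have "{0<..<d} \<inter> X = {max a 0<..<min b d}" unfolding X by auto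
   finally have L: "emeasure ?L X = emeasure lborel {max a 0<..<min b d}" .
   show ?thesis
   proof (cases "max a 0 < min b d")
    case True
    have "emeasure \<nu> (q ` {max a 0<..<min b d}) = ennreal (min b d - max a 0)"
     by (rule nu_arc_open_short[OF assms]) (use True X d in auto)
    then show ?thesis unfolding emD[OF XB] L eqs using True by simp
   next
    case False
    then have "{max a 0<..<min b d} = {}" by auto
    then show ?thesis unfolding emD[OF XB] L eqs by simp
   qed
  qed
  \<comment> \<open>Intervals of length \<open>e / 2\<close> around the multiples of
    \<open>e / 4\<close>: countably many generators that overlap enough to cover the line.\<close>
  define A where "A = (\<lambda>i::nat. {(real_of_int (int_decode i) - 1) * (e / 4)<..<(real_of_int (int_decode i) + 1) * (e / 4)})"
  show "range A \<subseteq> ?E"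
  proof (rule image_subsetI)
   fix i
   have "(real_of_int (int_decode i) + 1) * (e / 4) - (real_of_int (int_decode i) - 1) * (e / 4) < e"
    using e_pos by (simp add: field_simps)
   then show "A i \<in> ?E" unfolding A_def by blast
  qed
  show "(\<Union>i. A i) = UNIV"
  proof (intro equalityI subsetI UNIV_I)
   fix x :: real
   define k where "k = \<lfloor>x / (e / 4)\<rfloor>"
   have k: "real_of_int k \<le> x / (e / 4)" "x / (e / 4) < real_of_int k + 1" unfolding k_def by linarith+
   have "x \<in> A (int_encode k)"
    unfolding A_def using k e_pos by (simp add: field_simps)
   then show "x \<in> (\<Union>i. A i)" by blast
  qed
  show "emeasure ?D (A i) \<noteq> \<infinity>" for i
  proof -
   have "emeasure ?D (A i) = emeasure ?L (A i)"
   proof -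
    have "A i \<in> ?E" using \<open>range A \<subseteq> ?E\<close> by blast
    then show ?thesis using \<open>\<And>X. X \<in> ?E \<Longrightarrow> emeasure ?D X = emeasure ?L X\<close> by blast
   qed
   also have "\<dots> \<le> emeasure ?L UNIV" by (intro emeasure_mono) auto
   also have "\<dots> = ennreal d" using d by (subst emeasure_density) auto
   finally show ?thesis by (auto simp: top_unique)
  qed
 qed
qed

end

section \<open>The weak gradient\<close>

text \<open>An isolated point is the only point of \<open>K\<close> in some interval with rational
  ends, and different points get different intervals.\<close>

lemma countable_isolated_points:
 fixes K :: "real set"
 shows "countable {s \<in> K. \<not> s islimpt K}" (is "countable ?I")
proof -
 have "\<exists>p. fst p \<in> \<rat> \<and> snd p \<in> \<rat> \<and> K \<inter> {fst p<..<snd p} = {s}" if s: "s \<in> ?I" for s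
 proof -
  obtain h where h: "h > 0" "\<And>t. t \<in> K \<Longrightarrow> dist t s < h \<Longrightarrow> t = s"
   using s unfolding islimpt_approachable by blast
  obtain a where a: "a \<in> \<rat>" "s - h < a" "a < s" using Rats_dense_in_real[of "s - h" s] h by auto
  obtain b where b: "b \<in> \<rat>" "s < b" "b < s + h" using Rats_dense_in_real[of s "s + h"] h by auto
  have "t = s" if "t \<in> K" "a < t" "t < b" for t
  proof (rule h(2)[OF that(1)])
   show "dist t s < h" using that(2,3) a(2,3) b(2,3) by (simp add: dist_real_def abs_less_iff)
  qed
  moreover have "s \<in> K \<inter> {a<..<b}" using s a(3) b(2) by simp
  ultimately have "K \<inter> {a<..<b} = {s}" by (intro equalityI subsetI) (simp_all)
  then show ?thesis using a(1) b(1) by (intro exI[of _ "(a, b)"]) simp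
 qed
 then have "\<forall>s\<in>?I. \<exists>p. fst p \<in> \<rat> \<and> snd p \<in> \<rat> \<and> K \<inter> {fst p<..<snd p} = {s}" by (rule ballI)
 from bchoice[OF this] obtain p where p: "\<forall>s\<in>?I. fst (p s) \<in> \<rat> \<and> snd (p s) \<in> \<rat> \<and> K \<inter> {fst (p s)<..<snd (p s)} = {s}" ..
 have "inj_on p ?I"
 proof (rule inj_onI)
  fix s t assume st: "s \<in> ?I" "t \<in> ?I" "p s = p t"
  have 1: "K \<inter> {fst (p s)<..<snd (p s)} = {s}" by (rule bspec[OF p st(1), THEN conjunct2, THEN conjunct2])
  have 2: "K \<inter> {fst (p t)<..<snd (p t)} = {t}" by (rule bspec[OF p st(2), THEN conjunct2, THEN conjunct2])
  have "{s} = {t}" by (rule trans[OF 1[symmetric, unfolded st(3)] 2])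
  then show "s = t" by (rule singleton_inject)
 qed
 moreover have "countable (p ` ?I)"
 proof (rule countable_subset)
  show "p ` ?I \<subseteq> \<rat> \<times> \<rat>"
  proof
   fix q assume "q \<in> p ` ?I"
   then obtain s where "s \<in> ?I" "q = p s" by blast
   moreover have "fst (p s) \<in> \<rat>" "snd (p s) \<in> \<rat>"
    by (rule bspec[OF p \<open>s \<in> ?I\<close>, THEN conjunct1], rule bspec[OF p \<open>s \<in> ?I\<close>, THEN conjunct2, THEN conjunct1])
   ultimately show "q \<in> \<rat> \<times> \<rat>" by (simp only: mem_Times_iff)
  qed
  show "countable (\<rat> \<times> (\<rat> :: real set))" by (intro countable_SIGMA countable_rat)
 qed
 ultimately show ?thesis by (rule countable_image_inj_on[rotated])
qed

lemma real_derivative_abs_le: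
 assumes "(f has_real_derivative D) (at x)" "(g has_real_derivative E) (at x)"
  "\<forall>\<^sub>F y in at x. \<bar>f y - f x\<bar> \<le> \<bar>g y - g x\<bar>"
 shows "\<bar>D\<bar> \<le> \<bar>E\<bar>"
proof (rule tendsto_le[OF at_neq_bot])
 show "((\<lambda>y. \<bar>(g y - g x) / (y - x)\<bar>) \<longlongrightarrow> \<bar>E\<bar>) (at x)"
  using assms(2) unfolding has_field_derivative_iff by (rule tendsto_rabs)
 show "((\<lambda>y. \<bar>(f y - f x) / (y - x)\<bar>) \<longlongrightarrow> \<bar>D\<bar>) (at x)"
  using assms(1) unfolding has_field_derivative_iff by (rule tendsto_rabs)
 show "\<forall>\<^sub>F y in at x. \<bar>(f y - f x) / (y - x)\<bar> \<le> \<bar>(g y - g x) / (y - x)\<bar>"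
  using assms(3) by eventually_elim (simp add: abs_divide divide_right_mono)
qed

lemma real_derivative_mult_nonpos:
 assumes "(f has_real_derivative D) (at x)" "(g has_real_derivative E) (at x)"
  "\<forall>\<^sub>F y in at x. (f y - f x) * (g y - g x) \<le> 0"
 shows "D * E \<le> 0"
proof (rule tendsto_upperbound[OF _ _ at_neq_bot])
 show "((\<lambda>y. (f y - f x) / (y - x) * ((g y - g x) / (y - x))) \<longlongrightarrow> D * E) (at x)"
  using assms(1,2) unfolding has_field_derivative_iff by (rule tendsto_mult)
 show "\<forall>\<^sub>F y in at x. (f y - f x) / (y - x) * ((g y - g x) / (y - x)) \<le> 0"
  using assms(3)
 proof eventually_elim
  case (elim y)
  have "(f y - f x) / (y - x) * ((g y - g x) / (y - x)) = (f y - f x) * (g y - g x) / (y - x)\<^sup>2"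
   by (simp add: power2_eq_square)
  then show ?case using elim by (simp add: divide_nonpos_nonneg)
 qed
qed

context length_space
begin

abbreviation RL :: "real \<Rightarrow> real measure" where "RL d \<equiv> restrict_space lborel {0<..<d}"

abbreviation grad :: "('a \<Rightarrow> real) \<Rightarrow> 'a \<Rightarrow> real" where "grad \<equiv> weak_grad \<gamma> l"

abbreviation gnorm :: "('a \<Rightarrow> real) \<Rightarrow> real" where "gnorm u \<equiv> norm_L2 \<nu> (grad u)"

section \<open>Integrals and null sets along an arc\<close>

lemma space_RL: "space (RL d) = {0<..<d}"
 by (simp add: space_restrict_space)

lemma arc_sets_nu: "arc q d \<Longrightarrow> q ` {0<..<d} \<in> sets \<nu>"
 using arc_open_sets_nu[OF _ open_UNIV] by simp

lemma arc_measurable_borel: "arc q d \<Longrightarrow> q \<in> measurable (RL d) borel"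
proof -
 assume a: "arc q d"
 have "continuous_on {0<..<d} q" by (rule continuous_on_subset[OF arc_continuous_on[OF a]]) auto
 then have "q \<in> measurable (restrict_space borel {0<..<d}) borel" by (rule borel_measurable_continuous_on_restrict)
 then show ?thesis by (subst measurable_cong_sets[OF sets_restrict_space_cong[OF sets_lborel] refl])
qed

lemma arc_measurable: "arc q d \<Longrightarrow> q \<in> measurable (RL d) \<nu>"
proof (rule measurableI)
 assume a: "arc q d"
 show "q s \<in> space \<nu>" if "s \<in> space (RL d)" for s
  using that arc_in_skeleton[OF a] by (auto simp: space_RL space_nu)
 show "q -` A \<inter> space (RL d) \<in> sets (RL d)" if "A \<in> sets \<nu>" for A
  using measurable_sets[OF arc_measurable_borel[OF a]] that by (simp add: sets_nu)
qed

text \<open>Since an arc is parametrised by length, \<nu> on it is the image of Lebesgue measure.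
  Integrals and exceptional sets on the skeleton are reduced through this to one real
  variable.\<close>

lemma nu_restrict_arc:
 assumes "arc q d"
 shows "density \<nu> (indicator (q ` {0<..<d})) = distr (RL d) \<nu> q"
proof (rule measure_eqI)
 let ?A = "q ` {0<..<d}"
 fix B assume "B \<in> sets (density \<nu> (indicator ?A))"
 then have B: "B \<in> sets \<nu>" by simp
 have A: "?A \<in> sets \<nu>" by (rule arc_sets_nu[OF assms])
 define C where "C = q -` B \<inter> {0<..<d}"
 have "C \<in> sets (RL d)"
  using measurable_sets[OF arc_measurable[OF assms] B] by (simp add: C_def space_RL)
 then have C: "C \<in> sets borel" "C \<subseteq> {0<..<d}" by (auto simp: sets_restrict_space C_def)
 have As: "?A \<inter> space \<nu> \<in> sets \<nu>" using A by (metis sets.Int_space_eq2)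
 have "emeasure (density \<nu> (indicator ?A)) B = emeasure \<nu> (?A \<inter> B)"
  using A B by (subst emeasure_density) (auto simp: indicator_inter_arith[symmetric])
 also have "?A \<inter> B = dist (q 0) -` C \<inter> space (restrict_space \<nu> ?A)"
 proof -
  have "space (restrict_space \<nu> ?A) = ?A" using sets.sets_into_space[OF A] by (auto simp: space_restrict_space)
  moreover have "dist (q 0) (q s) = s" if "s \<in> {0<..<d}" for s using arc_inverse[OF assms, of s] that by auto
  ultimately show ?thesis by (auto simp: C_def)
 qed
 also have "emeasure \<nu> \<dots> = emeasure (restrict_space \<nu> ?A) (dist (q 0) -` C \<inter> space (restrict_space \<nu> ?A))"
  using As by (intro emeasure_restrict_space[symmetric]) (auto simp: space_restrict_space)
 also have "\<dots> = emeasure (distr (restrict_space \<nu> ?A) borel (dist (q 0))) C"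
  using C by (intro emeasure_distr[symmetric] measurable_restrict_space1 borel_measurable_nu
    borel_measurable_continuous_onI continuous_intros)
 also have "\<dots> = emeasure lborel C"
  unfolding distr_nu_arc[OF assms] using C
  by (subst emeasure_density) (auto simp: indicator_inter_arith[symmetric] Int_absorb1)
 also have "\<dots> = emeasure (RL d) C" using C by (intro emeasure_restrict_space[symmetric]) auto
 also have "\<dots> = emeasure (distr (RL d) \<nu> q) B"
  using B by (subst emeasure_distr[OF arc_measurable[OF assms]]) (auto simp: C_def space_RL)
 finally show "emeasure (density \<nu> (indicator ?A)) B = emeasure (distr (RL d) \<nu> q) B" .
qed simp

lemma nn_integral_arc:
 assumes "arc q d" "h \<in> borel_measurable \<nu>"
 shows "(\<integral>\<^sup>+z. h z * indicator (q ` {0<..<d}) z \<partial>\<nu>) = (\<integral>\<^sup>+s. h (q s) \<partial>RL d)"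
proof -
 have "(\<integral>\<^sup>+z. h z * indicator (q ` {0<..<d}) z \<partial>\<nu>) = (\<integral>\<^sup>+z. h z \<partial>density \<nu> (indicator (q ` {0<..<d})))"
  using assms arc_sets_nu[OF assms(1)] by (subst nn_integral_density) (auto simp: mult.commute)
 also have "\<dots> = (\<integral>\<^sup>+s. h (q s) \<partial>RL d)"
  unfolding nu_restrict_arc[OF assms(1)] using assms by (subst nn_integral_distr[OF arc_measurable]) auto
 finally show ?thesis .
qed

lemma integral_arc:
 fixes h :: "'a \<Rightarrow> real"
 assumes "arc q d" "h \<in> borel_measurable \<nu>"
 shows "(\<integral>z. indicator (q ` {0<..<d}) z * h z \<partial>\<nu>) = (\<integral>s. h (q s) \<partial>RL d)"
proof -
 have "(\<integral>z. indicator (q ` {0<..<d}) z * h z \<partial>\<nu>) = (\<integral>z. h z \<partial>density \<nu> (\<lambda>z. ennreal (indicator (q ` {0<..<d}) z)))"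
  using assms arc_sets_nu[OF assms(1)] by (subst integral_density) auto
 also have "(\<lambda>z. ennreal (indicator (q ` {0<..<d}) z)) = indicator (q ` {0<..<d})"
  by (auto simp: indicator_def)
 also have "(\<integral>z. h z \<partial>density \<nu> (indicator (q ` {0<..<d}))) = (\<integral>s. h (q s) \<partial>RL d)"
  unfolding nu_restrict_arc[OF assms(1)] using assms by (subst integral_distr[OF arc_measurable]) auto
 finally show ?thesis .
qed

lemma AE_nu_arcD:
 assumes "arc q d" "AE z in \<nu>. P z"
 shows "AE s in lborel. s \<in> {0<..<d} \<longrightarrow> P (q s)"
proof -
 obtain Z where Z: "{z \<in> space \<nu>. \<not> P z} \<subseteq> Z" "emeasure \<nu> Z = 0" "Z \<in> sets \<nu>"
  using AE_E[OF assms(2)] by auto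
 have "emeasure (distr (RL d) \<nu> q) Z = 0"
  unfolding nu_restrict_arc[OF assms(1), symmetric]
  using Z arc_sets_nu[OF assms(1)] by (subst emeasure_density) (auto simp: nn_integral_0_iff_AE intro!: AE_I'[of Z])
 then have 0: "emeasure (RL d) (q -` Z \<inter> space (RL d)) = 0"
  using Z by (subst (asm) emeasure_distr[OF arc_measurable[OF assms(1)]]) auto
 have m: "q -` Z \<inter> space (RL d) \<in> sets (RL d)" by (rule measurable_sets[OF arc_measurable[OF assms(1)] Z(3)])
 have "AE s in RL d. P (q s)"
 proof (rule AE_I[OF _ 0 m])
  show "{s \<in> space (RL d). \<not> P (q s)} \<subseteq> q -` Z \<inter> space (RL d)"
   using Z(1) arc_in_skeleton[OF assms(1)] by (auto simp: space_RL space_nu)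
 qed
 then show ?thesis by (subst (asm) AE_restrict_space_iff) auto
qed

lemma nu_arc_subset:
 assumes "arc q d" "E \<in> sets borel" "E \<subseteq> q ` {0<..<d}"
 shows "{s \<in> {0<..<d}. q s \<in> E} \<in> sets lborel" "emeasure \<nu> E = emeasure lborel {s \<in> {0<..<d}. q s \<in> E}"
proof -
 have ES: "E \<in> sets \<nu>" unfolding sets_nu using assms arc_in_skeleton[OF assms(1)] by auto
 have eq: "q -` E \<inter> space (RL d) = {s \<in> {0<..<d}. q s \<in> E}" unfolding space_RL by auto
 have RS: "{s \<in> {0<..<d}. q s \<in> E} \<in> sets (RL d)"
  unfolding eq[symmetric] by (rule measurable_sets[OF arc_measurable_borel[OF assms(1)] assms(2)])
 have "{0<..<d} \<inter> space lborel \<in> sets lborel" by simp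
 from RS[unfolded sets_restrict_space_iff[OF this]] show "{s \<in> {0<..<d}. q s \<in> E} \<in> sets lborel" by (rule conjunct2)
 have "emeasure \<nu> E = (\<integral>\<^sup>+z. indicator E z * indicator (q ` {0<..<d}) z \<partial>\<nu>)"
  unfolding nn_integral_indicator[OF ES, symmetric]
  using assms(3) by (intro nn_integral_cong) (auto split: split_indicator)
 also have "\<dots> = (\<integral>\<^sup>+s. indicator E (q s) \<partial>RL d)" using ES by (intro nn_integral_arc assms(1)) simp
 also have "\<dots> = (\<integral>\<^sup>+s. indicator {s \<in> {0<..<d}. q s \<in> E} s \<partial>RL d)"
  by (intro nn_integral_cong) (auto simp: space_RL indicator_def)
 also have "\<dots> = emeasure (RL d) {s \<in> {0<..<d}. q s \<in> E}" by (rule nn_integral_indicator[OF RS])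
 also have "\<dots> = emeasure lborel {s \<in> {0<..<d}. q s \<in> E}" by (rule emeasure_restrict_space) auto
 finally show "emeasure \<nu> E = emeasure lborel {s \<in> {0<..<d}. q s \<in> E}" .
qed

lemma AE_nu_arcI:
 assumes "arc q d" "AE s in lborel. s \<in> {0<..<d} \<longrightarrow> P (q s)"
 shows "AE z in \<nu>. z \<in> q ` {0<..<d} \<longrightarrow> P z"
proof -
 obtain N where N: "{s. \<not> (s \<in> {0<..<d} \<longrightarrow> P (q s))} \<subseteq> N" "emeasure lborel N = 0" "N \<in> sets borel"
  using AE_E[OF assms(2)] by auto
 define Z where "Z = q ` {0<..<d} \<inter> dist (q 0) -` N"
 have "dist (q 0) -` N \<in> sets borel"
  using measurable_sets_borel[OF borel_measurable_continuous_onI N(3), of "dist (q 0)"] by (simp add: continuous_intros)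
 then have Z: "Z \<in> sets \<nu>" "Z \<in> sets borel" using arc_sets_nu[OF assms(1)] unfolding Z_def sets_nu by auto
 show ?thesis
 proof (rule AE_I[OF _ _ Z(1)])
  show "{z \<in> space \<nu>. \<not> (z \<in> q ` {0<..<d} \<longrightarrow> P z)} \<subseteq> Z"
  proof
   fix z assume "z \<in> {z \<in> space \<nu>. \<not> (z \<in> q ` {0<..<d} \<longrightarrow> P z)}"
   then obtain s where s: "s \<in> {0<..<d}" "z = q s" "\<not> P (q s)" by blast
   then have "s \<in> N" using N(1) by blast
   then show "z \<in> Z" unfolding Z_def using s arc_inverse[OF assms(1), of s] by auto
  qed
  have "emeasure \<nu> Z = emeasure lborel {s \<in> {0<..<d}. q s \<in> Z}"
   by (rule nu_arc_subset(2)[OF assms(1) Z(2)]) (auto simp: Z_def)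
  also have "\<dots> \<le> emeasure lborel N"
  proof (rule emeasure_mono)
   show "{s \<in> {0<..<d}. q s \<in> Z} \<subseteq> N"
   proof
    fix s assume "s \<in> {s \<in> {0<..<d}. q s \<in> Z}"
    then show "s \<in> N" using arc_inverse[OF assms(1), of s] by (simp add: Z_def)
   qed
  qed (use N in simp)
  finally show "emeasure \<nu> Z = 0" using N by simp
 qed
qed

definition piece :: "nat \<Rightarrow> 'a set" where
 "piece n = \<gamma> n ` {0<..<l n} - (\<Union>j<n. \<gamma> j ` {0<..<l j})"

lemma piece_disjoint: "z \<in> piece n \<Longrightarrow> z \<in> piece k \<Longrightarrow> n = k"
 by (rule linorder_cases[of n k]) (auto simp: piece_def)

lemma skeleton_piece:
 assumes "z \<in> S"
 obtains n t where "z \<in> piece n" "t \<in> {0<..<l n}" "z = \<gamma> n t"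
proof -
 have "\<exists>n. z \<in> \<gamma> n ` {0<..<l n}" using assms skeleton_eq by blast
 then have "z \<in> \<gamma> (LEAST n. z \<in> \<gamma> n ` {0<..<l n}) ` {0<..<l (LEAST n. z \<in> \<gamma> n ` {0<..<l n})}" by (rule LeastI_ex)
 moreover have "z \<notin> \<gamma> j ` {0<..<l j}" if "j < (LEAST n. z \<in> \<gamma> n ` {0<..<l n})" for j using that by (rule not_less_Least)
 ultimately have "z \<in> piece (LEAST n. z \<in> \<gamma> n ` {0<..<l n})" unfolding piece_def by blast
 then show ?thesis using that unfolding piece_def by blast
qed

lemma piece_sets: "piece n \<in> sets borel"
 unfolding piece_def using arc_open_borel[OF arc_chart] by (intro sets.Diff sets.finite_UN) auto

lemma weak_grad_at:
 assumes "z \<in> piece n" "t \<in> {0<..<l n}" "z = \<gamma> n t"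
 shows "grad u z = deriv (u \<circ> \<gamma> n) t"
proof -
 have "inj_on (\<gamma> n) {0..l n}" using arc_chart[of n] by (simp add: arc_def isometric_embedding_inj_on)
 then have inv: "inv_into {0..l n} (\<gamma> n) z = t" using assms(2,3) by (auto intro: inv_into_f_eq)
 have "grad u z = (\<Sum>k. indicator (piece k) z * deriv (u \<circ> \<gamma> k) (inv_into {0..l k} (\<gamma> k) z))"
  unfolding weak_grad_def piece_def ..
 also have "\<dots> = (\<Sum>k\<in>{n}. indicator (piece k) z * deriv (u \<circ> \<gamma> k) (inv_into {0..l k} (\<gamma> k) z))"
 proof (rule suminf_finite)
  fix k assume "k \<notin> {n}"
  then have "z \<notin> piece k" using piece_disjoint assms(1) by blast
  then show "indicator (piece k) z * deriv (u \<circ> \<gamma> k) (inv_into {0..l k} (\<gamma> k) z) = 0" by simp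
 qed simp
 also have "\<dots> = deriv (u \<circ> \<gamma> n) t" using assms(1) inv by simp
 finally show ?thesis .
qed

text \<open>Composition with \<open>clip\<close> continues a function on an arc constantly beyond
  its ends; the result is continuous on the line, so measurability of derivatives of continuous
  functions applies.\<close>

definition clip :: "real \<Rightarrow> real \<Rightarrow> real" where "clip d s = max 0 (min d s)"

lemma clip_arc_continuous:
 assumes "arc q d" "continuous_on UNIV u"
 shows "continuous_on UNIV (\<lambda>s. u (q (clip d s)))"
proof -
 have d: "0 < d" using assms(1) by (simp add: arc_def)
 have "continuous_on UNIV (clip d)" unfolding clip_def by (intro continuous_intros)
 then have "continuous_on UNIV (\<lambda>s. q (clip d s))"
  by (rule continuous_on_compose2[OF arc_continuous_on[OF assms(1)]]) (use d in \<open>auto simp: clip_def\<close>)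
 then show ?thesis by (rule continuous_on_compose2[OF assms(2)]) simp
qed

lemma deriv_clip:
 assumes "s \<in> {0<..<d}"
 shows "deriv (\<lambda>s. u (q (clip d s))) s = deriv (u \<circ> q) s"
proof (rule deriv_cong_ev)
 have "\<forall>\<^sub>F t in nhds s. t \<in> {0<..<d}" using assms by (intro eventually_nhds_in_open) auto
 then show "\<forall>\<^sub>F t in nhds s. u (q (clip d t)) = (u \<circ> q) t" by eventually_elim (simp add: clip_def)
qed simp

lemma deriv_arc_measurable:
 assumes "arc q d" "continuous_on UNIV u"
 shows "deriv (u \<circ> q) \<in> borel_measurable (RL d)"
proof -
 have "deriv (\<lambda>s. u (q (clip d s))) \<in> borel_measurable borel"
  by (rule borel_measurable_deriv[OF clip_arc_continuous[OF assms]])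
 then have "deriv (\<lambda>s. u (q (clip d s))) \<in> borel_measurable (RL d)" by (intro measurable_restrict_space1) simp
 then show ?thesis by (rule measurable_cong[THEN iffD1, rotated]) (auto simp: space_RL intro: deriv_clip)
qed

lemma weak_grad_measurable:
 assumes "continuous_on UNIV u"
 shows "grad u \<in> borel_measurable \<nu>"
proof -
 define g where "g = (\<lambda>z. \<Sum>k. indicator (piece k) z * deriv (\<lambda>s. u (\<gamma> k (clip (l k) s))) (dist (\<gamma> k 0) z))"
 have "g \<in> borel_measurable borel"
  unfolding g_def
 proof (intro borel_measurable_suminf borel_measurable_times borel_measurable_indicator piece_sets)
  show "(\<lambda>z. deriv (\<lambda>s. u (\<gamma> k (clip (l k) s))) (dist (\<gamma> k 0) z)) \<in> borel_measurable borel" for k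
   by (rule measurable_compose[OF _ borel_measurable_deriv[OF clip_arc_continuous[OF arc_chart assms]]])
    (intro borel_measurable_continuous_onI continuous_intros)
 qed
 then have g: "g \<in> borel_measurable \<nu>" by (rule borel_measurable_nu)
 show ?thesis
 proof (rule measurable_cong[THEN iffD1, OF _ g])
  fix z assume "z \<in> space \<nu>"
  then have "z \<in> S" by (simp add: space_nu)
  then obtain n t where z: "z \<in> piece n" "t \<in> {0<..<l n}" "z = \<gamma> n t" by (rule skeleton_piece)
  have t: "dist (\<gamma> n 0) z = t" using arc_inverse[OF arc_chart, of t n] z by auto
  have "g z = (\<Sum>k\<in>{n}. indicator (piece k) z * deriv (\<lambda>s. u (\<gamma> k (clip (l k) s))) (dist (\<gamma> k 0) z))"
   unfolding g_def
  proof (rule suminf_finite)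
   fix k assume "k \<notin> {n}"
   then have "z \<notin> piece k" using piece_disjoint z(1) by blast
   then show "indicator (piece k) z * deriv (\<lambda>s. u (\<gamma> k (clip (l k) s))) (dist (\<gamma> k 0) z) = 0" by simp
  qed simp
  also have "\<dots> = deriv (u \<circ> \<gamma> n) t" using z(1,2) t by (simp add: deriv_clip)
  finally show "g z = grad u z" using weak_grad_at[OF z] by simp
 qed
qed

text \<open>Marks the points where \<open>weak_grad\<close> is a genuine derivative and not the
  default value of \<open>deriv\<close>. On the skeleton the index and parameter quantified here are
  determined by the point.\<close>

definition grad_exists :: "('a \<Rightarrow> real) \<Rightarrow> 'a \<Rightarrow> bool" where
 "grad_exists u z \<longleftrightarrow> (\<forall>n t. z \<in> piece n \<longrightarrow> t \<in> {0<..<l n} \<longrightarrow> z = \<gamma> n t \<longrightarrow> (u \<circ> \<gamma> n) differentiable (at t))"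

lemma AE_grad_exists:
 assumes "u \<in> AC \<iota>"
 shows "AE z in \<nu>. grad_exists u z"
proof -
 have "AE z in \<nu>. z \<in> \<gamma> n ` {0<..<l n} \<longrightarrow> (\<forall>t\<in>{0<..<l n}. z = \<gamma> n t \<longrightarrow> (u \<circ> \<gamma> n) differentiable (at t))" for n
 proof (rule AE_nu_arcI[OF arc_chart])
  have "local_arc_chart \<iota> (\<gamma> n) (l n)" using orientation by (simp add: orientation_def)
  then have "abs_continuous_on_interval 0 (l n) (u \<circ> \<gamma> n)" using assms by (simp add: AC_def)
  then obtain N where N: "negligible N" "\<And>x. 0 < x \<Longrightarrow> x < l n \<Longrightarrow> x \<notin> N \<Longrightarrow> (u \<circ> \<gamma> n) differentiable (at x)"
   using abs_continuous_differentiable_ae by blast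
  have "AE s in lebesgue. s \<notin> N" using N(1) by (intro AE_not_in) (simp add: negligible_iff_null_sets)
  then have "AE s in lborel. s \<notin> N" by (simp add: AE_completion_iff)
  then show "AE s in lborel. s \<in> {0<..<l n} \<longrightarrow> (\<forall>t\<in>{0<..<l n}. \<gamma> n s = \<gamma> n t \<longrightarrow> (u \<circ> \<gamma> n) differentiable (at t))"
  proof eventually_elim
   case (elim s)
   have "inj_on (\<gamma> n) {0..l n}" using arc_chart[of n] by (simp add: arc_def isometric_embedding_inj_on)
   then show ?case using N(2) elim by (auto dest!: inj_onD)
  qed
 qed
 then have "AE z in \<nu>. \<forall>n. z \<in> \<gamma> n ` {0<..<l n} \<longrightarrow> (\<forall>t\<in>{0<..<l n}. z = \<gamma> n t \<longrightarrow> (u \<circ> \<gamma> n) differentiable (at t))"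
  by (simp add: AE_all_countable)
 then show ?thesis by eventually_elim (auto simp: grad_exists_def piece_def)
qed

definition chart_index :: "'a \<Rightarrow> nat" where "chart_index z = (SOME n. z \<in> piece n)"

definition chart_coord :: "'a \<Rightarrow> real" where "chart_coord z = dist (\<gamma> (chart_index z) 0) z"

lemma grad_chart:
 fixes z :: 'a
 defines "n \<equiv> chart_index z" and "t \<equiv> chart_coord z"
 assumes "z \<in> S"
 shows "t \<in> {0<..<l n}" "\<gamma> n t = z" "grad_exists u z \<longleftrightarrow> (u \<circ> \<gamma> n) differentiable (at t)"
  "grad u z = deriv (u \<circ> \<gamma> n) t"
  "grad_exists u z \<Longrightarrow> ((u \<circ> \<gamma> n) has_real_derivative grad u z) (at t)"
  "((\<lambda>s. dist z (\<gamma> n s)) \<longlongrightarrow> 0) (at t)"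
proof -
 obtain k w where k: "z \<in> piece k" "w \<in> {0<..<l k}" "z = \<gamma> k w" by (rule skeleton_piece[OF assms(3)])
 have n: "z \<in> piece n" unfolding n_def chart_index_def using k(1) by (rule someI)
 have "k = n" by (rule piece_disjoint[OF k(1) n])
 with k have "dist (\<gamma> n 0) z = w" using arc_inverse[OF arc_chart, of w n] by auto
 then have "t = w" by (simp add: t_def chart_coord_def n_def)
 with k \<open>k = n\<close> have z: "t \<in> {0<..<l n}" "z = \<gamma> n t" by auto
 then show "t \<in> {0<..<l n}" "\<gamma> n t = z" by auto
 show grad: "grad u z = deriv (u \<circ> \<gamma> n) t" for u by (rule weak_grad_at[OF n z])
 have inj: "inj_on (\<gamma> n) {0..l n}" using arc_chart[of n] by (simp add: arc_def isometric_embedding_inj_on)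
 show ge: "grad_exists u z \<longleftrightarrow> (u \<circ> \<gamma> n) differentiable (at t)" for u
 proof
  assume "grad_exists u z"
  then show "(u \<circ> \<gamma> n) differentiable (at t)" using n z by (simp add: grad_exists_def)
 next
  assume d: "(u \<circ> \<gamma> n) differentiable (at t)"
  show "grad_exists u z" unfolding grad_exists_def
  proof (intro allI impI)
   fix k w assume k: "z \<in> piece k" "w \<in> {0<..<l k}" "z = \<gamma> k w"
   have kn: "k = n" using piece_disjoint[OF k(1) n] .
   have "\<gamma> n w = \<gamma> n t" by (rule trans[OF k(3)[unfolded kn, symmetric] z(2)])
   then have "w = t" by (rule inj_onD[OF inj]) (use k(2) z(1) kn in auto)
   then show "(u \<circ> \<gamma> k) differentiable (at w)" using d kn by simp
  qed
 qed
 show "((u \<circ> \<gamma> n) has_real_derivative grad u z) (at t)" if "grad_exists u z"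
  using that ge grad by (simp add: DERIV_deriv_iff_real_differentiable)
 have "isCont (\<gamma> n) t" using z(1) by (intro continuous_on_interior[OF arc_continuous_on[OF arc_chart]]) simp
 then have "((\<lambda>s. dist z (\<gamma> n s)) \<longlongrightarrow> dist z (\<gamma> n t)) (at t)"
  unfolding isCont_def by (intro tendsto_dist tendsto_const)
 then show "((\<lambda>s. dist z (\<gamma> n s)) \<longlongrightarrow> 0) (at t)" using z(2) by simp
qed

section \<open>Pointwise rules for the gradient\<close>

lemma grad_abs_le:
 assumes "z \<in> S" "grad_exists u z" "grad_exists v z"
  "0 < \<delta>" "\<And>w. dist z w < \<delta> \<Longrightarrow> \<bar>u w - u z\<bar> \<le> \<bar>v w - v z\<bar>"
 shows "\<bar>grad u z\<bar> \<le> \<bar>grad v z\<bar>"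
proof -
 let ?n = "chart_index z" and ?t = "chart_coord z"
 note n = grad_chart[OF assms(1)]
 have "\<forall>\<^sub>F s in at ?t. dist z (\<gamma> ?n s) < \<delta>" by (rule order_tendstoD(2)[OF n(6) assms(4)])
 then have "\<forall>\<^sub>F s in at ?t. \<bar>(u \<circ> \<gamma> ?n) s - (u \<circ> \<gamma> ?n) ?t\<bar> \<le> \<bar>(v \<circ> \<gamma> ?n) s - (v \<circ> \<gamma> ?n) ?t\<bar>"
  by eventually_elim (use assms(5) n(2) in simp)
 then show ?thesis by (rule real_derivative_abs_le[OF n(5)[OF assms(2)] n(5)[OF assms(3)]])
qed

lemma grad_mult_nonpos:
 assumes "z \<in> S" "grad_exists u z" "grad_exists v z"
  "\<And>w. (u w - u z) * (v w - v z) \<le> 0"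
 shows "grad u z * grad v z \<le> 0"
proof -
 let ?n = "chart_index z" and ?t = "chart_coord z"
 note n = grad_chart[OF assms(1)]
 show ?thesis
  by (rule real_derivative_mult_nonpos[OF n(5)[OF assms(2)] n(5)[OF assms(3)]]) (use assms(4) n(2) in simp)
qed

lemma grad_lipschitz:
 assumes "z \<in> S" "grad_exists u z" "0 < \<delta>" "\<And>w. dist z w < \<delta> \<Longrightarrow> \<bar>u w - u z\<bar> \<le> L * dist z w"
 shows "\<bar>grad u z\<bar> \<le> L"
proof -
 let ?n = "chart_index z" and ?t = "chart_coord z"
 note n = grad_chart[OF assms(1)]
 have "\<forall>\<^sub>F s in at ?t. dist z (\<gamma> ?n s) < \<delta>" by (rule order_tendstoD(2)[OF n(6) assms(3)])
 moreover have "\<forall>\<^sub>F s in at ?t. s \<in> {0<..<l ?n}" using n(1) by (intro eventually_at_in_open') auto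
 ultimately have ev: "\<forall>\<^sub>F s in at ?t. \<bar>((u \<circ> \<gamma> ?n) s - (u \<circ> \<gamma> ?n) ?t) / (s - ?t)\<bar> \<le> L"
  using eventually_neq_at_within[of ?t ?t UNIV]
 proof eventually_elim
  case (elim s)
  have "dist (\<gamma> ?n ?t) (\<gamma> ?n s) = \<bar>?t - s\<bar>" using elim n(1) by (intro arc_dist[OF arc_chart]) auto
  then have "dist z (\<gamma> ?n s) = \<bar>?t - s\<bar>" unfolding n(2) .
  then have "\<bar>u (\<gamma> ?n s) - u z\<bar> \<le> L * \<bar>s - ?t\<bar>"
   using assms(4)[of "\<gamma> ?n s"] elim by (simp add: abs_minus_commute[of ?t s])
  then show ?case using elim n(2) by (simp add: abs_divide pos_divide_le_eq)
 qed
 show ?thesis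
 proof (rule tendsto_upperbound[OF _ ev at_neq_bot])
  show "((\<lambda>s. \<bar>((u \<circ> \<gamma> ?n) s - (u \<circ> \<gamma> ?n) ?t) / (s - ?t)\<bar>) \<longlongrightarrow> \<bar>grad u z\<bar>) (at ?t)"
   using n(5)[OF assms(2)] unfolding has_field_derivative_iff by (rule tendsto_rabs)
 qed
qed

lemma grad_local_const:
 assumes "z \<in> S" "grad_exists u z" "0 < \<delta>" "\<And>w. dist z w < \<delta> \<Longrightarrow> u w = u z"
 shows "grad u z = 0"
 using grad_lipschitz[OF assms(1,2,3), of 0] assms(4) by simp

lemma grad_local_min:
 assumes "z \<in> S" "grad_exists u z" "\<And>w. u z \<le> u w"
 shows "grad u z = 0"
proof -
 let ?n = "chart_index z" and ?t = "chart_coord z"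
 note n = grad_chart[OF assms(1)]
 show ?thesis by (rule DERIV_local_min[OF n(5)[OF assms(2)], of 1]) (use assms(3) n(2) in auto)
qed

lemma grad_mult:
 assumes "z \<in> S" "grad_exists u z" "grad_exists v z"
 shows "grad (\<lambda>w. u w * v w) z = u z * grad v z + v z * grad u z"
proof -
 let ?n = "chart_index z" and ?t = "chart_coord z"
 note n = grad_chart[OF assms(1)]
 have "((\<lambda>s. (u \<circ> \<gamma> ?n) s * (v \<circ> \<gamma> ?n) s) has_real_derivative grad u z * (v \<circ> \<gamma> ?n) ?t + grad v z * (u \<circ> \<gamma> ?n) ?t) (at ?t)"
  by (rule DERIV_mult[OF n(5)[OF assms(2)] n(5)[OF assms(3)]])
 then have "(((\<lambda>w. u w * v w) \<circ> \<gamma> ?n) has_real_derivative grad u z * v z + grad v z * u z) (at ?t)"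
  by (simp add: o_def n(2))
 then show ?thesis unfolding n(4)[of "\<lambda>w. u w * v w"] by (simp add: DERIV_imp_deriv algebra_simps)
qed

text \<open>
 Up to countably many parameters, each point of the arc lying on the chart \<open>n\<close> is a limit of such points,
 and between these the change of parameter is an isometry of a subset of the line, so a translation or a reflection.
\<close>

lemma grad_arc:
 assumes "arc q d"
 shows "AE s in lborel. s \<in> {0<..<d} \<longrightarrow> (\<exists>w\<in>{1, -1}. \<forall>u. (u \<circ> q) differentiable (at s) \<longrightarrow>
  grad_exists u (q s) \<longrightarrow> grad u (q s) = w * deriv (u \<circ> q) s)"
proof -
 \<comment> \<open>The parameters at which the arc \<open>q\<close> runs on the chart
   \<open>n\<close>. This set may be totally disconnected, so the two parametrisations are compared
   through its limit points and not through intervals.\<close>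
 define K where "K = (\<lambda>n. {s \<in> {0<..<d}. q s \<in> \<gamma> n ` {0<..<l n}})"
 have "countable (\<Union>n. {s \<in> K n. \<not> s islimpt K n})" by (intro countable_UN countable_isolated_points) simp
 then have "AE s in lborel. s \<notin> (\<Union>n. {s \<in> K n. \<not> s islimpt K n})"
  by (intro AE_not_in countable_imp_null_set_lborel)
 then show ?thesis
 proof eventually_elim
  case (elim s)
  show ?case
  proof
   assume s: "s \<in> {0<..<d}"
   have "q s \<in> S" using s by (auto intro: arc_in_skeleton[OF assms])
   note n0 = grad_chart[OF this]
   define n f where "n = chart_index (q s)" and "f = chart_coord (q s)"
   note n = n0[folded n_def f_def]
   have "q s \<in> \<gamma> n ` {0<..<l n}" unfolding n(2)[symmetric] by (rule imageI[OF n(1)])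
   then have sK: "s \<in> K n" using s unfolding K_def by simp
   then have lim: "s islimpt K n" using elim by blast
   define t where "t = (\<lambda>r. dist (\<gamma> n 0) (q r))"
   have t: "t r \<in> {0<..<l n}" "\<gamma> n (t r) = q r" if "r \<in> K n" for r
   proof -
    obtain x where x: "x \<in> {0<..<l n}" "q r = \<gamma> n x" using \<open>r \<in> K n\<close> unfolding K_def by blast
    then have "t r = x" using arc_inverse[OF arc_chart, of x n] unfolding t_def by auto
    then show "t r \<in> {0<..<l n}" "\<gamma> n (t r) = q r" using x by auto
   qed
   have ts: "t s = f" using arc_inverse[OF arc_chart, of f n] n unfolding t_def by auto
   have iso: "\<bar>t r - t r'\<bar> = \<bar>r - r'\<bar>" if "r \<in> K n" "r' \<in> K n" for r r'
   proof -
    have "\<bar>t r - t r'\<bar> = dist (\<gamma> n (t r)) (\<gamma> n (t r'))"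
     using t(1)[OF that(1)] t(1)[OF that(2)] by (intro arc_dist[OF arc_chart, symmetric]) auto
    also have "\<dots> = dist (q r) (q r')" using t(2) that by simp
    also have "\<dots> = \<bar>r - r'\<bar>" using that by (intro arc_dist[OF assms]) (auto simp: K_def)
    finally show ?thesis .
   qed
   obtain r1 where r1: "r1 \<in> K n" "r1 \<noteq> s"
    using lim zero_less_one[where 'a=real] unfolding islimpt_approachable by blast
   define w where "w = (t r1 - t s) / (r1 - s)"
   have "\<bar>w\<bar> = 1" unfolding w_def abs_divide using iso[OF r1(1) sK] r1(2) by simp
   then have w: "w = 1 \<or> w = -1" by linarith
   \<comment> \<open>The change of parameter preserves distances to \<open>s\<close> and to
     \<open>r1\<close>. If it moved \<open>r\<close> with the sign opposite to that of
     \<open>r1\<close>, the distance between \<open>r\<close> and \<open>r1\<close> would be wrong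
     unless one of them were \<open>s\<close>.\<close>
   have aff: "t r = f + w * (r - s)" if r: "r \<in> K n" for r
   proof (rule ccontr)
    assume ne: "t r \<noteq> f + w * (r - s)"
    have "\<bar>t r - f\<bar> = \<bar>r - s\<bar>" using iso[OF r sK] ts by simp
    then have "t r - f = r - s \<or> t r - f = - (r - s)" by linarith
    then have a: "t r - f = - w * (r - s)" using w ne by auto
    have b: "t r1 - f = w * (r1 - s)" unfolding w_def using r1(2) ts by simp
    have "r \<noteq> s" using ne ts by auto
    have "t r - t r1 = - w * ((r - s) + (r1 - s))" using a b by (simp add: algebra_simps)
    then have "\<bar>(r - s) + (r1 - s)\<bar> = \<bar>r - r1\<bar>" using iso[OF r r1(1)] w by (auto simp: abs_mult)
    then have "r = s \<or> r1 = s" by linarith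
    then show False using \<open>r \<noteq> s\<close> r1(2) by simp
   qed
   show "\<exists>w\<in>{1, -1}. \<forall>u. (u \<circ> q) differentiable (at s) \<longrightarrow>
    grad_exists u (q s) \<longrightarrow> grad u (q s) = w * deriv (u \<circ> q) s"
   proof (intro bexI[of _ w] allI impI)
    show "w \<in> {1, -1}" using w by simp
    fix u assume diff: "(u \<circ> q) differentiable (at s)" and ge: "grad_exists u (q s)"
    have D1: "((u \<circ> q) has_real_derivative deriv (u \<circ> q) s) (at s within K n)"
     using diff by (simp add: DERIV_deriv_iff_real_differentiable has_field_derivative_at_within)
    have "((\<lambda>r. f + w * (r - s)) has_real_derivative w) (at s)"
     by (auto intro!: derivative_eq_intros)
    moreover have "((u \<circ> \<gamma> n) has_real_derivative grad u (q s)) (at (f + w * (s - s)))" using n(5)[OF ge] by simp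
    ultimately have "((\<lambda>r. (u \<circ> \<gamma> n) (f + w * (r - s))) has_real_derivative grad u (q s) * w) (at s)"
     by (rule DERIV_chain2[rotated])
    then have "((\<lambda>r. (u \<circ> \<gamma> n) (f + w * (r - s))) has_real_derivative grad u (q s) * w) (at s within K n)"
     by (rule has_field_derivative_at_within)
    then have D2: "((u \<circ> q) has_real_derivative grad u (q s) * w) (at s within K n)"
    proof (rule has_field_derivative_transform_within[OF _ zero_less_one sK])
     fix r assume "r \<in> K n"
     then show "(u \<circ> \<gamma> n) (f + w * (r - s)) = (u \<circ> q) r" using aff t(2) by simp
    qed
    \<comment> \<open>Along \<open>K n\<close> the two descriptions of \<open>u\<close> coincide; as
      \<open>s\<close> is a limit point, the derivative within \<open>K n\<close> is unique.\<close>
    have nt: "at s within K n \<noteq> bot" using lim by (simp add: trivial_limit_within)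
    have "deriv (u \<circ> q) s = grad u (q s) * w"
     by (rule tendsto_unique[OF nt]) (use D1 D2 in \<open>simp_all add: has_field_derivative_iff\<close>)
    then show "grad u (q s) = w * deriv (u \<circ> q) s" using w by auto
   qed
  qed
 qed
qed

section \<open>The energy along an arc and Morrey's inequality\<close>

lemma arc_local_chart: "arc q d \<Longrightarrow> d < e \<Longrightarrow> local_arc_chart \<iota> q d"
proof -
 assume a: "arc q d" and d: "d < e"
 have "q ` {0..d} \<subseteq> eball (q 0) \<iota>"
  using arc_inverse[OF a] d by (auto intro!: mem_eballI)
 then show ?thesis using a unfolding local_arc_chart_def arc_def by blast
qed

lemma arc_abs_continuous: "arc q d \<Longrightarrow> d < e \<Longrightarrow> u \<in> AC \<iota> \<Longrightarrow> abs_continuous_on_interval 0 d (u \<circ> q)"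
 using arc_local_chart[of q d] by (simp add: AC_def)

lemma AC_continuous: "u \<in> AC \<iota> \<Longrightarrow> continuous_on UNIV u"
 by (simp add: AC_def)

lemma AE_arc_differentiable:
 assumes "arc q d" "d < e" "u \<in> AC \<iota>"
 shows "AE s in lborel. s \<in> {0<..<d} \<longrightarrow> (u \<circ> q) differentiable (at s) \<and> grad_exists u (q s)"
proof -
 obtain N where N: "negligible N" "\<And>x. 0 < x \<Longrightarrow> x < d \<Longrightarrow> x \<notin> N \<Longrightarrow> (u \<circ> q) differentiable (at x)"
  using abs_continuous_differentiable_ae[OF arc_abs_continuous[OF assms]] by blast
 have "AE s in lebesgue. s \<notin> N" using N(1) by (intro AE_not_in) (simp add: negligible_iff_null_sets)
 then have "AE s in lborel. s \<notin> N" by (simp add: AE_completion_iff)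
 moreover have "AE s in lborel. s \<in> {0<..<d} \<longrightarrow> grad_exists u (q s)"
  by (rule AE_nu_arcD[OF assms(1) AE_grad_exists[OF assms(3)]])
 ultimately show ?thesis
  by eventually_elim (use N(2) in auto)
qed

text \<open>The sign relating the gradient to the derivative along \<open>q\<close> depends on the
  point but not on the function, so it cancels in a product.\<close>

lemma AE_grad_mult_arc:
 assumes "arc q d" "d < e" "u \<in> AC \<iota>" "v \<in> AC \<iota>"
 shows "AE s in lborel. s \<in> {0<..<d} \<longrightarrow>
  grad u (q s) * grad v (q s) = deriv (u \<circ> q) s * deriv (v \<circ> q) s"
 using grad_arc[OF assms(1)] AE_arc_differentiable[OF assms(1-3)] AE_arc_differentiable[OF assms(1,2,4)]
proof eventually_elim
 case (elim s)
 show ?case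
 proof
  assume s: "s \<in> {0<..<d}"
  then obtain w where w: "w \<in> {1, -1}" and *: "\<And>u. (u \<circ> q) differentiable (at s) \<Longrightarrow>
   grad_exists u (q s) \<Longrightarrow> grad u (q s) = w * deriv (u \<circ> q) s" using elim(1) by blast
  have "grad u (q s) = w * deriv (u \<circ> q) s" "grad v (q s) = w * deriv (v \<circ> q) s"
   using elim(2,3) s by (auto intro!: *)
  then show "grad u (q s) * grad v (q s) = deriv (u \<circ> q) s * deriv (v \<circ> q) s"
   using w by auto
 qed
qed

lemma AE_RL_I: "AE s in lborel. s \<in> {0<..<d} \<longrightarrow> P s \<Longrightarrow> AE s in RL d. P s"
 by (subst AE_restrict_space_iff) auto

lemma integral_grad_arc:
 assumes "arc q d" "d < e" "u \<in> AC \<iota>" "v \<in> AC \<iota>"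
 shows "(\<integral>z. indicator (q ` {0<..<d}) z * (grad u z * grad v z) \<partial>\<nu>) =
  (\<integral>s. deriv (u \<circ> q) s * deriv (v \<circ> q) s \<partial>RL d)"
proof -
 have m: "(\<lambda>z. grad u z * grad v z) \<in> borel_measurable \<nu>"
  by (intro borel_measurable_times weak_grad_measurable AC_continuous assms)
 have "(\<integral>z. indicator (q ` {0<..<d}) z * (grad u z * grad v z) \<partial>\<nu>) = (\<integral>s. grad u (q s) * grad v (q s) \<partial>RL d)"
  by (rule integral_arc[OF assms(1) m])
 also have "\<dots> = (\<integral>s. deriv (u \<circ> q) s * deriv (v \<circ> q) s \<partial>RL d)"
 proof (rule integral_cong_AE)
  show "(\<lambda>s. grad u (q s) * grad v (q s)) \<in> borel_measurable (RL d)"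
   by (rule measurable_compose[OF arc_measurable[OF assms(1)] m])
  show "(\<lambda>s. deriv (u \<circ> q) s * deriv (v \<circ> q) s) \<in> borel_measurable (RL d)"
   by (intro borel_measurable_times deriv_arc_measurable assms AC_continuous)
 qed (rule AE_RL_I[OF AE_grad_mult_arc[OF assms]])
 finally show ?thesis .
qed

lemma finite_RL: "0 < d \<Longrightarrow> emeasure (RL d) (space (RL d)) = ennreal d"
 by (subst emeasure_restrict_space) (auto simp: space_RL)

lemma finite_measure_RL: "0 < d \<Longrightarrow> finite_measure (RL d)"
 by (rule finite_measureI) (simp only: finite_RL infinity_ennreal_def ennreal_neq_top not_False_eq_True)

lemma one_Lp2_RL:
 assumes "0 < d"
 shows "(\<lambda>s. 1) \<in> Lp 2 (RL d)" "norm_L2 (RL d) (\<lambda>s. 1) = sqrt d"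
proof -
 interpret finite_measure "RL d" by (rule finite_measure_RL[OF assms])
 show "(\<lambda>s. 1) \<in> Lp 2 (RL d)" by (simp add: Lp2_iff)
 show "norm_L2 (RL d) (\<lambda>s. 1) = sqrt d"
  unfolding norm_L2_eq using assms finite_RL[OF assms] by (simp add: measure_def)
qed

lemma arc_deriv_L2:
 assumes "arc q d" "d < e" "u \<in> AC \<iota>" "grad u \<in> Lp 2 \<nu>"
 shows "deriv (u \<circ> q) \<in> Lp 2 (RL d)" "norm_L2 (RL d) (deriv (u \<circ> q)) \<le> gnorm u"
proof -
 let ?A = "q ` {0<..<d}"
 have m: "deriv (u \<circ> q) \<in> borel_measurable (RL d)" by (rule deriv_arc_measurable[OF assms(1) AC_continuous[OF assms(3)]])
 have gm: "(\<lambda>z. ennreal ((grad u z)\<^sup>2)) \<in> borel_measurable \<nu>"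
  using weak_grad_measurable[OF AC_continuous[OF assms(3)]] by measurable
 have "(\<integral>\<^sup>+s. ennreal ((deriv (u \<circ> q) s)\<^sup>2) \<partial>RL d) = (\<integral>\<^sup>+s. ennreal ((grad u (q s))\<^sup>2) \<partial>RL d)"
 proof (rule nn_integral_cong_AE)
  show "AE s in RL d. ennreal ((deriv (u \<circ> q) s)\<^sup>2) = ennreal ((grad u (q s))\<^sup>2)"
   using AE_RL_I[OF AE_grad_mult_arc[OF assms(1-3,3)]] by eventually_elim (simp add: power2_eq_square)
 qed
 also have "\<dots> = (\<integral>\<^sup>+z. ennreal ((grad u z)\<^sup>2) * indicator ?A z \<partial>\<nu>)"
  by (rule nn_integral_arc[OF assms(1) gm, symmetric])
 also have "\<dots> \<le> (\<integral>\<^sup>+z. ennreal ((grad u z)\<^sup>2) \<partial>\<nu>)"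
  by (intro nn_integral_mono) (simp add: indicator_def)
 also have "\<dots> = ennreal (\<integral>z. (grad u z)\<^sup>2 \<partial>\<nu>)"
  using assms(4) by (intro nn_integral_eq_integral) (auto simp: Lp2_iff)
 finally have le: "(\<integral>\<^sup>+s. ennreal ((deriv (u \<circ> q) s)\<^sup>2) \<partial>RL d) \<le> ennreal (\<integral>z. (grad u z)\<^sup>2 \<partial>\<nu>)" .
 have int: "integrable (RL d) (\<lambda>s. (deriv (u \<circ> q) s)\<^sup>2)"
 proof (rule integrableI_nonneg)
  show "(\<integral>\<^sup>+s. ennreal ((deriv (u \<circ> q) s)\<^sup>2) \<partial>RL d) < \<infinity>"
   using le by (rule le_less_trans) simp
 qed (use m in auto)
 then show "deriv (u \<circ> q) \<in> Lp 2 (RL d)" using m by (simp add: Lp2_iff)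
 have "(\<integral>s. (deriv (u \<circ> q) s)\<^sup>2 \<partial>RL d) \<le> (\<integral>z. (grad u z)\<^sup>2 \<partial>\<nu>)"
  using le by (subst (asm) nn_integral_eq_integral[OF int]) (auto simp: integral_nonneg_AE)
 then show "norm_L2 (RL d) (deriv (u \<circ> q)) \<le> gnorm u"
  unfolding norm_L2_eq by simp
qed

text \<open>The derivative is square integrable on a bounded interval, hence Lebesgue integrable,
  and the gauge integral of the fundamental theorem becomes an ordinary one.\<close>

lemma arc_increment:
 assumes "arc q d" "d < e" "u \<in> AC \<iota>" "grad u \<in> Lp 2 \<nu>"
 shows "(\<integral>s. deriv (u \<circ> q) s \<partial>RL d) = u (q d) - u (q 0)"
proof -
 have d: "0 < d" using assms(1) by (simp add: arc_def)
 have "integrable (RL d) (\<lambda>s. deriv (u \<circ> q) s * 1)"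
  by (rule Lp2_integrable_mult[OF arc_deriv_L2(1)[OF assms] one_Lp2_RL(1)[OF d]])
 then have "set_integrable lborel {0<..<d} (deriv (u \<circ> q))"
  unfolding set_integrable_def by (subst (asm) integrable_restrict_space) auto
 from set_borel_integral_eq_integral[OF this]
 have 1: "deriv (u \<circ> q) integrable_on {0<..<d}"
  "(LINT s:{0<..<d}|lborel. deriv (u \<circ> q) s) = integral {0<..<d} (deriv (u \<circ> q))" by auto
 have "(deriv (u \<circ> q) has_integral ((u \<circ> q) d - (u \<circ> q) 0)) {0..d}"
  by (rule abs_continuous_has_integral_deriv[OF arc_abs_continuous[OF assms(1-3)]]) (use d in simp)
 then have "(deriv (u \<circ> q) has_integral ((u \<circ> q) d - (u \<circ> q) 0)) {0<..<d}"
  by (simp add: has_integral_Icc_iff_Ioo)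
 then have "integral {0<..<d} (deriv (u \<circ> q)) = u (q d) - u (q 0)" by (simp add: integral_unique)
 moreover have "(\<integral>s. deriv (u \<circ> q) s \<partial>RL d) = (LINT s:{0<..<d}|lborel. deriv (u \<circ> q) s)"
  unfolding set_lebesgue_integral_def by (subst integral_restrict_space) auto
 ultimately show ?thesis using 1(2) by simp
qed

lemma geodesic_arc:
 assumes "geodesic h u v" "u \<noteq> v"
 shows "arc h (dist u v)" "h 0 = u" "h (dist u v) = v"
 using assms by (auto simp: geodesic_def arc_def)

text \<open>Integrate the derivative along the geodesic from \<open>x\<close> to \<open>y\<close>
  and apply Cauchy-Schwarz; the bound \<open>e\<close> makes this geodesic a local arc
  chart.\<close>

lemma morrey:
 assumes "u \<in> AC \<iota>" "grad u \<in> Lp 2 \<nu>" "dist x y < e"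
 shows "(u x - u y)\<^sup>2 \<le> dist x y * (gnorm u)\<^sup>2"
proof (cases "x = y")
 case False
 obtain h where h: "geodesic h x y" using geodesic_exists by blast
 note a = geodesic_arc[OF h False]
 let ?d = "dist x y"
 have d: "0 < ?d" using False by simp
 note L = arc_deriv_L2[OF a(1) assms(3,1,2)]
 have "u y - u x = inner_L2 (RL ?d) (deriv (u \<circ> h)) (\<lambda>s. 1)"
  using arc_increment[OF a(1) assms(3,1,2)] a(2,3) by (simp add: inner_L2_def)
 then have "\<bar>u y - u x\<bar> \<le> norm_L2 (RL ?d) (deriv (u \<circ> h)) * sqrt ?d"
  using Cauchy_Schwarz_L2[OF L(1) one_Lp2_RL(1)[OF d]] one_Lp2_RL(2)[OF d] by simp
 also have "\<dots> \<le> gnorm u * sqrt ?d" by (intro mult_right_mono L(2)) simp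
 finally have "\<bar>u y - u x\<bar>\<^sup>2 \<le> (gnorm u * sqrt ?d)\<^sup>2" by (intro power_mono) auto
 then show ?thesis by (simp add: power_mult_distrib power2_commute mult.commute)
qed simp

lemma lipschitz_AC:
 assumes "\<And>z w. \<bar>u z - u w\<bar> \<le> L * dist z w" "0 \<le> L"
 shows "u \<in> AC \<iota>"
proof -
 have "continuous_on UNIV u"
 proof (rule lipschitz_on_continuous_on[of L])
  show "L-lipschitz_on UNIV u" using assms by (intro lipschitz_onI) (auto simp: dist_real_def)
 qed
 moreover have "abs_continuous_on_interval 0 d (u \<circ> \<gamma>')" if "local_arc_chart \<iota> \<gamma>' d" for \<gamma>' d
 proof (rule lipschitz_imp_abs_continuous[OF _ assms(2)])
  fix s t assume st: "0 \<le> s" "s \<le> t" "t \<le> d"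
  have "dist (\<gamma>' t) (\<gamma>' s) = t - s"
   using that st isometric_embeddingD[of "{0..d}" \<gamma>' t s] by (simp add: local_arc_chart_def)
  then show "\<bar>(u \<circ> \<gamma>') t - (u \<circ> \<gamma>') s\<bar> \<le> L * (t - s)" using assms(1)[of "\<gamma>' t" "\<gamma>' s"] by simp
 qed
 ultimately show ?thesis by (simp add: AC_def)
qed

lemma gromov_AC: "(\<lambda>z. gromov a z b) \<in> AC \<iota>"
 by (rule lipschitz_AC[of _ 1]) (auto simp: gromov_lipschitz)

lemma gromov_on_arc:
 assumes "geodesic q a b" "0 \<le> s" "s \<le> dist a b"
 shows "gromov a (q s) b = s"
 using geodesic_dist[OF assms] by (simp add: gromov_def)

lemma nu_closed_subarc:
 assumes "arc q d" "0 < s" "s \<le> t" "t < d"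
 shows "q ` {s..t} \<in> sets \<nu>" "emeasure \<nu> (q ` {s..t}) = ennreal (t - s)"
proof -
 have sub: "{s..t} \<subseteq> {0<..<d}" using assms by auto
 have inj: "inj_on q {0..d}" using assms(1) by (simp add: arc_def isometric_embedding_inj_on)
 have "compact (q ` {s..t})"
  by (intro compact_continuous_image continuous_on_subset[OF arc_continuous_on[OF assms(1)]]) (use sub in auto)
 then have B: "q ` {s..t} \<in> sets borel" by (rule borel_compact)
 moreover have "q ` {s..t} \<subseteq> S" using assms by (auto intro!: arc_in_skeleton[OF assms(1)])
 ultimately show "q ` {s..t} \<in> sets \<nu>" by (simp add: sets_nu)
 have "{r \<in> {0<..<d}. q r \<in> q ` {s..t}} = {s..t}" using sub inj_onD[OF inj] by force
 then show "emeasure \<nu> (q ` {s..t}) = ennreal (t - s)"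
  using nu_arc_subset(2)[OF assms(1) B image_mono[OF sub]] assms(3) by simp
qed

end

section \<open>Cutoff functions and the gradient bound\<close>

locale vol_space = length_space \<iota> e ty \<nu> \<gamma> l
 for \<iota> e and ty :: "'a::{metric_space, second_countable_topology} itself"
  and \<nu> \<gamma> l +
 fixes m :: "'a measure" and V :: "real \<Rightarrow> real" and C :: real
 assumes sets_m: "sets m = sets borel" and C_ge: "1 \<le> C"
  and V_pos: "\<And>r. 0 < r \<Longrightarrow> 0 < V r"
  and V_mono: "\<And>r R. 0 < r \<Longrightarrow> r \<le> R \<Longrightarrow> V r \<le> V R"
  and V_double: "\<And>r. 0 < r \<Longrightarrow> V (2 * r) \<le> C * V r"
  and ball_finite: "\<And>x r. emeasure m (ball x r) < \<infinity>"
  and ball_lower: "\<And>x r. 0 < r \<Longrightarrow> V r / C \<le> measure m (ball x r)"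
  and ball_upper: "\<And>x r. 0 < r \<Longrightarrow> measure m (ball x r) \<le> C * V r"
begin

section \<open>Doubling and packing of balls\<close>

lemma space_m: "space m = UNIV"
 using sets_eq_imp_space_eq[OF sets_m] by simp

lemma ball_fmeasurable: "ball x r \<in> fmeasurable m"
 using ball_finite by (intro fmeasurableI) (auto simp: sets_m)

lemma V_double_pow:
 assumes "0 < r"
 shows "V (2 ^ n * r) \<le> C ^ n * V r"
proof (induction n)
 case (Suc n)
 have "V (2 ^ Suc n * r) \<le> C * V (2 ^ n * r)" using V_double[of "2 ^ n * r"] assms by (simp add: mult.assoc)
 also have "\<dots> \<le> C * (C ^ n * V r)" using Suc C_ge by (intro mult_left_mono) auto
 finally show ?case by (simp add: mult.assoc)
qed simp

lemma disjoint_balls_card: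
 fixes x :: 'a
 assumes "finite W" "0 < r" "\<And>w. w \<in> W \<Longrightarrow> ball w r \<subseteq> ball x R" "0 < R"
  "\<And>w w'. w \<in> W \<Longrightarrow> w' \<in> W \<Longrightarrow> w \<noteq> w' \<Longrightarrow> 2 * r \<le> dist w w'"
 shows "real (card W) * (V r / C) \<le> C * V R"
proof -
 have "real (card W) * (V r / C) = (\<Sum>w\<in>W. V r / C)" by simp
 also have "\<dots> \<le> (\<Sum>w\<in>W. measure m (ball w r))" by (intro sum_mono ball_lower assms)
 also have "\<dots> = measure m (\<Union>w\<in>W. ball w r)"
 proof (rule measure_UNION'[OF assms(1), symmetric])
  show "pairwise (\<lambda>x y. disjnt (ball x r) (ball y r)) W"
  proof (rule pairwiseI)
   fix w w' assume w: "w \<in> W" "w' \<in> W" "w \<noteq> w'"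
   show "disjnt (ball w r) (ball w' r)"
    unfolding disjnt_iff
   proof (intro allI notI)
    fix z assume "z \<in> ball w r \<and> z \<in> ball w' r"
    then have "dist w w' < 2 * r" using dist_triangle[of w w' z] by (simp add: dist_commute)
    then show False using assms(5)[OF w] by simp
   qed
  qed
 qed (rule ball_fmeasurable)
 also have "\<dots> \<le> measure m (ball x R)"
  using assms(1,3) by (intro measure_mono_fmeasurable ball_fmeasurable) (auto simp: sets_m)
 also have "\<dots> \<le> C * V R" by (rule ball_upper[OF assms(4)])
 finally show ?thesis .
qed

text \<open>A maximal \<open>r\<close>-separated set on the sphere. The balls of radius
  \<open>r / 2\<close> around it are disjoint in the ball of radius \<open>4 * r\<close>, three
  doublings larger; these cost \<open>C ^ 3\<close>, and comparing both kinds of balls with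
  \<open>V\<close> costs two more factors.\<close>

lemma sphere_net:
 fixes x :: 'a
 assumes r: "0 < r"
 obtains W where "finite W" "W \<noteq> {}" "\<And>w. w \<in> W \<Longrightarrow> dist x w = 2 * r"
  "\<And>z. dist x z = 2 * r \<Longrightarrow> \<exists>w\<in>W. dist z w < r" "real (card W) \<le> C ^ 5"
proof -
 define P where "P = (\<lambda>W. finite W \<and> (\<forall>w\<in>W. dist x w = 2 * r) \<and> (\<forall>w\<in>W. \<forall>w'\<in>W. w \<noteq> w' \<longrightarrow> r \<le> dist w w'))"
 have card: "real (card W) \<le> C ^ 5" if "P W" for W
 proof -
  have W: "finite W" "\<And>w. w \<in> W \<Longrightarrow> dist x w = 2 * r" "\<And>w w'. w \<in> W \<Longrightarrow> w' \<in> W \<Longrightarrow> w \<noteq> w' \<Longrightarrow> r \<le> dist w w'"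
   using that by (auto simp: P_def)
  have sub: "ball w (r / 2) \<subseteq> ball x (4 * r)" if "w \<in> W" for w
  proof
   fix z assume "z \<in> ball w (r / 2)"
   then have "dist x z < 4 * r" using dist_triangle[of x z w] W(2)[OF that] r by simp
   then show "z \<in> ball x (4 * r)" by simp
  qed
  have "real (card W) * (V (r / 2) / C) \<le> C * V (4 * r)"
   using r W by (intro disjoint_balls_card[OF W(1) _ sub]) auto
  also have "V (4 * r) \<le> C ^ 3 * V (r / 2)" using V_double_pow[of "r / 2" 3] r by (simp add: field_simps)
  then have "C * V (4 * r) \<le> C * (C ^ 3 * V (r / 2))" using C_ge by (intro mult_left_mono) auto
  finally have "real (card W) * V (r / 2) \<le> C ^ 5 * V (r / 2)"
   using C_ge by (simp add: field_simps eval_nat_numeral)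
  then show ?thesis using V_pos[of "r / 2"] r by simp
 qed
 define n where "n = nat \<lceil>C ^ 5\<rceil>"
 have cn: "card W \<le> n" if "P W" for W using card[OF that] unfolding n_def by linarith
 have P0: "P {}" by (simp add: P_def)
 have "\<exists>W. P W \<and> (\<forall>W'. P W' \<longrightarrow> card W' \<le> card W)"
  by (rule ex_has_greatest_nat[of P "{}" card "Suc n", OF P0]) (simp add: cn le_imp_less_Suc)
 then obtain W where W0: "P W \<and> (\<forall>W'. P W' \<longrightarrow> card W' \<le> card W)" ..
 have W: "P W" "\<And>W'. P W' \<Longrightarrow> card W' \<le> card W" using W0 by simp_all
 have net: "\<exists>w\<in>W. dist z w < r" if z: "dist x z = 2 * r" for z
 proof (rule ccontr)
  assume H: "\<not> (\<exists>w\<in>W. dist z w < r)"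
  then have far: "r \<le> dist z w" if "w \<in> W" for w using that not_less by blast
  have "z \<notin> W" using far[of z] r by auto
  moreover have "P (insert z W)" using W(1) z far unfolding P_def by (auto simp: dist_commute)
  ultimately show False using W(2)[of "insert z W"] W(1) by (simp add: P_def)
 qed
 obtain z where "dist x z = 2 * r" using point_at_distance[of "2 * r" x] r by auto
 from net[OF this] have "W \<noteq> {}" by blast
 show thesis
  using W(1) \<open>W \<noteq> {}\<close> net card[OF W(1)] by (intro that[of W]) (auto simp: P_def)
qed

text \<open>Falls from 1 to 0 between \<open>r\<close> and \<open>3 / 2 * r\<close>. It must end
  before \<open>2 * r\<close> because the net is only \<open>r\<close>-dense: a point of the sphere
  of radius \<open>2 * r\<close> within distance \<open>r\<close> of \<open>w\<close> has Gromov
  product at least \<open>3 / 2 * r\<close> with \<open>w\<close>.\<close>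

definition ramp :: "real \<Rightarrow> real \<Rightarrow> real" where
 "ramp r g = max 0 (min 1 (3 - 2 * g / r))"

lemma ramp_range: "0 \<le> ramp r g" "ramp r g \<le> 1"
 by (auto simp: ramp_def)

lemma ramp_one: "0 < r \<Longrightarrow> g \<le> r \<Longrightarrow> ramp r g = 1"
 by (simp add: ramp_def field_simps)

lemma ramp_zero: "0 < r \<Longrightarrow> 3 / 2 * r \<le> g \<Longrightarrow> ramp r g = 0"
 by (simp add: ramp_def field_simps)

lemma ramp_lipschitz: "0 < r \<Longrightarrow> \<bar>ramp r g - ramp r h\<bar> \<le> 2 / r * \<bar>g - h\<bar>"
proof -
 assume r: "0 < r"
 have "\<bar>ramp r g - ramp r h\<bar> \<le> \<bar>(3 - 2 * g / r) - (3 - 2 * h / r)\<bar>" unfolding ramp_def by linarith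
 also have "(3 - 2 * g / r) - (3 - 2 * h / r) = 2 / r * (h - g)" using r by (simp add: diff_divide_distrib right_diff_distrib)
 also have "\<bar>2 / r * (h - g)\<bar> = \<bar>2 / r\<bar> * \<bar>h - g\<bar>" by (rule abs_mult)
 also have "\<dots> = 2 / r * \<bar>g - h\<bar>" using r by (simp add: abs_minus_commute)
 finally show ?thesis .
qed

lemma Min_lipschitz:
 fixes f g :: "'b \<Rightarrow> real"
 assumes "finite W" "W \<noteq> {}" "\<And>w. w \<in> W \<Longrightarrow> \<bar>f w - g w\<bar> \<le> d"
 shows "\<bar>Min (f ` W) - Min (g ` W)\<bar> \<le> d"
proof -
 have "Min (f ` W) \<in> f ` W" "Min (g ` W) \<in> g ` W" using assms(1,2) by (auto intro!: Min_in)
 then obtain w1 w2 where w1: "w1 \<in> W" "Min (f ` W) = f w1" and w2: "w2 \<in> W" "Min (g ` W) = g w2" by blast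
 have "Min (f ` W) \<le> f w2" "Min (g ` W) \<le> g w1" by (intro Min_le finite_imageI assms(1) imageI w1 w2)+
 then show ?thesis using w1 w2 assms(3)[OF w1(1)] assms(3)[OF w2(1)] by linarith
qed

text \<open>
 The minimum, over a net \<open>W\<close> of the sphere of radius \<open>2 r\<close>, of ramps in the Gromov product with \<open>w \<in> W\<close>: its gradient
 vanishes off the pieces of the segments \<open>[x, w]\<close> at distance between \<open>r\<close> and \<open>3 r / 2\<close> from \<open>x\<close>.
\<close>

lemma cutoff_function:
 fixes x :: 'a
 assumes r: "0 < r" and re: "4 * r < e"
 obtains f where "\<And>z. 0 \<le> f z" "\<And>z. f z \<le> 1" "\<And>z. dist x z \<le> r \<Longrightarrow> f z = 1"
  "\<And>z. 2 * r \<le> dist x z \<Longrightarrow> f z = 0" "\<And>z w. \<bar>f z - f w\<bar> \<le> 2 / r * dist z w"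
  "grad f \<in> Lp 2 \<nu>" "(gnorm f)\<^sup>2 \<le> 2 * C ^ 5 / r"
proof -
 obtain W where W: "finite W" "W \<noteq> {}" "\<And>w. w \<in> W \<Longrightarrow> dist x w = 2 * r"
  "\<And>z. dist x z = 2 * r \<Longrightarrow> \<exists>w\<in>W. dist z w < r" "real (card W) \<le> C ^ 5"
  by (rule sphere_net[OF r]) (rule that)
 define c where "c = (\<lambda>z w. ramp r (gromov x z w))"
 define M where "M = (\<lambda>z. Min (c z ` W))"
 \<comment> \<open>Far from \<open>x\<close> the space need not be a tree and the products lose
   their meaning, so the function is cut off at the sphere, where \<open>M\<close> vanishes.\<close>
 define f where "f = (\<lambda>z. if dist x z \<le> 2 * r then M z else 0)"
 have M_lip: "\<bar>M z - M w\<bar> \<le> 2 / r * dist z w" for z w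
  unfolding M_def
 proof (rule Min_lipschitz[OF W(1,2)])
  fix v
  have "\<bar>c z v - c w v\<bar> \<le> 2 / r * \<bar>gromov x z v - gromov x w v\<bar>"
   unfolding c_def by (rule ramp_lipschitz[OF r])
  also have "\<dots> \<le> 2 / r * dist z w" using r by (intro mult_left_mono gromov_lipschitz) auto
  finally show "\<bar>c z v - c w v\<bar> \<le> 2 / r * dist z w" .
 qed
 have M_in: "\<exists>w\<in>W. M z = c z w" for z
 proof -
  have "Min (c z ` W) \<in> c z ` W" using W(1,2) by (intro Min_in) auto
  then show ?thesis unfolding M_def by blast
 qed
 have M_range: "0 \<le> M z" "M z \<le> 1" for z
  using M_in[of z] ramp_range unfolding c_def by auto
 have M_le: "M z \<le> c z w" if "w \<in> W" for z w unfolding M_def using W(1) that by simp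
 have M_zero: "M z = 0" if zr: "dist x z = 2 * r" for z
 proof -
  obtain w where w: "w \<in> W" "dist z w < r" using W(4)[OF zr] by blast
  have "3 / 2 * r \<le> gromov x z w" unfolding gromov_def using zr W(3)[OF w(1)] w(2) by simp
  then have "c z w = 0" unfolding c_def by (rule ramp_zero[OF r])
  then show ?thesis using M_le[OF w(1), of z] M_range(1)[of z] by simp
 qed
 have range: "0 \<le> f z" "f z \<le> 1" for z unfolding f_def using M_range by auto
 have one: "f z = 1" if "dist x z \<le> r" for z
 proof -
  obtain w where w: "w \<in> W" "M z = c z w" using M_in by blast
  have "gromov x z w \<le> r" using gromov_le(1)[of x z w] that by simp
  then show ?thesis unfolding f_def w(2) c_def using that r by (simp add: ramp_one)
 qed
 have zero: "f z = 0" if "2 * r \<le> dist x z" for z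
  unfolding f_def using that M_zero[of z] by auto
 \<comment> \<open>A geodesic from inside to outside meets the sphere, where \<open>M\<close>
   vanishes, so cutting off does not spoil the Lipschitz constant.\<close>
 have cross: "\<bar>f z\<bar> \<le> 2 / r * dist z w" if "dist x z \<le> 2 * r" "2 * r < dist x w" for z w
 proof -
  obtain h where h: "geodesic h z w" using geodesic_exists by blast
  have "continuous_on {0..dist z w} (\<lambda>s. dist x (h s))"
   using h by (intro continuous_intros isometric_embedding_continuous_on) (simp add: geodesic_def)
  moreover have "dist x (h 0) \<le> 2 * r" "2 * r \<le> dist x (h (dist z w))" using h that by (auto simp: geodesic_def)
  ultimately obtain s where s: "0 \<le> s" "s \<le> dist z w" "dist x (h s) = 2 * r"
   using IVT'[of "\<lambda>s. dist x (h s)" 0 "2 * r" "dist z w"] by auto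
  have "\<bar>f z\<bar> = \<bar>M z - M (h s)\<bar>" using M_zero[OF s(3)] that(1) by (simp add: f_def)
  also have "\<dots> \<le> 2 / r * dist z (h s)" by (rule M_lip)
  also have "\<dots> \<le> 2 / r * dist z w"
   using geodesic_dist(1)[OF h s(1,2)] s r by (intro mult_left_mono) auto
  finally show ?thesis .
 qed
 have lip: "\<bar>f z - f w\<bar> \<le> 2 / r * dist z w" for z w
 proof -
  consider "dist x z \<le> 2 * r" "dist x w \<le> 2 * r" | "dist x z \<le> 2 * r" "2 * r < dist x w"
   | "2 * r < dist x z" "dist x w \<le> 2 * r" | "2 * r < dist x z" "2 * r < dist x w" by linarith
  then show ?thesis
  proof cases
   case 1
   then show ?thesis using M_lip by (simp add: f_def)
  next
   case 2
   then show ?thesis using cross[OF 2] zero[of w] by simp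
  next
   case 3
   then show ?thesis using cross[OF 3(2,1)] zero[of z] by (simp add: dist_commute)
  next
   case 4
   then show ?thesis using zero[of z] zero[of w] r by simp
  qed
 qed
 have AC: "f \<in> AC \<iota>" by (rule lipschitz_AC[OF lip]) (use r in simp)
 have "\<forall>w\<in>W. \<exists>h. geodesic h x w" using geodesic_exists by blast
 from bchoice[OF this] obtain h where h: "\<forall>w\<in>W. geodesic (h w) x w" ..
 \<comment> \<open>Only on these arcs can a ramp vary: each has length \<open>r / 2\<close>, which
   together with the bound on the size of the net produces the energy
   \<open>O(1 / r)\<close>.\<close>
 define B where "B = (\<lambda>w. h w ` {r..3 / 2 * r})"
 have B: "B w \<in> sets \<nu>" "emeasure \<nu> (B w) = ennreal (r / 2)" if "w \<in> W" for w
 proof -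
  have "x \<noteq> w" using W(3)[OF that] r by auto
  from geodesic_arc(1)[OF bspec[OF h that] this] have "arc (h w) (2 * r)" using W(3)[OF that] by simp
  from nu_closed_subarc[OF this, of r "3 / 2 * r"] r
  show "B w \<in> sets \<nu>" "emeasure \<nu> (B w) = ennreal (r / 2)" by (auto simp: B_def field_simps)
 qed
 have grad0: "grad f z = 0" if z: "z \<in> S" "grad_exists f z" "\<And>w. w \<in> W \<Longrightarrow> z \<notin> B w" for z
 proof (cases "2 * r \<le> dist x z")
  case True
  show ?thesis by (rule grad_local_min[OF z(1,2)]) (use zero[OF True] range in simp)
 next
  case False
  \<comment> \<open>Each ramp is constant near \<open>z\<close>. If \<open>z\<close> is off [x, w],
    the projection is locally constant; if \<open>z\<close> is on it but off \<open>B w\<close>, the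
    ramp is on its plateau 1 or 0.\<close>
  have ex: "\<exists>\<delta>>0. \<forall>z'. dist z z' < \<delta> \<longrightarrow> c z' w = c z w" if w: "w \<in> W" for w
  proof -
   have dw: "dist x w < e / 2" using W(3)[OF w] re by simp
   have dz: "dist x z < e / 2" using False re by simp
   show ?thesis
   proof (cases "gromov x z w < dist x z")
    case True
    show ?thesis
    proof (intro exI[of _ "min (e / 2 - dist x z) (dist x z - gromov x z w)"] conjI allI impI)
     show "0 < min (e / 2 - dist x z) (dist x z - gromov x z w)" using True dz by simp
     fix z' assume z': "dist z z' < min (e / 2 - dist x z) (dist x z - gromov x z w)"
     have "dist x z' < e / 2" using dist_triangle[of x z' z] z' by simp
     then have "gromov x z' w = gromov x z w"
      using z' dw dz by (intro gromov_locally_constant) auto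
     then show "c z' w = c z w" by (simp add: c_def)
    qed
   next
    case notless: False
    then have eq: "gromov x z w = dist x z" using gromov_le(1)[of x z w] by simp
    have "z = h w (dist x z)" by (rule on_geodesic(1)[OF bspec[OF h w] dw eq])
    then have "dist x z \<notin> {r..3 / 2 * r}" using z(3)[OF w] unfolding B_def by blast
    then consider "dist x z < r" | "3 / 2 * r < dist x z" by fastforce
    then show ?thesis
    proof cases
     case 1
     show ?thesis
     proof (intro exI[of _ "r - dist x z"] conjI allI impI)
      fix z' assume "dist z z' < r - dist x z"
      then have "dist x z' < r" using dist_triangle[of x z' z] by simp
      then have "gromov x z' w \<le> r" using gromov_le(1)[of x z' w] by simp
      then show "c z' w = c z w" using eq 1 r by (simp add: c_def ramp_one)
     qed (use 1 in simp)
    next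
     case 2
     show ?thesis
     proof (intro exI[of _ "dist x z - 3 / 2 * r"] conjI allI impI)
      fix z' assume "dist z z' < dist x z - 3 / 2 * r"
      then have "3 / 2 * r \<le> gromov x z' w" using gromov_lipschitz[of x z w z'] eq by linarith
      then show "c z' w = c z w" using eq 2 r by (simp add: c_def ramp_zero)
     qed (use 2 in simp)
    qed
   qed
  qed
  then have "\<forall>w\<in>W. \<exists>\<delta>. 0 < \<delta> \<and> (\<forall>z'. dist z z' < \<delta> \<longrightarrow> c z' w = c z w)" by blast
  from bchoice[OF this] obtain \<delta> where \<delta>: "\<forall>w\<in>W. 0 < \<delta> w \<and> (\<forall>z'. dist z z' < \<delta> w \<longrightarrow> c z' w = c z w)" ..
  define \<delta>0 where "\<delta>0 = min (2 * r - dist x z) (Min (\<delta> ` W))"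
  have "0 < Min (\<delta> ` W)" using W(1,2) \<delta> by simp
  then have d0: "0 < \<delta>0" using False by (simp add: \<delta>0_def)
  show ?thesis
  proof (rule grad_local_const[OF z(1,2) d0])
   fix z' assume z': "dist z z' < \<delta>0"
   have "dist x z' \<le> 2 * r" using dist_triangle[of x z' z] z' by (simp add: \<delta>0_def)
   moreover have "c z' w = c z w" if "w \<in> W" for w
   proof -
    have "Min (\<delta> ` W) \<le> \<delta> w" using W(1) that by simp
    then have "dist z z' < \<delta> w" using z' by (simp add: \<delta>0_def)
    then show ?thesis using bspec[OF \<delta> that] by blast
   qed
   then have "c z' ` W = c z ` W" by (intro image_cong refl)
   ultimately show "f z' = f z" using False by (simp add: f_def M_def)
  qed
 qed
 \<comment> \<open>The square of the Lipschitz constant \<open>2 / r\<close> on each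
   \<open>B w\<close>; overlaps of these arcs only increase the majorant.\<close>
 define H where "H = (\<lambda>z. (4 / r\<^sup>2) * (\<Sum>w\<in>W. indicator (B w) z :: real))"
 have gm: "grad f \<in> borel_measurable \<nu>" by (rule weak_grad_measurable[OF AC_continuous[OF AC]])
 have Hi: "integrable \<nu> H" unfolding H_def
  using B by (intro Bochner_Integration.integrable_mult_right Bochner_Integration.integrable_sum)
   (auto simp: integrable_indicator_iff)
 have Hint: "(\<integral>z. H z \<partial>\<nu>) = (4 / r\<^sup>2) * (real (card W) * (r / 2))"
 proof -
  have "(\<integral>z. H z \<partial>\<nu>) = (4 / r\<^sup>2) * (\<Sum>w\<in>W. (\<integral>z. indicator (B w) z \<partial>\<nu>))"
   unfolding H_def using B by (subst Bochner_Integration.integral_sum[symmetric]) (auto simp: integrable_indicator_iff)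
  also have "(\<Sum>w\<in>W. (\<integral>z. indicator (B w) z \<partial>\<nu>)) = (\<Sum>w\<in>W. r / 2 :: real)"
  proof (rule sum.cong[OF refl])
   fix w assume w: "w \<in> W"
   have "B w \<inter> space \<nu> = B w" using sets.sets_into_space[OF B(1)[OF w]] by blast
   then show "(\<integral>z. indicator (B w) z \<partial>\<nu>) = (r / 2 :: real)" using B(2)[OF w] r by (simp add: measure_def)
  qed
  finally show ?thesis by simp
 qed
 have bound: "AE z in \<nu>. (grad f z)\<^sup>2 \<le> H z"
  using AE_grad_exists[OF AC] AE_space
 proof eventually_elim
  case (elim z)
  then have zS: "z \<in> S" by (simp add: space_nu)
  show ?case
  proof (cases "\<exists>w\<in>W. z \<in> B w")
   case True
   then obtain w where w: "w \<in> W" "z \<in> B w" by blast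
   have "\<bar>grad f z\<bar> \<le> 2 / r"
    by (rule grad_lipschitz[OF zS elim(1) zero_less_one]) (use lip in \<open>simp add: dist_commute\<close>)
   then have "(grad f z)\<^sup>2 \<le> (2 / r)\<^sup>2" using r by (intro abs_le_square_iff[THEN iffD1]) simp
   also have "\<dots> = (4 / r\<^sup>2) * indicator (B w) z" using w by (simp add: power_divide)
   also have "\<dots> \<le> H z" unfolding H_def
    using W(1) w(1) by (intro mult_left_mono member_le_sum) auto
   finally show ?thesis .
  next
   case False
   then show ?thesis using grad0[OF zS elim(1)] by (auto simp: H_def intro!: sum_nonneg)
  qed
 qed
 have gi: "integrable \<nu> (\<lambda>z. (grad f z)\<^sup>2)"
 proof (rule Bochner_Integration.integrable_bound[OF Hi])
  show "AE z in \<nu>. norm ((grad f z)\<^sup>2) \<le> norm (H z)"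
   using bound by eventually_elim (auto intro: order_trans[OF _ abs_ge_self])
 qed (use gm in simp)
 have "(gnorm f)\<^sup>2 \<le> (\<integral>z. H z \<partial>\<nu>)"
  unfolding norm_L2_sqr by (rule integral_mono_AE[OF gi Hi bound])
 also have "\<dots> = 2 * real (card W) / r" unfolding Hint using r by (simp add: field_simps power2_eq_square)
 also have "\<dots> \<le> 2 * C ^ 5 / r" using W(5) r by (simp add: divide_right_mono)
 finally have en: "(gnorm f)\<^sup>2 \<le> 2 * C ^ 5 / r" .
 show thesis
  by (rule that[of f, OF range one zero lip _ en]) (use gi gm in \<open>auto simp: Lp2_iff\<close>)
qed

end

context length_space
begin

lemma AE_nu_neq: "AE z in \<nu>. z \<noteq> p"
proof -
 have "AE z in \<nu>. z \<in> \<gamma> n ` {0<..<l n} \<longrightarrow> z \<noteq> p" for n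
 proof (rule AE_nu_arcI[OF arc_chart])
  have "AE s in lborel. s \<noteq> dist (\<gamma> n 0) p" by (rule AE_lborel_singleton)
  then show "AE s in lborel. s \<in> {0<..<l n} \<longrightarrow> \<gamma> n s \<noteq> p"
  proof eventually_elim
   case (elim s)
   then show ?case using arc_inverse[OF arc_chart, of s n] by auto
  qed
 qed
 then have "AE z in \<nu>. \<forall>n. z \<in> \<gamma> n ` {0<..<l n} \<longrightarrow> z \<noteq> p" by (subst AE_all_countable) (rule allI)
 then show ?thesis using AE_space
 proof eventually_elim
  case (elim z)
  then have "\<exists>n. z \<in> \<gamma> n ` {0<..<l n}" using skeleton_eq space_nu by blast
  then show ?case using elim by blast
 qed
qed

lemma nu_arc_finite:
 assumes "arc q d"
 shows "emeasure \<nu> (q ` {0<..<d}) = ennreal d"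
proof -
 have "{s \<in> {0<..<d}. q s \<in> q ` {0<..<d}} = {0<..<d}" by auto
 then show ?thesis
  using nu_arc_subset(2)[OF assms, of "q ` {0<..<d}"] arc_open_borel[OF assms, of 0 d] assms by (simp add: arc_def)
qed

end

context vol_space
begin

section \<open>The form domain and the gradient bound for weak solutions\<close>

abbreviation "\<F> \<equiv> form_domain \<iota> \<nu> \<gamma> l m"

lemma formD:
 assumes "u \<in> \<F>"
 shows "u \<in> AC \<iota>" "u \<in> Lp 2 m" "grad u \<in> Lp 2 \<nu>" "continuous_on UNIV u"
 using assms by (auto simp: form_domain_def AC_def)

lemma form_eq: "form \<nu> \<gamma> l u v = inner_L2 \<nu> (grad u) (grad v)"
 by (simp add: form_def inner_L2_def)

lemma measurable_m: "f \<in> borel_measurable m \<longleftrightarrow> f \<in> borel_measurable borel"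
 by (simp cong: measurable_cong_sets add: sets_m measurable_cong_sets[OF sets_m refl])

lemma continuous_measurable_m: "continuous_on UNIV f \<Longrightarrow> f \<in> borel_measurable m"
 by (simp add: measurable_m borel_measurable_continuous_onI)

lemma ball_norm: "0 < r \<Longrightarrow> (\<lambda>z. indicator (ball a r) z) \<in> Lp 2 m"
 "0 < r \<Longrightarrow> norm_L2 m (\<lambda>z. indicator (ball a r) z) \<le> sqrt (C * V r)"
proof -
 assume r: "0 < r"
 have b: "ball a r \<in> sets m" by (simp add: sets_m)
 show "(\<lambda>z. indicator (ball a r) z) \<in> Lp 2 m" by (rule norm_L2_indicator(1)[OF b ball_finite])
 have "(norm_L2 m (\<lambda>z. indicator (ball a r) z))\<^sup>2 \<le> C * V r"
  using norm_L2_indicator(2)[OF b ball_finite] ball_upper[OF r, of a] by simp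
 then show "norm_L2 m (\<lambda>z. indicator (ball a r) z) \<le> sqrt (C * V r)" by (rule real_le_rsqrt)
qed

lemma supported_L2:
 assumes "continuous_on UNIV f" "\<And>z. \<bar>f z\<bar> \<le> 1" "\<And>z. r \<le> dist a z \<Longrightarrow> f z = 0" "0 < r"
 shows "f \<in> Lp 2 m" "norm_L2 m f \<le> sqrt (C * V r)"
proof -
 have le: "AE z in m. \<bar>f z\<bar> \<le> \<bar>indicator (ball a r) z\<bar>"
  using assms(2,3) by (intro AE_I2) (auto simp: indicator_def not_less)
 show "f \<in> Lp 2 m" by (rule Lp2_bound[OF ball_norm(1)[OF assms(4)] continuous_measurable_m[OF assms(1)] le])
 show "norm_L2 m f \<le> sqrt (C * V r)"
  using norm_L2_mono_AE[OF continuous_measurable_m[OF assms(1)] ball_norm(1)[OF assms(4)] le] ball_norm(2)[OF assms(4), of a] by simp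
qed

lemma cutoff_form_domain:
 fixes x :: 'a
 assumes r: "0 < r" and re: "4 * r < e"
 obtains h where "\<And>z. 0 \<le> h z" "\<And>z. h z \<le> 1" "\<And>z. dist x z \<le> r \<Longrightarrow> h z = 1"
  "\<And>z. 2 * r \<le> dist x z \<Longrightarrow> h z = 0" "\<And>z w. \<bar>h z - h w\<bar> \<le> 2 / r * dist z w"
  "h \<in> \<F>" "norm_L2 m h \<le> sqrt (C * V (2 * r))" "gnorm h \<le> sqrt (2 * C ^ 5 / r)"
proof -
 obtain h where h: "\<And>z. 0 \<le> h z" "\<And>z. h z \<le> 1" "\<And>z. dist x z \<le> r \<Longrightarrow> h z = 1"
  "\<And>z. 2 * r \<le> dist x z \<Longrightarrow> h z = 0" "\<And>z w. \<bar>h z - h w\<bar> \<le> 2 / r * dist z w"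
  "grad h \<in> Lp 2 \<nu>" "(gnorm h)\<^sup>2 \<le> 2 * C ^ 5 / r"
  by (rule cutoff_function[OF r re]) (rule that)
 have AC: "h \<in> AC \<iota>" by (rule lipschitz_AC[OF h(5)]) (use r in simp)
 have "0 < 2 * r" using r by simp
 have b1: "\<bar>h z\<bar> \<le> 1" for z using h(1,2)[of z] by simp
 note s = supported_L2[OF AC_continuous[OF AC] b1 h(4) \<open>0 < 2 * r\<close>]
 show thesis
  by (rule that[OF h(1-5) _ s(2) real_le_rsqrt[OF h(7)]]) (use AC s(1) h(6) in \<open>simp_all add: form_domain_def\<close>)
qed

text \<open>
 The test function is the cutoff at \<open>a\<close> times the projection to \<open>[a, b]\<close>, scaled to increase from 0 to 1. The gradient of
 the projection lives on \<open>[a, b]\<close>, where it integrates \<open>\<partial>u\<close> to \<open>u b - u a\<close>.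
\<close>

lemma weak_solution_lipschitz:
 fixes a b :: 'a
 assumes u: "u \<in> \<F>" and k: "k \<in> Lp 2 m"
  and sol: "\<And>v. v \<in> \<F> \<Longrightarrow> form \<nu> \<gamma> l u v = - inner_L2 m k v"
  and r: "0 < r" "4 * r < e" and ab: "a \<noteq> b" "dist a b < r"
 shows "\<bar>u b - u a\<bar> \<le> dist a b * (norm_L2 m k * sqrt (C * V (2 * r)) + gnorm u * sqrt (2 * C ^ 5 / r))"
proof -
 define d where "d = dist a b"
 have d: "0 < d" "d < r" "d < e" using ab r unfolding d_def by auto
 obtain f where f: "\<And>z. 0 \<le> f z" "\<And>z. f z \<le> 1" "\<And>z. dist a z \<le> r \<Longrightarrow> f z = 1"
  "\<And>z. 2 * r \<le> dist a z \<Longrightarrow> f z = 0" "\<And>z w. \<bar>f z - f w\<bar> \<le> 2 / r * dist z w"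
  "f \<in> \<F>" "norm_L2 m f \<le> sqrt (C * V (2 * r))" "gnorm f \<le> sqrt (2 * C ^ 5 / r)"
  by (rule cutoff_form_domain[OF r]) (rule that)
 obtain h where h: "geodesic h a b" using geodesic_exists by blast
 have arc: "arc h d" and ends: "h 0 = a" "h d = b" unfolding d_def by (rule geodesic_arc[OF h ab(1)])+
 let ?A = "h ` {0<..<d}"
 define q where "q = (\<lambda>z. 1 / d * gromov a z b)"
 have q1: "0 \<le> q z" "q z \<le> 1" for z
  unfolding q_def using gromov_nonneg[of a z b] gromov_le(2)[of a z b] d
  by (auto simp: d_def)
 have qlip: "\<bar>q z - q w\<bar> \<le> 1 / d * dist z w" for z w
 proof -
  have "\<bar>q z - q w\<bar> = 1 / d * \<bar>gromov a z b - gromov a w b\<bar>"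
   unfolding q_def right_diff_distrib[symmetric] abs_mult using d by simp
  also have "\<dots> \<le> 1 / d * dist z w" using d by (intro mult_left_mono gromov_lipschitz) auto
  finally show ?thesis .
 qed
 have qAC: "q \<in> AC \<iota>" by (rule lipschitz_AC[OF qlip]) (use d in simp)
 define j where "j = (\<lambda>z. q z * f z)"
 have jlip: "\<bar>j z - j w\<bar> \<le> (2 / r + 1 / d) * dist z w" for z w
 proof -
  have "j z - j w = q z * (f z - f w) + f w * (q z - q w)" by (simp add: j_def algebra_simps)
  then have "\<bar>j z - j w\<bar> \<le> \<bar>q z\<bar> * \<bar>f z - f w\<bar> + \<bar>f w\<bar> * \<bar>q z - q w\<bar>"
   using abs_triangle_ineq[of "q z * (f z - f w)" "f w * (q z - q w)"] by (simp add: abs_mult)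
  also have "\<dots> \<le> 1 * \<bar>f z - f w\<bar> + 1 * \<bar>q z - q w\<bar>"
   using q1[of z] f(1,2)[of w] by (intro add_mono mult_right_mono) auto
  also have "\<dots> \<le> 2 / r * dist z w + 1 / d * dist z w" unfolding mult_1_left by (rule add_mono[OF f(5) qlip])
  finally show ?thesis by (simp add: distrib_right)
 qed
 have jAC: "j \<in> AC \<iota>" by (rule lipschitz_AC[OF jlip]) (use d r in simp)
 have j1: "\<bar>j z\<bar> \<le> 1" for z
  unfolding j_def abs_mult using q1[of z] f(1,2)[of z] by (simp add: mult_le_one)
 have j0: "j z = 0" if "2 * r \<le> dist a z" for z unfolding j_def using f(4)[OF that] by simp
 have "0 < 2 * r" using r by simp
 note jL2 = supported_L2[OF AC_continuous[OF jAC] j1 j0 this]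
 note fF = formD[OF f(6)]
 have ge: "AE z in \<nu>. z \<in> S \<and> grad_exists q z \<and> grad_exists (\<lambda>z. gromov a z b) z \<and> grad_exists f z \<and> z \<noteq> a \<and> z \<noteq> b"
  using AE_grad_exists[OF qAC] AE_grad_exists[OF gromov_AC[of a b]] AE_grad_exists[OF fF(1)] AE_nu_neq[of a] AE_nu_neq[of b] AE_space
  by eventually_elim (simp add: space_nu)
 \<comment> \<open>On the arc \<open>f = 1\<close>, because \<open>d < r\<close>. Off the arc either
   \<open>f\<close> vanishes or \<open>z\<close> is within \<open>2 * r\<close> of \<open>a\<close>,
   where the projection to [a, b] is locally constant. The two ends of the arc are null.\<close>
 have gradq: "AE z in \<nu>. f z * grad q z = indicator ?A z * grad q z"
  using ge
 proof eventually_elim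
  case (elim z)
  show ?case
  proof (cases "z \<in> ?A")
   case True
   then obtain s where s: "0 < s" "s < d" "z = h s" by auto
   have "dist a z = s" using geodesic_dist(1)[OF h, of s] s d_def by simp
   then have "f z = 1" using s d by (intro f(3)) simp
   then show ?thesis using True by simp
  next
   case notA: False
   show ?thesis
   proof (cases "f z = 0")
    case nz: False
    then have dz: "dist a z < 2 * r" using f(4)[of z] by (cases "2 * r \<le> dist a z") auto
    have lt: "gromov a z b < dist a z"
    proof (rule ccontr)
     assume "\<not> gromov a z b < dist a z"
     then have eq: "gromov a z b = dist a z" using gromov_le(1)[of a z b] by simp
     have "dist a b < e / 2" using ab r by simp
     from on_geodesic[OF h this eq] have z: "z = h (dist a z)" "dist a z \<le> d" by (auto simp: d_def)
     have "dist a z \<noteq> 0" using elim by auto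
     moreover have "dist a z \<noteq> d" using z(1) ends(2) elim by metis
     ultimately have "dist a z \<in> {0<..<d}" using z(2) by auto
     then have "z \<in> ?A" using z(1) by (metis imageI)
     then show False using notA by simp
    qed
    have "\<bar>grad q z\<bar> \<le> 0"
    proof -
     have g0: "dist a b < e / 2" "dist a z < e / 2" using ab r dz by auto
     obtain \<delta> where \<delta>: "\<delta> > 0" "\<And>w. dist z w < \<delta> \<Longrightarrow> gromov a w b = gromov a z b"
     proof (rule that[of "min (e / 2 - dist a z) (dist a z - gromov a z b)"])
      show "0 < min (e / 2 - dist a z) (dist a z - gromov a z b)" using g0 lt by simp
      fix w assume w: "dist z w < min (e / 2 - dist a z) (dist a z - gromov a z b)"
      have "dist a w < e / 2" using dist_triangle[of a w z] w by simp
      then show "gromov a w b = gromov a z b"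
       using w by (intro gromov_locally_constant g0) auto
     qed
     have "grad q z = 0"
     proof (rule grad_local_const[OF _ _ \<delta>(1)])
      show "q w = q z" if "dist z w < \<delta>" for w using \<delta>(2)[OF that] by (simp add: q_def)
     qed (use elim in auto)
     then show ?thesis by simp
    qed
    then show ?thesis using notA by simp
   qed (use notA in simp)
  qed
 qed
 have gradj: "AE z in \<nu>. grad j z = q z * grad f z + indicator ?A z * grad q z"
  using ge gradq
 proof eventually_elim
  case (elim z)
  have "grad j z = q z * grad f z + f z * grad q z" unfolding j_def by (rule grad_mult) (use elim in auto)
  then show ?case using elim by simp
 qed
 have As: "?A \<in> sets \<nu>" by (rule arc_sets_nu[OF arc])
 have m1: "q \<in> borel_measurable \<nu>" "grad q \<in> borel_measurable \<nu>" "grad f \<in> borel_measurable \<nu>" "grad j \<in> borel_measurable \<nu>"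
  using AC_continuous[OF qAC] AC_continuous[OF jAC] fF(4) weak_grad_measurable
  by (simp_all add: borel_measurable_nu borel_measurable_continuous_onI)
 have L1: "(\<lambda>z. q z * grad f z) \<in> Lp 2 \<nu>"
 proof (rule Lp2_bound[OF fF(3)])
  show "AE z in \<nu>. \<bar>q z * grad f z\<bar> \<le> \<bar>grad f z\<bar>"
   using q1 by (intro AE_I2) (simp add: abs_mult mult_left_le_one_le)
 qed (use m1 in simp)
 have N1: "norm_L2 \<nu> (\<lambda>z. q z * grad f z) \<le> gnorm f"
 proof (rule norm_L2_mono_AE[OF _ fF(3)])
  show "AE z in \<nu>. \<bar>q z * grad f z\<bar> \<le> \<bar>grad f z\<bar>"
   using q1 by (intro AE_I2) (simp add: abs_mult mult_left_le_one_le)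
 qed (use m1 in simp)
 have indL2: "(\<lambda>z. indicator ?A z) \<in> Lp 2 \<nu>"
  by (rule norm_L2_indicator(1)[OF As]) (simp add: nu_arc_finite[OF arc])
 have L2: "(\<lambda>z. indicator ?A z * grad q z) \<in> Lp 2 \<nu>"
 proof (rule Lp2_bound[OF Lp2_scale[OF indL2, of "1 / d"]])
  show "AE z in \<nu>. \<bar>indicator ?A z * grad q z\<bar> \<le> \<bar>1 / d * indicator ?A z\<bar>"
   using ge
  proof eventually_elim
   case (elim z)
   have "\<bar>grad q z\<bar> \<le> 1 / d"
    by (rule grad_lipschitz[of z q 1]) (use elim qlip in \<open>auto simp: dist_commute\<close>)
   then show ?case using d by (simp add: indicator_def)
  qed
 qed (use m1 As in simp)
 have "(\<lambda>z. 1 * (q z * grad f z) + 1 * (indicator ?A z * grad q z)) \<in> Lp 2 \<nu>" by (rule Lp2_add[OF L1 L2])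
 then have gL2: "grad j \<in> Lp 2 \<nu>"
  by (rule Lp2_cong_AE[OF _ m1(4)]) (use gradj in \<open>auto elim: eventually_mono\<close>)
 have jF: "j \<in> \<F>" using jAC jL2(1) gL2 by (simp add: form_domain_def)
 note uF = formD[OF u]
 have um: "grad u \<in> borel_measurable \<nu>" by (rule weak_grad_measurable[OF uF(4)])
 have "inner_L2 \<nu> (grad u) (grad j) = inner_L2 \<nu> (grad u) (\<lambda>z. 1 * (q z * grad f z) + 1 * (indicator ?A z * grad q z))"
  by (rule inner_L2_cong_AE) (use um m1 As gradj in \<open>auto elim: eventually_mono\<close>)
 also have "\<dots> = inner_L2 \<nu> (grad u) (\<lambda>z. q z * grad f z) + inner_L2 \<nu> (grad u) (\<lambda>z. indicator ?A z * grad q z)"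
  unfolding inner_L2_add_right[OF L1 L2 uF(3)] by simp
 also have "inner_L2 \<nu> (grad u) (\<lambda>z. indicator ?A z * grad q z) = (\<integral>z. indicator ?A z * (grad u z * grad q z) \<partial>\<nu>)"
  by (simp add: inner_L2_def ac_simps)
 also have "\<dots> = (\<integral>s. deriv (u \<circ> h) s * deriv (q \<circ> h) s \<partial>RL d)"
  by (rule integral_grad_arc[OF arc d(3) uF(1) qAC])
 also have "\<dots> = (\<integral>s. deriv (u \<circ> h) s * (1 / d) \<partial>RL d)"
 proof (rule Bochner_Integration.integral_cong[OF refl])
  fix s assume "s \<in> space (RL d)"
  then have s: "s \<in> {0<..<d}" by (simp add: space_RL)
  have "((\<lambda>t. 1 / d * t) has_real_derivative 1 / d) (at s)" using DERIV_cmult_Id by blast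
  moreover have "\<forall>\<^sub>F t in nhds s. (q \<circ> h) t = 1 / d * t"
  proof -
   have "\<forall>\<^sub>F t in nhds s. t \<in> {0<..<d}" using s by (intro eventually_nhds_in_open) auto
   then show ?thesis
    by eventually_elim (use gromov_on_arc[OF h] in \<open>simp add: q_def d_def\<close>)
  qed
  ultimately have "((q \<circ> h) has_real_derivative 1 / d) (at s)"
   by (subst DERIV_cong_ev[OF refl _ refl])
  then show "deriv (u \<circ> h) s * deriv (q \<circ> h) s = deriv (u \<circ> h) s * (1 / d)" by (simp add: DERIV_imp_deriv)
 qed
 also have "\<dots> = (u b - u a) / d"
  using arc_increment[OF arc d(3) uF(1,3)] ends by simp
 \<comment> \<open>Along the arc \<open>q\<close> has slope \<open>1 / d\<close>, so its part of the
   form is the mean slope of \<open>u\<close>; what remains is the equation tested with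
   \<open>j\<close> and a term carrying the gradient of the cutoff.\<close>
 finally have key: "(u b - u a) / d = form \<nu> \<gamma> l u j - inner_L2 \<nu> (grad u) (\<lambda>z. q z * grad f z)"
  by (simp add: form_eq)
 have "\<bar>form \<nu> \<gamma> l u j\<bar> \<le> norm_L2 m k * sqrt (C * V (2 * r))"
 proof -
  have "\<bar>form \<nu> \<gamma> l u j\<bar> = \<bar>inner_L2 m k j\<bar>" using sol[OF jF] by simp
  also have "\<dots> \<le> norm_L2 m k * norm_L2 m j" by (rule Cauchy_Schwarz_L2[OF k jL2(1)])
  also have "\<dots> \<le> norm_L2 m k * sqrt (C * V (2 * r))" by (intro mult_left_mono jL2(2) norm_L2_nonneg)
  finally show ?thesis .
 qed
 moreover have "\<bar>inner_L2 \<nu> (grad u) (\<lambda>z. q z * grad f z)\<bar> \<le> gnorm u * sqrt (2 * C ^ 5 / r)"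
 proof -
  have "\<bar>inner_L2 \<nu> (grad u) (\<lambda>z. q z * grad f z)\<bar> \<le> gnorm u * norm_L2 \<nu> (\<lambda>z. q z * grad f z)"
   by (rule Cauchy_Schwarz_L2[OF uF(3) L1])
  also have "\<dots> \<le> gnorm u * sqrt (2 * C ^ 5 / r)"
   using N1 f(8) by (intro mult_left_mono norm_L2_nonneg) auto
  finally show ?thesis .
 qed
 ultimately have "\<bar>(u b - u a) / d\<bar> \<le> norm_L2 m k * sqrt (C * V (2 * r)) + gnorm u * sqrt (2 * C ^ 5 / r)"
  unfolding key by linarith
 then show ?thesis using d unfolding d_def[symmetric] by (simp add: abs_divide field_simps)
qed

end

section \<open>The heat semigroup\<close>

text \<open>A measure on the whole line, so that intervals can vary without changing spaces;
  half-open intervals concatenate without overlap.\<close>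

definition leb_on :: "real \<Rightarrow> real \<Rightarrow> real measure" where
 "leb_on a b = density lborel (indicator {a<..b})"

lemma sets_leb_on [measurable_cong, simp]: "sets (leb_on a b) = sets borel"
 by (simp add: leb_on_def)

lemma space_leb_on [simp]: "space (leb_on a b) = UNIV"
 by (simp add: leb_on_def)

lemma emeasure_leb_on: "a \<le> b \<Longrightarrow> emeasure (leb_on a b) UNIV = ennreal (b - a)"
 unfolding leb_on_def by (subst emeasure_density) auto

lemma finite_leb_on: "a \<le> b \<Longrightarrow> finite_measure (leb_on a b)"
 by (rule finite_measureI) (simp only: space_leb_on emeasure_leb_on infinity_ennreal_def ennreal_neq_top not_False_eq_True)

lemma AE_leb_on: "AE s in leb_on a b. a < s \<and> s \<le> b"
 unfolding leb_on_def by (subst AE_density) (auto simp: indicator_def)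

lemma integral_leb_on:
 fixes f :: "real \<Rightarrow> real"
 assumes "f \<in> borel_measurable borel"
 shows "(\<integral>s. f s \<partial>leb_on a b) = (\<integral>s. indicator {a<..b} s * f s \<partial>lborel)"
proof -
 have "(\<integral>s. f s \<partial>density lborel (\<lambda>s. ennreal (indicator {a<..b} s))) = (\<integral>s. indicator {a<..b} s * f s \<partial>lborel)"
  using assms by (subst integral_density) auto
 moreover have "(\<lambda>s. ennreal (indicator {a<..b} s)) = indicator {a<..b}" by (auto simp: indicator_def)
 ultimately show ?thesis unfolding leb_on_def by simp
qed

lemma integrable_leb_on:
 fixes f :: "real \<Rightarrow> real"
 assumes "f \<in> borel_measurable borel"
 shows "integrable (leb_on a b) f \<longleftrightarrow> integrable lborel (\<lambda>s. indicator {a<..b} s * f s)"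
proof -
 have "integrable (density lborel (\<lambda>s. ennreal (indicator {a<..b} s))) f \<longleftrightarrow> integrable lborel (\<lambda>s. indicator {a<..b} s * f s)"
  using assms by (subst integrable_density) auto
 moreover have "(\<lambda>s. ennreal (indicator {a<..b} s)) = indicator {a<..b}" by (auto simp: indicator_def)
 ultimately show ?thesis unfolding leb_on_def by simp
qed

lemma leb_on_const: "a \<le> b \<Longrightarrow> (\<integral>s. c \<partial>leb_on a b) = (b - a) * (c::real)"
 using emeasure_leb_on[of a b] by (simp add: measure_def)

lemma leb_on_shift:
 fixes f :: "real \<Rightarrow> real"
 assumes "f \<in> borel_measurable borel"
 shows "(\<integral>s. f (s + h) \<partial>leb_on a b) = (\<integral>s. f s \<partial>leb_on (a + h) (b + h))"
  "integrable (leb_on a b) (\<lambda>s. f (s + h)) \<longleftrightarrow> integrable (leb_on (a + h) (b + h)) f"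
proof -
 have m: "(\<lambda>s. f (s + h)) \<in> borel_measurable borel" using assms by measurable
 have e: "indicator {a + h<..b + h} (h + 1 * s) * f (h + 1 * s) = indicator {a<..b} s * f (s + h)" for s
  by (auto simp: indicator_def add.commute)
 show "(\<integral>s. f (s + h) \<partial>leb_on a b) = (\<integral>s. f s \<partial>leb_on (a + h) (b + h))"
  unfolding integral_leb_on[OF m] integral_leb_on[OF assms]
  using lborel_integral_real_affine[of 1 "\<lambda>s. indicator {a + h<..b + h} s * f s" h] unfolding e by simp
 show "integrable (leb_on a b) (\<lambda>s. f (s + h)) \<longleftrightarrow> integrable (leb_on (a + h) (b + h)) f"
  unfolding integrable_leb_on[OF m] integrable_leb_on[OF assms]
  using lborel_integrable_real_affine_iff[of 1 "\<lambda>s. indicator {a + h<..b + h} s * f s" h] unfolding e by simp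
qed

lemma leb_on_subinterval:
 fixes f :: "real \<Rightarrow> real"
 assumes "f \<in> borel_measurable borel" "integrable (leb_on a d) f" "a \<le> b" "c \<le> d"
 shows "integrable (leb_on b c) f"
proof -
 have "integrable lborel (\<lambda>s. indicator {b<..c} s * (indicator {a<..d} s * f s))"
  using integrable_real_mult_indicator[of "{b<..c}" lborel "\<lambda>s. indicator {a<..d} s * f s"] assms(2)
  unfolding integrable_leb_on[OF assms(1)] by (simp add: ac_simps)
 moreover have "indicator {b<..c} s * (indicator {a<..d} s * f s) = indicator {b<..c} s * f s" for s
  using assms(3,4) by (auto simp: indicator_def)
 ultimately show ?thesis unfolding integrable_leb_on[OF assms(1)] by simp
qed

lemma leb_on_concat:
 fixes f :: "real \<Rightarrow> real"
 assumes "f \<in> borel_measurable borel" "integrable (leb_on a b) f" "integrable (leb_on b c) f" "a \<le> b" "b \<le> c"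
 shows "integrable (leb_on a c) f"
  "(\<integral>s. f s \<partial>leb_on a c) = (\<integral>s. f s \<partial>leb_on a b) + (\<integral>s. f s \<partial>leb_on b c)"
proof -
 have e: "indicator {a<..c} s * f s = indicator {a<..b} s * f s + indicator {b<..c} s * f s" for s
  using assms(4,5) by (auto simp: indicator_def)
 note i = assms(2,3)[unfolded integrable_leb_on[OF assms(1)]]
 show "integrable (leb_on a c) f"
  unfolding integrable_leb_on[OF assms(1)] e using i by simp
 show "(\<integral>s. f s \<partial>leb_on a c) = (\<integral>s. f s \<partial>leb_on a b) + (\<integral>s. f s \<partial>leb_on b c)"
  unfolding integral_leb_on[OF assms(1)] e using i by simp
qed

text \<open>Cauchy-Schwarz in time followed by Tonelli. That almost every path is integrable is part
  of the conclusion: without it the pointwise time integral would be a default value.\<close>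

lemma time_average_L2:
 fixes F :: "'a \<Rightarrow> real \<Rightarrow> real"
 assumes "sigma_finite_measure m" and F: "case_prod F \<in> borel_measurable (m \<Otimes>\<^sub>M borel)" and ab: "a \<le> b"
  and L2: "\<And>s. a < s \<Longrightarrow> s \<le> b \<Longrightarrow> (\<lambda>x. F x s) \<in> Lp 2 m \<and> (norm_L2 m (\<lambda>x. F x s))\<^sup>2 \<le> B"
 shows "AE x in m. F x \<in> Lp 2 (leb_on a b)"
  "AE x in m. integrable (leb_on a b) (F x)"
  "(\<lambda>x. \<integral>s. F x s \<partial>leb_on a b) \<in> Lp 2 m"
  "(norm_L2 m (\<lambda>x. \<integral>s. F x s \<partial>leb_on a b))\<^sup>2 \<le> (b - a)\<^sup>2 * B"
proof -
 let ?T = "leb_on a b"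
 interpret m: sigma_finite_measure m by fact
 interpret T: finite_measure ?T by (rule finite_leb_on[OF ab])
 interpret pair_sigma_finite m ?T ..
 have Fm: "case_prod F \<in> borel_measurable (m \<Otimes>\<^sub>M ?T)"
  using F by (subst measurable_cong_sets[OF sets_pair_measure_cong[OF refl sets_leb_on] refl])
 have Fx: "F x \<in> borel_measurable borel" if "x \<in> space m" for x
  using measurable_compose[OF measurable_Pair1'[OF that] F] by simp
 have sq: "(\<lambda>(x, s). ennreal ((F x s)\<^sup>2)) \<in> borel_measurable (m \<Otimes>\<^sub>M ?T)" using Fm by measurable
 define Z where "Z = (\<integral>\<^sup>+x. \<integral>\<^sup>+s. ennreal ((F x s)\<^sup>2) \<partial>?T \<partial>m)"
 have Zle: "Z \<le> ennreal ((b - a) * B)"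
 proof -
  have "Z = (\<integral>\<^sup>+s. \<integral>\<^sup>+x. ennreal ((F x s)\<^sup>2) \<partial>m \<partial>?T)"
   unfolding Z_def using Fubini'[OF sq] by simp
  also have "\<dots> \<le> (\<integral>\<^sup>+s. ennreal B \<partial>?T)"
  proof (rule nn_integral_mono_AE)
   show "AE s in ?T. (\<integral>\<^sup>+x. ennreal ((F x s)\<^sup>2) \<partial>m) \<le> ennreal B"
    using AE_leb_on
   proof eventually_elim
    case (elim s)
    then have "(\<integral>\<^sup>+x. ennreal ((F x s)\<^sup>2) \<partial>m) = ennreal (\<integral>x. (F x s)\<^sup>2 \<partial>m)"
     using L2[of s] by (intro nn_integral_eq_integral) (auto simp: Lp2_iff)
    also have "\<dots> \<le> ennreal B" using L2[of s] elim by (intro ennreal_leI) (simp add: norm_L2_sqr)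
    finally show ?case .
   qed
  qed
  also have "\<dots> = ennreal B * ennreal (b - a)" using emeasure_leb_on[OF ab] by simp
  finally show ?thesis using ab by (simp add: ennreal_mult''[symmetric] mult.commute)
 qed
 have meas1: "(\<lambda>x. \<integral>\<^sup>+s. ennreal ((F x s)\<^sup>2) \<partial>?T) \<in> borel_measurable m"
  using T.borel_measurable_nn_integral[OF sq] by simp
 have fin: "AE x in m. (\<integral>\<^sup>+s. ennreal ((F x s)\<^sup>2) \<partial>?T) \<noteq> \<infinity>"
 proof (rule nn_integral_noteq_infinite[OF meas1])
  show "(\<integral>\<^sup>+x. \<integral>\<^sup>+s. ennreal ((F x s)\<^sup>2) \<partial>?T \<partial>m) \<noteq> \<infinity>"
   using Zle unfolding Z_def by (auto simp: top_unique)
 qed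
 show AE1: "AE x in m. F x \<in> Lp 2 ?T"
  using fin AE_space
 proof eventually_elim
  case (elim x)
  have "integrable ?T (\<lambda>s. (F x s)\<^sup>2)"
   using elim Fx[of x] by (intro integrableI_nonneg) (auto simp: less_top)
  moreover have "F x \<in> borel_measurable ?T"
   by (subst measurable_cong_sets[OF sets_leb_on refl]) (rule Fx[OF elim(2)])
  ultimately show ?case by (simp add: Lp2_iff)
 qed
 have one: "(\<lambda>s. 1) \<in> Lp 2 ?T" by (simp add: Lp2_iff)
 have n1: "norm_L2 ?T (\<lambda>s. 1) = sqrt (b - a)"
  unfolding norm_L2_eq using leb_on_const[OF ab, of 1] by simp
 show AE2: "AE x in m. integrable ?T (F x)"
  using AE1
 proof eventually_elim
  case (elim x)
  from Lp2_integrable_mult[OF elim one] show ?case by simp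
 qed
 define A where "A = (\<lambda>x. \<integral>s. F x s \<partial>?T)"
 have Am: "A \<in> borel_measurable m" unfolding A_def by (rule T.borel_measurable_lebesgue_integral[OF Fm])
 have pt: "AE x in m. ennreal ((A x)\<^sup>2) \<le> ennreal (b - a) * (\<integral>\<^sup>+s. ennreal ((F x s)\<^sup>2) \<partial>?T)"
  using AE1
 proof eventually_elim
  case (elim x)
  have "\<bar>A x\<bar> \<le> norm_L2 ?T (F x) * sqrt (b - a)"
   using Cauchy_Schwarz_L2[OF elim one] n1 by (simp add: inner_L2_def A_def)
  then have "\<bar>A x\<bar>\<^sup>2 \<le> (norm_L2 ?T (F x) * sqrt (b - a))\<^sup>2" by (intro power_mono) auto
  then have "(A x)\<^sup>2 \<le> (b - a) * (\<integral>s. (F x s)\<^sup>2 \<partial>?T)"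
   using ab by (simp add: power_mult_distrib norm_L2_sqr mult.commute)
  moreover have "(\<integral>\<^sup>+s. ennreal ((F x s)\<^sup>2) \<partial>?T) = ennreal (\<integral>s. (F x s)\<^sup>2 \<partial>?T)"
   using elim by (intro nn_integral_eq_integral) (auto simp: Lp2_iff)
  ultimately show ?case using ab by (simp add: ennreal_mult'[symmetric] ennreal_leI)
 qed
 have le: "(\<integral>\<^sup>+x. ennreal ((A x)\<^sup>2) \<partial>m) \<le> ennreal ((b - a)\<^sup>2 * B)"
 proof -
  have "(\<integral>\<^sup>+x. ennreal ((A x)\<^sup>2) \<partial>m) \<le> (\<integral>\<^sup>+x. ennreal (b - a) * (\<integral>\<^sup>+s. ennreal ((F x s)\<^sup>2) \<partial>?T) \<partial>m)"
   by (rule nn_integral_mono_AE[OF pt])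
  also have "\<dots> = ennreal (b - a) * Z" unfolding Z_def by (rule nn_integral_cmult[OF meas1])
  also have "\<dots> \<le> ennreal (b - a) * ennreal ((b - a) * B)" by (intro mult_left_mono Zle) simp
  also have "\<dots> = ennreal ((b - a)\<^sup>2 * B)" using ab by (simp add: ennreal_mult'[symmetric] power2_eq_square mult.assoc)
  finally show ?thesis .
 qed
 have int: "integrable m (\<lambda>x. (A x)\<^sup>2)"
  using Am le by (intro integrableI_nonneg) (auto intro: le_less_trans)
 then show "(\<lambda>x. \<integral>s. F x s \<partial>?T) \<in> Lp 2 m" using Am unfolding A_def[symmetric] by (simp add: Lp2_iff)
 have "0 \<le> (b - a)\<^sup>2 * B"
 proof (cases "a = b")
  case False
  then have "0 \<le> (norm_L2 m (\<lambda>x. F x b))\<^sup>2" "(norm_L2 m (\<lambda>x. F x b))\<^sup>2 \<le> B" using L2[of b] ab by auto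
  then have "0 \<le> B" by linarith
  then show ?thesis by simp
 qed simp
 then show "(norm_L2 m (\<lambda>x. \<integral>s. F x s \<partial>?T))\<^sup>2 \<le> (b - a)\<^sup>2 * B"
  using le unfolding A_def[symmetric] norm_L2_sqr
  by (subst (asm) nn_integral_eq_integral[OF int]) auto
qed

text \<open>A supremum argument with the tolerance \<open>\<epsilon> * s\<close>. To pass the
  supremum from the left it is enough that a bound valid before \<open>t\<close> persists at
  \<open>t\<close>, which is weaker than left continuity.\<close>

lemma nonincreasing_if_right_derivative_nonpos:
 fixes f :: "real \<Rightarrow> real"
 assumes right: "\<And>t \<epsilon>. 0 \<le> t \<Longrightarrow> 0 < \<epsilon> \<Longrightarrow> \<exists>\<delta>>0. \<forall>h. 0 < h \<and> h < \<delta> \<longrightarrow> f (t + h) \<le> f t + \<epsilon> * h"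
  and left: "\<And>t c. 0 < t \<Longrightarrow> (\<And>s. 0 \<le> s \<Longrightarrow> s < t \<Longrightarrow> f s \<le> c) \<Longrightarrow> f t \<le> c"
  and t: "0 \<le> t"
 shows "f t \<le> f 0"
proof (rule field_le_epsilon)
 fix e :: real assume e: "0 < e"
 define \<epsilon> where "\<epsilon> = e / (t + 1)"
 have \<epsilon>: "0 < \<epsilon>" "\<epsilon> * t \<le> e" using e t by (auto simp: \<epsilon>_def field_simps)

 define Y where "Y = {r \<in> {0..t}. \<forall>s. 0 \<le> s \<and> s \<le> r \<longrightarrow> f s \<le> f 0 + \<epsilon> * s}"
 have Y0: "0 \<in> Y" using t by (auto simp: Y_def)
 have bdd: "bdd_above Y" by (rule bdd_aboveI[of _ t]) (auto simp: Y_def)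
 define w where "w = Sup Y"
 have w: "0 \<le> w" "w \<le> t"
 proof -
  show "0 \<le> w" unfolding w_def by (rule cSup_upper[OF Y0 bdd])
  show "w \<le> t" unfolding w_def
  proof (rule cSup_least)
   show "Y \<noteq> {}" using Y0 by blast
  qed (simp add: Y_def)
 qed
 have below: "f s \<le> f 0 + \<epsilon> * s" if s: "0 \<le> s" "s < w" for s
 proof -
  obtain r where "r \<in> Y" "s < r" using less_cSup_iff[OF _ bdd, of s] Y0 s unfolding w_def by blast
  then show ?thesis using s by (auto simp: Y_def)
 qed
 have at: "f w \<le> f 0 + \<epsilon> * w"
 proof (cases "w = 0")
  case False
  show ?thesis
  proof (rule left)
   show "0 < w" using False w by simp
   fix s assume s: "0 \<le> s" "s < w"
   have "\<epsilon> * s \<le> \<epsilon> * w" using \<epsilon> s by (intro mult_left_mono) auto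
   then show "f s \<le> f 0 + \<epsilon> * w" using below[OF s] by simp
  qed
 qed simp
 have "w = t"
 proof (rule ccontr)
  assume "w \<noteq> t"
  then have lt: "w < t" using w by simp
  obtain \<delta> where \<delta>: "\<delta> > 0" "\<And>h. 0 < h \<Longrightarrow> h < \<delta> \<Longrightarrow> f (w + h) \<le> f w + \<epsilon> * h"
   using right[OF w(1) \<epsilon>(1)] by blast
  define h where "h = min (\<delta> / 2) (t - w)"
  have h: "0 < h" "h < \<delta>" "h \<le> t - w" using \<delta> lt by (auto simp: h_def min_def)
  have "w + h \<in> Y"
   unfolding Y_def
  proof (intro CollectI conjI allI impI)
   show "w + h \<in> {0..t}" using h w by auto
   fix s assume s: "0 \<le> s \<and> s \<le> w + h"
   consider "s < w" | "s = w" | "w < s" by linarith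
   then show "f s \<le> f 0 + \<epsilon> * s"
   proof cases
    case 3
    then have "f (w + (s - w)) \<le> f w + \<epsilon> * (s - w)" using s h by (intro \<delta>(2)) auto
    then show ?thesis using at by (simp add: algebra_simps)
   qed (use below s at in auto)
  qed
  then have "w + h \<le> w" unfolding w_def by (rule cSup_upper[OF _ bdd])
  then show False using h by simp
 qed
 then show "f t \<le> f 0 + e" using at \<epsilon>(2) by simp
qed

text \<open>The form enters only through \<open>truncation\<close>, which says that the generator
  pairs non-negatively with the negative part; this is the infinitesimal version of preservation of
  positivity.\<close>

locale heat_semigroup =
 fixes m :: "'a::{metric_space, second_countable_topology} measure"
  and G :: "'a operator" and P :: "real \<Rightarrow> ('a \<Rightarrow> real) \<Rightarrow> 'a \<Rightarrow> real" and p :: "real \<Rightarrow> 'a \<Rightarrow> 'a \<Rightarrow> real"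
 assumes sets_m: "sets m = sets borel"
  and ball_finite: "\<And>x r. emeasure m (ball x r) < \<infinity>"
  and ball_pos: "\<And>x r. 0 < r \<Longrightarrow> 0 < emeasure m (ball x r)"
  and cball_compact: "\<And>x r. compact (cball (x::'a) r)"
  and semigroup: "is_semigroup_of m G P"
  and heat_kernel: "is_heat_kernel m P p"
  and truncation: "\<And>f g. (f, g) \<in> G \<Longrightarrow> 0 \<le> inner_L2 m g (\<lambda>x. max 0 (- f x))"
begin

section \<open>The semigroup and its kernel representation\<close>

lemma space_m: "space m = UNIV"
 using sets_eq_imp_space_eq[OF sets_m] by simp

lemma sigma_finite_m: "sigma_finite_measure m"
proof
 obtain x :: 'a where True by simp
 have "(\<Union>n. ball x (real n)) = UNIV"
 proof (intro equalityI subsetI UNIV_I)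
  fix y
  obtain n :: nat where "dist x y < real n" using reals_Archimedean2 by blast
  then show "y \<in> (\<Union>n. ball x (real n))" by auto
 qed
 then show "\<exists>A. countable A \<and> A \<subseteq> sets m \<and> \<Union> A = space m \<and> (\<forall>a\<in>A. emeasure m a \<noteq> \<infinity>)"
  using ball_finite by (intro exI[of _ "range (\<lambda>n. ball x (real n))"]) (auto simp: sets_m space_m less_top[symmetric])
qed

sublocale M: sigma_finite_measure m by (rule sigma_finite_m)

lemma P_L2: "0 \<le> t \<Longrightarrow> f \<in> Lp 2 m \<Longrightarrow> P t f \<in> Lp 2 m"
 using semigroup unfolding is_semigroup_of_def linear_L2_def by blast

lemma P_linear: "0 \<le> t \<Longrightarrow> f \<in> Lp 2 m \<Longrightarrow> g \<in> Lp 2 m \<Longrightarrow>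
  AE x in m. P t (\<lambda>x. a * f x + b * g x) x = a * P t f x + b * P t g x"
 using semigroup unfolding is_semigroup_of_def linear_L2_def by blast

lemma P_bounded:
 assumes "0 \<le> t"
 obtains K where "0 < K" "\<And>f. f \<in> Lp 2 m \<Longrightarrow> norm_L2 m (P t f) \<le> K * norm_L2 m f"
proof -
 have "\<forall>t\<ge>0. \<exists>K. \<forall>f\<in>Lp 2 m. norm_L2 m (P t f) \<le> K * norm_L2 m f"
  using semigroup unfolding is_semigroup_of_def by blast
 then obtain K where K: "\<And>f. f \<in> Lp 2 m \<Longrightarrow> norm_L2 m (P t f) \<le> K * norm_L2 m f" using assms by blast
 have "norm_L2 m (P t f) \<le> (\<bar>K\<bar> + 1) * norm_L2 m f" if "f \<in> Lp 2 m" for f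
 proof -
  have "K * norm_L2 m f \<le> (\<bar>K\<bar> + 1) * norm_L2 m f" by (intro mult_right_mono norm_L2_nonneg) simp
  then show ?thesis using K[OF that] by linarith
 qed
 then show ?thesis by (intro that[of "\<bar>K\<bar> + 1"]) auto
qed

lemma P_zero: "f \<in> Lp 2 m \<Longrightarrow> AE x in m. P 0 f x = f x"
 using semigroup unfolding is_semigroup_of_def by blast

lemma P_add: "0 \<le> s \<Longrightarrow> 0 \<le> t \<Longrightarrow> f \<in> Lp 2 m \<Longrightarrow> AE x in m. P (s + t) f x = P s (P t f) x"
 using semigroup unfolding is_semigroup_of_def by blast

lemma P_continuous: "f \<in> Lp 2 m \<Longrightarrow> ((\<lambda>t. norm_L2 m (\<lambda>x. P t f x - f x)) \<longlongrightarrow> 0) (at_right 0)"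
 using semigroup unfolding is_semigroup_of_def by blast

lemma G_iff: "(f, g) \<in> G \<longleftrightarrow> f \<in> Lp 2 m \<and> g \<in> Lp 2 m \<and>
  ((\<lambda>t. norm_L2 m (\<lambda>x. (P t f x - f x) / t - g x)) \<longlongrightarrow> 0) (at_right 0)"
proof -
 have "G = {(f, g). f \<in> Lp 2 m \<and> g \<in> Lp 2 m \<and>
      ((\<lambda>t. norm_L2 m (\<lambda>x. (P t f x - f x) / t - g x)) \<longlongrightarrow> 0) (at_right 0)}"
  using semigroup unfolding is_semigroup_of_def by (elim conjE)
 then show ?thesis by simp
qed

lemma P_diff_norm:
 assumes "0 \<le> t" "f \<in> Lp 2 m" "g \<in> Lp 2 m"
 shows "norm_L2 m (\<lambda>x. P t f x - P t g x) = norm_L2 m (P t (\<lambda>x. f x - g x))"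
proof (rule norm_L2_cong_AE)
 show "AE x in m. P t f x - P t g x = P t (\<lambda>x. f x - g x) x"
  using P_linear[OF assms, of 1 "-1"] by (simp add: eq_commute[of "P t f _ - P t g _"])
qed (intro Lp2_measurable Lp2_diff P_L2 assms)+

lemma P_cong:
 assumes "0 \<le> t" "f \<in> Lp 2 m" "g \<in> Lp 2 m" "AE x in m. f x = g x"
 shows "AE x in m. P t f x = P t g x"
proof -
 obtain K where K: "0 < K" "\<And>f. f \<in> Lp 2 m \<Longrightarrow> norm_L2 m (P t f) \<le> K * norm_L2 m f"
  by (rule P_bounded[OF assms(1)]) (rule that)
 have d: "(\<lambda>x. f x - g x) \<in> Lp 2 m" by (rule Lp2_diff[OF assms(2,3)])
 have "norm_L2 m (\<lambda>x. f x - g x) = norm_L2 m (\<lambda>x. 0)"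
  using assms by (intro norm_L2_cong_AE) (auto intro: Lp2_measurable[OF d] elim: eventually_mono)
 then have "norm_L2 m (\<lambda>x. f x - g x) = 0" by (simp add: norm_L2_eq)
 then have "norm_L2 m (\<lambda>x. P t f x - P t g x) = 0"
  using P_diff_norm[OF assms(1-3)] K(2)[OF d] norm_L2_nonneg[of m "P t (\<lambda>x. f x - g x)"] by simp
 then have "AE x in m. P t f x - P t g x = 0"
  by (rule norm_L2_eq_0[rotated]) (intro Lp2_diff P_L2 assms)
 then show ?thesis by (rule eventually_mono) simp
qed

text \<open>Extended by 0 to \<open>t \<le> 0\<close>, so that it is a Borel function on the whole line.\<close>

definition pk :: "real \<Rightarrow> 'a \<Rightarrow> 'a \<Rightarrow> real" where "pk t x y = (if 0 < t then p t x y else 0)"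

lemma p_continuous: "continuous_on ({0<..} \<times> UNIV) (\<lambda>(t, x, y). p t x y)"
 using heat_kernel by (simp add: is_heat_kernel_def)

lemma pk_measurable: "(\<lambda>(t, x, y). pk t x y) \<in> borel_measurable borel"
proof -
 have "(\<lambda>z. if z \<in> {0<..} \<times> UNIV then (\<lambda>(t, x, y). p t x y) z else 0) \<in> borel_measurable borel"
  by (rule borel_measurable_continuous_on_if[OF _ p_continuous continuous_on_const])
   (intro borel_open open_Times open_greaterThan open_UNIV)
 moreover have "(\<lambda>z. if z \<in> {0<..} \<times> UNIV then (\<lambda>(t, x, y). p t x y) z else 0) = (\<lambda>(t, x, y). pk t x y)"
  by (auto simp: pk_def fun_eq_iff)
 ultimately show ?thesis by simp
qed

text \<open>The version of \<open>P t g\<close> given by the kernel. For different \<open>t\<close>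
  the functions \<open>P t g\<close> are chosen independently on null sets, whereas this version is
  jointly measurable in time and space, as Fubini's theorem requires.\<close>

definition U :: "('a \<Rightarrow> real) \<Rightarrow> real \<Rightarrow> 'a \<Rightarrow> real" where
 "U g t x = (\<integral>y. pk t x y * g y \<partial>m)"

lemma sets_prod_m: "sets (borel \<Otimes>\<^sub>M m) = sets (borel \<Otimes>\<^sub>M (borel :: 'a measure))" "sets (m \<Otimes>\<^sub>M borel) = sets ((borel :: 'a measure) \<Otimes>\<^sub>M borel)"
 by (rule sets_pair_measure_cong[OF refl sets_m], rule sets_pair_measure_cong[OF sets_m refl])

lemma pk_measurable_pair: "(\<lambda>q. pk (fst (fst q)) (snd (fst q)) (snd q)) \<in> borel_measurable ((borel \<Otimes>\<^sub>M borel) \<Otimes>\<^sub>M m)"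
proof -
 have "(\<lambda>q. (\<lambda>(t, x, y). pk t x y) (fst (fst q), snd (fst q), snd q)) \<in> borel_measurable ((borel \<Otimes>\<^sub>M borel) \<Otimes>\<^sub>M (borel :: 'a measure))"
  by (rule measurable_compose[OF _ pk_measurable]) (simp add: borel_prod[symmetric])
 then have "(\<lambda>q. pk (fst (fst q)) (snd (fst q)) (snd q)) \<in> borel_measurable ((borel \<Otimes>\<^sub>M borel) \<Otimes>\<^sub>M (borel :: 'a measure))"
  by simp
 then show ?thesis
  by (subst measurable_cong_sets[OF sets_pair_measure_cong[OF refl sets_m] refl])
qed

lemma U_measurable:
 assumes "g \<in> borel_measurable m"
 shows "(\<lambda>(t, x). U g t x) \<in> borel_measurable (borel \<Otimes>\<^sub>M borel)"
proof -
 have "(\<lambda>q. \<integral>y. pk (fst q) (snd q) y * g y \<partial>m) \<in> borel_measurable (borel \<Otimes>\<^sub>M borel)"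
 proof (rule M.borel_measurable_lebesgue_integral)
  have "(\<lambda>z. g (snd z)) \<in> borel_measurable ((borel \<Otimes>\<^sub>M borel) \<Otimes>\<^sub>M m)"
   by (rule measurable_compose[OF measurable_snd assms])
  from borel_measurable_times[OF pk_measurable_pair this]
  show "(\<lambda>(q, y). pk (fst q) (snd q) y * g y) \<in> borel_measurable ((borel \<Otimes>\<^sub>M borel) \<Otimes>\<^sub>M m)"
   by (simp add: case_prod_beta)
 qed
 then show ?thesis by (simp add: U_def case_prod_beta)
qed

lemma U_measurable_swap:
 assumes "g \<in> borel_measurable m"
 shows "(\<lambda>(x, t). U g t x) \<in> borel_measurable (m \<Otimes>\<^sub>M borel)"
proof -
 have "(\<lambda>(x, t). U g t x) \<in> borel_measurable ((borel :: 'a measure) \<Otimes>\<^sub>M borel)"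
  using measurable_pair_swap[OF U_measurable[OF assms]] by (simp add: case_prod_beta)
 then show ?thesis by (subst measurable_cong_sets[OF sets_prod_m(2) refl])
qed

lemma U_measurable1:
 assumes "g \<in> borel_measurable m"
 shows "U g t \<in> borel_measurable m"
proof -
 have "t \<in> space borel" by simp
 from measurable_compose[OF measurable_Pair1'[OF this] U_measurable[OF assms]]
 have "U g t \<in> borel_measurable borel" by simp
 then show ?thesis by (subst measurable_cong_sets[OF sets_m refl])
qed

lemma P_eq_U:
 assumes "0 < t" "g \<in> Lp 2 m"
 shows "AE x in m. P t g x = U g t x" "AE x in m. integrable m (\<lambda>y. p t x y * g y)"
 using heat_kernel assms unfolding is_heat_kernel_def U_def pk_def by (auto elim: eventually_mono)

lemma U_L2:
 assumes "0 < t" "g \<in> Lp 2 m"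
 shows "U g t \<in> Lp 2 m" "norm_L2 m (U g t) = norm_L2 m (P t g)"
proof -
 have PL: "P t g \<in> Lp 2 m" using assms by (intro P_L2) auto
 have Um: "U g t \<in> borel_measurable m" by (rule U_measurable1[OF Lp2_measurable[OF assms(2)]])
 show "U g t \<in> Lp 2 m" by (rule Lp2_cong_AE[OF PL Um P_eq_U(1)[OF assms]])
 show "norm_L2 m (U g t) = norm_L2 m (P t g)"
  by (rule norm_L2_cong_AE[symmetric, OF Lp2_measurable[OF PL] Um P_eq_U(1)[OF assms]])
qed

lemma U_diff_norm:
 assumes "0 < s" "0 < t" "g \<in> Lp 2 m"
 shows "norm_L2 m (\<lambda>x. U g s x - U g t x) = norm_L2 m (\<lambda>x. P s g x - P t g x)"
proof (rule norm_L2_cong_AE)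
 show "AE x in m. U g s x - U g t x = P s g x - P t g x"
  using P_eq_U(1)[OF assms(1,3)] P_eq_U(1)[OF assms(2,3)] by eventually_elim simp
qed (use assms in \<open>intro Lp2_measurable Lp2_diff U_L2 P_L2; simp\<close>)+

lemma P_right_continuous:
 assumes "0 \<le> t" "g \<in> Lp 2 m" "0 < \<epsilon>"
 obtains \<delta> where "0 < \<delta>" "\<And>h. 0 < h \<Longrightarrow> h < \<delta> \<Longrightarrow> norm_L2 m (\<lambda>x. P (t + h) g x - P t g x) < \<epsilon>"
proof -
 obtain K where K: "0 < K" "\<And>f. f \<in> Lp 2 m \<Longrightarrow> norm_L2 m (P t f) \<le> K * norm_L2 m f"
  by (rule P_bounded[OF assms(1)]) (rule that)
 have "\<epsilon> / K > 0" using assms(3) K by simp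
 from order_tendstoD(2)[OF P_continuous[OF assms(2)] this]
 obtain \<delta> where \<delta>: "\<delta> > 0" "\<And>h. 0 < h \<Longrightarrow> h < \<delta> \<Longrightarrow> norm_L2 m (\<lambda>x. P h g x - g x) < \<epsilon> / K"
  unfolding eventually_at_right_field by auto
 show ?thesis
 proof (rule that[OF \<delta>(1)])
  fix h assume h: "0 < h" "h < \<delta>"
  have Ph: "P h g \<in> Lp 2 m" using h assms by (intro P_L2) auto
  have "norm_L2 m (\<lambda>x. P (t + h) g x - P t g x) = norm_L2 m (\<lambda>x. P t (P h g) x - P t g x)"
  proof (rule norm_L2_cong_AE)
   show "AE x in m. P (t + h) g x - P t g x = P t (P h g) x - P t g x"
    using P_add[of t h g] h assms by (auto elim: eventually_mono)
  qed (use Ph assms h in \<open>intro Lp2_measurable Lp2_diff P_L2; simp\<close>)+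
  also have "\<dots> = norm_L2 m (P t (\<lambda>x. P h g x - g x))" by (rule P_diff_norm[OF assms(1) Ph assms(2)])
  also have "\<dots> \<le> K * norm_L2 m (\<lambda>x. P h g x - g x)" by (rule K(2)[OF Lp2_diff[OF Ph assms(2)]])
  also have "\<dots> < \<epsilon>" using \<delta>(2)[OF h] K(1) by (simp add: field_simps)
  finally show "norm_L2 m (\<lambda>x. P (t + h) g x - P t g x) < \<epsilon>" .
 qed
qed

lemma U_path_measurable:
 assumes "g \<in> borel_measurable m"
 shows "(\<lambda>s. U g s x) \<in> borel_measurable borel"
proof -
 have "x \<in> space borel" by simp
 from measurable_compose[OF measurable_Pair2'[OF this] U_measurable[OF assms]]
 show ?thesis by simp
qed

lemma pk_measurable2: "pk t x \<in> borel_measurable m"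
proof -
 have "(\<lambda>y. (\<lambda>(t, x, y). pk t x y) (t, x, y)) \<in> borel_measurable (borel :: 'a measure)"
  by (rule measurable_compose[OF _ pk_measurable]) (simp add: borel_prod[symmetric])
 then show ?thesis by (subst measurable_cong_sets[OF sets_m refl]) simp
qed

lemma U_time_average:
 assumes g: "g \<in> Lp 2 m" and ab: "0 < a" "a \<le> b"
  and B: "\<And>s. a < s \<Longrightarrow> s \<le> b \<Longrightarrow> (norm_L2 m (U g s))\<^sup>2 \<le> B"
 shows "AE x in m. integrable (leb_on a b) (\<lambda>s. U g s x)"
  "(\<lambda>x. \<integral>s. U g s x \<partial>leb_on a b) \<in> Lp 2 m"
  "(norm_L2 m (\<lambda>x. \<integral>s. U g s x \<partial>leb_on a b))\<^sup>2 \<le> (b - a)\<^sup>2 * B"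
  "(\<lambda>x. \<integral>s. \<bar>U g s x\<bar> \<partial>leb_on a b) \<in> Lp 2 m"
proof -
 have m1: "case_prod (\<lambda>x s. U g s x) \<in> borel_measurable (m \<Otimes>\<^sub>M borel)"
  by (rule U_measurable_swap[OF Lp2_measurable[OF g]])
 have L2: "(\<lambda>x. U g s x) \<in> Lp 2 m \<and> (norm_L2 m (\<lambda>x. U g s x))\<^sup>2 \<le> B" if "a < s" "s \<le> b" for s
  using U_L2(1)[of s g] B[OF that] that ab g by simp
 note T = time_average_L2[OF sigma_finite_m m1 ab(2) L2]
 show "AE x in m. integrable (leb_on a b) (\<lambda>s. U g s x)" by (rule T(2))
 show "(\<lambda>x. \<integral>s. U g s x \<partial>leb_on a b) \<in> Lp 2 m" by (rule T(3))
 show "(norm_L2 m (\<lambda>x. \<integral>s. U g s x \<partial>leb_on a b))\<^sup>2 \<le> (b - a)\<^sup>2 * B" by (rule T(4))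
 have m2: "case_prod (\<lambda>x s. \<bar>U g s x\<bar>) \<in> borel_measurable (m \<Otimes>\<^sub>M borel)"
  using borel_measurable_abs[OF m1] by (simp add: case_prod_beta)
 have L2': "(\<lambda>x. \<bar>U g s x\<bar>) \<in> Lp 2 m \<and> (norm_L2 m (\<lambda>x. \<bar>U g s x\<bar>))\<^sup>2 \<le> B" if "a < s" "s \<le> b" for s
  using L2[OF that] by (auto simp: Lp2_iff norm_L2_sqr)
 show "(\<lambda>x. \<integral>s. \<bar>U g s x\<bar> \<partial>leb_on a b) \<in> Lp 2 m"
  by (rule time_average_L2(3)[OF sigma_finite_m m2 ab(2) L2'])
qed

lemma U_U:
 assumes "0 < s" "0 < h" "g \<in> Lp 2 m"
 shows "AE x in m. U (U g s) h x = U g (s + h) x"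
proof -
 have PL: "P s g \<in> Lp 2 m" using assms by (intro P_L2) auto
 have "AE x in m. P h (U g s) x = P h (P s g) x"
  by (rule P_cong) (use U_L2(1)[OF assms(1,3)] PL P_eq_U(1)[OF assms(1,3)] assms in \<open>auto elim: eventually_mono\<close>)
 moreover have "AE x in m. P (h + s) g x = P h (P s g) x" using assms by (intro P_add) auto
 moreover have "0 < h + s" using assms by simp
 note P_eq_U(1)[OF this assms(3)]
 ultimately show ?thesis using P_eq_U(1)[OF assms(2) U_L2(1)[OF assms(1,3)]]
  by eventually_elim (simp add: add.commute)
qed

text \<open>Fubini's theorem moves \<open>P h\<close> under the time integral. It applies because
  the time integral of \<open>\<bar>U g s\<bar>\<close> is again in L^2, and at almost every
  \<open>x\<close> the kernel is integrable against any given L^2 function.\<close>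

lemma P_time_integral:
 assumes g: "g \<in> Lp 2 m" and ab: "0 < a" "a \<le> b" and h: "0 < h"
  and B: "\<And>s. a < s \<Longrightarrow> s \<le> b \<Longrightarrow> (norm_L2 m (U g s))\<^sup>2 \<le> B"
 shows "AE x in m. P h (\<lambda>x. \<integral>s. U g s x \<partial>leb_on a b) x = (\<integral>s. U g s x \<partial>leb_on (a + h) (b + h))"
  "AE x in m. integrable (leb_on (a + h) (b + h)) (\<lambda>s. U g s x)"
proof -
 let ?T = "leb_on a b"
 interpret T: finite_measure ?T by (rule finite_leb_on[OF ab(2)])
 interpret pair_sigma_finite m ?T ..
 have A: "AE x in m. integrable ?T (\<lambda>s. U g s x)" "(\<lambda>x. \<integral>s. U g s x \<partial>?T) \<in> Lp 2 m"
  "(\<lambda>x. \<integral>s. \<bar>U g s x\<bar> \<partial>?T) \<in> Lp 2 m"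
  by (rule U_time_average(1,2,4)[OF g ab B]; assumption)+
 have gm: "g \<in> borel_measurable m" by (rule Lp2_measurable[OF g])
 define I where "I = (\<lambda>x. \<integral>s. U g s x \<partial>?T)"
 define Fb where "Fb = (\<lambda>x. \<integral>s. \<bar>U g s x\<bar> \<partial>?T)"
 have IL: "I \<in> Lp 2 m" "Fb \<in> Lp 2 m" using A(2,3) by (simp_all add: I_def Fb_def)
 have sT: "sets (m \<Otimes>\<^sub>M ?T) = sets (m \<Otimes>\<^sub>M borel)" by (rule sets_pair_measure_cong[OF refl sets_leb_on])
 have Um: "(\<lambda>(y, s). U g s y) \<in> borel_measurable (m \<Otimes>\<^sub>M ?T)"
  by (subst measurable_cong_sets[OF sT refl]) (rule U_measurable_swap[OF gm])
 have fub: "integrable ?T (\<lambda>s. \<integral>y. pk h x y * U g s y \<partial>m) \<and>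
   (\<integral>y. pk h x y * I y \<partial>m) = (\<integral>s. (\<integral>y. pk h x y * U g s y \<partial>m) \<partial>?T)"
  if x: "integrable m (\<lambda>y. p h x y * Fb y)" for x
 proof -
  have m1: "(\<lambda>(y, s). pk h x y * U g s y) \<in> borel_measurable (m \<Otimes>\<^sub>M ?T)"
   using borel_measurable_times[OF measurable_compose[OF measurable_fst pk_measurable2[of h x]] Um]
   by (simp add: case_prod_beta)
  have int: "integrable (m \<Otimes>\<^sub>M ?T) (\<lambda>(y, s). pk h x y * U g s y)"
  proof (rule Fubini_integrable[OF m1])
   have "integrable m (\<lambda>y. \<bar>p h x y * Fb y\<bar>)" using x by (rule integrable_abs)
   moreover have "\<bar>p h x y * Fb y\<bar> = (\<integral>s. norm ((\<lambda>(y, s). pk h x y * U g s y) (y, s)) \<partial>?T)" for y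
   proof -
    have "0 \<le> Fb y" unfolding Fb_def by (simp add: integral_nonneg_AE)
    then show ?thesis using h by (simp add: abs_mult pk_def Fb_def)
   qed
   ultimately show "integrable m (\<lambda>y. \<integral>s. norm ((\<lambda>(y, s). pk h x y * U g s y) (y, s)) \<partial>?T)" by simp
   show "AE y in m. integrable ?T (\<lambda>s. (\<lambda>(y, s). pk h x y * U g s y) (y, s))"
    using A(1) by eventually_elim simp
  qed
  show ?thesis
  proof
   show "integrable ?T (\<lambda>s. \<integral>y. pk h x y * U g s y \<partial>m)" by (rule integrable_snd[OF int])
   have "(\<integral>y. pk h x y * I y \<partial>m) = (\<integral>y. (\<integral>s. pk h x y * U g s y \<partial>?T) \<partial>m)" by (simp add: I_def)
   also have "\<dots> = (\<integral>s. (\<integral>y. pk h x y * U g s y \<partial>m) \<partial>?T)" by (rule Fubini_integral[OF int, symmetric])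
   finally show "(\<integral>y. pk h x y * I y \<partial>m) = (\<integral>s. (\<integral>y. pk h x y * U g s y \<partial>m) \<partial>?T)" .
  qed
 qed
 \<comment> \<open>The semigroup law holds for each \<open>s\<close> off a null set that depends on
   \<open>s\<close>; joint measurability exchanges the two quantifiers.\<close>
 have swap: "AE x in m. AE s in ?T. U (U g s) h x = U g (s + h) x"
 proof (subst AE_commute)
  have m1: "(\<lambda>q. U (U g (snd q)) h (fst q)) \<in> borel_measurable (m \<Otimes>\<^sub>M ?T)"
   unfolding U_def[of "U g _"]
  proof (rule M.borel_measurable_lebesgue_integral)
   have "(\<lambda>q. pk (fst (fst (((h, fst (fst q)), snd q)))) (snd (fst (((h, fst (fst q)), snd q)))) (snd ((h, fst (fst q)), snd q))) \<in> borel_measurable ((m \<Otimes>\<^sub>M ?T) \<Otimes>\<^sub>M m)"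
   proof (rule measurable_compose[OF _ pk_measurable_pair])
    have "(\<lambda>z. z) \<in> measurable m borel" by (rule measurable_ident_sets[OF sets_m])
    then have "(\<lambda>q. fst (fst q)) \<in> measurable ((m \<Otimes>\<^sub>M ?T) \<Otimes>\<^sub>M m) borel"
     by (intro measurable_compose[OF _ \<open>(\<lambda>z. z) \<in> measurable m borel\<close>] measurable_compose[OF measurable_fst measurable_fst])
    then show "(\<lambda>q. ((h, fst (fst q)), snd q)) \<in> measurable ((m \<Otimes>\<^sub>M ?T) \<Otimes>\<^sub>M m) ((borel \<Otimes>\<^sub>M borel) \<Otimes>\<^sub>M m)"
     by (intro measurable_Pair measurable_const measurable_snd) simp_all
   qed
   moreover have "(\<lambda>q. U g (snd (fst q)) (snd q)) \<in> borel_measurable ((m \<Otimes>\<^sub>M ?T) \<Otimes>\<^sub>M m)"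
   proof -
    have "(\<lambda>q. (\<lambda>(x, t). U g t x) (snd q, snd (fst q))) \<in> borel_measurable ((m \<Otimes>\<^sub>M ?T) \<Otimes>\<^sub>M m)"
    proof (rule measurable_compose[OF _ U_measurable_swap[OF gm]])
     have "(\<lambda>q. snd (fst q)) \<in> measurable ((m \<Otimes>\<^sub>M ?T) \<Otimes>\<^sub>M m) ?T"
      by (rule measurable_compose[OF measurable_fst measurable_snd])
     then have "(\<lambda>q. snd (fst q)) \<in> measurable ((m \<Otimes>\<^sub>M ?T) \<Otimes>\<^sub>M m) borel"
      by (subst (asm) measurable_cong_sets[OF refl sets_leb_on])
     then show "(\<lambda>q. (snd q, snd (fst q))) \<in> measurable ((m \<Otimes>\<^sub>M ?T) \<Otimes>\<^sub>M m) (m \<Otimes>\<^sub>M borel)"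
      by (intro measurable_Pair measurable_snd)
    qed
    then show ?thesis by simp
   qed
   ultimately have "(\<lambda>q. pk h (fst (fst q)) (snd q) * U g (snd (fst q)) (snd q)) \<in> borel_measurable ((m \<Otimes>\<^sub>M ?T) \<Otimes>\<^sub>M m)"
    by simp
   then show "(\<lambda>(q, y). pk h (fst q) y * U g (snd q) y) \<in> borel_measurable ((m \<Otimes>\<^sub>M ?T) \<Otimes>\<^sub>M m)"
    by (simp add: case_prod_beta)
  qed
  have m2: "(\<lambda>q. U g (snd q + h) (fst q)) \<in> borel_measurable (m \<Otimes>\<^sub>M ?T)"
  proof -
   have "(\<lambda>q. (\<lambda>(x, t). U g t x) (fst q, snd q + h)) \<in> borel_measurable (m \<Otimes>\<^sub>M ?T)"
   proof (rule measurable_compose[OF _ U_measurable_swap[OF gm]])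
    have "(\<lambda>q. snd q) \<in> measurable (m \<Otimes>\<^sub>M ?T) borel"
     by (subst measurable_cong_sets[OF sT refl]) (rule measurable_snd)
    then have "(\<lambda>q. snd q + h) \<in> measurable (m \<Otimes>\<^sub>M ?T) borel" by measurable
    then show "(\<lambda>q. (fst q, snd q + h)) \<in> measurable (m \<Otimes>\<^sub>M ?T) (m \<Otimes>\<^sub>M borel)"
     by (intro measurable_Pair measurable_fst)
   qed
   then show ?thesis by simp
  qed
  show "{q \<in> space (m \<Otimes>\<^sub>M ?T). U (U g (snd q)) h (fst q) = U g (snd q + h) (fst q)} \<in> sets (m \<Otimes>\<^sub>M ?T)"
   using m1 m2 by measurable
  show "AE s in ?T. AE x in m. U (U g s) h x = U g (s + h) x"
   using AE_leb_on by eventually_elim (use U_U[OF _ h g] ab in auto)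
 qed
 have main: "AE x in m. P h I x = (\<integral>s. U g s x \<partial>leb_on (a + h) (b + h)) \<and>
   integrable (leb_on (a + h) (b + h)) (\<lambda>s. U g s x)"
  using swap P_eq_U(2)[OF h IL(2)] P_eq_U(1)[OF h IL(1)]
 proof eventually_elim
  case (elim x)
  note f = fub[OF elim(2)]
  have pm: "(\<lambda>s. U g (s + h) x) \<in> borel_measurable borel"
   using U_path_measurable[OF gm, of x] by measurable
  have pm2: "(\<lambda>s. \<integral>y. pk h x y * U g s y \<partial>m) \<in> borel_measurable ?T"
   using borel_measurable_integrable[OF conjunct1[OF f]] .
  have ae: "AE s in ?T. (\<integral>y. pk h x y * U g s y \<partial>m) = U g (s + h) x"
   using elim(1) by (simp add: U_def[of "U g _"])
  have pmT: "(\<lambda>s. U g (s + h) x) \<in> borel_measurable ?T"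
   by (subst measurable_cong_sets[OF sets_leb_on refl]) (rule pm)
  have i1: "integrable ?T (\<lambda>s. U g (s + h) x)"
   using conjunct1[OF f] integrable_cong_AE[OF pm2 pmT ae] by simp
  have "P h I x = (\<integral>y. pk h x y * I y \<partial>m)" using elim(3) by (simp add: U_def)
  also have "\<dots> = (\<integral>s. (\<integral>y. pk h x y * U g s y \<partial>m) \<partial>?T)" by (rule conjunct2[OF f])
  also have "\<dots> = (\<integral>s. U g (s + h) x \<partial>?T)" by (rule integral_cong_AE[OF pm2 pmT ae])
  also have "\<dots> = (\<integral>s. U g s x \<partial>leb_on (a + h) (b + h))"
   by (rule leb_on_shift(1)[OF U_path_measurable[OF gm]])
  finally show ?case using i1 leb_on_shift(2)[OF U_path_measurable[OF gm, of x], of a b h] by simp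
 qed
 show "AE x in m. P h (\<lambda>x. \<integral>s. U g s x \<partial>leb_on a b) x = (\<integral>s. U g s x \<partial>leb_on (a + h) (b + h))"
  "AE x in m. integrable (leb_on (a + h) (b + h)) (\<lambda>s. U g s x)"
  using main unfolding I_def[symmetric] by (auto elim: eventually_mono)
qed

section \<open>Time averages in the domain of the generator\<close>

definition avg :: "('a \<Rightarrow> real) \<Rightarrow> real \<Rightarrow> real \<Rightarrow> 'a \<Rightarrow> real" where
 "avg g a b x = 1 / (b - a) * (\<integral>s. U g s x \<partial>leb_on a b)"

lemma avg_L2:
 assumes g: "g \<in> Lp 2 m" and ab: "0 < a" "a < b"
  and B: "\<And>s. a < s \<Longrightarrow> s \<le> b \<Longrightarrow> (norm_L2 m (U g s))\<^sup>2 \<le> B"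
 shows "avg g a b \<in> Lp 2 m" "(norm_L2 m (avg g a b))\<^sup>2 \<le> B"
proof -
 note A = U_time_average[OF g ab(1) less_imp_le[OF ab(2)] B]
 show "avg g a b \<in> Lp 2 m" unfolding avg_def using Lp2_scale[OF A(2)] .
 have "(norm_L2 m (avg g a b))\<^sup>2 = (1 / (b - a))\<^sup>2 * (norm_L2 m (\<lambda>x. \<integral>s. U g s x \<partial>leb_on a b))\<^sup>2"
  unfolding avg_def norm_L2_scale by (simp add: power_mult_distrib power_divide)
 also have "\<dots> \<le> (1 / (b - a))\<^sup>2 * ((b - a)\<^sup>2 * B)" by (intro mult_left_mono A(3) zero_le_power2; assumption)
 also have "\<dots> = B" using ab by (simp add: power_divide)
 finally show "(norm_L2 m (avg g a b))\<^sup>2 \<le> B" .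
qed

lemma U_minus_average:
 assumes g: "g \<in> Lp 2 m" and v: "v \<in> Lp 2 m" and ab: "0 < a" "a \<le> b" and \<epsilon>: "0 \<le> \<epsilon>"
  and le: "\<And>s. a < s \<Longrightarrow> s \<le> b \<Longrightarrow> norm_L2 m (\<lambda>x. U g s x - v x) \<le> \<epsilon>"
 shows "AE x in m. integrable (leb_on a b) (\<lambda>s. U g s x - v x)"
  "(\<lambda>x. \<integral>s. U g s x - v x \<partial>leb_on a b) \<in> Lp 2 m"
  "norm_L2 m (\<lambda>x. \<integral>s. U g s x - v x \<partial>leb_on a b) \<le> (b - a) * \<epsilon>"
proof -
 have "(\<lambda>q. v (fst q)) \<in> borel_measurable (m \<Otimes>\<^sub>M borel)"
  by (rule measurable_compose[OF measurable_fst Lp2_measurable[OF v]])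
 from borel_measurable_diff[OF U_measurable_swap[OF Lp2_measurable[OF g]] this]
 have m1: "case_prod (\<lambda>x s. U g s x - v x) \<in> borel_measurable (m \<Otimes>\<^sub>M borel)"
  by (simp add: case_prod_beta)
 have L2: "(\<lambda>x. U g s x - v x) \<in> Lp 2 m \<and> (norm_L2 m (\<lambda>x. U g s x - v x))\<^sup>2 \<le> \<epsilon>\<^sup>2" if s: "a < s" "s \<le> b" for s
 proof
  show "(\<lambda>x. U g s x - v x) \<in> Lp 2 m" using s ab g v by (intro Lp2_diff U_L2(1)) auto
  show "(norm_L2 m (\<lambda>x. U g s x - v x))\<^sup>2 \<le> \<epsilon>\<^sup>2" by (rule power_mono[OF le[OF s] norm_L2_nonneg])
 qed
 show "AE x in m. integrable (leb_on a b) (\<lambda>s. U g s x - v x)"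
  "(\<lambda>x. \<integral>s. U g s x - v x \<partial>leb_on a b) \<in> Lp 2 m"
  by (rule time_average_L2(2,3)[OF sigma_finite_m m1 ab(2) L2]; assumption)+
 have "(norm_L2 m (\<lambda>x. \<integral>s. U g s x - v x \<partial>leb_on a b))\<^sup>2 \<le> (b - a)\<^sup>2 * \<epsilon>\<^sup>2"
  by (rule time_average_L2(4)[OF sigma_finite_m m1 ab(2) L2]; assumption)
 then show "norm_L2 m (\<lambda>x. \<integral>s. U g s x - v x \<partial>leb_on a b) \<le> (b - a) * \<epsilon>"
  unfolding power_mult_distrib[symmetric] by (rule power2_le_imp_le) (use ab \<epsilon> in simp)
qed

text \<open>Applying \<open>P h\<close> shifts the interval of integration by \<open>h\<close>. In
  the difference the common part cancels, leaving integrals over ]b, b + h] and ]a, a + h]; divided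
  by \<open>h\<close> they converge to the values at \<open>b\<close> and \<open>a\<close> by right
  strong continuity.\<close>

lemma avg_in_domain:
 assumes g: "g \<in> Lp 2 m" and ab: "0 < a" "a < b"
  and B: "\<And>s. a < s \<Longrightarrow> s \<le> b \<Longrightarrow> (norm_L2 m (U g s))\<^sup>2 \<le> B"
 shows "(avg g a b, \<lambda>x. (U g b x - U g a x) / (b - a)) \<in> G"
proof -
 let ?k = "\<lambda>x. (U g b x - U g a x) / (b - a)"
 have b: "0 < b" using ab by simp
 have gm: "g \<in> borel_measurable m" by (rule Lp2_measurable[OF g])
 have Ua: "U g a \<in> Lp 2 m" and Ub: "U g b \<in> Lp 2 m" using U_L2(1) ab b g by auto
 have kL: "?k \<in> Lp 2 m" using Lp2_scale[OF Lp2_diff[OF Ub Ua], of "1 / (b - a)"] by simp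
 have AL: "avg g a b \<in> Lp 2 m" by (rule avg_L2(1)[OF g ab B])
 have TA: "AE x in m. integrable (leb_on a b) (\<lambda>s. U g s x)" "(\<lambda>x. \<integral>s. U g s x \<partial>leb_on a b) \<in> Lp 2 m"
  by (rule U_time_average(1,2)[OF g ab(1) less_imp_le[OF ab(2)] B]; assumption)+
 have near: "\<exists>\<delta>>0. \<forall>s. c < s \<and> s < c + \<delta> \<longrightarrow> norm_L2 m (\<lambda>x. U g s x - U g c x) < \<epsilon>" if c: "0 < c" "0 < \<epsilon>" for c \<epsilon>
 proof -
  obtain \<delta> where \<delta>: "0 < \<delta>" "\<And>h. 0 < h \<Longrightarrow> h < \<delta> \<Longrightarrow> norm_L2 m (\<lambda>x. P (c + h) g x - P c g x) < \<epsilon>"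
   by (rule P_right_continuous[OF less_imp_le[OF c(1)] g c(2)]) (rule that)
  show ?thesis
  proof (intro exI[of _ \<delta>] conjI \<delta>(1) allI impI)
   fix s assume s: "c < s \<and> s < c + \<delta>"
   have "norm_L2 m (\<lambda>x. P (c + (s - c)) g x - P c g x) < \<epsilon>" by (rule \<delta>(2)) (use s in auto)
   then show "norm_L2 m (\<lambda>x. U g s x - U g c x) < \<epsilon>" using U_diff_norm[of s c g] s c g by simp
  qed
 qed
 have "((\<lambda>t. norm_L2 m (\<lambda>x. (P t (avg g a b) x - avg g a b x) / t - ?k x)) \<longlongrightarrow> 0) (at_right 0)"
 proof (rule tendstoI)
  fix \<epsilon> :: real assume \<epsilon>: "0 < \<epsilon>"
  define q where "q = \<epsilon> * (b - a) / 3"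
  have q: "0 < q" using \<epsilon> ab by (simp add: q_def)
  obtain \<delta>a where \<delta>a: "\<delta>a > 0" "\<And>s. a < s \<Longrightarrow> s < a + \<delta>a \<Longrightarrow> norm_L2 m (\<lambda>x. U g s x - U g a x) < q"
   using near[OF ab(1) q] by blast
  obtain \<delta>b where \<delta>b: "\<delta>b > 0" "\<And>s. b < s \<Longrightarrow> s < b + \<delta>b \<Longrightarrow> norm_L2 m (\<lambda>x. U g s x - U g b x) < q"
   using near[OF b q] by blast
  \<comment> \<open>\<open>h < b - a\<close> makes the shifted interval overlap the original one, so
    that there is a common part to cancel.\<close>
  define D where "D = min (b - a) (min \<delta>a \<delta>b)"
  have D: "0 < D" using ab \<delta>a \<delta>b by (simp add: D_def)
  have main: "norm_L2 m (\<lambda>x. (P h (avg g a b) x - avg g a b x) / h - ?k x) < \<epsilon>" if h: "0 < h" "h < D" for h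
  proof -
   have hh: "h < b - a" "h < \<delta>a" "h < \<delta>b" using h by (auto simp: D_def)
   have ca: "norm_L2 m (\<lambda>x. U g s x - U g a x) \<le> q" if "a < s" "s \<le> a + h" for s
    using \<delta>a(2)[of s] that hh by simp
   have cb: "norm_L2 m (\<lambda>x. U g s x - U g b x) \<le> q" if "b < s" "s \<le> b + h" for s
    using \<delta>b(2)[of s] that hh by simp
   have le: "a \<le> a + h" "b \<le> b + h" "0 \<le> q" using h q by auto
   have sa: "(\<lambda>x. \<integral>s. U g s x - U g a x \<partial>leb_on a (a + h)) \<in> Lp 2 m"
    "norm_L2 m (\<lambda>x. \<integral>s. U g s x - U g a x \<partial>leb_on a (a + h)) \<le> (a + h - a) * q"
    by (rule U_minus_average(2,3)[OF g Ua ab(1) le(1,3) ca]; assumption)+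
   have sb: "(\<lambda>x. \<integral>s. U g s x - U g b x \<partial>leb_on b (b + h)) \<in> Lp 2 m"
    "norm_L2 m (\<lambda>x. \<integral>s. U g s x - U g b x \<partial>leb_on b (b + h)) \<le> (b + h - b) * q"
    by (rule U_minus_average(2,3)[OF g Ub b le(2,3) cb]; assumption)+
   define Ea where "Ea = (\<lambda>x. \<integral>s. U g s x - U g a x \<partial>leb_on a (a + h))"
   define Eb where "Eb = (\<lambda>x. \<integral>s. U g s x - U g b x \<partial>leb_on b (b + h))"
   define I where "I = (\<lambda>x. \<integral>s. U g s x \<partial>leb_on a b)"
   have IL: "I \<in> Lp 2 m" using TA(2) by (simp add: I_def)
   have PI: "AE x in m. P h I x = (\<integral>s. U g s x \<partial>leb_on (a + h) (b + h))"
    "AE x in m. integrable (leb_on (a + h) (b + h)) (\<lambda>s. U g s x)"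
    unfolding I_def by (rule P_time_integral[OF g ab(1) less_imp_le[OF ab(2)] h(1) B]; assumption)+
   have Plin: "AE x in m. P h (avg g a b) x = 1 / (b - a) * P h I x"
    using P_linear[OF less_imp_le[OF h(1)] IL IL, of "1 / (b - a)" 0] by (simp add: avg_def[abs_def] I_def)
   have eq: "AE x in m. (P h (avg g a b) x - avg g a b x) / h - ?k x = 1 / ((b - a) * h) * Eb x + - 1 / ((b - a) * h) * Ea x"
    using Plin PI TA(1)
   proof eventually_elim
    case (elim x)
    have pm: "(\<lambda>s. U g s x) \<in> borel_measurable borel" by (rule U_path_measurable[OF gm])
    have i1: "integrable (leb_on a (a + h)) (\<lambda>s. U g s x)"
     by (rule leb_on_subinterval[OF pm elim(4)]) (use h hh in auto)
    have i2: "integrable (leb_on (a + h) b) (\<lambda>s. U g s x)"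
     by (rule leb_on_subinterval[OF pm elim(4)]) (use h hh in auto)
    have i3: "integrable (leb_on b (b + h)) (\<lambda>s. U g s x)"
     by (rule leb_on_subinterval[OF pm elim(3)]) (use h hh in auto)
    have c1: "(\<integral>s. U g s x \<partial>leb_on a b) = (\<integral>s. U g s x \<partial>leb_on a (a + h)) + (\<integral>s. U g s x \<partial>leb_on (a + h) b)"
     by (rule leb_on_concat(2)[OF pm i1 i2]) (use h hh in auto)
    have c2: "(\<integral>s. U g s x \<partial>leb_on (a + h) (b + h)) = (\<integral>s. U g s x \<partial>leb_on (a + h) b) + (\<integral>s. U g s x \<partial>leb_on b (b + h))"
     by (rule leb_on_concat(2)[OF pm i2 i3]) (use h hh in auto)
    interpret Ta: finite_measure "leb_on a (a + h)" by (rule finite_leb_on) (use h in simp)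
    interpret Tb: finite_measure "leb_on b (b + h)" by (rule finite_leb_on) (use h in simp)
    have e1: "Ea x = (\<integral>s. U g s x \<partial>leb_on a (a + h)) - h * U g a x"
     unfolding Ea_def using i1 h leb_on_const[of a "a + h" "U g a x"] by simp
    have e2: "Eb x = (\<integral>s. U g s x \<partial>leb_on b (b + h)) - h * U g b x"
     unfolding Eb_def using i3 h leb_on_const[of b "b + h" "U g b x"] by simp
    have "P h I x - I x = (\<integral>s. U g s x \<partial>leb_on b (b + h)) - (\<integral>s. U g s x \<partial>leb_on a (a + h))"
     using elim(2) c1 c2 by (simp add: I_def)
    then have "P h I x - I x = Eb x - Ea x + h * (U g b x - U g a x)" using e1 e2 by (simp add: algebra_simps)
    moreover have "P h (avg g a b) x - avg g a b x = 1 / (b - a) * (P h I x - I x)"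
     using elim(1) by (simp add: avg_def I_def right_diff_distrib)
    ultimately have e3: "P h (avg g a b) x - avg g a b x = 1 / (b - a) * (Eb x - Ea x + h * (U g b x - U g a x))" by simp
    have alg: "(1 / T * (y - z + h * w)) / h - w / T = 1 / (T * h) * y + - 1 / (T * h) * z" if "T \<noteq> 0" for T w y z :: real
     using that h(1) by (simp add: field_simps)
    show ?case unfolding e3 by (rule alg) (use ab in simp)
   qed
   have EL: "Ea \<in> Lp 2 m" "Eb \<in> Lp 2 m" using sa(1) sb(1) by (simp_all add: Ea_def Eb_def)
   have PA: "P h (avg g a b) \<in> Lp 2 m" using h AL by (intro P_L2) auto
   have "norm_L2 m (\<lambda>x. (P h (avg g a b) x - avg g a b x) / h - ?k x) = norm_L2 m (\<lambda>x. 1 / ((b - a) * h) * Eb x + - 1 / ((b - a) * h) * Ea x)"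
   proof (rule norm_L2_cong_AE[OF _ _ eq])
    show "(\<lambda>x. (P h (avg g a b) x - avg g a b x) / h - ?k x) \<in> borel_measurable m"
     using Lp2_measurable[OF PA] Lp2_measurable[OF AL] Lp2_measurable[OF kL] by measurable
    show "(\<lambda>x. 1 / ((b - a) * h) * Eb x + - 1 / ((b - a) * h) * Ea x) \<in> borel_measurable m"
     by (rule Lp2_measurable[OF Lp2_add[OF EL(2,1)]])
   qed
   also have "\<dots> \<le> norm_L2 m (\<lambda>x. 1 / ((b - a) * h) * Eb x) + norm_L2 m (\<lambda>x. - 1 / ((b - a) * h) * Ea x)"
    by (intro norm_L2_triangle Lp2_scale EL)
   also have "\<dots> = 1 / ((b - a) * h) * norm_L2 m Eb + 1 / ((b - a) * h) * norm_L2 m Ea"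
    unfolding norm_L2_scale using ab h by simp
   also have "\<dots> \<le> 1 / ((b - a) * h) * (h * q) + 1 / ((b - a) * h) * (h * q)"
    using ab h sa(2) sb(2) unfolding Ea_def Eb_def by (intro add_mono mult_left_mono) auto
   also have "\<dots> = 2 * q / (b - a)" using h by simp
   also have "\<dots> = 2 / 3 * \<epsilon>" unfolding q_def using ab by (simp add: field_simps)
   also have "\<dots> < \<epsilon>" using \<epsilon> by simp
   finally show ?thesis .
  qed
  show "\<forall>\<^sub>F t in at_right 0. dist (norm_L2 m (\<lambda>x. (P t (avg g a b) x - avg g a b x) / t - ?k x)) 0 < \<epsilon>"
   unfolding eventually_at_right_field
   using D main by (intro exI[of _ D]) (auto simp: norm_L2_nonneg)
 qed
 then show ?thesis unfolding G_iff using AL kL by simp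
qed

lemma P_in_domain:
 assumes fk: "(f, k) \<in> G" and t: "0 \<le> t"
 shows "(P t f, P t k) \<in> G"
proof -
 have f: "f \<in> Lp 2 m" and k: "k \<in> Lp 2 m"
  and lim: "((\<lambda>h. norm_L2 m (\<lambda>x. (P h f x - f x) / h - k x)) \<longlongrightarrow> 0) (at_right 0)"
  using fk unfolding G_iff by auto
 obtain K where K: "0 < K" "\<And>f. f \<in> Lp 2 m \<Longrightarrow> norm_L2 m (P t f) \<le> K * norm_L2 m f"
  by (rule P_bounded[OF t]) (rule that)
 have Ptf: "P t f \<in> Lp 2 m" and Ptk: "P t k \<in> Lp 2 m" using t f k by (auto intro: P_L2)
 have le: "norm_L2 m (\<lambda>x. (P h (P t f) x - P t f x) / h - P t k x) \<le> K * norm_L2 m (\<lambda>x. (P h f x - f x) / h - k x)"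
  if h: "0 < h" for h
 proof -
  have Phf: "P h f \<in> Lp 2 m" using h f by (intro P_L2) auto
  define v where "v = (\<lambda>x. 1 / h * P h f x + - 1 / h * f x)"
  define w where "w = (\<lambda>x. 1 * v x + - 1 * k x)"
  have v: "v \<in> Lp 2 m" unfolding v_def by (rule Lp2_add[OF Phf f])
  have w: "w \<in> Lp 2 m" unfolding w_def by (rule Lp2_add[OF v k])
  have we: "w = (\<lambda>x. (P h f x - f x) / h - k x)" by (simp add: w_def v_def fun_eq_iff diff_divide_distrib)
  have "AE x in m. (P h (P t f) x - P t f x) / h - P t k x = P t w x"
   using P_add[of h t f] P_add[of t h f] P_linear[OF t Phf f, of "1 / h" "- 1 / h"] P_linear[OF t v k, of 1 "- 1"] h t f
   unfolding v_def[symmetric] w_def[symmetric]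
   by (auto simp: add.commute elim!: eventually_elim2 simp: diff_divide_distrib)
  then have "norm_L2 m (\<lambda>x. (P h (P t f) x - P t f x) / h - P t k x) = norm_L2 m (P t w)"
  proof (rule norm_L2_cong_AE[rotated 2])
   have "P h (P t f) \<in> Lp 2 m" using h by (intro P_L2 Ptf) simp
   then show "(\<lambda>x. (P h (P t f) x - P t f x) / h - P t k x) \<in> borel_measurable m"
    using Lp2_measurable[OF Ptf] Lp2_measurable[OF Ptk] Lp2_measurable[of "P h (P t f)" m] by measurable
   show "P t w \<in> borel_measurable m" by (rule Lp2_measurable[OF P_L2[OF t w]])
  qed
  also have "\<dots> \<le> K * norm_L2 m w" by (rule K(2)[OF w])
  finally show ?thesis unfolding we .
 qed
 have "((\<lambda>h. norm_L2 m (\<lambda>x. (P h (P t f) x - P t f x) / h - P t k x)) \<longlongrightarrow> 0) (at_right 0)"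
 proof (rule tendsto_sandwich[OF _ _ tendsto_const])
  show "\<forall>\<^sub>F h in at_right 0. 0 \<le> norm_L2 m (\<lambda>x. (P h (P t f) x - P t f x) / h - P t k x)"
   by (simp add: norm_L2_nonneg)
  show "\<forall>\<^sub>F h in at_right 0. norm_L2 m (\<lambda>x. (P h (P t f) x - P t f x) / h - P t k x) \<le> K * norm_L2 m (\<lambda>x. (P h f x - f x) / h - k x)"
   using eventually_at_right_less[of 0] by eventually_elim (rule le)
  show "((\<lambda>h. K * norm_L2 m (\<lambda>x. (P h f x - f x) / h - k x)) \<longlongrightarrow> 0) (at_right 0)"
   using tendsto_mult_left[OF lim, of K] by simp
 qed
 then show ?thesis unfolding G_iff using Ptf Ptk by simp
qed

section \<open>Negative parts and positivity of the heat kernel\<close>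

abbreviation neg :: "('a \<Rightarrow> real) \<Rightarrow> 'a \<Rightarrow> real" where "neg f \<equiv> (\<lambda>x. max 0 (- f x))"

lemma neg_L2: "f \<in> Lp 2 m \<Longrightarrow> neg f \<in> Lp 2 m"
 by (rule Lp2_bound[of f]) (auto dest!: Lp2_measurable)

text \<open>The right derivative of the squared norm of the negative part along the flow is -2 <f^-,
  G f>, which the truncation property makes non-positive; the second-order terms are absorbed by
  \<epsilon>.\<close>

lemma neg_norm_right:
 assumes fk: "(f, k) \<in> G" and e: "0 < \<epsilon>"
 shows "\<exists>\<delta>>0. \<forall>h. 0 < h \<and> h < \<delta> \<longrightarrow> (norm_L2 m (neg (P h f)))\<^sup>2 \<le> (norm_L2 m (neg f))\<^sup>2 + \<epsilon> * h"
proof -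
 have f: "f \<in> Lp 2 m" and k: "k \<in> Lp 2 m"
  and lim: "((\<lambda>h. norm_L2 m (\<lambda>x. (P h f x - f x) / h - k x)) \<longlongrightarrow> 0) (at_right 0)"
  using fk unfolding G_iff by auto
 have nf: "neg f \<in> Lp 2 m" by (rule neg_L2[OF f])
 define N where "N = norm_L2 m (neg f)"
 have N: "0 \<le> N" unfolding N_def by (rule norm_L2_nonneg)
 define d where "d = (\<lambda>h. norm_L2 m (\<lambda>x. (P h f x - f x) / h - k x))"
 have "((\<lambda>h. 2 * N * d h + h * (d h + norm_L2 m k)\<^sup>2) \<longlongrightarrow> 2 * N * 0 + 0 * (0 + norm_L2 m k)\<^sup>2) (at_right 0)"
  unfolding d_def by (intro tendsto_intros lim)
 then have "((\<lambda>h. 2 * N * d h + h * (d h + norm_L2 m k)\<^sup>2) \<longlongrightarrow> 0) (at_right 0)" by simp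
 from order_tendstoD(2)[OF this e]
 obtain \<delta> where \<delta>: "\<delta> > 0" "\<And>h. 0 < h \<Longrightarrow> h < \<delta> \<Longrightarrow> 2 * N * d h + h * (d h + norm_L2 m k)\<^sup>2 < \<epsilon>"
  unfolding eventually_at_right_field by auto
 show ?thesis
 proof (intro exI[of _ \<delta>] conjI allI impI \<delta>(1))
  fix h assume "0 < h \<and> h < \<delta>"
  then have h: "0 < h" "h < \<delta>" by auto
  have Ph: "P h f \<in> Lp 2 m" using h f by (intro P_L2) auto
  define r where "r = (\<lambda>x. (P h f x - f x) / h - k x)"
  have rL: "r \<in> Lp 2 m" unfolding r_def
   using Lp2_diff[OF Lp2_scale[OF Lp2_diff[OF Ph f], of "1 / h"] k] by simp
  have rn: "norm_L2 m r = d h" by (simp add: r_def d_def)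
  define z where "z = (\<lambda>x. h * r x + h * k x)"
  have zL: "z \<in> Lp 2 m" unfolding z_def by (rule Lp2_add[OF rL k])
  have ze: "P h f x = f x + z x" for x unfolding z_def r_def using h by (simp add: field_simps)
  have pt: "(neg (P h f) x)\<^sup>2 \<le> (neg f x)\<^sup>2 + - 2 * (neg f x * z x) + (z x)\<^sup>2" for x
  proof -
   \<comment> \<open>The square of the negative part lies below its tangent at \<open>a\<close> plus
     the square of the increment, since its derivative is Lipschitz with constant 2.\<close>
   have *: "(max 0 (- (a + b)))\<^sup>2 \<le> (max 0 (- a))\<^sup>2 + - 2 * (max 0 (- a) * b) + b\<^sup>2" for a b :: real
   proof (cases "a \<le> 0")
    case True
    have "(max 0 (- (a + b)))\<^sup>2 \<le> (- (a + b))\<^sup>2" by (simp add: max_def del: power2_minus)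
    also have "\<dots> = (a + b)\<^sup>2" by (rule power2_minus)
    also have "\<dots> = (max 0 (- a))\<^sup>2 + - 2 * (max 0 (- a) * b) + b\<^sup>2"
     using True by (simp add: max_def power2_eq_square algebra_simps)
    finally show ?thesis .
   next
    case False
    have "max 0 (- (a + b)) \<le> \<bar>b\<bar>" using False by auto
    then have "(max 0 (- (a + b)))\<^sup>2 \<le> \<bar>b\<bar>\<^sup>2" by (intro power_mono) auto
    then show ?thesis using False by (simp add: max_def)
   qed
   show ?thesis unfolding ze by (rule *)
  qed
  have "(norm_L2 m (neg (P h f)))\<^sup>2 \<le> (\<integral>x. (neg f x)\<^sup>2 + - 2 * (neg f x * z x) + (z x)\<^sup>2 \<partial>m)"
   unfolding norm_L2_sqr
  proof (rule integral_mono)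
   show "integrable m (\<lambda>x. (neg (P h f) x)\<^sup>2)" using neg_L2[OF Ph] by (simp add: Lp2_iff)
   show "integrable m (\<lambda>x. (neg f x)\<^sup>2 + - 2 * (neg f x * z x) + (z x)\<^sup>2)"
    using nf zL Lp2_integrable_mult[OF nf zL] by (intro Bochner_Integration.integrable_add integrable_mult_right) (simp_all add: Lp2_iff)
  qed (rule pt)
  also have "\<dots> = N\<^sup>2 + - 2 * inner_L2 m (neg f) z + (norm_L2 m z)\<^sup>2"
   unfolding N_def norm_L2_sqr inner_L2_def using nf zL Lp2_integrable_mult[OF nf zL]
   by (simp add: Lp2_iff)
  also have "inner_L2 m (neg f) z = h * inner_L2 m (neg f) r + h * inner_L2 m (neg f) k"
   unfolding z_def by (rule inner_L2_add_right[OF rL k nf])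
  also have "N\<^sup>2 + - 2 * (h * inner_L2 m (neg f) r + h * inner_L2 m (neg f) k) + (norm_L2 m z)\<^sup>2
   \<le> N\<^sup>2 + h * (2 * N * d h + h * (d h + norm_L2 m k)\<^sup>2)"
  proof -
   have "0 \<le> inner_L2 m (neg f) k" using truncation[OF fk] by (simp add: inner_L2_commute)
   then have 1: "0 \<le> h * inner_L2 m (neg f) k" using h by simp
   have "- inner_L2 m (neg f) r \<le> N * d h" using Cauchy_Schwarz_L2[OF nf rL] unfolding N_def rn by simp
   then have 2: "h * - inner_L2 m (neg f) r \<le> h * (N * d h)" using h by (intro mult_left_mono) auto
   have "norm_L2 m z \<le> norm_L2 m (\<lambda>x. h * r x) + norm_L2 m (\<lambda>x. h * k x)"
    unfolding z_def by (intro norm_L2_triangle Lp2_scale rL k)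
   also have "\<dots> = h * (d h + norm_L2 m k)" unfolding norm_L2_scale rn using h by (simp add: distrib_left)
   finally have "(norm_L2 m z)\<^sup>2 \<le> (h * (d h + norm_L2 m k))\<^sup>2" by (intro power_mono norm_L2_nonneg)
   then have 3: "(norm_L2 m z)\<^sup>2 \<le> h * (h * (d h + norm_L2 m k)\<^sup>2)" by (simp add: power_mult_distrib power2_eq_square ac_simps)
   show ?thesis using 1 2 3 by (simp add: algebra_simps)
  qed
  also have "\<dots> \<le> N\<^sup>2 + h * \<epsilon>" using \<delta>(2)[OF h] h by (intro add_left_mono mult_left_mono) auto
  also have "\<dots> = N\<^sup>2 + \<epsilon> * h" by simp
  finally show "(norm_L2 m (neg (P h f)))\<^sup>2 \<le> (norm_L2 m (neg f))\<^sup>2 + \<epsilon> * h" unfolding N_def .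
 qed
qed

definition ball_ind :: "'a \<Rightarrow> real \<Rightarrow> 'a \<Rightarrow> real" where "ball_ind z d = indicator (ball z d)"

lemma ball_ind_L2: "ball_ind z d \<in> Lp 2 m" "(norm_L2 m (ball_ind z d))\<^sup>2 = measure m (ball z d)"
 unfolding ball_ind_def using norm_L2_indicator[of "ball z d" m] ball_finite[of z d] by (auto simp: sets_m)

lemma ball_ind_integral: "integrable m (\<lambda>y. c * ball_ind z d y)" "(\<integral>y. c * ball_ind z d y \<partial>m) = c * measure m (ball z d)"
 unfolding ball_ind_def using ball_finite[of z d]
 by (intro integrable_mult_right integrable_real_indicator) (auto simp: sets_m space_m)

lemma p_seq_continuous:
 assumes "\<And>n. 0 < s n" "s \<longlonglongrightarrow> s0" "0 < s0"
 shows "(\<lambda>n. p (s n) x y) \<longlonglongrightarrow> p s0 x y"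
proof -
 have "continuous_on {0<..} (\<lambda>t. (\<lambda>(t, x, y). p t x y) (t, x, y))"
  by (rule continuous_on_compose2[OF p_continuous]) (auto intro!: continuous_intros)
 then have "continuous_on {0<..} (\<lambda>t. p t x y)" by simp
 then show ?thesis
  using continuous_on_tendsto_compose[of "{0<..}" "\<lambda>t. p t x y" s s0] assms by simp
qed

text \<open>Closed balls are compact, so the kernel is bounded for times in
  \<open>{s0 / 2..2 * s0}\<close> and \<open>y\<close> in the ball, and dominated convergence
  applies.\<close>

lemma U_ball_continuous: "continuous_on {0<..} (\<lambda>s::real. U (ball_ind z d) s x)"
 unfolding continuous_on_sequentially
proof (intro allI ballI impI, elim conjE)
 fix s :: "nat \<Rightarrow> real" and s0 :: real assume s0: "s0 \<in> {0<..}" and s: "\<forall>n. s n \<in> {0<..}" "s \<longlonglongrightarrow> s0"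
 let ?K = "{s0 / 2..2 * s0} \<times> {x} \<times> cball z d"
 have "compact ?K" by (intro compact_Times cball_compact) auto
 moreover have "continuous_on ?K (\<lambda>(t, x, y). p t x y)"
  by (rule continuous_on_subset[OF p_continuous]) (use s0 in auto)
 ultimately have "bounded ((\<lambda>(t, x, y). p t x y) ` ?K)" by (intro compact_imp_bounded compact_continuous_image)
 then obtain M where M: "\<And>q. q \<in> ?K \<Longrightarrow> norm ((\<lambda>(t, x, y). p t x y) q) \<le> M" unfolding bounded_iff by blast
 have sn: "\<forall>\<^sub>F n in sequentially. s n \<in> {s0 / 2..2 * s0}"
 proof -
  have "\<forall>\<^sub>F n in sequentially. s0 / 2 < s n" "\<forall>\<^sub>F n in sequentially. s n < 2 * s0"
   using s0 by (intro order_tendstoD[OF s(2)]; simp)+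
  then show ?thesis by eventually_elim auto
 qed
 then obtain k where k: "\<And>n. n \<ge> k \<Longrightarrow> s n \<in> {s0 / 2..2 * s0}" unfolding eventually_sequentially by blast
 have "(\<lambda>n. \<integral>y. pk (s (n + k)) x y * ball_ind z d y \<partial>m) \<longlonglongrightarrow> (\<integral>y. pk s0 x y * ball_ind z d y \<partial>m)"
 proof (rule integral_dominated_convergence[where w="\<lambda>y. M * ball_ind z d y"])
  show "integrable m (\<lambda>y. M * ball_ind z d y)" by (rule ball_ind_integral)
  have bm: "ball_ind z d \<in> borel_measurable m" by (rule Lp2_measurable[OF ball_ind_L2(1)])
  show "(\<lambda>y. pk s0 x y * ball_ind z d y) \<in> borel_measurable m"
   "\<And>n. (\<lambda>y. pk (s (n + k)) x y * ball_ind z d y) \<in> borel_measurable m"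
   by (intro borel_measurable_times pk_measurable2 bm)+
  show "AE y in m. (\<lambda>n. pk (s (n + k)) x y * ball_ind z d y) \<longlonglongrightarrow> pk s0 x y * ball_ind z d y"
  proof (rule AE_I2)
   fix y
   have "(\<lambda>n. p (s (n + k)) x y) \<longlonglongrightarrow> p s0 x y"
    using s s0 LIMSEQ_ignore_initial_segment[OF s(2), of k] by (intro p_seq_continuous) auto
   then show "(\<lambda>n. pk (s (n + k)) x y * ball_ind z d y) \<longlonglongrightarrow> pk s0 x y * ball_ind z d y"
    using s s0 by (intro tendsto_mult tendsto_const) (simp add: pk_def)
  qed
  show "AE y in m. norm (pk (s (n + k)) x y * ball_ind z d y) \<le> M * ball_ind z d y" for n
  proof (rule AE_I2)
   fix y
   have "\<bar>p (s (n + k)) x y\<bar> \<le> M" if "y \<in> ball z d"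
    using M[of "(s (n + k), x, y)"] k[of "n + k"] that by simp
   then show "norm (pk (s (n + k)) x y * ball_ind z d y) \<le> M * ball_ind z d y"
    using s(1) by (auto simp: ball_ind_def indicator_def pk_def)
  qed
 qed
 then have "(\<lambda>n. U (ball_ind z d) (s n) x) \<longlonglongrightarrow> U (ball_ind z d) s0 x"
  unfolding U_def by (rule LIMSEQ_offset)
 then show "((\<lambda>s. U (ball_ind z d) s x) \<circ> s) \<longlonglongrightarrow> U (ball_ind z d) s0 x" by (simp add: o_def)
qed

text \<open>
 The semigroup is not known to be bounded on bounded time intervals, so left continuity is not available;
 lower semicontinuity from the left suffices, and Fatou's lemma provides it.
\<close>

lemma neg_norm_decreasing:
 assumes ab: "0 < a" "a < b" and t: "0 \<le> t"
  and B: "\<And>s. a < s \<Longrightarrow> s \<le> b \<Longrightarrow> (norm_L2 m (U (ball_ind z d) s))\<^sup>2 \<le> B"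
 shows "(norm_L2 m (neg (P t (avg (ball_ind z d) a b))))\<^sup>2 \<le> (norm_L2 m (neg (avg (ball_ind z d) a b)))\<^sup>2"
proof -
 let ?g = "ball_ind z d"
 let ?w = "avg ?g a b"
 have g: "?g \<in> Lp 2 m" by (rule ball_ind_L2)
 have wG: "(?w, \<lambda>x. (U ?g b x - U ?g a x) / (b - a)) \<in> G" by (rule avg_in_domain[OF g ab B])
 then have wL: "?w \<in> Lp 2 m" unfolding G_iff by simp
 define j where "j = (\<lambda>t. (norm_L2 m (neg (P t ?w)))\<^sup>2)"
 have negm: "neg f \<in> borel_measurable m" if "f \<in> Lp 2 m" for f using Lp2_measurable[OF neg_L2[OF that]] .
 have neg_cong: "norm_L2 m (neg f) = norm_L2 m (neg f')" if "f \<in> Lp 2 m" "f' \<in> Lp 2 m" "AE x in m. f x = f' x" for f f'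
  by (rule norm_L2_cong_AE) (use negm that in \<open>auto elim: eventually_mono\<close>)
 have "j t \<le> j 0"
 proof (rule nonincreasing_if_right_derivative_nonpos[OF _ _ t])
  fix t \<epsilon> :: real assume t: "0 \<le> t" and e: "0 < \<epsilon>"
  have PtL: "P t ?w \<in> Lp 2 m" by (rule P_L2[OF t wL])
  obtain \<delta> where \<delta>: "\<delta> > 0" "\<And>h. 0 < h \<and> h < \<delta> \<Longrightarrow> (norm_L2 m (neg (P h (P t ?w))))\<^sup>2 \<le> (norm_L2 m (neg (P t ?w)))\<^sup>2 + \<epsilon> * h"
   using neg_norm_right[OF P_in_domain[OF wG t] e] by blast
  show "\<exists>\<delta>>0. \<forall>h. 0 < h \<and> h < \<delta> \<longrightarrow> j (t + h) \<le> j t + \<epsilon> * h"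
  proof (intro exI[of _ \<delta>] conjI \<delta>(1) allI impI)
   fix h assume h: "0 < h \<and> h < \<delta>"
   have "norm_L2 m (neg (P (t + h) ?w)) = norm_L2 m (neg (P h (P t ?w)))"
   proof (rule neg_cong)
    show "AE x in m. P (t + h) ?w x = P h (P t ?w) x" using P_add[of h t ?w] h t wL by (simp add: add.commute)
   qed (use h t wL PtL in \<open>auto intro!: P_L2\<close>)
   then show "j (t + h) \<le> j t + \<epsilon> * h" unfolding j_def using \<delta>(2)[OF h] by simp
  qed
 next
  fix t c :: real assume t: "0 < t" and le: "\<And>s. 0 \<le> s \<Longrightarrow> s < t \<Longrightarrow> j s \<le> c"
  \<comment> \<open>The kernel version of the flow of the average. It is continuous in
    \<open>t\<close> at every point \<open>x\<close>, which gives Fatou's lemma its pointwise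
    limit.\<close>
  define W where "W = (\<lambda>t x. 1 / (b - a) * (\<integral>s. U ?g (s + t) x \<partial>leb_on a b))"
  have gm: "?g \<in> borel_measurable m" by (rule Lp2_measurable[OF g])
  have PW: "AE x in m. P t ?w x = W t x" if "0 < t" for t
  proof -
   define I where "I = (\<lambda>x. \<integral>s. U ?g s x \<partial>leb_on a b)"
   have IL: "I \<in> Lp 2 m" unfolding I_def by (rule U_time_average(2)[OF g ab(1) less_imp_le[OF ab(2)] B])
   have "AE x in m. P t ?w x = 1 / (b - a) * P t I x"
    using P_linear[OF less_imp_le[OF that] IL IL, of "1 / (b - a)" 0] by (simp add: avg_def[abs_def] I_def)
   moreover have "AE x in m. P t I x = (\<integral>s. U ?g s x \<partial>leb_on (a + t) (b + t))"
    unfolding I_def by (rule P_time_integral(1)[OF g ab(1) less_imp_le[OF ab(2)] that B])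
   ultimately show ?thesis
    by eventually_elim (simp add: W_def leb_on_shift(1)[OF U_path_measurable[OF gm]])
  qed
  have Wm: "W t \<in> borel_measurable m" for t
  proof -
   have "(\<lambda>x. \<integral>s. U ?g (s + t) x \<partial>leb_on a b) \<in> borel_measurable m"
   proof -
    interpret T: finite_measure "leb_on a b" by (rule finite_leb_on) (use ab in simp)
    have "(\<lambda>q. (\<lambda>(x, t). U ?g t x) (fst q, snd q + t)) \<in> borel_measurable (m \<Otimes>\<^sub>M leb_on a b)"
    proof (rule measurable_compose[OF _ U_measurable_swap[OF gm]])
     have "(\<lambda>q. snd q) \<in> measurable (m \<Otimes>\<^sub>M leb_on a b) borel"
      by (subst measurable_cong_sets[OF sets_pair_measure_cong[OF refl sets_leb_on] refl]) (rule measurable_snd)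
     then have "(\<lambda>q. snd q + t) \<in> measurable (m \<Otimes>\<^sub>M leb_on a b) borel" by measurable
     then show "(\<lambda>q. (fst q, snd q + t)) \<in> measurable (m \<Otimes>\<^sub>M leb_on a b) (m \<Otimes>\<^sub>M borel)"
      by (intro measurable_Pair measurable_fst)
    qed
    then show ?thesis by (intro T.borel_measurable_lebesgue_integral) (simp add: case_prod_beta)
   qed
   then show ?thesis unfolding W_def by measurable
  qed
  have WL: "W t \<in> Lp 2 m" "norm_L2 m (neg (W t)) = norm_L2 m (neg (P t ?w))" if "0 < t" for t
  proof -
   have "P t ?w \<in> Lp 2 m" using that wL by (intro P_L2) auto
   from Lp2_cong_AE[OF this Wm PW[OF that]] show "W t \<in> Lp 2 m" .
   then show "norm_L2 m (neg (W t)) = norm_L2 m (neg (P t ?w))"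
    using \<open>P t ?w \<in> Lp 2 m\<close> PW[OF that] by (intro neg_cong) (auto elim: eventually_mono)
  qed
  \<comment> \<open>Times that increase to \<open>t\<close> from below; the shift by 2 keeps even
    the first one positive, where the kernel is defined.\<close>
  define r where "r = (\<lambda>n. t * (1 - inverse (real (Suc (Suc n)))))"
  have r: "0 < r n" "r n < t" for n
  proof -
   have "inverse (real (Suc (Suc n))) < 1" "0 < inverse (real (Suc (Suc n)))" by (simp_all add: inverse_less_1_iff)
   then show "0 < r n" "r n < t" unfolding r_def using t by (simp_all add: mult_less_cancel_left1 mult_less_cancel_left2)
  qed
  have rlim: "r \<longlonglongrightarrow> t"
  proof -
   have "(\<lambda>n. t * (1 - inverse (real (Suc (n + 1))))) \<longlonglongrightarrow> t * (1 - 0)"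
    by (intro tendsto_intros LIMSEQ_ignore_initial_segment[OF LIMSEQ_inverse_real_of_nat])
   then show ?thesis by (simp add: r_def)
  qed
  have Wlim: "(\<lambda>n. W (r n) x) \<longlonglongrightarrow> W t x" for x
  proof -
   have cont: "continuous_on {0<..} (\<lambda>s. U ?g s x)" by (rule U_ball_continuous)
   have "bounded ((\<lambda>s. U ?g s x) ` {a..b + t})"
    by (intro compact_imp_bounded compact_continuous_image continuous_on_subset[OF cont]) (use ab in auto)
   then obtain M where M: "\<And>s. s \<in> {a..b + t} \<Longrightarrow> norm (U ?g s x) \<le> M" unfolding bounded_iff by blast
   have "(\<lambda>n. \<integral>s. U ?g (s + r n) x \<partial>leb_on a b) \<longlonglongrightarrow> (\<integral>s. U ?g (s + t) x \<partial>leb_on a b)"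
   proof (rule integral_dominated_convergence[where w="\<lambda>s. M"])
    interpret T: finite_measure "leb_on a b" by (rule finite_leb_on) (use ab in simp)
    show "integrable (leb_on a b) (\<lambda>s. M)" by simp
    have pm: "(\<lambda>s. U ?g (s + h) x) \<in> borel_measurable (leb_on a b)" for h
     using U_path_measurable[OF gm, of x] by measurable
    show "(\<lambda>s. U ?g (s + t) x) \<in> borel_measurable (leb_on a b)" by (rule pm)
    show "(\<lambda>s. U ?g (s + r n) x) \<in> borel_measurable (leb_on a b)" for n by (rule pm)
    show "AE s in leb_on a b. (\<lambda>n. U ?g (s + r n) x) \<longlonglongrightarrow> U ?g (s + t) x"
     using AE_leb_on
    proof eventually_elim
     case (elim s)
     have "(\<lambda>n. s + r n) \<longlonglongrightarrow> s + t" by (intro tendsto_intros rlim)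
     then show ?case
      by (rule continuous_on_tendsto_compose[OF cont]) (use elim ab t r in \<open>auto intro!: always_eventually add_pos_pos\<close>)
    qed
    show "AE s in leb_on a b. norm (U ?g (s + r n) x) \<le> M" for n
     using AE_leb_on
    proof eventually_elim
     case (elim s)
     show ?case by (rule M) (use elim r[of n] in auto)
    qed
   qed
   then show ?thesis unfolding W_def by (intro tendsto_mult tendsto_const)
  qed
  have "(\<integral>\<^sup>+x. ennreal ((neg (W t) x)\<^sup>2) \<partial>m) = (\<integral>\<^sup>+x. liminf (\<lambda>n. ennreal ((neg (W (r n)) x)\<^sup>2)) \<partial>m)"
  proof (rule nn_integral_cong)
   fix x
   have "(\<lambda>n. ennreal ((neg (W (r n)) x)\<^sup>2)) \<longlonglongrightarrow> ennreal ((neg (W t) x)\<^sup>2)"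
    by (intro tendsto_ennrealI tendsto_power tendsto_max tendsto_const tendsto_minus Wlim)
   then show "ennreal ((neg (W t) x)\<^sup>2) = liminf (\<lambda>n. ennreal ((neg (W (r n)) x)\<^sup>2))"
    by (intro lim_imp_Liminf[symmetric]) auto
  qed
  also have "\<dots> \<le> liminf (\<lambda>n. \<integral>\<^sup>+x. ennreal ((neg (W (r n)) x)\<^sup>2) \<partial>m)"
   by (intro nn_integral_liminf measurable_compose[OF negm[OF WL(1)[OF r(1)]], of "\<lambda>v. ennreal (v\<^sup>2)"]) measurable
  also have "\<dots> \<le> ennreal c"
  proof (rule Liminf_le)
   show "\<forall>\<^sub>F n in sequentially. (\<integral>\<^sup>+x. ennreal ((neg (W (r n)) x)\<^sup>2) \<partial>m) \<le> ennreal c"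
   proof (rule always_eventually, rule allI)
    fix n
    have "(\<integral>\<^sup>+x. ennreal ((neg (W (r n)) x)\<^sup>2) \<partial>m) = ennreal ((norm_L2 m (neg (W (r n))))\<^sup>2)"
     unfolding norm_L2_sqr using neg_L2[OF WL(1)[OF r(1)]] by (intro nn_integral_eq_integral) (auto simp: Lp2_iff)
    also have "(norm_L2 m (neg (W (r n))))\<^sup>2 \<le> c"
     using le[of "r n"] r[of n] WL(2)[OF r(1), of n] by (simp add: j_def)
    then have "ennreal ((norm_L2 m (neg (W (r n))))\<^sup>2) \<le> ennreal c" by (rule ennreal_leI)
    finally show "(\<integral>\<^sup>+x. ennreal ((neg (W (r n)) x)\<^sup>2) \<partial>m) \<le> ennreal c" .
   qed
  qed simp
  finally have fat: "(\<integral>\<^sup>+x. ennreal ((neg (W t) x)\<^sup>2) \<partial>m) \<le> ennreal c" .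
  have "0 \<le> c" using le[of 0] t by (auto simp: j_def intro: order_trans[OF zero_le_power2])
  moreover have "(\<integral>\<^sup>+x. ennreal ((neg (W t) x)\<^sup>2) \<partial>m) = ennreal ((norm_L2 m (neg (W t)))\<^sup>2)"
   unfolding norm_L2_sqr using neg_L2[OF WL(1)[OF t]] by (intro nn_integral_eq_integral) (auto simp: Lp2_iff)
  ultimately have "(norm_L2 m (neg (W t)))\<^sup>2 \<le> c" using fat by simp
  then show "j t \<le> c" using WL(2)[OF t] by (simp add: j_def)
 qed
 also have "j 0 = (norm_L2 m (neg ?w))\<^sup>2"
 proof -
  have "norm_L2 m (neg (P 0 ?w)) = norm_L2 m (neg ?w)" by (rule neg_cong) (use wL P_zero in \<open>auto intro: P_L2\<close>)
  then show ?thesis by (simp add: j_def)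
 qed
 finally show ?thesis by (simp add: j_def)
qed

lemma AE_dense:
 fixes x :: 'a
 assumes "AE z in m. Q z" "0 < r"
 obtains z where "dist x z < r" "Q z"
proof -
 have "\<exists>z. dist x z < r \<and> Q z"
 proof (rule ccontr)
  assume "\<nexists>z. dist x z < r \<and> Q z"
  with assms(1) have "AE z in m. z \<notin> ball x r" by (auto elim!: eventually_mono)
  moreover have "ball x r \<in> sets m" by (simp add: sets_m)
  ultimately have "emeasure m (ball x r) = 0" using AE_iff_null_sets[of "ball x r" m] by auto
  with ball_pos[OF assms(2), of x] show False by simp
 qed
 with that show ?thesis by blast
qed

text \<open>The indicator itself need not be in the domain. Its averages over short times are, they
  approach it in L^2, and so their negative parts are small; the flow does not enlarge the negative
  part, and for the fixed \<open>t\<close> the operator bound carries the estimate back to the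
  indicator.\<close>

lemma P_ball_nonneg:
 assumes t: "0 < t"
 shows "AE x in m. 0 \<le> U (ball_ind z d) t x"
proof -
 let ?g = "ball_ind z d"
 have g: "?g \<in> Lp 2 m" by (rule ball_ind_L2)
 have gm: "?g \<in> borel_measurable m" by (rule Lp2_measurable[OF g])
 have PgL: "P t ?g \<in> Lp 2 m" using t g by (intro P_L2) auto
 obtain K where K: "0 < K" "\<And>f. f \<in> Lp 2 m \<Longrightarrow> norm_L2 m (P t f) \<le> K * norm_L2 m f"
  by (rule P_bounded[OF less_imp_le[OF t]]) (rule that)
 have bound: "norm_L2 m (neg (P t ?g)) \<le> (1 + K) * \<epsilon>" if \<epsilon>: "0 < \<epsilon>" for \<epsilon>
 proof -
  from order_tendstoD(2)[OF P_continuous[OF g] \<epsilon>]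
  obtain \<delta> where \<delta>: "\<delta> > 0" "\<And>h. 0 < h \<Longrightarrow> h < \<delta> \<Longrightarrow> norm_L2 m (\<lambda>x. P h ?g x - ?g x) < \<epsilon>"
   unfolding eventually_at_right_field by auto
  define a b where "a = \<delta> / 3" and "b = 2 * \<delta> / 3"
  have ab: "0 < a" "a < b" "b < \<delta>" using \<delta> by (auto simp: a_def b_def)
  have near: "norm_L2 m (\<lambda>x. U ?g s x - ?g x) \<le> \<epsilon>" if s: "a < s" "s \<le> b" for s
  proof -
   have s0: "0 < s" using s ab by simp
   have "norm_L2 m (\<lambda>x. U ?g s x - ?g x) = norm_L2 m (\<lambda>x. P s ?g x - ?g x)"
   proof (rule norm_L2_cong_AE)
    show "(\<lambda>x. U ?g s x - ?g x) \<in> borel_measurable m"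
     by (intro borel_measurable_diff gm Lp2_measurable[OF U_L2(1)[OF s0 g]])
    show "(\<lambda>x. P s ?g x - ?g x) \<in> borel_measurable m"
     by (intro borel_measurable_diff gm Lp2_measurable[OF P_L2[OF less_imp_le[OF s0] g]])
    show "AE x in m. U ?g s x - ?g x = P s ?g x - ?g x"
     using P_eq_U(1)[OF s0 g] by eventually_elim simp
   qed
   also have "\<dots> < \<epsilon>" using s ab by (intro \<delta>(2)) auto
   finally show ?thesis by simp
  qed
  have B: "(norm_L2 m (U ?g s))\<^sup>2 \<le> (\<epsilon> + norm_L2 m ?g)\<^sup>2" if s: "a < s" "s \<le> b" for s
  proof (rule power_mono[OF _ norm_L2_nonneg])
   have UL: "U ?g s \<in> Lp 2 m" using s ab by (intro U_L2(1) g) auto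
   have "norm_L2 m (\<lambda>x. (U ?g s x - ?g x) + ?g x) \<le> norm_L2 m (\<lambda>x. U ?g s x - ?g x) + norm_L2 m ?g"
    by (intro norm_L2_triangle Lp2_diff UL g)
   then show "norm_L2 m (U ?g s) \<le> \<epsilon> + norm_L2 m ?g" using near[OF s] by simp
  qed
  define w where "w = avg ?g a b"
  have wL: "w \<in> Lp 2 m" unfolding w_def by (rule avg_L2(1)[OF g ab(1,2) B])
  have wg: "norm_L2 m (\<lambda>x. w x - ?g x) \<le> \<epsilon>"
  proof -
   have T: "AE x in m. integrable (leb_on a b) (\<lambda>s. U ?g s x - ?g x)"
    "(\<lambda>x. \<integral>s. U ?g s x - ?g x \<partial>leb_on a b) \<in> Lp 2 m"
    "norm_L2 m (\<lambda>x. \<integral>s. U ?g s x - ?g x \<partial>leb_on a b) \<le> (b - a) * \<epsilon>"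
    by (rule U_minus_average[OF g g ab(1) less_imp_le[OF ab(2)] less_imp_le[OF \<epsilon>] near]; assumption)+
   have eq: "AE x in m. w x - ?g x = 1 / (b - a) * (\<integral>s. U ?g s x - ?g x \<partial>leb_on a b)"
    using T(1)
   proof eventually_elim
    case (elim x)
    interpret Ta: finite_measure "leb_on a b" by (rule finite_leb_on) (use ab in simp)
    have "integrable (leb_on a b) (\<lambda>s. (U ?g s x - ?g x) + ?g x)"
     using elim by (intro Bochner_Integration.integrable_add) auto
    then have i: "integrable (leb_on a b) (\<lambda>s. U ?g s x)" by simp
    have "(\<integral>s. U ?g s x - ?g x \<partial>leb_on a b) = (\<integral>s. U ?g s x \<partial>leb_on a b) - (b - a) * ?g x"
     unfolding leb_on_const[OF less_imp_le[OF ab(2)], symmetric] using i by (intro Bochner_Integration.integral_diff) simp_all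
    then show ?case using ab by (simp add: w_def avg_def field_simps)
   qed
   have "norm_L2 m (\<lambda>x. w x - ?g x) = norm_L2 m (\<lambda>x. 1 / (b - a) * (\<integral>s. U ?g s x - ?g x \<partial>leb_on a b))"
    by (intro norm_L2_cong_AE eq Lp2_measurable[OF Lp2_diff[OF wL g]] Lp2_measurable[OF Lp2_scale[OF T(2)]])
   also have "\<dots> = 1 / (b - a) * norm_L2 m (\<lambda>x. \<integral>s. U ?g s x - ?g x \<partial>leb_on a b)"
    unfolding norm_L2_scale using ab by simp
   also have "\<dots> \<le> 1 / (b - a) * ((b - a) * \<epsilon>)" using ab by (intro mult_left_mono T(3)) simp
   also have "\<dots> = \<epsilon>" using ab by simp
   finally show ?thesis .
  qed
  have "norm_L2 m (neg w) \<le> norm_L2 m (\<lambda>x. w x - ?g x)"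
  proof (rule norm_L2_mono_AE[OF Lp2_measurable[OF neg_L2[OF wL]] Lp2_diff[OF wL g]])
   show "AE x in m. \<bar>max 0 (- w x)\<bar> \<le> \<bar>w x - ?g x\<bar>"
    by (rule AE_I2) (auto simp: ball_ind_def indicator_def)
  qed
  then have nw: "norm_L2 m (neg w) \<le> \<epsilon>" using wg by simp
  have "(norm_L2 m (neg (P t w)))\<^sup>2 \<le> (norm_L2 m (neg w))\<^sup>2"
   unfolding w_def by (rule neg_norm_decreasing[OF ab(1,2) less_imp_le[OF t] B]; assumption)
  from power2_le_imp_le[OF this norm_L2_nonneg] have nP: "norm_L2 m (neg (P t w)) \<le> \<epsilon>" using nw by simp
  have PwL: "P t w \<in> Lp 2 m" using t wL by (intro P_L2) auto
  have dL: "(\<lambda>x. P t w x - P t ?g x) \<in> Lp 2 m" by (rule Lp2_diff[OF PwL PgL])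
  have aL: "(\<lambda>x. \<bar>P t w x - P t ?g x\<bar>) \<in> Lp 2 m"
   by (rule Lp2_bound[OF dL]) (auto intro: borel_measurable_abs Lp2_measurable[OF dL])
  have "norm_L2 m (neg (P t ?g)) \<le> norm_L2 m (\<lambda>x. neg (P t w) x + \<bar>P t w x - P t ?g x\<bar>)"
  proof (rule norm_L2_mono_AE[OF Lp2_measurable[OF neg_L2[OF PgL]]])
   show "(\<lambda>x. neg (P t w) x + \<bar>P t w x - P t ?g x\<bar>) \<in> Lp 2 m"
    using Lp2_add[OF neg_L2[OF PwL] aL, of 1 1] by simp
   show "AE x in m. \<bar>max 0 (- P t ?g x)\<bar> \<le> \<bar>neg (P t w) x + \<bar>P t w x - P t ?g x\<bar>\<bar>"
    by (rule AE_I2) auto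
  qed
  also have "\<dots> \<le> norm_L2 m (neg (P t w)) + norm_L2 m (\<lambda>x. \<bar>P t w x - P t ?g x\<bar>)"
   by (intro norm_L2_triangle neg_L2 PwL aL)
  also have "norm_L2 m (\<lambda>x. \<bar>P t w x - P t ?g x\<bar>) = norm_L2 m (\<lambda>x. P t w x - P t ?g x)"
   by (simp add: norm_L2_eq)
  also have "\<dots> = norm_L2 m (P t (\<lambda>x. w x - ?g x))" by (rule P_diff_norm) (use t wL g in auto)
  also have "\<dots> \<le> K * norm_L2 m (\<lambda>x. w x - ?g x)" by (rule K(2)[OF Lp2_diff[OF wL g]])
  also have "\<dots> \<le> K * \<epsilon>" using wg K by (intro mult_left_mono) auto
  finally show ?thesis using nP by (simp add: algebra_simps)
 qed
 have "norm_L2 m (neg (P t ?g)) \<le> 0"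
 proof (rule field_le_epsilon)
  fix \<epsilon> :: real assume "0 < \<epsilon>"
  then show "norm_L2 m (neg (P t ?g)) \<le> 0 + \<epsilon>" using bound[of "\<epsilon> / (1 + K)"] K(1) by simp
 qed
 then have "norm_L2 m (neg (P t ?g)) = 0" using norm_L2_nonneg by (intro antisym)
 from norm_L2_eq_0[OF neg_L2[OF PgL] this] P_eq_U(1)[OF t g]
 show ?thesis by eventually_elim (auto simp: max_def split: if_splits)
qed

lemma p_continuous_space: "0 < t \<Longrightarrow> continuous_on UNIV (\<lambda>(x, y). p t x y)"
proof -
 assume t: "0 < t"
 have "continuous_on UNIV (\<lambda>q. (\<lambda>(t, x, y). p t x y) (t, fst q, snd q))"
  by (rule continuous_on_compose2[OF p_continuous]) (use t in \<open>auto intro!: continuous_intros\<close>)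
 then show ?thesis by (simp add: case_prod_beta)
qed

lemma p_near:
 assumes t: "0 < t" and "0 < \<epsilon>"
 obtains d where "0 < d" "\<And>x' y'. dist x x' < d \<Longrightarrow> dist y y' < d \<Longrightarrow> \<bar>p t x' y' - p t x y\<bar> < \<epsilon>"
proof -
 have "\<exists>\<delta>>0. \<forall>q. dist q (x, y) < \<delta> \<longrightarrow> dist ((\<lambda>(x, y). p t x y) q) ((\<lambda>(x, y). p t x y) (x, y)) < \<epsilon>"
  using p_continuous_space[OF t] \<open>0 < \<epsilon>\<close> unfolding continuous_on_iff by (metis UNIV_I)
 then obtain \<delta> where \<delta>: "\<delta> > 0" "\<And>q. dist q (x, y) < \<delta> \<Longrightarrow> dist ((\<lambda>(x, y). p t x y) q) ((\<lambda>(x, y). p t x y) (x, y)) < \<epsilon>"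
  by blast
 show ?thesis
 proof (rule that[of "\<delta> / 2"])
  show "0 < \<delta> / 2" using \<delta> by simp
  fix x' y' assume h: "dist x x' < \<delta> / 2" "dist y y' < \<delta> / 2"
  have "dist (x', y') (x, y) \<le> dist x' x + dist y' y" unfolding dist_Pair_Pair by (rule sqrt_sum_squares_le_sum) auto
  then have "dist (x', y') (x, y) < \<delta>" using h by (simp add: dist_commute)
  from \<delta>(2)[OF this] show "\<bar>p t x' y' - p t x y\<bar> < \<epsilon>" by (simp add: dist_real_def)
 qed
qed

text \<open>If the kernel were negative at a point it would be so nearby, and the flow of a small
  ball around \<open>y\<close> would be negative near \<open>x\<close>, on a set of positive
  measure.\<close>

lemma p_nonneg:
 assumes t: "0 < t"
 shows "0 \<le> p t x y"
proof (rule ccontr)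
 assume "\<not> 0 \<le> p t x y"
 then have c: "0 < - p t x y / 2" by simp
 obtain d where d: "0 < d" "\<And>x' y'. dist x x' < d \<Longrightarrow> dist y y' < d \<Longrightarrow> \<bar>p t x' y' - p t x y\<bar> < - p t x y / 2"
  by (rule p_near[OF t c]) (rule that)
 define c where "c = - p t x y / 2"
 have c: "0 < c" "\<And>x' y'. dist x x' < d \<Longrightarrow> dist y y' < d \<Longrightarrow> p t x' y' < - c"
  using c unfolding c_def by (simp, use d(2) in fastforce)
 have "AE x' in m. 0 \<le> U (ball_ind y d) t x' \<and> integrable m (\<lambda>z. p t x' z * ball_ind y d z)"
  using P_ball_nonneg[OF t, of y d] P_eq_U(2)[OF t ball_ind_L2(1), of y d] by eventually_elim simp
 then obtain x' where x': "dist x x' < d" "0 \<le> U (ball_ind y d) t x' \<and> integrable m (\<lambda>z. p t x' z * ball_ind y d z)"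
  by (rule AE_dense[OF _ d(1)])
 have "U (ball_ind y d) t x' \<le> (\<integral>z. - c * ball_ind y d z \<partial>m)"
  unfolding U_def
 proof (rule integral_mono)
  show "integrable m (\<lambda>z. pk t x' z * ball_ind y d z)" using x' t by (simp add: pk_def)
  show "integrable m (\<lambda>z. - c * ball_ind y d z)" by (rule ball_ind_integral)
  show "pk t x' z * ball_ind y d z \<le> - c * ball_ind y d z" for z
   using c(2)[OF x'(1), of z] t by (auto simp: pk_def ball_ind_def indicator_def)
 qed
 also have "\<dots> = - c * measure m (ball y d)" by (rule ball_ind_integral)
 also have "\<dots> < 0"
 proof -
  have "0 < measure m (ball y d)" using ball_pos[OF d(1), of y] ball_finite[of y d]
   by (simp add: measure_def enn2real_positive_iff)
  then show ?thesis using c by simp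
 qed
 finally show False using x' by simp
qed

end

section \<open>Truncation in the form\<close>

context vol_space
begin

abbreviation "Lap \<equiv> laplacian \<iota> \<nu> \<gamma> l m"

abbreviation decay :: "real \<Rightarrow> 'a \<Rightarrow> real \<Rightarrow> 'a \<Rightarrow> real" where
 "decay a x r y \<equiv> exp (- a * (dist x y / r))"

text \<open>The increments of \<open>u\<close> and of its negative part have opposite signs, hence
  so have the gradients; the negative part varies no more than \<open>u\<close> does and therefore
  stays in the domain.\<close>

lemma neg_part_form:
 assumes u: "u \<in> \<F>"
 shows "(\<lambda>z. max 0 (- u z)) \<in> \<F>" "form \<nu> \<gamma> l u (\<lambda>z. max 0 (- u z)) \<le> 0"
proof -
 let ?n = "\<lambda>z. max 0 (- u z)"
 note F = formD[OF u]
 have cont: "continuous_on UNIV ?n" using F(4) by (intro continuous_intros)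
 have nAC: "?n \<in> AC \<iota>"
 proof -
  have "abs_continuous_on_interval 0 d (?n \<circ> q)" if c: "local_arc_chart \<iota> q d" for q d
   unfolding abs_continuous_on_interval_def
  proof (intro allI impI)
   fix \<epsilon> :: real assume "0 < \<epsilon>"
   moreover have "abs_continuous_on_interval 0 d (u \<circ> q)" using F(1) c by (simp add: AC_def)
   ultimately obtain \<delta> where \<delta>: "\<delta> > 0" "\<And>(n::nat) s t. (\<forall>i<n. 0 \<le> s i \<and> s i \<le> t i \<and> t i \<le> d) \<and>
    disjoint_family_on (\<lambda>i. {s i<..<t i}) {..<n} \<and> (\<Sum>i<n. t i - s i) < \<delta> \<Longrightarrow>
    (\<Sum>i<n. \<bar>(u \<circ> q) (t i) - (u \<circ> q) (s i)\<bar>) < \<epsilon>"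
    unfolding abs_continuous_on_interval_def by meson
   show "\<exists>\<delta>>0. \<forall>(n::nat) s t. (\<forall>i<n. 0 \<le> s i \<and> s i \<le> t i \<and> t i \<le> d) \<and>
    disjoint_family_on (\<lambda>i. {s i<..<t i}) {..<n} \<and> (\<Sum>i<n. t i - s i) < \<delta> \<longrightarrow>
    (\<Sum>i<n. \<bar>(?n \<circ> q) (t i) - (?n \<circ> q) (s i)\<bar>) < \<epsilon>"
   proof (intro exI[of _ \<delta>] conjI \<delta>(1) allI impI)
    fix n :: nat and s t :: "nat \<Rightarrow> real"
    assume h: "(\<forall>i<n. 0 \<le> s i \<and> s i \<le> t i \<and> t i \<le> d) \<and>
     disjoint_family_on (\<lambda>i. {s i<..<t i}) {..<n} \<and> (\<Sum>i<n. t i - s i) < \<delta>"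
    have "(\<Sum>i<n. \<bar>(?n \<circ> q) (t i) - (?n \<circ> q) (s i)\<bar>) \<le> (\<Sum>i<n. \<bar>(u \<circ> q) (t i) - (u \<circ> q) (s i)\<bar>)"
     by (intro sum_mono) auto
    also have "\<dots> < \<epsilon>" by (rule \<delta>(2)[OF h])
    finally show "(\<Sum>i<n. \<bar>(?n \<circ> q) (t i) - (?n \<circ> q) (s i)\<bar>) < \<epsilon>" .
   qed
  qed
  then show ?thesis unfolding AC_def using cont by auto
 qed
 have S: "AE z in \<nu>. z \<in> S" by (rule AE_I2) (simp add: space_nu)
 have "?n \<in> Lp 2 m" by (rule Lp2_bound[OF F(2) continuous_measurable_m[OF cont]]) auto
 moreover have "grad ?n \<in> Lp 2 \<nu>"
 proof (rule Lp2_bound[OF F(3) weak_grad_measurable[OF cont]])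
  show "AE z in \<nu>. \<bar>grad ?n z\<bar> \<le> \<bar>grad u z\<bar>"
   using AE_grad_exists[OF F(1)] AE_grad_exists[OF nAC] S
  proof eventually_elim
   case (elim z)
   show ?case by (rule grad_abs_le[OF elim(3,2,1) zero_less_one]) auto
  qed
 qed
 ultimately show "?n \<in> \<F>" using nAC by (simp add: form_domain_def)
 have "AE z in \<nu>. grad u z * grad ?n z \<le> 0"
  using AE_grad_exists[OF F(1)] AE_grad_exists[OF nAC] S
 proof eventually_elim
  case (elim z)
  show ?case
  proof (rule grad_mult_nonpos[OF elim(3,1,2)])
   fix w
   show "(u w - u z) * (max 0 (- u w) - max 0 (- u z)) \<le> 0"
    by (cases "u w \<le> u z") (auto simp: mult_le_0_iff)
  qed
 qed
 then have "0 \<le> (\<integral>z. - (grad u z * grad ?n z) \<partial>\<nu>)"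
  by (intro integral_nonneg_AE) (auto elim: eventually_mono)
 then show "form \<nu> \<gamma> l u ?n \<le> 0" unfolding form_def by simp
qed

lemma laplacian_truncation:
 assumes "(f, k) \<in> Lap"
 shows "0 \<le> inner_L2 m k (\<lambda>x. max 0 (- f x))"
proof -
 obtain u where u: "f \<in> Lp 2 m" "k \<in> Lp 2 m" "u \<in> \<F>" "AE x in m. f x = u x" "\<And>v. v \<in> \<F> \<Longrightarrow> form \<nu> \<gamma> l u v = - inner_L2 m k v"
  using assms unfolding laplacian_def by blast
 have "0 \<le> inner_L2 m k (\<lambda>x. max 0 (- u x))"
  using neg_part_form[OF u(3)] u(5)[OF neg_part_form(1)[OF u(3)]] by simp
 also have "\<dots> = inner_L2 m k (\<lambda>x. max 0 (- f x))"
 proof (rule inner_L2_cong_AE)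
  show "AE x in m. max 0 (- u x) = max 0 (- f x)" using u(4) by eventually_elim simp
 qed (use Lp2_measurable[OF u(1)] Lp2_measurable[OF u(2)] Lp2_measurable[OF formD(2)[OF u(3)]] in auto)
 finally show ?thesis .
qed

lemma ball_emeasure: "emeasure m (ball x r) = ennreal (measure m (ball x r))"
 using ball_finite[of x r] by (simp add: emeasure_eq_ennreal_measure)

lemma ball_measure_pos: "0 < r \<Longrightarrow> 0 < measure m (ball x r)"
 using ball_lower[of r x] V_pos[of r] C_ge by (auto intro: less_le_trans[rotated])

end

locale heat_space = vol_space \<iota> e ty \<nu> \<gamma> l m V C
 for \<iota> e and ty :: "'a::{metric_space, second_countable_topology} itself"
  and \<nu> \<gamma> l m V C +
 fixes P :: "real \<Rightarrow> ('a \<Rightarrow> real) \<Rightarrow> 'a \<Rightarrow> real" and p :: "real \<Rightarrow> 'a \<Rightarrow> 'a \<Rightarrow> real"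
 assumes semigroup: "is_semigroup_of m (Lap) P"
  and heat_kernel: "is_heat_kernel m P p"
begin

sublocale H: heat_semigroup m "Lap" P p
proof
 show "compact (cball x r)" for x :: 'a and r using proper by (simp add: proper_space_def)
 show "0 < emeasure m (ball x r)" if "0 < r" for x r
  unfolding ball_emeasure using ball_measure_pos[OF that] by simp
qed (rule sets_m ball_finite semigroup heat_kernel laplacian_truncation; assumption?)+

end

section \<open>Heat kernel estimates\<close>

locale hke_space = heat_space \<iota> e ty \<nu> \<gamma> l m V C P p
 for \<iota> e and ty :: "'a::{metric_space, second_countable_topology} itself"
  and \<nu> \<gamma> l m V C P p +
 fixes \<Psi> :: "real \<Rightarrow> real" and C1 c2 \<delta> Cs \<beta>1 \<beta>2 :: real
 assumes C1_pos: "0 < C1" and c2_pos: "0 < c2" and \<delta>_pos: "0 < \<delta>" and Cs_ge: "1 < Cs" and \<beta>1_gt: "1 < \<beta>1"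
  and psi_pos: "\<And>r. 0 < r \<Longrightarrow> 0 < \<Psi> r"
  and psi_strict: "\<And>r R. 0 < r \<Longrightarrow> r < R \<Longrightarrow> \<Psi> r < \<Psi> R"
  and psi_surj: "\<And>t. 0 < t \<Longrightarrow> \<exists>r>0. \<Psi> r = t"
  and psi_lower: "\<And>r R. 0 < r \<Longrightarrow> r \<le> R \<Longrightarrow> (R / r) powr \<beta>1 / Cs \<le> \<Psi> R / \<Psi> r"
  and psi_upper: "\<And>r R. 0 < r \<Longrightarrow> r \<le> R \<Longrightarrow> \<Psi> R / \<Psi> r \<le> Cs * (R / r) powr \<beta>2"
  and hke_upper: "\<And>r. 0 < r \<Longrightarrow> AE q in m \<Otimes>\<^sub>M m.
   p (\<Psi> r) (fst q) (snd q) \<le> C1 / measure m (ball (fst q) r) * exp (- c2 * Phi \<Psi> (dist (fst q) (snd q)) (\<Psi> r))"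
  and hke_lower: "\<And>r. 0 < r \<Longrightarrow> AE q in m \<Otimes>\<^sub>M m. dist (fst q) (snd q) \<le> \<delta> * r \<longrightarrow>
   p (\<Psi> r) (fst q) (snd q) \<ge> (1 / C1) / measure m (ball (fst q) r)"
begin

text \<open>Every ball has positive measure, so a set of full measure is dense. This carries
  inequalities between continuous functions from almost every point to every point.\<close>

lemma closed_AE_imp_UNIV:
 fixes x :: 'a
 assumes "closed D" "AE z in m. z \<in> D"
 shows "x \<in> D"
proof (rule ccontr)
 assume "x \<notin> D"
 with assms(1) obtain r where r: "0 < r" "ball x r \<subseteq> - D"
  using openE[of "- D" x] by (auto simp: open_closed)
 obtain z where "dist x z < r" "z \<in> D" by (rule H.AE_dense[OF assms(2) r(1)])
 with r show False by auto
qed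

lemma closed_AE_pair_imp_UNIV:
 fixes x y :: 'a
 assumes "closed D" "AE q in m \<Otimes>\<^sub>M m. q \<in> D"
 shows "(x, y) \<in> D"
proof -
 interpret pair_sigma_finite m m by unfold_locales
 have "AE x in m. AE y in m. (x, y) \<in> D" by (rule AE_pair[OF assms(2)])
 then have "AE x in m. x \<in> (\<lambda>x. (x, y)) -` D"
 proof eventually_elim
  case (elim x)
  have "closed ((\<lambda>y. (x, y)) -` D)" by (rule closed_vimage[OF assms(1)]) (intro continuous_intros)
  from closed_AE_imp_UNIV[OF this, of y] elim show ?case by simp
 qed
 moreover have "closed ((\<lambda>x. (x, y)) -` D)" by (rule closed_vimage[OF assms(1)]) (intro continuous_intros)
 ultimately have "x \<in> (\<lambda>x. (x, y)) -` D" by (intro closed_AE_imp_UNIV)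
 then show ?thesis by simp
qed

text \<open>The choice of radius \<open>r\<close> in the supremum. The work is to show that the
  supremum is finite, without which the real \<open>SUP\<close> carries no information: as
  \<open>s\<close> tends to 0, \<open>\<Psi> r / \<Psi> s\<close> grows at least like the power
  \<beta>1 > 1 of \<open>1 / s\<close> and beats \<open>d / s\<close>.\<close>

lemma Phi_ge:
 assumes r: "0 < r" and d: "0 \<le> d"
 shows "d / r - 1 \<le> Phi \<Psi> d (\<Psi> r)"
proof -
 \<comment> \<open>For \<open>s \<le> 1\<close> the subtracted term is at least
   \<open>a * (1 / s) powr \<beta>1\<close>; the number \<open>M\<close> is where this overtakes
   \<open>d / s\<close>.\<close>
 define a where "a = \<Psi> r / (Cs * \<Psi> 1)"
 have a: "0 < a" unfolding a_def using psi_pos[OF r] psi_pos[of 1] Cs_ge by simp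
 define M where "M = max 1 ((d / a) powr (1 / (\<beta>1 - 1)))"
 have "bdd_above ((\<lambda>s. d / s - \<Psi> r / \<Psi> s) ` {0<..})"
 proof (rule bdd_aboveI2)
  fix s :: real assume "s \<in> {0<..}"
  then have s: "0 < s" by simp
  have ps: "0 < \<Psi> r / \<Psi> s" using psi_pos[OF r] psi_pos[OF s] by simp
  show "d / s - \<Psi> r / \<Psi> s \<le> d * M"
  proof (cases "1 / s \<le> M")
   case True
   then have "d * (1 / s) \<le> d * M" using d by (intro mult_left_mono)
   then show ?thesis using ps by simp
  next
   case False
   then have sM: "1 < 1 / s" "(d / a) powr (1 / (\<beta>1 - 1)) < 1 / s" by (auto simp: M_def)
   have s1: "s \<le> 1" using sM(1) s by (simp add: field_simps)
   have "((d / a) powr (1 / (\<beta>1 - 1))) powr (\<beta>1 - 1) \<le> (1 / s) powr (\<beta>1 - 1)"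
    using sM(2) \<beta>1_gt by (intro powr_mono2) auto
   then have "d / a \<le> (1 / s) powr (\<beta>1 - 1)" using \<beta>1_gt d a by (simp add: powr_powr)
   then have "d * (1 / s) \<le> a * (1 / s) powr (\<beta>1 - 1) * (1 / s)" using a s
    by (intro mult_right_mono) (simp_all add: field_simps)
   also have "\<dots> = a * (1 / s) powr \<beta>1"
    using powr_add[of "1 / s" "\<beta>1 - 1" 1] s by simp
   also have "\<dots> \<le> a * (Cs * (\<Psi> 1 / \<Psi> s))"
    using psi_lower[OF s s1] a Cs_ge by (intro mult_left_mono) (auto simp: field_simps)
   also have "\<dots> = \<Psi> r / \<Psi> s" unfolding a_def using psi_pos[of 1] Cs_ge by simp
   finally have "d / s - \<Psi> r / \<Psi> s \<le> 0" by simp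
   also have "0 \<le> d * M" using d by (simp add: M_def)
   finally show ?thesis .
  qed
 qed
 then have "d / r - \<Psi> r / \<Psi> r \<le> Phi \<Psi> d (\<Psi> r)" unfolding Phi_def using r by (intro cSUP_upper) auto
 then show ?thesis using psi_pos[OF r] by simp
qed

text \<open>At time \<open>\<Psi> r\<close> the sub-Gaussian factor is weakened to exponential decay
  at scale \<open>r\<close>; that is all the estimates below use, and it involves \<Psi> no
  longer.\<close>

lemma p_upper:
 assumes r: "0 < r"
 shows "p (\<Psi> r) x y \<le> C1 * C * exp c2 / V r * decay c2 x r y"
proof -
 let ?D = "{q. (\<lambda>(x, y). p (\<Psi> r) x y) q \<le> C1 * C * exp c2 / V r * exp (- c2 * (dist (fst q) (snd q) / r))}"
 have "(x, y) \<in> ?D"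
 proof (rule closed_AE_pair_imp_UNIV)
  show "closed ?D"
   by (intro closed_Collect_le H.p_continuous_space psi_pos r continuous_intros) (use r in auto)
  show "AE q in m \<Otimes>\<^sub>M m. q \<in> ?D"
   using hke_upper[OF r]
  proof eventually_elim
   case (elim q)
   have "- c2 * Phi \<Psi> (dist (fst q) (snd q)) (\<Psi> r) \<le> c2 - c2 * (dist (fst q) (snd q) / r)"
    using mult_left_mono[OF Phi_ge[OF r, of "dist (fst q) (snd q)"], of c2] c2_pos by (simp add: algebra_simps)
   then have "exp (- c2 * Phi \<Psi> (dist (fst q) (snd q)) (\<Psi> r)) \<le> exp c2 * exp (- c2 * (dist (fst q) (snd q) / r))"
    by (simp flip: exp_add)
   moreover have "C1 / measure m (ball (fst q) r) \<le> C1 * C / V r"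
    using ball_lower[OF r, of "fst q"] ball_measure_pos[OF r] V_pos[OF r] C1_pos C_ge by (simp add: field_simps)
   ultimately have "C1 / measure m (ball (fst q) r) * exp (- c2 * Phi \<Psi> (dist (fst q) (snd q)) (\<Psi> r)) \<le>
    C1 * C / V r * (exp c2 * exp (- c2 * (dist (fst q) (snd q) / r)))"
    using V_pos[OF r] C1_pos C_ge by (intro mult_mono) auto
   then show ?case using elim by (simp add: case_prod_beta)
  qed
 qed
 then show ?thesis by simp
qed

lemma p_lower:
 assumes r: "0 < r" and xy: "dist x y < \<delta> * r"
 shows "1 / (C1 * C * V r) \<le> p (\<Psi> r) x y"
proof -
 \<comment> \<open>The kernel bound is known for pairs at distance at most
   \<open>\<delta> * r\<close>, and adjoining the pairs at distance at least
   \<open>\<delta> * r\<close> keeps the set closed. This is why the hypothesis of the lemma is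
   strict.\<close>
 let ?D = "{q. 1 / (C1 * C * V r) \<le> (\<lambda>(x, y). p (\<Psi> r) x y) q} \<union> {q. \<delta> * r \<le> dist (fst q) (snd q)}"
 have "(x, y) \<in> ?D"
 proof (rule closed_AE_pair_imp_UNIV)
  show "closed ?D"
   by (intro closed_Un closed_Collect_le H.p_continuous_space psi_pos r continuous_intros)
  show "AE q in m \<Otimes>\<^sub>M m. q \<in> ?D"
   using hke_lower[OF r]
  proof eventually_elim
   case (elim q)
   have "1 / (C1 * C * V r) \<le> (1 / C1) / measure m (ball (fst q) r)"
    using ball_upper[OF r, of "fst q"] ball_measure_pos[OF r] V_pos[OF r] C1_pos C_ge by (simp add: field_simps)
   then show ?case using elim by (auto simp: case_prod_beta)
  qed
 qed
 then show ?thesis using xy by simp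
qed

end

section \<open>Integrals of exponentials and linear volume growth\<close>

context vol_space
begin

text \<open>Dyadic balls: the \<open>n\<close>-th has measure at most
  \<open>C * C ^ n * V r\<close>, while on its shell the exponential is of order
  \<open>exp (- a * 2 ^ n / 2)\<close>, so the sum over the shells is dominated by a geometric
  series whose constant does not depend on \<open>x\<close> and \<open>r\<close>.\<close>

lemma exp_dist_integral:
 assumes a: "0 < a"
 obtains B where "0 < B" "\<And>(x :: 'a) r. 0 < r \<Longrightarrow> integrable m (\<lambda>y. decay a x r y)"
  "\<And>(x :: 'a) r. 0 < r \<Longrightarrow> (\<integral>y. decay a x r y \<partial>m) \<le> B * V r"
proof -
 \<comment> \<open>From exp (-y) \<le> k! / y^k the shell \<open>n\<close> gains
   \<open>(1 / 2 ^ k) ^ n\<close>; with this \<open>k\<close> the gain beats the doubling factor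
   \<open>C ^ n\<close> and leaves \<open>(1 / 2) ^ n\<close>.\<close>
 obtain k :: nat where k: "2 * C \<le> 2 ^ k"
  using real_arch_pow[of 2 "2 * C"] by (auto intro: less_imp_le)
 define A where "A = exp a * fact k * (2 / a) ^ k * C"
 have A: "0 < A" using a C_ge by (simp add: A_def)
 have shell: "exp a * exp (- a * 2 ^ n / 2) * (C * C ^ n) \<le> A * (1 / 2) ^ n" for n :: nat
 proof -
  define y where "y = a * 2 ^ n / 2"
  have y: "0 < y" using a by (simp add: y_def)
  have "y ^ k / fact k \<le> exp y"
  proof -
   have "(\<Sum>i\<in>{k}. y ^ i /\<^sub>R fact i) \<le> (\<Sum>i. y ^ i /\<^sub>R fact i)"
    using y by (intro sum_le_suminf summable_exp_generic) auto
   then show ?thesis by (simp add: exp_def divide_inverse mult.commute)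
  qed
  then have "exp (- y) \<le> fact k / y ^ k" using y by (simp add: exp_minus field_simps)
  also have "\<dots> = fact k * (2 / a) ^ k * (1 / 2 ^ k) ^ n"
   unfolding y_def using a by (simp add: power_divide power_mult_distrib power_mult[symmetric] mult.commute)
  finally have "exp (- y) * C ^ n \<le> fact k * (2 / a) ^ k * (1 / 2 ^ k) ^ n * C ^ n"
   using C_ge by (intro mult_right_mono) auto
  also have "\<dots> = fact k * (2 / a) ^ k * (C / 2 ^ k) ^ n" by (simp add: power_divide)
  also have "\<dots> \<le> fact k * (2 / a) ^ k * (1 / 2) ^ n"
   using k C_ge a by (intro mult_left_mono power_mono) (auto simp: field_simps)
  finally have "(exp a * C) * (exp (- y) * C ^ n) \<le> (exp a * C) * (fact k * (2 / a) ^ k * (1 / 2) ^ n)"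
   using C_ge by (intro mult_left_mono) auto
  then show ?thesis by (simp add: A_def y_def ac_simps)
 qed
 have nn: "(\<integral>\<^sup>+y. ennreal (decay a x r y) \<partial>m) \<le> ennreal (2 * A * V r)" if r: "0 < r" for x :: 'a and r
 proof -
  let ?b = "\<lambda>n. exp a * exp (- a * 2 ^ n / 2)"
  have "(\<integral>\<^sup>+y. ennreal (decay a x r y) \<partial>m) \<le>
   (\<integral>\<^sup>+y. (\<Sum>n. ennreal (?b n) * indicator (ball x (2 ^ n * r)) y) \<partial>m)"
  proof (rule nn_integral_mono)
   fix y
   obtain n :: nat where n: "dist x y < 2 ^ n * r" "decay a x r y \<le> ?b n"
   proof -
    have "\<exists>n::nat. dist x y / r < 2 ^ n" by (rule real_arch_pow) simp
    \<comment> \<open>The least such \<open>n\<close> satisfies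
      \<open>2 ^ n \<le> 2 * (dist x y / r)\<close> unless it is 0; the factor \<open>exp a\<close>
      pays for the case 0.\<close>
    then obtain n :: nat where n: "dist x y / r < 2 ^ n" "\<And>i. i < n \<Longrightarrow> \<not> dist x y / r < 2 ^ i"
     using exists_least_iff[of "\<lambda>n. dist x y / r < 2 ^ n"] by auto
    have "2 ^ n \<le> 2 * (dist x y / r) + 2"
    proof (cases n)
     case 0 then show ?thesis using r by (simp add: field_simps)
    next
     case (Suc i) then show ?thesis using n(2)[of i] by simp
    qed
    then have "a * 2 ^ n \<le> a * (2 * (dist x y / r) + 2)" using a by (intro mult_left_mono) auto
    then have "- a * (dist x y / r) \<le> a + - a * 2 ^ n / 2" by (simp add: algebra_simps)
    then have "decay a x r y \<le> exp (a + - a * 2 ^ n / 2)" by (subst exp_le_cancel_iff)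
    then have "decay a x r y \<le> ?b n" unfolding exp_add .
    moreover have "dist x y < 2 ^ n * r" using n(1) r by (simp add: field_simps)
    ultimately show ?thesis by (rule that[rotated])
   qed
   have "ennreal (decay a x r y) \<le> (\<Sum>i\<in>{n}. ennreal (?b i) * indicator (ball x (2 ^ i * r)) y)"
    using n by (simp add: ennreal_leI)
   also have "\<dots> \<le> (\<Sum>i. ennreal (?b i) * indicator (ball x (2 ^ i * r)) y)"
    by (intro sum_le_suminf) auto
   finally show "ennreal (decay a x r y) \<le> (\<Sum>n. ennreal (?b n) * indicator (ball x (2 ^ n * r)) y)" .
  qed
  also have "\<dots> = (\<Sum>n. ennreal (?b n) * emeasure m (ball x (2 ^ n * r)))"
  proof (subst nn_integral_suminf)
   show "(\<lambda>y. ennreal (?b n) * indicator (ball x (2 ^ n * r)) y) \<in> borel_measurable m" for n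
    by (intro borel_measurable_times_ennreal borel_measurable_indicator borel_measurable_const) (simp add: sets_m)
  qed (simp add: sets_m nn_integral_cmult_indicator)
  also have "\<dots> \<le> (\<Sum>n. ennreal (A * V r * (1 / 2) ^ n))"
  proof (rule suminf_le)
   fix n :: nat
   have "ennreal (?b n) * emeasure m (ball x (2 ^ n * r)) = ennreal (?b n * measure m (ball x (2 ^ n * r)))"
    unfolding ball_emeasure by (simp add: ennreal_mult)
   also have "?b n * measure m (ball x (2 ^ n * r)) \<le> ?b n * (C * (C ^ n * V r))"
    using ball_upper[of "2 ^ n * r" x] V_double_pow[OF r, of n] r C_ge
    by (intro mult_left_mono) (auto intro: order_trans)
   also have "\<dots> = (?b n * (C * C ^ n)) * V r" by simp
   also have "\<dots> \<le> A * (1 / 2) ^ n * V r" using V_pos[OF r] by (intro mult_right_mono shell) auto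
   finally show "ennreal (?b n) * emeasure m (ball x (2 ^ n * r)) \<le> ennreal (A * V r * (1 / 2) ^ n)"
    by (simp add: ennreal_leI ac_simps)
  qed auto
  also have "\<dots> = ennreal (2 * A * V r)"
  proof (rule suminf_ennreal_eq)
   show "0 \<le> A * V r * (1 / 2) ^ n" for n using A V_pos[OF r] by simp
   show "(\<lambda>n. A * V r * (1 / 2) ^ n) sums (2 * A * V r)"
    using sums_mult[OF geometric_sums[of "1 / 2 :: real"], of "A * V r"] by (simp add: ac_simps)
  qed
  finally show ?thesis .
 qed
 have meas: "(\<lambda>y. decay a x r y) \<in> borel_measurable m" for x :: 'a and r
  unfolding measurable_m by measurable
 show ?thesis
 proof (rule that[of "2 * A"])
  show "0 < 2 * A" using A by simp
  fix x :: 'a and r :: real assume r: "0 < r"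
  have "(\<integral>\<^sup>+y. ennreal (decay a x r y) \<partial>m) < \<infinity>"
   using nn[OF r, of x] by (rule le_less_trans) simp
  with meas show i: "integrable m (\<lambda>y. decay a x r y)" by (intro integrableI_nonneg) auto
  have "ennreal (\<integral>y. decay a x r y \<partial>m) \<le> ennreal (2 * A * V r)"
   using nn[OF r, of x] nn_integral_eq_integral[OF i] by simp
  then show "(\<integral>y. decay a x r y \<partial>m) \<le> 2 * A * V r" using A V_pos[OF r] by (simp add: ennreal_le_iff)
 qed
qed

text \<open>By unboundedness a geodesic of length \<open>2 * real n * r\<close> exists; its points
  at distance \<open>2 * r\<close> from one another carry \<open>n\<close> disjoint balls inside one
  large ball.\<close>

lemma volume_linear_growth:
 fixes n :: nat
 assumes r: "0 < r" and n: "0 < n"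
 shows "real n * V r \<le> C\<^sup>2 * V (2 * real n * r)"
proof -
 fix x :: 'a
 obtain y where y: "dist x y = 2 * real n * r" using point_at_distance[of "2 * real n * r" x] r by auto
 obtain h where h: "geodesic h x y" using geodesic_exists ..
 have d: "dist (h (2 * real i * r)) (h (2 * real j * r)) = \<bar>2 * real i * r - 2 * real j * r\<bar>" if "i < n" "j < n" for i j
  using h that r unfolding geodesic_def y
  by (intro isometric_embeddingD[of "{0..2 * real n * r}"]) auto
 have sep: "2 * r \<le> dist (h (2 * real i * r)) (h (2 * real j * r))" if "i < n" "j < n" "i \<noteq> j" for i j
 proof -
  have "1 \<le> \<bar>real i - real j\<bar>" using that(3) by (cases i j rule: linorder_cases) auto
  then have "2 * r * 1 \<le> 2 * r * \<bar>real i - real j\<bar>" using r by (intro mult_left_mono) auto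
  also have "\<dots> = \<bar>2 * r * (real i - real j)\<bar>" using r by (simp add: abs_mult)
  finally show ?thesis using d[OF that(1,2)] by (simp add: algebra_simps)
 qed
 let ?W = "(\<lambda>i. h (2 * real i * r)) ` {..<n}"
 have inj: "inj_on (\<lambda>i. h (2 * real i * r)) {..<n}"
 proof (rule inj_onI)
  fix i j assume "i \<in> {..<n}" "j \<in> {..<n}" "h (2 * real i * r) = h (2 * real j * r)"
  then show "i = j" using sep[of i j] r by auto
 qed
 have "real (card ?W) * (V r / C) \<le> C * V (2 * real n * r)"
 proof (rule disjoint_balls_card)
  show "ball w r \<subseteq> ball x (2 * real n * r)" if w: "w \<in> ?W" for w
  proof -
   from w obtain i where i: "i < n" "w = h (2 * real i * r)" by blast
   have "dist x w = 2 * real i * r" using d[OF n i(1)] h i n r by (simp add: geodesic_def)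
   moreover have "(2 * real i + 1) * r \<le> 2 * real n * r" using i(1) r by (intro mult_right_mono) auto
   ultimately have *: "dist x w + r \<le> 2 * real n * r" by (simp add: algebra_simps)
   show ?thesis
   proof
    fix z assume "z \<in> ball w r"
    then show "z \<in> ball x (2 * real n * r)" using * dist_triangle[of x z w] by simp
   qed
  qed
 qed (use r n sep in auto)
 then have "real n * (V r / C) \<le> C * V (2 * real n * r)" unfolding card_image[OF inj] by simp
 then show ?thesis using C_ge by (simp add: field_simps power2_eq_square)
qed

end

lemma (in vol_space) V_scale:
 assumes "0 < a"
 obtains D where "0 < D" "\<And>r. 0 < r \<Longrightarrow> V r \<le> D * V (a * r)"
proof -
 obtain n :: nat where n: "1 / a < 2 ^ n" using real_arch_pow[of 2 "1 / a"] by auto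
 show ?thesis
 proof (rule that[of "C ^ n"])
  show "0 < C ^ n" using C_ge by simp
  fix r :: real assume r: "0 < r"
  have "r \<le> 2 ^ n * (a * r)" using n assms r by (simp add: field_simps)
  then have "V r \<le> V (2 ^ n * (a * r))" using r by (intro V_mono)
  also have "\<dots> \<le> C ^ n * V (a * r)" using assms r by (intro V_double_pow) simp
  finally show "V r \<le> C ^ n * V (a * r)" .
 qed
qed

lemma (in vol_space) exp_dist_Lp:
 assumes "0 < a" "0 < q"
 obtains B where "0 < B" "\<And>(x :: 'a) r. 0 < r \<Longrightarrow> (\<lambda>y. decay a x r y) \<in> Lp q m"
  "\<And>(x :: 'a) r. 0 < r \<Longrightarrow> (\<integral>y. decay a x r y powr q \<partial>m) \<le> B * V r"
proof -
 have "0 < q * a" using assms by simp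
 then obtain B where B: "0 < B" "\<And>(x :: 'a) r. 0 < r \<Longrightarrow> integrable m (\<lambda>y. decay (q * a) x r y)"
  "\<And>(x :: 'a) r. 0 < r \<Longrightarrow> (\<integral>y. decay (q * a) x r y \<partial>m) \<le> B * V r"
  by (rule exp_dist_integral) (rule that)
 have eq: "decay a x r y powr q = decay (q * a) x r y" for x y :: 'a and r
  by (simp add: powr_def ac_simps)
 have meas: "(\<lambda>y. decay a x r y) \<in> borel_measurable m" for x :: 'a and r
  unfolding measurable_m by measurable
 show ?thesis
 proof (rule that[OF B(1)])
  fix x :: 'a and r :: real assume r: "0 < r"
  show "(\<lambda>y. decay a x r y) \<in> Lp q m"
   unfolding Lp_iff abs_exp_cancel eq using meas B(2)[OF r] by blast
  show "(\<integral>y. decay a x r y powr q \<partial>m) \<le> B * V r" unfolding eq by (rule B(3)[OF r])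
 qed
qed

section \<open>Heat averages of balls and their energy\<close>

context hke_space
begin

abbreviation "ball_ind \<equiv> H.ball_ind"
abbreviation "U \<equiv> H.U"

lemma psi_mono: "0 < r \<Longrightarrow> r \<le> R \<Longrightarrow> \<Psi> r \<le> \<Psi> R"
 using psi_strict[of r R] by (cases "r = R") auto

lemma psi_between:
 assumes "0 < r" "\<Psi> r < s" "s \<le> \<Psi> R" "0 < R"
 obtains w where "r \<le> w" "w \<le> R" "s = \<Psi> w"
proof -
 have "0 < s" using psi_pos[OF assms(1)] assms(2) by simp
 then obtain w where w: "0 < w" "\<Psi> w = s" using psi_surj by blast
 have "r \<le> w" using psi_mono[OF w(1), of r] w assms by (cases "r \<le> w") auto
 moreover have "w \<le> R" using psi_strict[OF assms(4), of w] w assms by (cases "w \<le> R") auto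
 ultimately show ?thesis using that w by blast
qed

lemma U_ball_integrable:
 assumes w: "0 < w"
 shows "integrable m (\<lambda>z. H.pk (\<Psi> w) y z * ball_ind x r z)"
proof (rule Bochner_Integration.integrable_bound)
 let ?M = "C1 * C * exp c2 / V w"
 show "integrable m (\<lambda>z. ?M * ball_ind x r z)" by (rule H.ball_ind_integral)
 show "(\<lambda>z. H.pk (\<Psi> w) y z * ball_ind x r z) \<in> borel_measurable m"
  by (intro borel_measurable_times H.pk_measurable2 Lp2_measurable[OF H.ball_ind_L2(1)])
 show "AE z in m. norm (H.pk (\<Psi> w) y z * ball_ind x r z) \<le> norm (?M * ball_ind x r z)"
 proof (rule AE_I2)
  fix z
  have M: "0 \<le> ?M" using C1_pos C_ge V_pos[OF w] by simp
  have "p (\<Psi> w) y z \<le> ?M * decay c2 y w z" by (rule p_upper[OF w])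
  also have "\<dots> \<le> ?M * 1" using w c2_pos M by (intro mult_left_mono) auto
  finally have "\<bar>p (\<Psi> w) y z\<bar> \<le> \<bar>?M\<bar>" using H.p_nonneg[OF psi_pos[OF w], of y z] M by linarith
  then show "norm (H.pk (\<Psi> w) y z * ball_ind x r z) \<le> norm (?M * ball_ind x r z)"
   using psi_pos[OF w] unfolding real_norm_def abs_mult[of _ "ball_ind x r z"]
   by (intro mult_right_mono) (simp_all add: H.pk_def)
 qed
qed

lemma U_ball_nonneg:
 assumes w: "0 < w"
 shows "0 \<le> U (ball_ind x r) (\<Psi> w) y"
 unfolding H.U_def using H.p_nonneg[OF psi_pos[OF w]] psi_pos[OF w]
 by (intro Bochner_Integration.integral_nonneg) (auto simp: H.pk_def H.ball_ind_def)

text \<open>As \<open>r \<le> w\<close>, moving the centre of the exponential from a point of the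
  ball to \<open>x\<close> costs only the factor \<open>exp c2\<close>.\<close>

lemma U_ball_upper:
 assumes r: "0 < r" "r \<le> w"
 shows "U (ball_ind x r) (\<Psi> w) y \<le> C1 * C\<^sup>2 * exp (2 * c2) * (V r / V w) * decay c2 x w y"
proof -
 have w: "0 < w" using r by simp
 let ?M = "C1 * C * exp c2 / V w * (exp c2 * decay c2 x w y)"
 have M: "0 \<le> ?M" using C1_pos C_ge V_pos[OF w] by simp
 have "U (ball_ind x r) (\<Psi> w) y \<le> (\<integral>z. ?M * ball_ind x r z \<partial>m)"
  unfolding H.U_def
 proof (rule integral_mono[OF U_ball_integrable[OF w]])
  show "integrable m (\<lambda>z. ?M * ball_ind x r z)" by (rule H.ball_ind_integral)
  fix z
  show "H.pk (\<Psi> w) y z * ball_ind x r z \<le> ?M * ball_ind x r z"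
  proof (cases "z \<in> ball x r")
   case True
   have "dist x y \<le> dist y z + w" using True r dist_triangle[of x y z] by (simp add: dist_commute)
   then have "c2 * (dist x y / w) \<le> c2 * (dist y z / w + 1)"
    using w c2_pos by (intro mult_left_mono) (auto simp: field_simps)
   then have "decay c2 y w z \<le> exp c2 * decay c2 x w y"
    by (simp add: algebra_simps flip: exp_add)
   then have "C1 * C * exp c2 / V w * decay c2 y w z \<le> ?M"
    using C1_pos C_ge V_pos[OF w] by (intro mult_left_mono) auto
   with p_upper[OF w, of y z] have "p (\<Psi> w) y z \<le> ?M" by simp
   then show ?thesis using True psi_pos[OF w] by (simp add: H.ball_ind_def H.pk_def)
  qed (simp add: H.ball_ind_def)
 qed
 also have "\<dots> = ?M * measure m (ball x r)" by (simp add: H.ball_ind_def sets_m space_m)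
 also have "\<dots> \<le> ?M * (C * V r)" by (intro mult_left_mono ball_upper r M)
 also have "\<dots> = C1 * C\<^sup>2 * (exp c2 * exp c2) * (V r / V w) * decay c2 x w y" by (simp add: power2_eq_square)
 also have "exp c2 * exp c2 = exp (2 * c2)" by (simp flip: exp_add)
 finally show ?thesis .
qed

text \<open>Points of the ball of radius \<open>h * r\<close> about \<open>x\<close> are within
  \<open>2 * h * r \<le> \<delta> * w\<close> of each other, where the near-diagonal bound holds;
  positivity of the kernel allows the rest of the ball to be dropped.\<close>

lemma U_ball_lower:
 assumes r: "0 < r" "r \<le> w" and h: "0 < h" "2 * h \<le> 1" "2 * h \<le> \<delta>" and xy: "dist x y < h * r"
 shows "V (h * r) / (C1 * C\<^sup>2 * V w) \<le> U (ball_ind x r) (\<Psi> w) y"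
proof -
 have w: "0 < w" using r by simp
 have hr: "0 < h * r" "h * r \<le> r" using h r by (auto simp: mult_le_cancel_right1)
 let ?c = "1 / (C1 * C * V w)"
 have c: "0 \<le> ?c" using C1_pos C_ge V_pos[OF w] by simp
 have "V (h * r) / (C1 * C\<^sup>2 * V w) = ?c * (V (h * r) / C)" by (simp add: power2_eq_square)
 also have "\<dots> \<le> ?c * measure m (ball x (h * r))" by (intro mult_left_mono ball_lower hr c)
 also have "\<dots> = (\<integral>z. ?c * ball_ind x (h * r) z \<partial>m)" by (simp add: H.ball_ind_def sets_m space_m)
 also have "\<dots> \<le> U (ball_ind x r) (\<Psi> w) y"
  unfolding H.U_def
 proof (rule integral_mono[OF _ U_ball_integrable[OF w]])
  show "integrable m (\<lambda>z. ?c * ball_ind x (h * r) z)" by (rule H.ball_ind_integral)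
  fix z
  show "?c * ball_ind x (h * r) z \<le> H.pk (\<Psi> w) y z * ball_ind x r z"
  proof (cases "z \<in> ball x (h * r)")
   case True
   have "dist y z < 2 * h * r" using True xy dist_triangle[of y z x] by (simp add: dist_commute)
   also have "\<dots> \<le> \<delta> * w" using h r \<delta>_pos by (intro mult_mono) auto
   finally have "?c \<le> p (\<Psi> w) y z" by (rule p_lower[OF w])
   moreover have "z \<in> ball x r" using True hr by simp
   ultimately show ?thesis using True psi_pos[OF w] by (simp add: H.ball_ind_def H.pk_def)
  next
   case False
   then show ?thesis using H.p_nonneg[OF psi_pos[OF w], of y z] psi_pos[OF w] by (simp add: H.ball_ind_def H.pk_def)
  qed
 qed
 finally show ?thesis .
qed

text \<open>\<open>k\<close> stands for \<Delta> u, so the last line says that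
  \<open>- \<Delta> u\<close> is at least \<open>c / \<Psi> r\<close> near \<open>x\<close>: a bump
  of width \<open>r\<close> with a definite source at its centre.\<close>

definition heat_average :: "real \<Rightarrow> real \<Rightarrow> real \<Rightarrow> real \<Rightarrow> 'a \<Rightarrow> real \<Rightarrow> ('a \<Rightarrow> real) \<Rightarrow> ('a \<Rightarrow> real) \<Rightarrow> bool" where
 "heat_average a h c B x r u k \<longleftrightarrow>
   u \<in> \<F> \<and> (u, k) \<in> Lap \<and> (\<forall>v\<in>\<F>. form \<nu> \<gamma> l u v = - inner_L2 m k v) \<and>
   (\<forall>y. 0 \<le> u y \<and> u y \<le> B * decay a x r y) \<and>
   (\<forall>y. \<bar>k y\<bar> \<le> B / \<Psi> r * decay a x r y) \<and>
   (\<forall>y. dist x y < h * r \<longrightarrow> c \<le> u y \<and> c / \<Psi> r \<le> - k y)"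

text \<open>The flow of the ball is averaged from time \<open>\<Psi> r\<close> to
  \<open>\<Psi> (K * r)\<close>. Its value near \<open>x\<close> at the first time is at least
  \<open>c0\<close>, and by linear volume growth it is at most \<open>c0 / 2\<close> everywhere at
  the last time, so it drops by a definite amount; this drop divided by the elapsed time is
  \<open>- \<Delta> u\<close>.\<close>

lemma heat_average_exists:
 obtains a h c B where "0 < a" "0 < h" "h \<le> 1 / 2" "0 < c" "0 < B"
  "\<And>x r. 0 < r \<Longrightarrow> \<exists>u k. heat_average a h c B x r u k"
proof -
 define h where "h = min 1 \<delta> / 2"
 have h: "0 < h" "2 * h \<le> 1" "2 * h \<le> \<delta>" using \<delta>_pos by (auto simp: h_def)
 obtain Dh where Dh: "0 < Dh" "\<And>r. 0 < r \<Longrightarrow> V r \<le> Dh * V (h * r)" by (rule V_scale[OF h(1)]) (rule that)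
 define C3 where "C3 = C1 * C\<^sup>2 * exp (2 * c2)"
 have C3: "0 < C3" using C1_pos C_ge by (simp add: C3_def)
 define c0 where "c0 = 1 / (C1 * C\<^sup>2 * Dh)"
 have c0: "0 < c0" using C1_pos C_ge Dh by (simp add: c0_def)
 \<comment> \<open>The bound by \<open>Cs\<close> makes the elapsed time at least
   \<open>\<Psi> r\<close>; the other one makes the late flow at most \<open>c0 / 2\<close>, since
   \<open>V r / V (K * r)\<close> is at most \<open>C\<^sup>2 / real n\<close>.\<close>
 obtain n :: nat where n: "max Cs (C3 * C\<^sup>2 * 2 / c0) < real n" using reals_Archimedean2 by blast
 then have n1: "0 < n" "Cs < real n" "C3 * C\<^sup>2 / real n < c0 / 2"
  using Cs_ge c0 by (auto simp: field_simps intro: Nat.gr0I)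
 define K where "K = 2 * real n"
 have K: "1 \<le> K" "0 < K" using n1 by (auto simp: K_def)
 obtain DK where DK: "0 < DK" "\<And>r. 0 < r \<Longrightarrow> V r \<le> DK * V (1 / K * r)"
  using V_scale[of "1 / K"] K by (metis zero_less_divide_1_iff)
 define CT where "CT = Cs * K powr \<beta>2"
 have CT: "0 < CT" using Cs_ge K by (simp add: CT_def)
 \<comment> \<open>The first entry bounds the average itself, with \<open>DK\<close> for the growth
   of \<open>V\<close> up to radius \<open>K * r\<close>; the second bounds half of
   \<open>c0\<close> divided by an elapsed time of at most \<open>CT * \<Psi> r\<close>.\<close>
 define c where "c = min (c0 / DK) (c0 / (2 * CT))"
 have c: "0 < c" "c \<le> c0 / DK" "c \<le> c0 / (2 * CT)" using c0 DK CT by (auto simp: c_def)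
 \<comment> \<open>All times of the average correspond to radii up to \<open>K * r\<close>, and the
   slowest decay is the one at that largest scale.\<close>
 define a where "a = c2 / K"
 have a: "0 < a" using c2_pos K by (simp add: a_def)
 have "\<exists>u k. heat_average a h c (2 * C3) x r u k" if r: "0 < r" for x r
 proof -
  let ?g = "ball_ind x r" and ?E = "\<lambda>y. decay a x r y"
  define t1 t2 where "t1 = \<Psi> r" and "t2 = \<Psi> (K * r)"
  have Kr: "0 < K * r" "r \<le> K * r" using K r by auto
  have g: "?g \<in> Lp 2 m" by (rule H.ball_ind_L2)
  have t1: "0 < t1" unfolding t1_def by (rule psi_pos[OF r])
  have T: "t1 \<le> t2 - t1" "t2 - t1 \<le> CT * t1"
  proof -
   have "2 * Cs \<le> K powr 1" using n1 K by (simp add: K_def)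
   also have "\<dots> \<le> K powr \<beta>1" using K \<beta>1_gt by (intro powr_mono) auto
   finally have "2 \<le> K powr \<beta>1 / Cs" using Cs_ge by (simp add: field_simps)
   also have "\<dots> \<le> t2 / t1" using psi_lower[OF r Kr(2)] r unfolding t1_def t2_def by simp
   finally show "t1 \<le> t2 - t1" using t1 by (simp add: field_simps)
   have "t2 / t1 \<le> CT" using psi_upper[OF r Kr(2)] r unfolding t1_def t2_def CT_def by simp
   then show "t2 - t1 \<le> CT * t1" using t1 by (simp add: field_simps)
  qed
  have ab: "t1 < t2" using T t1 by simp
  have Up: "U ?g (\<Psi> w) y \<le> C3 * ?E y" if w: "r \<le> w" "w \<le> K * r" for w y
  proof -
   have s0: "0 < w" using w r by simp
   have "U ?g (\<Psi> w) y \<le> C3 * (V r / V w) * decay c2 x w y" unfolding C3_def by (rule U_ball_upper[OF r w(1)])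
   also have "\<dots> \<le> C3 * 1 * ?E y"
   proof (intro mult_mono)
    show "V r / V w \<le> 1" using V_mono[OF r w(1)] V_pos[OF s0] by simp
    have "dist x y / (K * r) \<le> dist x y / w" using w s0 by (intro divide_left_mono) auto
    then have "c2 * (dist x y / (K * r)) \<le> c2 * (dist x y / w)" using c2_pos by (intro mult_left_mono) auto
    then show "decay c2 x w y \<le> ?E y" by (simp add: a_def)
   qed (use C3 V_pos[OF r] V_pos[OF s0] in auto)
   finally show ?thesis by simp
  qed
  have Lo: "c0 / DK \<le> U ?g (\<Psi> w) y" if w: "r \<le> w" "w \<le> K * r" and y: "dist x y < h * r" for w y
  proof -
   have s0: "0 < w" using w r by simp
   have "V w \<le> V (K * r)" by (rule V_mono[OF s0 w(2)])
   also have "\<dots> \<le> DK * V r" using DK(2)[OF Kr(1)] K by simp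
   also have "\<dots> \<le> DK * (Dh * V (h * r))" using DK(1) Dh(2)[OF r] by (intro mult_left_mono) auto
   finally have "c0 / DK \<le> V (h * r) / (C1 * C\<^sup>2 * V w)"
    unfolding c0_def using DK Dh(1) C1_pos C_ge V_pos[OF s0] by (simp add: field_simps)
   also have "\<dots> \<le> U ?g (\<Psi> w) y" by (rule U_ball_lower[OF r w(1) h y])
   finally show ?thesis .
  qed
  have Lo1: "c0 \<le> U ?g t1 y" if y: "dist x y < h * r" for y
  proof -
   have "c0 \<le> V (h * r) / (C1 * C\<^sup>2 * V r)"
    unfolding c0_def using Dh(1) Dh(2)[OF r] C1_pos C_ge V_pos[OF r] by (simp add: field_simps)
   also have "\<dots> \<le> U ?g t1 y" unfolding t1_def by (rule U_ball_lower[OF r order_refl h y])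
   finally show ?thesis .
  qed
  have Up2: "U ?g t2 y \<le> c0 / 2" for y
  proof -
   have "V r / V (K * r) \<le> C\<^sup>2 / real n"
    using volume_linear_growth[OF r n1(1)] V_pos[OF Kr(1)] n1(1) by (simp add: K_def field_simps)
   then have "C3 * (V r / V (K * r)) * exp (- c2 * (dist x y / (K * r))) \<le> C3 * (C\<^sup>2 / real n) * 1"
    using C3 c2_pos Kr V_pos[OF r] V_pos[OF Kr(1)] by (intro mult_mono) auto
   with U_ball_upper[OF r Kr(2), of x y] have "U ?g t2 y \<le> C3 * (C\<^sup>2 / real n) * 1"
    unfolding C3_def[symmetric] t2_def by (rule order_trans)
   also have "\<dots> = C3 * C\<^sup>2 / real n" by simp
   finally show ?thesis using n1(3) by linarith
  qed
  have s_range: "\<exists>w. r \<le> w \<and> w \<le> K * r \<and> s = \<Psi> w" if "t1 < s" "s \<le> t2" for s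
   using psi_between[OF r that[unfolded t1_def t2_def] Kr(1)] by blast
  have U0: "0 \<le> U ?g s y" "U ?g s y \<le> C3 * ?E y" if s: "t1 < s" "s \<le> t2" for s y
   using s_range[OF s] r U_ball_nonneg[of _ x r y] Up by auto
  have "(0::real) < 2" by simp
  then have E2: "?E \<in> Lp 2 m" by (rule exp_dist_Lp[OF a]) (use r in blast)
  have B: "(norm_L2 m (U ?g s))\<^sup>2 \<le> (norm_L2 m (\<lambda>y. C3 * ?E y))\<^sup>2" if s: "t1 < s" "s \<le> t2" for s
  proof (rule power_mono[OF norm_L2_mono_AE norm_L2_nonneg])
   show "U ?g s \<in> borel_measurable m" by (rule H.U_measurable1[OF Lp2_measurable[OF g]])
   show "(\<lambda>y. C3 * ?E y) \<in> Lp 2 m" by (rule Lp2_scale[OF E2])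
   show "AE y in m. \<bar>U ?g s y\<bar> \<le> \<bar>C3 * ?E y\<bar>" using U0[OF s] C3 by (intro AE_I2) simp
  qed
  let ?k = "\<lambda>y. (U ?g t2 y - U ?g t1 y) / (t2 - t1)"
  have "(H.avg ?g t1 t2, ?k) \<in> Lap" by (rule H.avg_in_domain[OF g t1 ab B])
  then obtain u where u: "?k \<in> Lp 2 m" "u \<in> \<F>" "AE y in m. H.avg ?g t1 t2 y = u y"
   "\<And>v. v \<in> \<F> \<Longrightarrow> form \<nu> \<gamma> l u v = - inner_L2 m ?k v"
   unfolding laplacian_def by blast
  have uk: "(u, ?k) \<in> Lap"
   unfolding laplacian_def using u formD(2)[OF u(2)] by (auto intro!: bexI[of _ u])
  have ui: "AE y in m. integrable (leb_on t1 t2) (\<lambda>s. U ?g s y)"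
   by (rule H.U_time_average(1)[OF g t1 less_imp_le[OF ab] B])
  have avg_bounds: "0 \<le> u y \<and> u y \<le> C3 * ?E y \<and> (dist x y < h * r \<longrightarrow> c \<le> u y)"
   if eq: "H.avg ?g t1 t2 y = u y" and i: "integrable (leb_on t1 t2) (\<lambda>s. U ?g s y)" for y
  proof -
   interpret T: finite_measure "leb_on t1 t2" by (rule finite_leb_on) (use ab in simp)
   have u_eq: "(\<integral>s. U ?g s y \<partial>leb_on t1 t2) = (t2 - t1) * u y"
    using eq ab by (simp add: H.avg_def field_simps)
   have AEs: "AE s in leb_on t1 t2. 0 \<le> U ?g s y \<and> U ?g s y \<le> C3 * ?E y"
    using AE_leb_on by eventually_elim (use U0 in auto)
   have "(\<integral>s. 0 \<partial>leb_on t1 t2) \<le> (\<integral>s. U ?g s y \<partial>leb_on t1 t2)"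
    using AEs by (intro integral_mono_AE i) auto
   moreover have "(\<integral>s. U ?g s y \<partial>leb_on t1 t2) \<le> (\<integral>s. C3 * ?E y \<partial>leb_on t1 t2)"
    using AEs by (intro integral_mono_AE i) auto
   moreover have "(\<integral>s. c \<partial>leb_on t1 t2) \<le> (\<integral>s. U ?g s y \<partial>leb_on t1 t2)" if y: "dist x y < h * r"
   proof (intro integral_mono_AE i)
    show "AE s in leb_on t1 t2. c \<le> U ?g s y"
     using AE_leb_on
    proof eventually_elim
     case (elim s)
     then show ?case using s_range[of s] Lo[OF _ _ y] c(2) by fastforce
    qed
   qed simp
   ultimately show ?thesis
    unfolding u_eq leb_on_const[OF less_imp_le[OF ab]] using ab by (simp add: zero_le_mult_iff)
  qed
  have AEb: "AE y in m. 0 \<le> u y \<and> u y \<le> C3 * ?E y \<and> (dist x y < h * r \<longrightarrow> c \<le> u y)"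
   using u(3) ui by eventually_elim (rule avg_bounds)
  \<comment> \<open>The representative in the form domain is continuous, so its almost everywhere
    bounds hold everywhere; the alternative \<open>h * r \<le> dist x y\<close> keeps the set
    closed.\<close>
  have u_bounds: "0 \<le> u y \<and> u y \<le> C3 * ?E y \<and> (dist x y < h * r \<longrightarrow> c \<le> u y)" for y
  proof -
   let ?D = "{y. 0 \<le> u y} \<inter> {y. u y \<le> C3 * ?E y} \<inter> ({y. h * r \<le> dist x y} \<union> {y. c \<le> u y})"
   have "closed ?D"
    by (intro closed_Int closed_Un closed_Collect_le continuous_intros formD(4)[OF u(2)]) (use r in auto)
   moreover have "AE y in m. y \<in> ?D" using AEb by eventually_elim auto
   ultimately have "y \<in> ?D" by (rule closed_AE_imp_UNIV)
   then show ?thesis by auto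
  qed
  have k_up: "\<bar>?k y\<bar> \<le> 2 * C3 / \<Psi> r * ?E y" for y
  proof -
   have "\<bar>U ?g t2 y - U ?g t1 y\<bar> \<le> 2 * C3 * ?E y"
    using Up[of r y] Up[of "K * r" y] U_ball_nonneg[OF r, of x r y] U_ball_nonneg[OF Kr(1), of x r y] Kr
    unfolding t1_def t2_def by simp
   then have "\<bar>?k y\<bar> \<le> 2 * C3 * ?E y / (t2 - t1)" using ab by (simp add: abs_divide divide_right_mono)
   also have "\<dots> \<le> 2 * C3 * ?E y / t1" using T t1 C3 by (intro divide_left_mono) auto
   finally show ?thesis by (simp add: t1_def)
  qed
  have k_lo: "c / \<Psi> r \<le> - ?k y" if y: "dist x y < h * r" for y
  proof -
   have "c / \<Psi> r \<le> c0 / (2 * CT) / t1" using c(3) t1 unfolding t1_def[symmetric] by (intro divide_right_mono) auto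
   also have "\<dots> = (c0 / 2) / (CT * t1)" by simp
   also have "\<dots> \<le> (c0 / 2) / (t2 - t1)" using T t1 c0 CT ab by (intro divide_left_mono) auto
   also have "\<dots> \<le> (U ?g t1 y - U ?g t2 y) / (t2 - t1)" using Lo1[OF y] Up2[of y] ab by (intro divide_right_mono) auto
   also have "\<dots> = - ?k y" by (metis minus_diff_eq minus_divide_left)
   finally show ?thesis .
  qed
  have "u y \<le> 2 * C3 * ?E y" for y using u_bounds[of y] C3 by (auto intro: order_trans)
  then show ?thesis unfolding heat_average_def using u uk u_bounds k_up k_lo
   by (intro exI[of _ u] exI[of _ ?k]) simp
 qed
 then show ?thesis using a h c C3 by (intro that[of a h c "2 * C3"]) simp_all
qed

definition energy_bounds :: "real \<Rightarrow> real \<Rightarrow> 'a \<Rightarrow> real \<Rightarrow> ('a \<Rightarrow> real) \<Rightarrow> ('a \<Rightarrow> real) \<Rightarrow> bool" where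
 "energy_bounds a A x r u k \<longleftrightarrow>
   u \<in> \<F> \<and> (u, k) \<in> Lap \<and> (\<forall>y. 0 \<le> u y \<and> u y \<le> A * decay a x r y) \<and>
   norm_L2 m k * sqrt (V r) \<le> A / r \<and> 1 \<le> A * (r * (gnorm u)\<^sup>2) \<and>
   (gnorm u)\<^sup>2 \<le> A / r \<and> (AE z in \<nu>. \<bar>grad u z\<bar> \<le> A / r)"

text \<open>Write v = V(r), t = \<Psi>(r) and N^2 for the energy. Testing the equation with
  \<open>u\<close> gives N^2 \<le> A1 v/t (\<open>E1\<close>), testing with the cutoff gives N^2
  \<ge> A2 r (v/t)^2 (\<open>E2\<close>), and together they bound r v by a multiple of t. Morrey's
  inequality turns the drop of \<open>u\<close> over the distance M r into a lower bound for r N^2,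
  hence by \<open>E1\<close> a bound of t by a multiple of r v. With t \<approx> r v known, N^2 is
  comparable to 1/r.\<close>

lemma energy_estimates:
 obtains r0 a A where "0 < r0" "0 < a" "0 < A"
  "\<And>x r. 0 < r \<Longrightarrow> r \<le> r0 \<Longrightarrow> r * V r \<le> A * \<Psi> r \<and> \<Psi> r \<le> A * (r * V r) \<and>
   (\<exists>u k. energy_bounds a A x r u k)"
proof -
 obtain a q c B where a: "0 < a" and q: "0 < q" "q \<le> 1 / 2" and c: "0 < c" and B: "0 < B"
  and test: "\<And>x r. 0 < r \<Longrightarrow> \<exists>u k. heat_average a q c B x r u k"
  by (rule heat_average_exists) (rule that)
 have "(0::real) < 2" by simp
 then obtain B2 where B2: "0 < B2" "\<And>(x :: 'a) r. 0 < r \<Longrightarrow> (\<lambda>y. decay a x r y) \<in> Lp 2 m"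
  "\<And>(x :: 'a) r. 0 < r \<Longrightarrow> (\<integral>y. decay a x r y powr 2 \<partial>m) \<le> B2 * V r"
  by (rule exp_dist_Lp[OF a]) (rule that)
 have exp_norm: "norm_L2 m f \<le> K * sqrt (B2 * V r)"
  if "f \<in> borel_measurable m" "\<And>y. \<bar>f y\<bar> \<le> K * decay a x r y" "0 \<le> K" "0 < r" for f K r and x :: 'a
 proof -
  let ?E = "\<lambda>y. decay a x r y"
  have "norm_L2 m f \<le> norm_L2 m (\<lambda>y. K * ?E y)"
  proof (intro norm_L2_mono_AE that(1) Lp2_scale B2(2) that(4) AE_I2)
   show "\<bar>f y\<bar> \<le> \<bar>K * ?E y\<bar>" for y using that(2)[of y] by linarith
  qed
  also have "\<dots> = K * norm_L2 m ?E" unfolding norm_L2_scale using that(3) by simp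
  also have "norm_L2 m ?E = sqrt (\<integral>y. ?E y powr 2 \<partial>m)" by (simp add: norm_L2_eq powr_numeral)
  also have "K * \<dots> \<le> K * sqrt (B2 * V r)" by (intro mult_left_mono real_sqrt_le_mono B2(3) that)
  finally show ?thesis .
 qed
 have "0 < q / 2" using q by simp
 then obtain D where D: "0 < D" "\<And>r. 0 < r \<Longrightarrow> V r \<le> D * V (q / 2 * r)" by (rule V_scale) (rule that)
 \<comment> \<open>At distance \<open>M * r\<close> from \<open>x\<close> the exponential bound has
   fallen below \<open>c / 2\<close>, half the lower bound of \<open>u\<close> at
   \<open>x\<close>.\<close>
 define M where "M = max 1 (ln (2 * B / c) / a)"
 have M: "1 \<le> M" "B * exp (- a * M) \<le> c / 2"
 proof -
  have "ln (2 * B / c) \<le> a * M" using a by (simp add: M_def field_simps max_def)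
  then have "exp (- (a * M)) \<le> exp (- ln (2 * B / c))" by simp
  also have "\<dots> = c / (2 * B)" using B c by (simp add: exp_minus)
  finally show "B * exp (- a * M) \<le> c / 2" using B by (simp add: field_simps)
 qed (simp add: M_def)
 define A1 where "A1 = B\<^sup>2 * B2"
 define A2 where "A2 = (c / (C * D))\<^sup>2 * q / (4 * C ^ 5)"
 define A3 where "A3 = 4 * M * A1 / c\<^sup>2"
 define A4 where "A4 = B * sqrt B2 * A1 / A2"
 define A5 where "A5 = C * A4 + sqrt (A1\<^sup>2 / A2 * (2 * C ^ 5))"
 have pos: "0 < A1" "0 < A2" "0 < A3" "0 < A4" "0 \<le> A5"
  using B B2 c C_ge D q M by (auto simp: A1_def A2_def A3_def A4_def A5_def)
 define A where "A = A1 / A2 + A3 + B + A4 + A3\<^sup>2 / A2 + A1\<^sup>2 / A2 + A5"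
 have A: "0 < A" "A1 / A2 \<le> A" "A3 \<le> A" "B \<le> A" "A4 \<le> A" "A3\<^sup>2 / A2 \<le> A" "A1\<^sup>2 / A2 \<le> A" "A5 \<le> A"
  using pos B by (auto simp: A_def add_pos_pos add_pos_nonneg)
 \<comment> \<open>The factor 5 keeps both \<open>4 * r\<close>, needed by the cutoff, and
   \<open>M * r\<close>, needed by Morrey's inequality, below \<open>e\<close>.\<close>
 define r0 where "r0 = e / (5 * M)"
 have r0: "0 < r0" using e_pos M by (simp add: r0_def)
 have main: "r * V r \<le> A * \<Psi> r \<and> \<Psi> r \<le> A * (r * V r) \<and>
   (\<exists>u k. energy_bounds a A x r u k)" if r: "0 < r" "r \<le> r0" for x r
 proof -
  have rM: "M * r < e"
  proof -
   have "M * r \<le> M * r0" using r M by (intro mult_left_mono) auto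
   also have "\<dots> < e" using M e_pos by (simp add: r0_def)
   finally show ?thesis .
  qed
  have r4: "4 * r < e"
  proof -
   have "r0 * 1 \<le> r0 * M" using M r0 by (intro mult_left_mono) auto
   also have "\<dots> = e / 5" using M by (simp add: r0_def)
   finally show ?thesis using r e_pos by simp
  qed
  obtain u k where u: "u \<in> \<F>" "(u, k) \<in> Lap" and form: "\<And>v. v \<in> \<F> \<Longrightarrow> form \<nu> \<gamma> l u v = - inner_L2 m k v"
   and ub: "\<And>y. 0 \<le> u y" "\<And>y. u y \<le> B * decay a x r y"
   and kb: "\<And>y. \<bar>k y\<bar> \<le> B / \<Psi> r * decay a x r y"
   and lo: "\<And>y. dist x y < q * r \<Longrightarrow> c \<le> u y" "\<And>y. dist x y < q * r \<Longrightarrow> c / \<Psi> r \<le> - k y"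
   using test[OF r(1), of x] unfolding heat_average_def by blast
  define v t N where "v = V r" and "t = \<Psi> r" and "N = gnorm u"
  have vt: "0 < v" "0 < t" "0 \<le> N" unfolding v_def t_def N_def by (auto intro: V_pos psi_pos r norm_L2_nonneg)
  have kL: "k \<in> Lp 2 m" using u(2) by (simp add: laplacian_def)
  have uF: "u \<in> AC \<iota>" "u \<in> Lp 2 m" "grad u \<in> Lp 2 \<nu>" "continuous_on UNIV u" by (rule formD[OF u(1)])+
  have nk: "norm_L2 m k \<le> B / t * sqrt (B2 * v)"
   unfolding v_def t_def using kb psi_pos[OF r(1)] B r by (intro exp_norm[where x=x] Lp2_measurable kL) auto
  have nu: "norm_L2 m u \<le> B * sqrt (B2 * v)"
   unfolding v_def using ub B r by (intro exp_norm[where x=x] Lp2_measurable uF) auto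
  have E1: "N\<^sup>2 \<le> A1 * v / t"
  proof -
   have "N\<^sup>2 = form \<nu> \<gamma> l u u" unfolding N_def norm_L2_sqr form_def by (simp add: power2_eq_square)
   also have "\<dots> = - inner_L2 m k u" by (rule form[OF u(1)])
   also have "\<dots> \<le> norm_L2 m k * norm_L2 m u" using Cauchy_Schwarz_L2[OF kL uF(2)] by simp
   also have "\<dots> \<le> (B / t * sqrt (B2 * v)) * (B * sqrt (B2 * v))" using B B2 vt by (intro mult_mono nk nu norm_L2_nonneg) auto
   also have "\<dots> = B\<^sup>2 / t * (sqrt (B2 * v))\<^sup>2" by (simp add: power2_eq_square)
   also have "\<dots> = A1 * v / t" using B2 vt by (simp add: A1_def)
   finally show ?thesis .
  qed
  have E2: "A2 * (v / t)\<^sup>2 * r \<le> N\<^sup>2"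
  proof -
   \<comment> \<open>The cutoff then vanishes at distance \<open>q * r\<close> and beyond, and so
     lives where \<open>- k \<ge> c / t\<close>.\<close>
   define d where "d = q / 2 * r"
   have d: "0 < d" "4 * d < e" "d < q * r" "2 * d = q * r"
   proof -
    have "q * r \<le> 1 / 2 * r" using q r by (intro mult_right_mono) auto
    moreover have "4 * d = 2 * (q * r)" by (simp add: d_def)
    ultimately show "4 * d < e" using r4 r(1) by linarith
   qed (use q r in \<open>auto simp: d_def\<close>)
   obtain h where h: "\<And>z. 0 \<le> h z" "\<And>z. h z \<le> 1" "\<And>z. dist x z \<le> d \<Longrightarrow> h z = 1"
    "\<And>z. 2 * d \<le> dist x z \<Longrightarrow> h z = 0" "h \<in> \<F>" "gnorm h \<le> sqrt (2 * C ^ 5 / d)"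
    by (rule cutoff_form_domain[OF d(1,2)]) (rule that)
   note hF = formD[OF h(5)]
   have "c / t * (v / (C * D)) \<le> c / t * measure m (ball x d)"
   proof (intro mult_left_mono)
    have "v \<le> D * V d" unfolding v_def d_def by (rule D(2)[OF r(1)])
    also have "V d \<le> C * measure m (ball x d)" using ball_lower[OF d(1), of x] C_ge by (simp add: field_simps)
    then have "D * V d \<le> D * (C * measure m (ball x d))" using D(1) by (intro mult_left_mono) auto
    finally show "v / (C * D) \<le> measure m (ball x d)" using C_ge D(1) by (simp add: field_simps)
   qed (use c vt in simp)
   also have "\<dots> = (\<integral>z. c / t * indicator (ball x d) z \<partial>m)" by (simp add: sets_m space_m)
   also have "\<dots> \<le> (\<integral>z. - (k z * h z) \<partial>m)"
   proof (rule integral_mono)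
    show "integrable m (\<lambda>z. c / t * indicator (ball x d) z)"
     using ball_finite[of x d] by (intro integrable_mult_right integrable_real_indicator) (auto simp: sets_m)
    show "integrable m (\<lambda>z. - (k z * h z))"
     by (intro Bochner_Integration.integrable_minus Lp2_integrable_mult kL hF)
    fix z
    show "c / t * indicator (ball x d) z \<le> - (k z * h z)"
    proof (cases "dist x z < q * r")
     case True
     have "0 \<le> c / t" using c vt by simp
     moreover have "c / t \<le> - k z" using lo(2)[OF True] by (simp add: t_def)
     ultimately show ?thesis using h(1)[of z] h(3)[of z]
      by (cases "z \<in> ball x d") (auto simp: mult_le_0_iff)
    qed (use h(4)[of z] d in auto)
   qed
   also have "\<dots> = form \<nu> \<gamma> l u h" unfolding form[OF h(5)] inner_L2_def by simp
   also have "\<dots> \<le> N * gnorm h" unfolding form_eq N_def using Cauchy_Schwarz_L2[OF uF(3) hF(3)] by simp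
   also have "\<dots> \<le> N * sqrt (2 * C ^ 5 / d)" using vt by (intro mult_left_mono h) auto
   finally have "(c / t * (v / (C * D)))\<^sup>2 \<le> (N * sqrt (2 * C ^ 5 / d))\<^sup>2"
    using c vt C_ge D by (intro power_mono) auto
   also have "\<dots> = N\<^sup>2 * (4 * C ^ 5 / (q * r))" using C_ge d(1) q r by (simp add: power_mult_distrib d_def)
   finally have "(c / t * (v / (C * D)))\<^sup>2 * (q * r / (4 * C ^ 5)) \<le> N\<^sup>2 * (4 * C ^ 5 / (q * r)) * (q * r / (4 * C ^ 5))"
    using C_ge q r by (intro mult_right_mono) auto
   also have "\<dots> = N\<^sup>2" using C_ge q r by simp
   finally show ?thesis by (simp add: A2_def power_mult_distrib power_divide ac_simps)
  qed
  have dirB: "r * v \<le> A1 / A2 * t"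
  proof -
   have "A2 * (v / t)\<^sup>2 * r \<le> A1 * v / t" using E1 E2 by simp
   then have "(v / t) * (A2 * (v / t) * r) \<le> (v / t) * A1" by (simp add: power2_eq_square ac_simps)
   then have "A2 * (v / t) * r \<le> A1" using vt by (subst (asm) mult_le_cancel_left_pos) auto
   then show ?thesis using vt pos by (simp add: field_simps)
  qed
  have dirA: "t \<le> A3 * (r * v)"
  proof -
   obtain y where y: "dist x y = M * r" using point_at_distance[of "M * r" x] M r by auto
   have "u y \<le> c / 2" using ub(2)[of y] M(2) r by (simp add: y)
   moreover have "c \<le> u x" using lo(1)[of x] q r by simp
   ultimately have "(c / 2)\<^sup>2 \<le> (u x - u y)\<^sup>2" using c by (intro power_mono) auto
   also have "\<dots> \<le> M * r * N\<^sup>2" using morrey[OF uF(1,3), of x y] rM unfolding y N_def by simp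
   also have "\<dots> \<le> M * r * (A1 * v / t)" using M r by (intro mult_left_mono E1) auto
   finally show ?thesis using vt c by (simp add: A3_def power2_eq_square field_simps)
  qed
  have E3: "1 \<le> A3\<^sup>2 / A2 * (r * N\<^sup>2)"
  proof -
   have "1 \<le> A3 * (r * v) / t" using dirA vt by simp
   then have "1\<^sup>2 \<le> (A3 * (r * v) / t)\<^sup>2" by (intro power_mono) auto
   also have "\<dots> = A3\<^sup>2 / A2 * r * (A2 * (v / t)\<^sup>2 * r)" using pos by (simp add: power2_eq_square)
   also have "\<dots> \<le> A3\<^sup>2 / A2 * r * N\<^sup>2" using pos r by (intro mult_left_mono E2) auto
   finally show ?thesis by (simp add: ac_simps)
  qed
  have vt': "v / t \<le> A1 / A2 / r"
  proof -
   have "v / t = r * v / (r * t)" using r by simp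
   also have "\<dots> \<le> A1 / A2 * t / (r * t)" using dirB vt r by (intro divide_right_mono) auto
   also have "\<dots> = A1 / A2 / r" using vt by simp
   finally show ?thesis .
  qed
  have E4: "N\<^sup>2 \<le> A1\<^sup>2 / A2 / r"
  proof -
   have "N\<^sup>2 \<le> A1 * (v / t)" using E1 by simp
   also have "\<dots> \<le> A1 * (A1 / A2 / r)" using pos by (intro mult_left_mono vt') auto
   finally show ?thesis by (simp add: power2_eq_square)
  qed
  have E5: "norm_L2 m k * sqrt v \<le> A4 / r"
  proof -
   have "norm_L2 m k * sqrt v \<le> B / t * sqrt (B2 * v) * sqrt v" using vt by (intro mult_right_mono nk) auto
   also have "\<dots> = B * sqrt B2 * (v / t)" using vt B2 by (simp add: real_sqrt_mult)
   also have "\<dots> \<le> B * sqrt B2 * (A1 / A2 / r)" using B B2 by (intro mult_left_mono vt') auto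
   finally show ?thesis by (simp add: A4_def)
  qed
  \<comment> \<open>At scale \<open>r\<close> itself both terms of the gradient bound are of order
    \<open>1 / r\<close>: the first by \<open>E5\<close>, the second because both factors are of
    order r^(-1/2).\<close>
  have lip: "\<bar>u b - u z\<bar> \<le> A5 / r * dist z b" if "dist z b < r" for z b
  proof (cases "z = b")
   case False
   have "\<bar>u b - u z\<bar> \<le> dist z b * (norm_L2 m k * sqrt (C * V (2 * r)) + N * sqrt (2 * C ^ 5 / r))"
    unfolding N_def by (rule weak_solution_lipschitz[OF u(1) kL form r(1) r4 False that])
   also have "\<dots> \<le> dist z b * (A5 / r)"
   proof (intro mult_left_mono)
    have "norm_L2 m k * sqrt (C * V (2 * r)) \<le> norm_L2 m k * sqrt (C\<^sup>2 * v)"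
     using V_double[OF r(1)] C_ge by (intro mult_left_mono real_sqrt_le_mono norm_L2_nonneg) (simp add: v_def power2_eq_square)
    also have "\<dots> = C * (norm_L2 m k * sqrt v)" using C_ge by (simp add: real_sqrt_mult)
    also have "\<dots> \<le> C * (A4 / r)" using C_ge by (intro mult_left_mono E5) auto
    finally have 1: "norm_L2 m k * sqrt (C * V (2 * r)) \<le> C * (A4 / r)" .
    have "N \<le> sqrt (A1\<^sup>2 / A2 / r)" using E4 by (rule real_le_rsqrt)
    then have "N * sqrt (2 * C ^ 5 / r) \<le> sqrt (A1\<^sup>2 / A2 / r) * sqrt (2 * C ^ 5 / r)"
     using C_ge r by (intro mult_right_mono) auto
    also have "\<dots> = sqrt (A1\<^sup>2 / A2 * (2 * C ^ 5) / r\<^sup>2)" by (simp add: real_sqrt_mult[symmetric] power2_eq_square)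
    also have "\<dots> = sqrt (A1\<^sup>2 / A2 * (2 * C ^ 5)) / r" using r by (simp only: real_sqrt_divide real_sqrt_abs abs_of_pos)
    finally show "norm_L2 m k * sqrt (C * V (2 * r)) + N * sqrt (2 * C ^ 5 / r) \<le> A5 / r"
     using 1 by (simp add: A5_def add_divide_distrib)
   qed simp
   finally show ?thesis by (simp add: mult.commute)
  qed simp
  have "AE z in \<nu>. z \<in> S" by (rule AE_I2) (simp add: space_nu)
  then have gb: "AE z in \<nu>. \<bar>grad u z\<bar> \<le> A / r"
   using AE_grad_exists[OF uF(1)]
  proof eventually_elim
   case (elim z)
   have "\<bar>grad u z\<bar> \<le> A5 / r" by (rule grad_lipschitz[OF elim r(1)]) (rule lip)
   also have "\<dots> \<le> A / r" using A r by (intro divide_right_mono) auto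
   finally show ?case .
  qed
  show ?thesis
  proof (rule conjI[OF _ conjI[OF _ exI[of _ u, OF exI[of _ k]]]], goal_cases)
   case 3
   show ?case
    unfolding energy_bounds_def
   proof (intro conjI allI u gb ub(1))
    show "u y \<le> A * decay a x r y" for y
     by (rule order_trans[OF ub(2)]) (use A in \<open>auto intro: mult_right_mono\<close>)
    show "norm_L2 m k * sqrt (V r) \<le> A / r"
     using E5 divide_right_mono[OF A(5), of r] r by (simp add: v_def)
    show "1 \<le> A * (r * (gnorm u)\<^sup>2)"
     using E3 mult_right_mono[OF A(6), of "r * N\<^sup>2"] r by (simp add: N_def)
    show "(gnorm u)\<^sup>2 \<le> A / r"
     using E4 divide_right_mono[OF A(7), of r] r by (simp add: N_def)
   qed
  next
   case 1
   show ?case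
    using dirB mult_right_mono[OF A(2), of t] vt by (simp add: v_def t_def)
  next
   case 2
   have "A3 * (r * v) \<le> A * (r * v)" using A(3) r vt by (intro mult_right_mono) auto
   then show ?case using dirA by (simp add: v_def t_def)
  qed
 qed
 show ?thesis by (rule that[OF r0 a A(1) main])
qed

end

section \<open>The Riesz transform\<close>

text \<open>Operators here are mere relations; linearity of the square root comes from its being its
  own adjoint, since the defining condition of an adjoint is linear.\<close>

lemma adjoint_operator_linear:
 assumes "(f, g) \<in> adjoint_operator M T" "(f', g') \<in> adjoint_operator M T" "T \<subseteq> Lp 2 M \<times> Lp 2 M"
 shows "(\<lambda>x. a * f x + b * f' x, \<lambda>x. a * g x + b * g' x) \<in> adjoint_operator M T"
proof -
 have L: "f \<in> Lp 2 M" "g \<in> Lp 2 M" "f' \<in> Lp 2 M" "g' \<in> Lp 2 M"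
  and *: "\<And>h k. (h, k) \<in> T \<Longrightarrow> inner_L2 M k f = inner_L2 M h g"
   "\<And>h k. (h, k) \<in> T \<Longrightarrow> inner_L2 M k f' = inner_L2 M h g'"
  using assms(1,2) unfolding adjoint_operator_def by auto
 have "inner_L2 M k (\<lambda>x. a * f x + b * f' x) = inner_L2 M h (\<lambda>x. a * g x + b * g' x)" if "(h, k) \<in> T" for h k
  using that assms(3) L *[OF that] by (auto simp: inner_L2_add_right)
 then show ?thesis unfolding adjoint_operator_def using Lp2_add[OF L(1,3)] Lp2_add[OF L(2,4)] by auto
qed

text \<open>Polarisation, with linearity available only almost everywhere.\<close>

lemma linear_isometry_inner:
 assumes R: "linear_L2 M N R" "\<And>f. f \<in> Lp 2 M \<Longrightarrow> norm_L2 N (R f) = norm_L2 M f"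
  and f: "f \<in> Lp 2 M" and g: "g \<in> Lp 2 M"
 shows "inner_L2 N (R f) (R g) = inner_L2 M f g"
proof -
 let ?s = "\<lambda>x. 1 * f x + 1 * g x"
 have RL: "R f \<in> Lp 2 N" "R g \<in> Lp 2 N" using R(1) f g by (auto simp: linear_L2_def)
 have s: "?s \<in> Lp 2 M" by (rule Lp2_add[OF f g])
 have "(norm_L2 N (\<lambda>y. 1 * R f y + 1 * R g y))\<^sup>2 = (norm_L2 N (R ?s))\<^sup>2"
 proof (intro arg_cong[where f="\<lambda>v. v\<^sup>2"] norm_L2_cong_AE)
  show "(\<lambda>y. 1 * R f y + 1 * R g y) \<in> borel_measurable N" by (rule Lp2_measurable[OF Lp2_add[OF RL]])
  show "R ?s \<in> borel_measurable N" using R(1) s by (auto simp: linear_L2_def intro: Lp2_measurable)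
  have "AE y in N. R ?s y = 1 * R f y + 1 * R g y" using R(1) f g unfolding linear_L2_def by blast
  then show "AE y in N. 1 * R f y + 1 * R g y = R ?s y" by eventually_elim simp
 qed
 also have "\<dots> = (norm_L2 M ?s)\<^sup>2" using R(2)[OF s] by simp
 finally show ?thesis unfolding norm_L2_add_sqr[OF RL] norm_L2_add_sqr[OF f g] R(2)[OF f] R(2)[OF g] by simp
qed

locale riesz_space = hke_space \<iota> e ty \<nu> \<gamma> l m V C P p \<Psi> C1 c2 \<delta> Cs \<beta>1 \<beta>2
 for \<iota> e and ty :: "'a::{metric_space, second_countable_topology} itself"
  and \<nu> \<gamma> l m V C P p \<Psi> C1 c2 \<delta> Cs \<beta>1 \<beta>2 +
 fixes Q :: "'a operator" and R :: "('a \<Rightarrow> real) \<Rightarrow> 'a \<Rightarrow> real"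
 assumes sqrt_operator: "is_sqrt_operator m (neg_operator (Lap)) Q"
  and riesz_transform: "is_riesz_transform \<iota> \<nu> \<gamma> l m Q R"
  and riesz: "(\<exists>q. 1 < q \<and> q < 2 \<and> Riesz_inequality m \<nu> R q) \<or>
        (\<exists>q>2. reverse_Riesz_inequality \<iota> \<nu> \<gamma> l m Q q)"
begin

section \<open>The square root of the Laplacian and duality\<close>

lemma Q_adjoint: "adjoint_operator m Q = Q"
 using sqrt_operator unfolding is_sqrt_operator_def self_adjoint_def by blast

lemma Q_L2: "(f, g) \<in> Q \<Longrightarrow> f \<in> Lp 2 m \<and> g \<in> Lp 2 m"
 using Q_adjoint unfolding adjoint_operator_def by blast

lemma Q_symmetric: "(f, g) \<in> Q \<Longrightarrow> (f', g') \<in> Q \<Longrightarrow> inner_L2 m g f' = inner_L2 m f g'"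
 using Q_adjoint unfolding adjoint_operator_def by blast

lemma Q_linear: "(f, g) \<in> Q \<Longrightarrow> (f', g') \<in> Q \<Longrightarrow> (\<lambda>x. a * f x + b * f' x, \<lambda>x. a * g x + b * g' x) \<in> Q"
proof -
 assume "(f, g) \<in> Q" "(f', g') \<in> Q"
 moreover have "Q \<subseteq> Lp 2 m \<times> Lp 2 m" using Q_L2 by auto
 ultimately show ?thesis using adjoint_operator_linear[of f g m Q f' g' a b] unfolding Q_adjoint by blast
qed

lemma Q_nonneg: "(f, g) \<in> Q \<Longrightarrow> 0 \<le> inner_L2 m f g"
 using sqrt_operator unfolding is_sqrt_operator_def by blast

text \<open>Log-convexity of \<open>s \<mapsto> \<langle>Q\<^sup>s u, u\<rangle>\<close> at \<open>s = 1, 2, 3\<close>, without the spectral theorem.\<close>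

lemma moment_inequality:
 assumes uh: "(u, h) \<in> Q" and hw: "(h, w) \<in> Q"
 shows "(norm_L2 m h)\<^sup>2 = inner_L2 m u w" "norm_L2 m h ^ 3 \<le> inner_L2 m h u * norm_L2 m w"
proof -
 have L: "u \<in> Lp 2 m" "h \<in> Lp 2 m" "w \<in> Lp 2 m" using Q_L2 uh hw by blast+
 have hh: "inner_L2 m h h = inner_L2 m u w" by (rule Q_symmetric[OF uh hw])
 have nh: "(norm_L2 m h)\<^sup>2 = inner_L2 m h h" unfolding norm_L2_sqr inner_L2_def by (simp add: power2_eq_square)
 then show "(norm_L2 m h)\<^sup>2 = inner_L2 m u w" using hh by simp
 have "0 \<le> inner_L2 m h u + 2 * s * inner_L2 m h h + s\<^sup>2 * inner_L2 m h w" for s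
 proof -
  have "0 \<le> inner_L2 m (\<lambda>x. 1 * u x + s * h x) (\<lambda>x. 1 * h x + s * w x)"
   by (intro Q_nonneg Q_linear uh hw)
  also have "\<dots> = inner_L2 m h u + 2 * s * inner_L2 m h h + s\<^sup>2 * inner_L2 m h w"
   unfolding inner_L2_add_left[OF L(1,2) Lp2_add[OF L(2,3)]] inner_L2_add_right[OF L(2,3) L(1)] inner_L2_add_right[OF L(2,3) L(2)]
   using hh by (simp add: inner_L2_commute[of m u h] power2_eq_square algebra_simps)
  finally show ?thesis .
 qed
 then have "(inner_L2 m h h)\<^sup>2 \<le> inner_L2 m h u * inner_L2 m h w"
  by (rule quadratic_nonneg_imp_discriminant) (rule Q_nonneg[OF hw])
 also have "\<dots> \<le> inner_L2 m h u * (norm_L2 m h * norm_L2 m w)"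
  using Cauchy_Schwarz_L2[OF L(2,3)] Q_nonneg[OF uh]
  by (intro mult_left_mono) (auto simp: inner_L2_commute)
 finally have *: "norm_L2 m h * norm_L2 m h ^ 3 \<le> norm_L2 m h * (inner_L2 m h u * norm_L2 m w)"
  unfolding nh[symmetric] by (simp add: power2_eq_square power3_eq_cube ac_simps)
 show "norm_L2 m h ^ 3 \<le> inner_L2 m h u * norm_L2 m w"
 proof (cases "norm_L2 m h = 0")
  case True
  then show ?thesis using Q_nonneg[OF uh] norm_L2_nonneg[of m w] by (simp add: inner_L2_commute)
 next
  case False
  then have "0 < norm_L2 m h" using norm_L2_nonneg[of m h] by simp
  then show ?thesis using * by simp
 qed
qed

text \<open>Both hypotheses end in one inequality with conjugate exponents and \<open>2 < s\<close>,
  hence \<open>q < 2\<close>. Under R_q, the pairing is transported to the skeleton by the isometry,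
  where the transform of \<open>h\<close> is the gradient of \<open>u\<close>, and R_q controls the
  transform of \<open>u\<close>. Under the reverse inequality, Hoelder is applied on the space
  itself and the norm of \<open>h\<close> is controlled by that of the gradient.\<close>

lemma riesz_duality:
 obtains s q K where "2 < s" "1 < q" "1 / s + 1 / q = 1" "0 < K"
  "\<And>u h. (u, h) \<in> Q \<Longrightarrow> u \<in> \<F> \<Longrightarrow> u \<in> Lp q m \<Longrightarrow> grad u \<in> Lp s \<nu> \<Longrightarrow>
   inner_L2 m h u \<le> K * ((\<integral>z. \<bar>grad u z\<bar> powr s \<partial>\<nu>) powr (1 / s) * (\<integral>y. \<bar>u y\<bar> powr q \<partial>m) powr (1 / q))"
 using riesz
proof (elim disjE exE conjE)
 fix q :: real assume q: "1 < q" "q < 2" and "Riesz_inequality m \<nu> R q"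
 then obtain K where K: "0 < K" "\<And>f. f \<in> Lp q m \<inter> Lp 2 m \<Longrightarrow> Lp_norm q \<nu> (R f) \<le> ennreal K * Lp_norm q m f"
  unfolding Riesz_inequality_def by blast
 define s where "s = q / (q - 1)"
 have s: "2 < s" "1 / s + 1 / q = 1" using q by (auto simp: s_def field_simps)
 show thesis
 proof (rule that[OF s(1) q(1) s(2) K(1)])
  fix u h assume uh: "(u, h) \<in> Q" and uF: "u \<in> \<F>" and uq: "u \<in> Lp q m" and gs: "grad u \<in> Lp s \<nu>"
  have L: "u \<in> Lp 2 m" "h \<in> Lp 2 m" using Q_L2[OF uh] by auto
  have R: "linear_L2 m \<nu> R" "\<And>f. f \<in> Lp 2 m \<Longrightarrow> norm_L2 \<nu> (R f) = norm_L2 m f" "AE z in \<nu>. R h z = grad u z"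
   using riesz_transform uh uF unfolding is_riesz_transform_def by auto
  have Rm: "R u \<in> borel_measurable \<nu>" "R h \<in> borel_measurable \<nu>"
   using R(1) L by (auto simp: linear_L2_def intro: Lp2_measurable)
  have le: "Lp_norm q \<nu> (R u) \<le> ennreal K * Lp_norm q m u" using uq L by (intro K) auto
  have "ennreal K * Lp_norm q m u < \<infinity>" using uq by (simp add: Lp_def ennreal_mult_less_top)
  with le have Rq: "R u \<in> Lp q \<nu>" using Rm unfolding Lp_def by (auto intro: le_less_trans)
  have le': "(\<integral>z. \<bar>R u z\<bar> powr q \<partial>\<nu>) powr (1 / q) \<le> K * (\<integral>y. \<bar>u y\<bar> powr q \<partial>m) powr (1 / q)"
   using le K(1) unfolding Lp_norm_eq[OF Rq] Lp_norm_eq[OF uq]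
   by (simp add: ennreal_mult[symmetric] ennreal_le_iff)
  have "inner_L2 m h u = inner_L2 \<nu> (R h) (R u)" by (rule linear_isometry_inner[OF R(1,2) L(2,1), symmetric])
  also have "\<dots> = inner_L2 \<nu> (grad u) (R u)"
   using R(3) by (intro inner_L2_cong_AE Rm Lp2_measurable[OF formD(3)[OF uF]]) auto
  also have "\<dots> \<le> (\<integral>z. \<bar>grad u z\<bar> powr s \<partial>\<nu>) powr (1 / s) * (\<integral>z. \<bar>R u z\<bar> powr q \<partial>\<nu>) powr (1 / q)"
   using Holder_inequality_Lp(2)[OF gs Rq _ q(1) s(2)] s(1) unfolding inner_L2_def by simp
  also have "\<dots> \<le> (\<integral>z. \<bar>grad u z\<bar> powr s \<partial>\<nu>) powr (1 / s) * (K * (\<integral>y. \<bar>u y\<bar> powr q \<partial>m) powr (1 / q))"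
   by (intro mult_left_mono le') simp
  finally show "inner_L2 m h u \<le> K * ((\<integral>z. \<bar>grad u z\<bar> powr s \<partial>\<nu>) powr (1 / s) * (\<integral>y. \<bar>u y\<bar> powr q \<partial>m) powr (1 / q))"
   by (simp add: ac_simps)
 qed
next
 fix s :: real assume s: "2 < s" and "reverse_Riesz_inequality \<iota> \<nu> \<gamma> l m Q s"
 then obtain K where K: "0 < K" "\<And>f g. f \<in> \<F> \<Longrightarrow> (f, g) \<in> Q \<Longrightarrow> Lp_norm s m g \<le> ennreal K * Lp_norm s \<nu> (grad f)"
  unfolding reverse_Riesz_inequality_def by blast
 define q where "q = s / (s - 1)"
 have q: "1 < q" "1 / s + 1 / q = 1" using s by (auto simp: q_def field_simps)
 show thesis
 proof (rule that[OF s(1) q K(1)])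
  fix u h assume uh: "(u, h) \<in> Q" and uF: "u \<in> \<F>" and uq: "u \<in> Lp q m" and gs: "grad u \<in> Lp s \<nu>"
  have L: "u \<in> Lp 2 m" "h \<in> Lp 2 m" using Q_L2[OF uh] by auto
  have le: "Lp_norm s m h \<le> ennreal K * Lp_norm s \<nu> (grad u)" by (rule K(2)[OF uF uh])
  have "ennreal K * Lp_norm s \<nu> (grad u) < \<infinity>" using gs by (simp add: Lp_def ennreal_mult_less_top)
  with le have hs: "h \<in> Lp s m" using Lp2_measurable[OF L(2)] unfolding Lp_def by (auto intro: le_less_trans)
  have le': "(\<integral>y. \<bar>h y\<bar> powr s \<partial>m) powr (1 / s) \<le> K * (\<integral>z. \<bar>grad u z\<bar> powr s \<partial>\<nu>) powr (1 / s)"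
   using le K(1) unfolding Lp_norm_eq[OF hs] Lp_norm_eq[OF gs]
   by (simp add: ennreal_mult[symmetric] ennreal_le_iff)
  have "inner_L2 m h u \<le> (\<integral>y. \<bar>h y\<bar> powr s \<partial>m) powr (1 / s) * (\<integral>y. \<bar>u y\<bar> powr q \<partial>m) powr (1 / q)"
   using Holder_inequality_Lp(2)[OF hs uq _ q] s unfolding inner_L2_def by simp
  also have "\<dots> \<le> K * (\<integral>z. \<bar>grad u z\<bar> powr s \<partial>\<nu>) powr (1 / s) * (\<integral>y. \<bar>u y\<bar> powr q \<partial>m) powr (1 / q)"
   by (intro mult_right_mono le') simp
  finally show "inner_L2 m h u \<le> K * ((\<integral>z. \<bar>grad u z\<bar> powr s \<partial>\<nu>) powr (1 / s) * (\<integral>y. \<bar>u y\<bar> powr q \<partial>m) powr (1 / q))"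
   by (simp add: ac_simps)
 qed
qed

text \<open>About \<open>r0 / (2 * r)\<close> disjoint balls of radius \<open>r\<close> along a
  geodesic fit into a ball of the fixed radius \<open>r0\<close>. Rounding down loses at most a
  factor 2, as the quotient is at least 1.\<close>

lemma volume_upper:
 assumes r0: "0 < r0" and r: "0 < r" "2 * r \<le> r0"
 shows "V r \<le> 4 * C\<^sup>2 * V r0 / r0 * r"
proof -
 define n where "n = nat \<lfloor>r0 / (2 * r)\<rfloor>"
 have "1 \<le> r0 / (2 * r)" using r by simp
 then have n: "real n \<le> r0 / (2 * r)" "r0 / (2 * r) < real n + 1" "1 \<le> real n"
  unfolding n_def by (auto simp: le_nat_floor of_nat_floor)
 have "r0 / (4 * r) * V r \<le> real n * V r"
 proof (rule mult_right_mono)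
  have "r0 / (2 * r) \<le> 2 * real n" using n by simp
  then show "r0 / (4 * r) \<le> real n" using r by (simp add: field_simps)
 qed (use V_pos[OF r(1)] in simp)
 also have "\<dots> \<le> C\<^sup>2 * V (2 * real n * r)" by (rule volume_linear_growth[OF r(1)]) (use n in simp)
 also have "\<dots> \<le> C\<^sup>2 * V r0"
  using n r r0 by (intro mult_left_mono V_mono) (auto simp: field_simps)
 finally show ?thesis using r r0 by (simp add: field_simps)
qed

text \<open>The Riesz hypothesis enters only in \<open>lower\<close>; the upper bound on the volume
  is packing, and the bounds on \<Psi> follow from its comparison with
  \<open>r * V r\<close>.\<close>

lemma volume_scale_small:
 obtains r1 A where "0 < r1" "0 < A"
  "\<And>r. 0 < r \<Longrightarrow> r \<le> r1 \<Longrightarrow> r \<le> A * V r \<and> V r \<le> A * r \<and> r\<^sup>2 \<le> A * \<Psi> r \<and> \<Psi> r \<le> A * r\<^sup>2"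
proof -
 obtain r0 a A where r0: "0 < r0" and a: "0 < a" and A: "0 < A" and est:
  "\<And>x r. 0 < r \<Longrightarrow> r \<le> r0 \<Longrightarrow> r * V r \<le> A * \<Psi> r \<and> \<Psi> r \<le> A * (r * V r) \<and>
   (\<exists>u k. energy_bounds a A x r u k)"
  by (rule energy_estimates) (rule that)
 obtain s q K where s: "2 < s" and q: "1 < q" and sq: "1 / s + 1 / q = 1" and K: "0 < K" and dual:
  "\<And>u h. (u, h) \<in> Q \<Longrightarrow> u \<in> \<F> \<Longrightarrow> u \<in> Lp q m \<Longrightarrow> grad u \<in> Lp s \<nu> \<Longrightarrow>
   inner_L2 m h u \<le> K * ((\<integral>z. \<bar>grad u z\<bar> powr s \<partial>\<nu>) powr (1 / s) * (\<integral>y. \<bar>u y\<bar> powr q \<partial>m) powr (1 / q))"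
  by (rule riesz_duality) (rule that)
 have q0: "0 < q" using q by simp
 obtain Bq where Bq: "0 < Bq" "\<And>(x :: 'a) r. 0 < r \<Longrightarrow> (\<lambda>y. decay a x r y) \<in> Lp q m"
  "\<And>(x :: 'a) r. 0 < r \<Longrightarrow> (\<integral>y. decay a x r y powr q \<partial>m) \<le> Bq * V r"
  by (rule exp_dist_Lp[OF a q0]) (rule that)
 define K1 where "K1 = K * (A * (A powr q * Bq)) powr (1 / q)"
 have K1: "0 < K1" using K A Bq by (simp add: K1_def)
 \<comment> \<open>Positive because \<open>2 < s\<close>: the gap between the exponents
   \<open>1 / q\<close> and \<open>1 / 2\<close> on which the lower bound for the volume
   rests.\<close>
 define j where "j = 1 / q - 1 / 2"
 have j: "0 < j"
 proof -
  have "1 / s < 1 / 2" using s by simp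
  then show ?thesis using sq by (simp add: j_def)
 qed
 define K2 where "K2 = A powr (5 / 2) * K1"
 have K2: "0 < K2" using A K1 by (simp add: K2_def)
 have lower: "r \<le> K2 powr (1 / j) * V r" if r: "0 < r" "r \<le> r0" for r
 proof -
  obtain x :: 'a where True by simp
  obtain u k where u: "u \<in> \<F>" "(u, k) \<in> Lap"
   and ub: "\<And>y. 0 \<le> u y" "\<And>y. u y \<le> A * decay a x r y"
   and nk: "norm_L2 m k * sqrt (V r) \<le> A / r" and N1: "1 \<le> A * (r * (gnorm u)\<^sup>2)"
   and N2: "(gnorm u)\<^sup>2 \<le> A / r" and gb: "AE z in \<nu>. \<bar>grad u z\<bar> \<le> A / r"
   using est[OF r, of x] unfolding energy_bounds_def by blast
  define v where "v = V r"
  have v: "0 < v" unfolding v_def by (rule V_pos[OF r(1)])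
  have uF: "u \<in> AC \<iota>" "u \<in> Lp 2 m" "grad u \<in> Lp 2 \<nu>" by (rule formD[OF u(1)])+
  have Ar: "0 < A / r" using A r by simp
  have "(u, \<lambda>x. - k x) \<in> Q O Q"
   using sqrt_operator u(2) unfolding is_sqrt_operator_def neg_operator_def by blast
  then obtain h where uh: "(u, h) \<in> Q" and hw: "(h, \<lambda>x. - k x) \<in> Q" by blast
  have nh: "(norm_L2 m h)\<^sup>2 = (gnorm u)\<^sup>2"
  proof -
   obtain u' where u': "u' \<in> \<F>" "AE x in m. u x = u' x" "\<And>v. v \<in> \<F> \<Longrightarrow> form \<nu> \<gamma> l u' v = - inner_L2 m k v"
    using u(2) unfolding laplacian_def by blast
   \<comment> \<open>\<open>u'\<close> is the representative hidden in the definition of the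
     operator; two continuous functions that agree almost everywhere coincide.\<close>
   have "u' = u"
   proof
    fix y
    have "closed {y. u y = u' y}" using formD(4)[OF u(1)] formD(4)[OF u'(1)] by (intro closed_Collect_eq)
    from closed_AE_imp_UNIV[OF this, of y] u'(2) show "u' y = u y" by simp
   qed
   then have "(gnorm u)\<^sup>2 = - inner_L2 m k u"
    using u'(3)[OF u(1)] unfolding norm_L2_sqr form_def by (simp add: power2_eq_square)
   then show ?thesis using moment_inequality(1)[OF uh hw] by (simp add: inner_L2_def mult.commute)
  qed
  \<comment> \<open>Interpolation between the uniform bound \<open>A / r\<close> and the energy
    bound \<open>A / r\<close>: the integral of the power \<open>s\<close> is at most
    \<open>(A / r) powr (s - 1)\<close>, whose s-th root is
    \<open>(A / r) powr (1 / q)\<close>.\<close>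
  have gpow: "AE z in \<nu>. \<bar>grad u z\<bar> powr s \<le> (A / r) powr (s - 2) * (grad u z)\<^sup>2"
   using gb
  proof eventually_elim
   case (elim z)
   have "\<bar>grad u z\<bar> powr s = \<bar>grad u z\<bar> powr (s - 2) * \<bar>grad u z\<bar> powr 2" unfolding powr_add[symmetric] by simp
   also have "\<dots> \<le> (A / r) powr (s - 2) * \<bar>grad u z\<bar> powr 2" using elim s by (intro mult_right_mono powr_mono2) auto
   finally show ?case by (simp add: powr_numeral)
  qed
  have g2: "integrable \<nu> (\<lambda>z. (A / r) powr (s - 2) * (grad u z)\<^sup>2)"
   using uF(3) by (intro integrable_mult_right) (simp add: Lp2_iff)
  have gm: "grad u \<in> borel_measurable \<nu>" by (rule Lp2_measurable[OF uF(3)])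
  have gi: "integrable \<nu> (\<lambda>z. \<bar>grad u z\<bar> powr s)"
   using gm gpow by (intro Bochner_Integration.integrable_bound[OF g2]) auto
  have gs: "grad u \<in> Lp s \<nu>" unfolding Lp_iff using gm gi by simp
  have gI: "(\<integral>z. \<bar>grad u z\<bar> powr s \<partial>\<nu>) \<le> (A / r) powr (s - 1)"
  proof -
   have "(\<integral>z. \<bar>grad u z\<bar> powr s \<partial>\<nu>) \<le> (\<integral>z. (A / r) powr (s - 2) * (grad u z)\<^sup>2 \<partial>\<nu>)"
    by (rule integral_mono_AE[OF gi g2 gpow])
   also have "\<dots> = (A / r) powr (s - 2) * (gnorm u)\<^sup>2" unfolding norm_L2_sqr by simp
   also have "\<dots> \<le> (A / r) powr (s - 2) * (A / r) powr 1"
    unfolding powr_one[OF less_imp_le[OF Ar]] using N2 by (intro mult_left_mono) auto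
   also have "\<dots> = (A / r) powr (s - 1)" unfolding powr_add[symmetric] by simp
   finally show ?thesis .
  qed
  have upow: "\<bar>u y\<bar> powr q \<le> A powr q * decay a x r y powr q" for y
  proof -
   have "\<bar>u y\<bar> powr q \<le> (A * decay a x r y) powr q" using ub q by (intro powr_mono2) auto
   then show ?thesis using A by (simp add: powr_mult)
  qed
  have E: "integrable m (\<lambda>y. A powr q * decay a x r y powr q)"
   using Bq(2)[OF r(1), of x] by (intro integrable_mult_right) (simp add: Lp_iff)
  have um: "u \<in> borel_measurable m" by (rule Lp2_measurable[OF uF(2)])
  have ui: "integrable m (\<lambda>y. \<bar>u y\<bar> powr q)"
   using um upow by (intro Bochner_Integration.integrable_bound[OF E]) auto
  have uq: "u \<in> Lp q m" unfolding Lp_iff using um ui by simp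
  have uI: "(\<integral>y. \<bar>u y\<bar> powr q \<partial>m) \<le> A powr q * Bq * v"
  proof -
   have "(\<integral>y. \<bar>u y\<bar> powr q \<partial>m) \<le> (\<integral>y. A powr q * decay a x r y powr q \<partial>m)"
    by (rule integral_mono[OF ui E upow])
   also have "\<dots> = A powr q * (\<integral>y. decay a x r y powr q \<partial>m)" by simp
   also have "\<dots> \<le> A powr q * (Bq * v)" unfolding v_def by (intro mult_left_mono Bq(3) r) simp
   finally show ?thesis by simp
  qed
  have "inner_L2 m h u \<le> K * ((\<integral>z. \<bar>grad u z\<bar> powr s \<partial>\<nu>) powr (1 / s) * (\<integral>y. \<bar>u y\<bar> powr q \<partial>m) powr (1 / q))"
   by (rule dual[OF uh u(1) uq gs])
  also have "\<dots> \<le> K * (((A / r) powr (s - 1)) powr (1 / s) * (A powr q * Bq * v) powr (1 / q))"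
   using K s q gI uI by (intro mult_left_mono mult_mono powr_mono2) auto
  also have "((A / r) powr (s - 1)) powr (1 / s) = (A / r) powr (1 / q)"
  proof -
   have "(s - 1) * (1 / s) = 1 / q" using sq s by (simp add: field_simps)
   then show ?thesis unfolding powr_powr by simp
  qed
  also have "K * ((A / r) powr (1 / q) * (A powr q * Bq * v) powr (1 / q)) = K1 * (v / r) powr (1 / q)"
   unfolding K1_def using A r Bq(1) v by (simp add: ac_simps flip: powr_mult)
  finally have M1: "inner_L2 m h u \<le> K1 * (v / r) powr (1 / q)" .
  define N where "N = norm_L2 m h"
  have N: "0 \<le> N" "1 \<le> A * r * N\<^sup>2" using N1 nh by (simp_all add: N_def norm_L2_nonneg)
  have "N ^ 3 \<le> inner_L2 m h u * norm_L2 m k"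
   using moment_inequality(2)[OF uh hw] by (simp add: N_def norm_L2_eq)
  also have "\<dots> \<le> K1 * (v / r) powr (1 / q) * norm_L2 m k" by (intro mult_right_mono M1 norm_L2_nonneg)
  finally have "N ^ 3 * sqrt v \<le> K1 * (v / r) powr (1 / q) * norm_L2 m k * sqrt v" using v by (intro mult_right_mono) auto
  also have "\<dots> = K1 * (v / r) powr (1 / q) * (norm_L2 m k * sqrt v)" by simp
  also have "\<dots> \<le> K1 * (v / r) powr (1 / q) * (A / r)" using nk K1 unfolding v_def by (intro mult_left_mono) auto
  finally have N3: "N ^ 3 * sqrt v \<le> K1 * (v / r) powr (1 / q) * (A / r)" .
  \<comment> \<open>The exponent \<open>3 / 2\<close> turns the lower bound for the energy into one
    for \<open>N ^ 3\<close>, the quantity in the moment inequality.\<close>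
  have "1 \<le> (A * r * N\<^sup>2) powr (3 / 2)" using N by (intro ge_one_powr_ge_zero) auto
  also have "\<dots> = (A * r) powr (3 / 2) * N ^ 3"
  proof -
   have "0 < N" using N by (cases "N = 0") auto
   then have "N\<^sup>2 = N powr 2" "N ^ 3 = N powr 3" by simp_all
   then have "(N\<^sup>2) powr (3 / 2) = N ^ 3" by (simp only: powr_powr) simp
   then show ?thesis using A r by (simp add: powr_mult)
  qed
  finally have "1 * sqrt v \<le> (A * r) powr (3 / 2) * N ^ 3 * sqrt v" using v by (intro mult_right_mono) auto
  also have "\<dots> = (A * r) powr (3 / 2) * (N ^ 3 * sqrt v)" by simp
  also have "\<dots> \<le> (A * r) powr (3 / 2) * (K1 * (v / r) powr (1 / q) * (A / r))" by (intro mult_left_mono N3) simp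
  also have "\<dots> = K2 * (v / r) powr (1 / q) * (r powr (3 / 2) / r)"
  proof -
   have "A powr (3 / 2) * A = A powr (5 / 2)" using A powr_add[of A "3 / 2" 1] by simp
   then show ?thesis using A r by (simp add: K2_def powr_mult)
  qed
  also have "r powr (3 / 2) / r = sqrt r" using r powr_diff[of r "3 / 2" 1] by (simp add: powr_half_sqrt)
  finally have "sqrt v / sqrt r \<le> K2 * (v / r) powr (1 / q)" using r by (simp add: field_simps)
  also have "sqrt v / sqrt r = (v / r) powr (1 / 2)" using v r by (simp add: powr_half_sqrt real_sqrt_divide)
  \<comment> \<open>After cancellation of the square root the positive power \<open>j\<close> of
    \<open>v / r\<close> remains, so that \<open>v / r\<close> is bounded below.\<close>
  also have "(v / r) powr (1 / q) = (v / r) powr (1 / 2) * (v / r) powr j" unfolding j_def by (simp flip: powr_add)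
  finally have "(v / r) powr (1 / 2) * 1 \<le> (v / r) powr (1 / 2) * (K2 * (v / r) powr j)" by (simp add: ac_simps)
  then have "1 \<le> K2 * (v / r) powr j" using v r by (subst (asm) mult_le_cancel_left_pos) auto
  then have "1 powr (1 / j) \<le> (K2 * (v / r) powr j) powr (1 / j)" using j by (intro powr_mono2) auto
  also have "\<dots> = K2 powr (1 / j) * (v / r)" using K2 j v r by (simp add: powr_mult powr_powr)
  finally show ?thesis using r v by (simp add: v_def field_simps)
 qed
 define G1 G2 where "G1 = K2 powr (1 / j)" and "G2 = 4 * C\<^sup>2 * V r0 / r0"
 have G: "0 < G1" "0 < G2" using K2 C_ge V_pos[OF r0] r0 by (auto simp: G1_def G2_def)
 show ?thesis
 proof (rule that[of "r0 / 2" "G1 + G2 + G1 * A + A * G2"])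
  show "0 < r0 / 2" "0 < G1 + G2 + G1 * A + A * G2" using r0 G A by (auto intro!: add_pos_pos)
  fix r assume r: "0 < r" "r \<le> r0 / 2"
  let ?A = "G1 + G2 + G1 * A + A * G2"
  have le: "G1 \<le> ?A" "G2 \<le> ?A" "G1 * A \<le> ?A" "A * G2 \<le> ?A" using G A by auto
  have v: "0 < V r" "0 < \<Psi> r" using V_pos psi_pos r by auto
  have 1: "r \<le> G1 * V r" unfolding G1_def by (rule lower) (use r r0 in auto)
  have 2: "V r \<le> G2 * r" unfolding G2_def by (rule volume_upper[OF r0 r(1)]) (use r in simp)
  have ps: "r * V r \<le> A * \<Psi> r" "\<Psi> r \<le> A * (r * V r)" using est[of r] r r0 by auto
  have "r\<^sup>2 \<le> r * (G1 * V r)" unfolding power2_eq_square using 1 r by (intro mult_left_mono) auto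
  also have "\<dots> = G1 * (r * V r)" by simp
  also have "\<dots> \<le> G1 * (A * \<Psi> r)" using G by (intro mult_left_mono ps) auto
  finally have 3: "r\<^sup>2 \<le> G1 * A * \<Psi> r" by simp
  have "A * (r * V r) \<le> A * (r * (G2 * r))" using A r 2 by (intro mult_left_mono) auto
  then have 4: "\<Psi> r \<le> A * G2 * r\<^sup>2" using ps(2) by (simp add: power2_eq_square ac_simps)
  show "r \<le> ?A * V r \<and> V r \<le> ?A * r \<and> r\<^sup>2 \<le> ?A * \<Psi> r \<and> \<Psi> r \<le> ?A * r\<^sup>2"
   using 1 2 3 4 mult_right_mono[OF le(1) less_imp_le[OF v(1)]] mult_right_mono[OF le(2) less_imp_le[OF r(1)]]
    mult_right_mono[OF le(3) less_imp_le[OF v(2)]] mult_right_mono[OF le(4) zero_le_power2[of r]]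
   by linarith
 qed
qed

end

section \<open>Comparison of the measures\<close>

text \<open>Two points at distance at least \<open>2 * h\<close> cannot lie in the same ball of
  radius \<open>h\<close>, so a finite cover by such balls bounds the size of separated sets and a
  largest one exists; being largest, it is a net.\<close>

lemma maximal_separated_subset:
 fixes K :: "'a::metric_space set"
 assumes K: "compact K" and h: "0 < h"
 obtains W where "finite W" "W \<subseteq> K" "\<And>w w'. w \<in> W \<Longrightarrow> w' \<in> W \<Longrightarrow> w \<noteq> w' \<Longrightarrow> 2 * h \<le> dist w w'"
  "\<And>z. z \<in> K \<Longrightarrow> \<exists>w\<in>W. dist w z < 2 * h"
proof -
 define P where "P W \<longleftrightarrow> finite W \<and> W \<subseteq> K \<and> (\<forall>w\<in>W. \<forall>w'\<in>W. w \<noteq> w' \<longrightarrow> 2 * h \<le> dist w w')" for W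
 obtain F where F: "finite F" "K \<subseteq> (\<Union>x\<in>F. ball x h)"
  using compact_eq_totally_bounded[of K] K h by blast
 have card: "card W < Suc (card F)" if W: "P W" for W
 proof -
  have "\<forall>w\<in>W. \<exists>x\<in>F. dist x w < h" using W F(2) unfolding P_def by fastforce
  then obtain f where f: "\<And>w. w \<in> W \<Longrightarrow> f w \<in> F" "\<And>w. w \<in> W \<Longrightarrow> dist (f w) w < h" by metis
  have "inj_on f W"
  proof (rule inj_onI, rule ccontr)
   fix w w' assume w: "w \<in> W" "w' \<in> W" "f w = f w'" "w \<noteq> w'"
   have "dist w w' \<le> dist (f w) w + dist (f w) w'" by (rule dist_triangle3)
   also have "\<dots> < 2 * h" using f(2)[OF w(1)] f(2)[OF w(2)] w(3) by simp
   finally show False using W w unfolding P_def by force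
  qed
  then have "card W \<le> card F" using f(1) F(1) by (intro card_inj_on_le) auto
  then show ?thesis by simp
 qed
 have "P {}" by (simp add: P_def)
 moreover have "\<forall>W. P W \<longrightarrow> card W < Suc (card F)" using card by blast
 ultimately have "\<exists>W. P W \<and> (\<forall>W'. P W' \<longrightarrow> card W' \<le> card W)" by (rule ex_has_greatest_nat)
 then obtain W where W: "P W" "\<And>W'. P W' \<Longrightarrow> card W' \<le> card W" by blast
 have "\<exists>w\<in>W. dist w z < 2 * h" if z: "z \<in> K" for z
 proof (rule ccontr)
  assume *: "\<not> (\<exists>w\<in>W. dist w z < 2 * h)"
  then have "z \<notin> W" using h by auto
  moreover have "P (insert z W)" using W(1) * z unfolding P_def by (auto simp: dist_commute not_less)
  ultimately show False using W(2)[of "insert z W"] W(1) by (simp add: P_def)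
 qed
 with W(1) show ?thesis unfolding P_def by (intro that[of W]) auto
qed

text \<open>Balls of radius \<open>2 \<eta>\<close> around a maximal \<open>2 \<eta>\<close>-separated set cover, and those of radius \<open>\<eta>\<close> are disjoint.\<close>

lemma compact_measure_comparison:
 fixes \<mu>1 \<mu>2 :: "'a::metric_space measure"
 assumes sets1: "sets \<mu>1 = sets borel" and sets2: "sets \<mu>2 = sets borel" and K: "compact K" and h0: "0 < h0"
  and fin: "\<And>x r. emeasure \<mu>2 (ball x r) < \<infinity>"
  and comp: "\<And>z h. z \<in> K \<Longrightarrow> 0 < h \<Longrightarrow> h \<le> h0 \<Longrightarrow> emeasure \<mu>1 (ball z (2 * h)) \<le> ennreal c * emeasure \<mu>2 (ball z h)"
 shows "emeasure \<mu>1 K \<le> ennreal c * emeasure \<mu>2 K"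
proof (cases "K = {}")
 case False
 \<comment> \<open>The disjoint balls stay in this neighbourhood of \<open>K\<close>. Its measure
   decreases to that of \<open>K\<close> as \<open>h\<close> tends to 0, because \<mu>2 is finite on
   balls.\<close>
 define N where "N h = {z. infdist z K < h}" for h
 have Nb: "N h \<in> sets borel" for h unfolding N_def by (intro borel_open open_Collect_less continuous_intros)
 have bound: "emeasure \<mu>1 K \<le> ennreal c * emeasure \<mu>2 (N h)" if h: "0 < h" "h \<le> h0" for h
 proof -
  obtain W where W: "finite W" "W \<subseteq> K" "\<And>w w'. w \<in> W \<Longrightarrow> w' \<in> W \<Longrightarrow> w \<noteq> w' \<Longrightarrow> 2 * h \<le> dist w w'"
   "\<And>z. z \<in> K \<Longrightarrow> \<exists>w\<in>W. dist w z < 2 * h"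
   by (rule maximal_separated_subset[OF K h(1)]) (rule that)
  have U: "(\<Union>w\<in>W. ball w d) \<in> sets borel" for d by (intro borel_open open_UN ballI open_ball)
  have "K \<subseteq> (\<Union>w\<in>W. ball w (2 * h))" using W(4) by fastforce
  then have "emeasure \<mu>1 K \<le> emeasure \<mu>1 (\<Union>w\<in>W. ball w (2 * h))"
   using U by (intro emeasure_mono) (simp_all add: sets1)
  also have "\<dots> \<le> (\<Sum>w\<in>W. emeasure \<mu>1 (ball w (2 * h)))"
   using W(1) by (intro emeasure_subadditive_finite) (auto simp: sets1)
  also have "\<dots> \<le> (\<Sum>w\<in>W. ennreal c * emeasure \<mu>2 (ball w h))" using W(2) h by (intro sum_mono comp) auto
  also have "\<dots> = ennreal c * (\<Sum>w\<in>W. emeasure \<mu>2 (ball w h))" by (rule sum_distrib_left[symmetric])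
  also have "(\<Sum>w\<in>W. emeasure \<mu>2 (ball w h)) = emeasure \<mu>2 (\<Union>w\<in>W. ball w h)"
  proof (rule sum_emeasure)
   show "disjoint_family_on (\<lambda>w. ball w h) W"
    unfolding disjoint_family_on_def
   proof (intro ballI impI)
    fix w w' assume w: "w \<in> W" "w' \<in> W" "w \<noteq> w'"
    have "dist w z + dist w' z \<ge> 2 * h" for z using W(3)[OF w] dist_triangle2[of w w' z] by simp
    then have "\<not> (dist w z < h \<and> dist w' z < h)" for z by (metis add_strict_mono mult_2 not_less)
    then show "ball w h \<inter> ball w' h = {}" by auto
   qed
  qed (use W(1) in \<open>auto simp: sets2\<close>)
  also have "ennreal c * \<dots> \<le> ennreal c * emeasure \<mu>2 (N h)"
  proof (intro mult_left_mono emeasure_mono)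
   show "(\<Union>w\<in>W. ball w h) \<subseteq> N h"
    using W(2) by (auto simp: N_def dist_commute intro: le_less_trans[OF infdist_le])
  qed (use Nb in \<open>simp_all add: sets2\<close>)
  finally show ?thesis .
 qed
 let ?N = "\<lambda>n. N (h0 / real (Suc n))"
 have "(\<lambda>n. emeasure \<mu>2 (?N n)) \<longlonglongrightarrow> emeasure \<mu>2 (\<Inter>n. ?N n)"
 proof (rule Lim_emeasure_decseq)
  show "range ?N \<subseteq> sets \<mu>2" using Nb by (auto simp: sets2)
  show "decseq ?N"
   unfolding decseq_def N_def
  proof (intro allI impI subsetI CollectI)
   fix i j :: nat and z assume "i \<le> j" "z \<in> {z. infdist z K < h0 / real (Suc j)}"
   moreover have "h0 / real (Suc j) \<le> h0 / real (Suc i)" using h0 \<open>i \<le> j\<close> by (intro divide_left_mono) auto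
   ultimately show "infdist z K < h0 / real (Suc i)" by simp
  qed
  obtain x d where x: "K \<subseteq> ball x d" using bounded_subset_ballD[OF compact_imp_bounded[OF K]] by blast
  have "?N n \<subseteq> ball x (d + h0)" for n
  proof
   fix z assume z: "z \<in> ?N n"
   have "h0 / real (Suc n) \<le> h0 / 1" using h0 by (intro divide_left_mono) auto
   then have "Inf (dist z ` K) < h0" using z infdist_notempty[OF False, of z] by (simp add: N_def)
   then obtain w where w: "w \<in> K" "dist z w < h0" using cInf_lessD[of "dist z ` K" h0] False by blast
   moreover have "dist x w < d" using x w(1) by auto
   ultimately show "z \<in> ball x (d + h0)" using dist_triangle[of x z w] by (simp add: dist_commute)
  qed
  then have "emeasure \<mu>2 (?N n) \<le> emeasure \<mu>2 (ball x (d + h0))" for n by (intro emeasure_mono) (simp_all add: sets2)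
  then show "emeasure \<mu>2 (?N n) \<noteq> \<infinity>" for n using fin[of x "d + h0"] by (metis infinity_ennreal_def leD less_top)
 qed
 also have "(\<Inter>n. ?N n) = K"
 proof
  show "K \<subseteq> (\<Inter>n. ?N n)" using h0 by (auto simp: N_def)
  show "(\<Inter>n. ?N n) \<subseteq> K"
  proof
   fix z assume z: "z \<in> (\<Inter>n. ?N n)"
   have "infdist z K \<le> 0"
   proof (rule LIMSEQ_le_const)
    show "(\<lambda>n. h0 / real (Suc n)) \<longlonglongrightarrow> 0"
     using tendsto_mult_right_zero[OF LIMSEQ_inverse_real_of_nat, of h0] by (simp add: divide_inverse)
    show "\<exists>N. \<forall>n\<ge>N. infdist z K \<le> h0 / real (Suc n)" using z by (auto simp: N_def intro: less_imp_le)
   qed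
   then have "infdist z K = 0" using infdist_nonneg[of z K] by simp
   then show "z \<in> K" using in_closed_iff_infdist_zero[OF compact_imp_closed[OF K] False] by simp
  qed
 qed
 finally have "(\<lambda>n. ennreal c * emeasure \<mu>2 (?N n)) \<longlonglongrightarrow> ennreal c * emeasure \<mu>2 K"
  by (intro ennreal_tendsto_cmult) auto
 then show ?thesis
 proof (rule LIMSEQ_le_const)
  have "emeasure \<mu>1 K \<le> ennreal c * emeasure \<mu>2 (?N n)" for n
  proof (rule bound)
   have "h0 / real (Suc n) \<le> h0 / 1" using h0 by (intro divide_left_mono) auto
   then show "h0 / real (Suc n) \<le> h0" by simp
  qed (use h0 in simp)
  then show "\<exists>M. \<forall>n\<ge>M. emeasure \<mu>1 K \<le> ennreal c * emeasure \<mu>2 (?N n)" by blast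
 qed
qed simp

context length_space
begin

text \<open>A priori \<nu> may be infinite on balls. On a single arc it is finite, and inner
  regularity of Lebesgue measure on the parameter interval is transported by
  \<open>q\<close>.\<close>

lemma nu_arc_inner_regular:
 assumes q: "arc q d" and E: "E \<in> sets borel" "E \<subseteq> q ` {0<..<d}"
  and le: "\<And>K. compact K \<Longrightarrow> K \<subseteq> E \<Longrightarrow> emeasure \<nu> K \<le> c"
 shows "emeasure \<nu> E \<le> c"
proof -
 let ?L = "density lborel (indicator {0<..<d}) :: real measure"
 let ?E = "{s \<in> {0<..<d}. q s \<in> E}"
 have L: "emeasure ?L X = emeasure lborel X" if "X \<in> sets borel" "X \<subseteq> {0<..<d}" for X
 proof -
  have "emeasure ?L X = (\<integral>\<^sup>+s. indicator {0<..<d} s * indicator X s \<partial>lborel)" using that by (intro emeasure_density) auto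
  also have "\<dots> = (\<integral>\<^sup>+s. indicator X s \<partial>lborel)" using that(2) by (intro nn_integral_cong) (auto split: split_indicator)
  also have "\<dots> = emeasure lborel X" using that by (intro nn_integral_indicator) auto
  finally show ?thesis .
 qed
 have E': "?E \<in> sets borel" using nu_arc_subset(1)[OF q E] by simp
 have fin: "emeasure ?L (space ?L) \<noteq> \<infinity>"
 proof -
  have "emeasure ?L (space ?L) = emeasure lborel {0<..<d}" by (subst emeasure_density) auto
  also have "\<dots> = ennreal d" using q by (simp add: arc_def)
  finally show ?thesis by simp
 qed
 have "emeasure \<nu> E = emeasure ?L ?E" unfolding nu_arc_subset(2)[OF q E] using E' by (intro L[symmetric]) auto
 also have "\<dots> = (SUP K\<in>{K. K \<subseteq> ?E \<and> compact K}. emeasure ?L K)"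
  by (rule inner_regular[OF _ fin E']) simp
 also have "\<dots> \<le> c"
 proof (rule SUP_least)
  fix X assume "X \<in> {K. K \<subseteq> ?E \<and> compact K}"
  then have X: "X \<subseteq> ?E" "compact X" by auto
  have cK: "compact (q ` X)"
   using X by (intro compact_continuous_image continuous_on_subset[OF arc_continuous_on[OF q]]) auto
  have inj: "inj_on q {0..d}" using q by (auto simp: arc_def intro: isometric_embedding_inj_on)
  have "{s \<in> {0<..<d}. q s \<in> q ` X} = X"
   using X(1) inj_onD[OF inj] by force
  then have "emeasure ?L X = emeasure \<nu> (q ` X)"
   using X cK by (subst nu_arc_subset(2)[OF q]) (auto intro!: L borel_compact)
  also have "\<dots> \<le> c" using cK X by (intro le) auto
  finally show "emeasure ?L X \<le> c" .
 qed
 finally show ?thesis .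
qed

end

section \<open>From comparable balls to comparable measures\<close>

locale linear_volume_space = vol_space \<iota> e ty \<nu> \<gamma> l m V C
 for \<iota> e and ty :: "'a::{metric_space, second_countable_topology} itself"
  and \<nu> \<gamma> l m V C +
 fixes B r1 :: real
 assumes radon: "radon_measure m" and B_pos: "0 < B" and r1_pos: "0 < r1"
  and ball_linear_lower: "\<And>(z::'a) r. 0 < r \<Longrightarrow> r \<le> r1 \<Longrightarrow> ennreal (r / B) \<le> emeasure m (ball z r)"
  and ball_linear_upper: "\<And>(z::'a) r. 0 < r \<Longrightarrow> r \<le> r1 \<Longrightarrow> emeasure m (ball z r) \<le> ennreal (B * r)"
begin

text \<open>The length of the part on one arc as a finite Borel measure on the whole space, the form
  in which it can be compared with \<open>m\<close> on balls.\<close>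

definition arc_measure :: "(real \<Rightarrow> 'a) \<Rightarrow> real \<Rightarrow> 'a measure" where
 "arc_measure q d = distr (RL d) borel q"

lemma emeasure_arc_measure:
 assumes "arc q d" "X \<in> sets borel"
 shows "emeasure (arc_measure q d) X = emeasure \<nu> (X \<inter> q ` {0<..<d})"
  "emeasure (arc_measure q d) X = emeasure lborel {s \<in> {0<..<d}. q s \<in> X}"
proof -
 have Xb: "X \<inter> q ` {0<..<d} \<in> sets borel" using assms arc_open_borel[of q d 0 d] by auto
 have S: "q -` X \<inter> space (RL d) = {s \<in> {0<..<d}. q s \<in> X \<inter> q ` {0<..<d}}" by (auto simp: space_RL)
 have "emeasure (arc_measure q d) X = emeasure (RL d) (q -` X \<inter> space (RL d))"
  unfolding arc_measure_def by (rule emeasure_distr[OF arc_measurable_borel[OF assms(1)] assms(2)])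
 also have "\<dots> = emeasure lborel {s \<in> {0<..<d}. q s \<in> X \<inter> q ` {0<..<d}}"
  unfolding S by (rule emeasure_restrict_space) auto
 finally have *: "emeasure (arc_measure q d) X = emeasure lborel {s \<in> {0<..<d}. q s \<in> X \<inter> q ` {0<..<d}}" .
 then show "emeasure (arc_measure q d) X = emeasure \<nu> (X \<inter> q ` {0<..<d})"
  using nu_arc_subset(2)[OF assms(1) Xb] by simp
 have "{s \<in> {0<..<d}. q s \<in> X \<inter> q ` {0<..<d}} = {s \<in> {0<..<d}. q s \<in> X}" by auto
 with * show "emeasure (arc_measure q d) X = emeasure lborel {s \<in> {0<..<d}. q s \<in> X}" by simp
qed

lemma sets_arc_measure: "sets (arc_measure q d) = sets borel"
 by (simp add: arc_measure_def)

text \<open>A ball of radius \<open>2 * h\<close> contains at most length \<open>4 * h\<close> of a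
  single arc, while \<open>m\<close> gives the ball of radius \<open>h\<close> at least
  \<open>h / B\<close>.\<close>

lemma nu_le_m_compact:
 assumes q: "arc q d" and K: "compact K" "K \<subseteq> q ` {0<..<d}"
 shows "emeasure \<nu> K \<le> ennreal (4 * B) * emeasure m K"
proof -
 have Kb: "K \<in> sets borel" by (rule borel_compact[OF K(1)])
 have "emeasure (arc_measure q d) K \<le> ennreal (4 * B) * emeasure m K"
 proof (rule compact_measure_comparison[OF sets_arc_measure sets_m K(1) r1_pos ball_finite])
  fix z h assume z: "z \<in> K" and h: "0 < h" "h \<le> r1"
  obtain s0 where s0: "s0 \<in> {0<..<d}" "z = q s0" using z K by auto
  have sub: "{s \<in> {0<..<d}. q s \<in> ball z (2 * h)} \<subseteq> {s0 - 2 * h<..<s0 + 2 * h}"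
  proof
   fix s assume s: "s \<in> {s \<in> {0<..<d}. q s \<in> ball z (2 * h)}"
   then have "\<bar>s0 - s\<bar> < 2 * h" using arc_dist[OF q, of s0 s] s0 by auto
   then show "s \<in> {s0 - 2 * h<..<s0 + 2 * h}" by auto
  qed
  have "emeasure (arc_measure q d) (ball z (2 * h)) = emeasure lborel {s \<in> {0<..<d}. q s \<in> ball z (2 * h)}"
   by (rule emeasure_arc_measure(2)[OF q]) simp
  also have "\<dots> \<le> emeasure lborel {s0 - 2 * h<..<s0 + 2 * h}" by (rule emeasure_mono[OF sub]) simp
  also have "\<dots> = ennreal (4 * B) * ennreal (h / B)" using h B_pos by (simp flip: ennreal_mult)
  also have "\<dots> \<le> ennreal (4 * B) * emeasure m (ball z h)" by (intro mult_left_mono ball_linear_lower h) simp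
  finally show "emeasure (arc_measure q d) (ball z (2 * h)) \<le> ennreal (4 * B) * emeasure m (ball z h)" .
 qed
 moreover have "K \<inter> q ` {0<..<d} = K" using K by auto
 ultimately show ?thesis using emeasure_arc_measure(1)[OF q Kb] by simp
qed

text \<open>The upper bound on \<open>m\<close> covers the whole ball, side branches included,
  whereas the arc alone supplies enough length provided it continues on both sides of the centre.
  Compactness keeps \<open>K\<close> at a positive distance \<open>h z0\<close> from the
  ends.\<close>

lemma m_le_nu_compact:
 assumes q: "arc q d" and K: "compact K" "K \<subseteq> q ` {0<..<d}"
 shows "emeasure m K \<le> ennreal (2 * B) * emeasure \<nu> K"
proof (cases "K = {}")
 case False
 have Kb: "K \<in> sets borel" by (rule borel_compact[OF K(1)])
 define h where "h z = min (dist (q 0) z) (d - dist (q 0) z)" for z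
 have "continuous_on K h" unfolding h_def by (intro continuous_intros)
 from continuous_attains_inf[OF K(1) False this] obtain z0 where z0: "z0 \<in> K" "\<And>z. z \<in> K \<Longrightarrow> h z0 \<le> h z" by blast
 have hs: "h (q s) = min s (d - s)" if "s \<in> {0<..<d}" for s using arc_inverse[OF q, of s] that by (simp add: h_def)
 have h0: "0 < h z0"
 proof -
  obtain s where "s \<in> {0<..<d}" "z0 = q s" using z0(1) K by auto
  then show ?thesis using hs[of s] by simp
 qed
 define j0 where "j0 = min (r1 / 2) (h z0)"
 have "emeasure m K \<le> ennreal (2 * B) * emeasure (arc_measure q d) K"
 proof (rule compact_measure_comparison[OF sets_m sets_arc_measure K(1)])
  show "0 < j0" using h0 r1_pos by (simp add: j0_def)
  fix x r
  have "emeasure (arc_measure q d) (ball x r) \<le> emeasure lborel {0<..<d}"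
   by (subst emeasure_arc_measure(2)[OF q]) (auto intro: emeasure_mono)
  also have "\<dots> < \<infinity>" using q by (simp add: arc_def)
  finally show "emeasure (arc_measure q d) (ball x r) < \<infinity>" .
 next
  fix z j assume z: "z \<in> K" and j: "0 < j" "j \<le> j0"
  obtain s0 where s0: "s0 \<in> {0<..<d}" "z = q s0" using z K by auto
  have "j \<le> min s0 (d - s0)" using z0(2)[OF z] hs[OF s0(1)] j by (simp add: s0 j0_def)
  then have s: "j \<le> s0" "j \<le> d - s0" by auto
  have sub: "{s0 - j<..<s0 + j} \<subseteq> {s \<in> {0<..<d}. q s \<in> ball z j}"
  proof
   fix t assume t: "t \<in> {s0 - j<..<s0 + j}"
   then have t0: "t \<in> {0<..<d}" using s by auto
   have "\<bar>s0 - t\<bar> < j" using t by auto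
   then show "t \<in> {s \<in> {0<..<d}. q s \<in> ball z j}" using arc_dist[OF q, of s0 t] s0 t0 by simp
  qed
  have "emeasure m (ball z (2 * j)) \<le> ennreal (B * (2 * j))"
   using j by (intro ball_linear_upper) (auto simp: j0_def)
  also have "\<dots> = ennreal B * emeasure lborel {s0 - j<..<s0 + j}" using j B_pos by (simp flip: ennreal_mult)
  also have "\<dots> \<le> ennreal B * emeasure (arc_measure q d) (ball z j)"
   unfolding emeasure_arc_measure(2)[OF q borel_open[OF open_ball]]
  proof (intro mult_left_mono emeasure_mono sub)
   have "{s \<in> {0<..<d}. q s \<in> ball z j} \<in> sets borel" using arc_preimage_open[OF q open_ball] by (rule borel_open)
   then show "{s \<in> {0<..<d}. q s \<in> ball z j} \<in> sets lborel" by simp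
  qed simp
  also have "\<dots> \<le> ennreal (2 * B) * emeasure (arc_measure q d) (ball z j)" using B_pos by (intro mult_right_mono ennreal_leI) auto
  finally show "emeasure m (ball z (2 * j)) \<le> ennreal (2 * B) * emeasure (arc_measure q d) (ball z j)" .
 qed
 moreover have "K \<inter> q ` {0<..<d} = K" using K by auto
 ultimately show ?thesis using emeasure_arc_measure(1)[OF q Kb] by simp
qed simp

lemma m_inner_regular:
 assumes "E \<in> sets borel" "\<And>K. compact K \<Longrightarrow> K \<subseteq> E \<Longrightarrow> emeasure m K \<le> c"
 shows "emeasure m E \<le> c"
proof -
 have "emeasure m E = (SUP K\<in>{K. compact K \<and> K \<subseteq> E}. emeasure m K)" using radon assms(1) by (simp add: radon_measure_def)
 also have "\<dots> \<le> c" by (rule SUP_least) (use assms(2) in auto)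
 finally show ?thesis .
qed

text \<open>Every small ball contains a segment of length comparable to its radius, which by the
  comparison on arcs carries a definite part of the mass of the ball. So \<open>m\<close> is
  dominated on balls by its restriction to the skeleton, hence on compact sets, and a compact set
  off the skeleton is null.\<close>

lemma m_skeleton_null: "emeasure m (- S) = 0"
proof -
 have Sb: "- S \<in> sets borel" using skeleton_borel by auto
 let ?\<mu> = "density m (indicator S)"
 have mu: "emeasure ?\<mu> X = emeasure m (X \<inter> S)" if "X \<in> sets borel" for X
 proof -
  have "emeasure ?\<mu> X = (\<integral>\<^sup>+z. indicator S z * indicator X z \<partial>m)"
   using that skeleton_borel by (intro emeasure_density borel_measurable_indicator) (simp_all add: sets_m)
  also have "\<dots> = (\<integral>\<^sup>+z. indicator (X \<inter> S) z \<partial>m)" by (intro nn_integral_cong) (auto split: split_indicator)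
  also have "\<dots> = emeasure m (X \<inter> S)" using that skeleton_borel by (intro nn_integral_indicator) (auto simp: sets_m)
  finally show ?thesis .
 qed
 have "emeasure m (- S) \<le> 0"
 proof (rule m_inner_regular[OF Sb])
  fix K assume K: "compact K" "K \<subseteq> - S"
  have "emeasure m K \<le> ennreal (32 * B\<^sup>2) * emeasure ?\<mu> K"
  proof (rule compact_measure_comparison[OF sets_m _ K(1)])
   show "sets ?\<mu> = sets borel" by (simp add: sets_m)
   show "0 < min (r1 / 2) (e / 2)" using r1_pos e_pos by simp
   show "emeasure ?\<mu> (ball x r) < \<infinity>" for x r
   proof -
    have "emeasure ?\<mu> (ball x r) \<le> emeasure m (ball x r)"
     unfolding mu[OF borel_open[OF open_ball]] by (intro emeasure_mono) (auto simp: sets_m)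
    then show ?thesis using ball_finite[of x r] by (rule le_less_trans)
   qed
   fix z d assume "z \<in> K" and d: "0 < d" "d \<le> min (r1 / 2) (e / 2)"
   obtain y where y: "dist z y = d" using point_at_distance[of d z] d by auto
   obtain h where h: "geodesic h z y" using geodesic_exists ..
   have q: "arc h d" using geodesic_arc[OF h] y d by auto
   \<comment> \<open>The middle half of the segment: compact, and away from both ends, which may lie
     outside the skeleton.\<close>
   let ?K = "h ` {d / 4..3 * d / 4}"
   have cK: "compact ?K"
    by (intro compact_continuous_image continuous_on_subset[OF arc_continuous_on[OF q]]) (use d in auto)
   have sub: "?K \<subseteq> h ` {0<..<d}" using d by auto
   have "ennreal (d / 2) = emeasure \<nu> ?K" using nu_closed_subarc(2)[OF q, of "d / 4" "3 * d / 4"] d by simp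
   also have "\<dots> \<le> ennreal (4 * B) * emeasure m ?K" by (rule nu_le_m_compact[OF q cK sub])
   also have "\<dots> \<le> ennreal (4 * B) * emeasure ?\<mu> (ball z d)"
    unfolding mu[OF borel_open[OF open_ball]]
   proof (intro mult_left_mono emeasure_mono)
    show "?K \<subseteq> ball z d \<inter> S"
    proof (intro subsetI IntI)
     fix w assume "w \<in> ?K"
     then obtain s where s: "s \<in> {d / 4..3 * d / 4}" "w = h s" by blast
     have "dist z w = s" using geodesic_dist(1)[OF h, of s] s y d by auto
     then show "w \<in> ball z d" using s d by auto
     show "w \<in> S" unfolding s(2) by (rule arc_in_skeleton[OF q]) (use s d in auto)
    qed
   qed (use skeleton_borel in \<open>simp_all add: sets_m\<close>)
   finally have *: "ennreal (d / 2) \<le> ennreal (4 * B) * emeasure ?\<mu> (ball z d)" .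
   have "emeasure m (ball z (2 * d)) \<le> ennreal (B * (2 * d))" using d by (intro ball_linear_upper) auto
   also have "\<dots> = ennreal (4 * B) * ennreal (d / 2)" using d B_pos by (simp flip: ennreal_mult)
   also have "\<dots> \<le> ennreal (4 * B) * (ennreal (4 * B) * emeasure ?\<mu> (ball z d))" by (intro mult_left_mono *) simp
   also have "\<dots> = ennreal (16 * B\<^sup>2) * emeasure ?\<mu> (ball z d)"
    using B_pos by (simp add: power2_eq_square mult.assoc[symmetric] flip: ennreal_mult)
   also have "\<dots> \<le> ennreal (32 * B\<^sup>2) * emeasure ?\<mu> (ball z d)" by (intro mult_right_mono ennreal_leI) auto
   finally show "emeasure m (ball z (2 * d)) \<le> ennreal (32 * B\<^sup>2) * emeasure ?\<mu> (ball z d)" .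
  qed
  also have "emeasure ?\<mu> K = emeasure m (K \<inter> S)" by (rule mu[OF borel_compact[OF K(1)]])
  also have "K \<inter> S = {}" using K by auto
  finally show "emeasure m K \<le> 0" by simp
 qed
 then show ?thesis by simp
qed

text \<open>The disjoint pieces cut the skeleton into countably many parts of single charts. On
  each, the compact case and inner regularity compare the measures with a constant independent of
  the chart, so the inequalities can be summed; the complement of the skeleton is null for
  both.\<close>

lemma measures_comparable:
 assumes A: "A \<in> sets borel"
 shows "emeasure \<nu> (A \<inter> S) \<le> ennreal (4 * B) * emeasure m A" "emeasure m A \<le> ennreal (4 * B) * emeasure \<nu> (A \<inter> S)"
proof -
 let ?A = "\<lambda>n. A \<inter> piece n"
 have Ab: "?A n \<in> sets borel" for n using A piece_sets by auto
 have sub: "?A n \<subseteq> \<gamma> n ` {0<..<l n}" for n by (auto simp: piece_def)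
 have subS: "?A n \<subseteq> S" for n using sub[of n] by (auto simp: skeleton_eq)
 have un: "A \<inter> S = (\<Union>n. ?A n)"
 proof
  show "A \<inter> S \<subseteq> (\<Union>n. ?A n)" by (auto elim!: skeleton_piece)
 qed (use subS in auto)
 have disj: "disjoint_family ?A" unfolding disjoint_family_on_def using piece_disjoint by blast
 have nu_sum: "emeasure \<nu> (A \<inter> S) = (\<Sum>n. emeasure \<nu> (?A n))"
  unfolding un using Ab subS by (intro suminf_emeasure[symmetric] disj) (auto simp: sets_nu)
 have m_sum: "emeasure m (A \<inter> S) = (\<Sum>n. emeasure m (?A n))"
  unfolding un using Ab by (intro suminf_emeasure[symmetric] disj) (auto simp: sets_m)
 have m_eq: "emeasure m A = emeasure m (A \<inter> S)"
 proof (rule emeasure_eq_AE)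
  have "- S \<in> null_sets m" using m_skeleton_null skeleton_borel by (auto simp: null_sets_def sets_m)
  then have "AE x in m. x \<notin> - S" by (rule AE_not_in)
  then show "AE x in m. x \<in> A \<longleftrightarrow> x \<in> A \<inter> S" by eventually_elim auto
 qed (use A skeleton_borel in \<open>auto simp: sets_m\<close>)
 have nu_m: "emeasure \<nu> (?A n) \<le> ennreal (4 * B) * emeasure m (?A n)" for n
 proof (rule nu_arc_inner_regular[OF arc_chart Ab sub])
  fix K assume K: "compact K" "K \<subseteq> ?A n"
  have "emeasure \<nu> K \<le> ennreal (4 * B) * emeasure m K" by (rule nu_le_m_compact[OF arc_chart K(1)]) (use K sub in blast)
  also have "\<dots> \<le> ennreal (4 * B) * emeasure m (?A n)" using K Ab by (intro mult_left_mono emeasure_mono) (simp_all add: sets_m)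
  finally show "emeasure \<nu> K \<le> ennreal (4 * B) * emeasure m (?A n)" .
 qed
 have m_nu: "emeasure m (?A n) \<le> ennreal (4 * B) * emeasure \<nu> (?A n)" for n
 proof (rule m_inner_regular[OF Ab])
  fix K assume K: "compact K" "K \<subseteq> ?A n"
  have "emeasure m K \<le> ennreal (2 * B) * emeasure \<nu> K" by (rule m_le_nu_compact[OF arc_chart K(1)]) (use K sub in blast)
  also have "\<dots> \<le> ennreal (4 * B) * emeasure \<nu> (?A n)"
   using K Ab subS B_pos by (intro mult_mono emeasure_mono ennreal_leI) (simp_all add: sets_nu)
  finally show "emeasure m K \<le> ennreal (4 * B) * emeasure \<nu> (?A n)" .
 qed
 show "emeasure \<nu> (A \<inter> S) \<le> ennreal (4 * B) * emeasure m A"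
  unfolding m_eq nu_sum m_sum ennreal_suminf_cmult[symmetric] using nu_m by (intro suminf_le) auto
 show "emeasure m A \<le> ennreal (4 * B) * emeasure \<nu> (A \<inter> S)"
  unfolding m_eq nu_sum m_sum ennreal_suminf_cmult[symmetric] using m_nu by (intro suminf_le) auto
qed

end

theorem theorem1p5:
 fixes \<iota> :: ereal
  and \<nu> m :: "'a::{metric_space, second_countable_topology} measure"
  and \<gamma> :: "nat \<Rightarrow> real \<Rightarrow> 'a" and l :: "nat \<Rightarrow> real"
  and V \<Psi> :: "real \<Rightarrow> real"
  and Q :: "'a operator"
  and P :: "real \<Rightarrow> ('a \<Rightarrow> real) \<Rightarrow> 'a \<Rightarrow> real"
  and p :: "real \<Rightarrow> 'a \<Rightarrow> 'a \<Rightarrow> real"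
  and R :: "('a \<Rightarrow> real) \<Rightarrow> 'a \<Rightarrow> real"
 assumes unbounded: "\<not> bounded (UNIV :: 'a set)"
  and proper: "proper_space TYPE('a)"
  and geodesic: "geodesic_space TYPE('a)"
  and tree: "uniform_local_tree TYPE('a) \<iota>"
  and length_measure: "is_length_measure \<iota> \<nu>"
  and orientation: "orientation \<iota> \<gamma> l"
  and radon: "radon_measure m"
  and volume: "UVG m V"
  and sqrt_operator: "is_sqrt_operator m (neg_operator (laplacian \<iota> \<nu> \<gamma> l m)) Q"
  and semigroup: "is_semigroup_of m (laplacian \<iota> \<nu> \<gamma> l m) P"
  and heat_kernel: "is_heat_kernel m P p"
  and riesz_transform: "is_riesz_transform \<iota> \<nu> \<gamma> l m Q R"
  and scale: "scale_function \<Psi>"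
  and hke: "HKE m p \<Psi>"
  and riesz: "(\<exists>q. 1 < q \<and> q < 2 \<and> Riesz_inequality m \<nu> R q) \<or>
        (\<exists>q>2. reverse_Riesz_inequality \<iota> \<nu> \<gamma> l m Q q)"
 shows "\<exists>r0>0. \<exists>C>1.
      (\<forall>r. 0 < r \<and> r \<le> r0 \<longrightarrow>
       r / C \<le> V r \<and> V r \<le> C * r \<and> r\<^sup>2 / C \<le> \<Psi> r \<and> \<Psi> r \<le> C * r\<^sup>2) \<and>
      (\<forall>A\<in>sets borel.
       ennreal (1 / C) * emeasure \<nu> (A \<inter> skeleton \<iota>) \<le> emeasure m A \<and>
       emeasure m A \<le> ennreal C * emeasure \<nu> (A \<inter> skeleton \<iota>))"
proof -
 obtain e where e: "0 < e" "ereal e \<le> \<iota>"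
 proof -
  have "0 < \<iota>" using tree by (simp add: uniform_local_tree_def)
  from ereal_dense2[OF this] obtain z where "0 < ereal z" "ereal z < \<iota>" by blast
  then show ?thesis by (intro that[of z]) auto
 qed
 obtain C where C: "1 \<le> C" and UVG: "\<And>r. 0 < r \<Longrightarrow> 0 < V r / C" "\<And>r. 0 < r \<Longrightarrow> V (2 * r) \<le> C * V r"
  "\<And>r x. 0 < r \<Longrightarrow> ennreal (V r / C) \<le> emeasure m (ball x r)" "\<And>r x. 0 < r \<Longrightarrow> emeasure m (ball x r) \<le> ennreal (C * V r)"
  and V_mono: "mono_on {0..} V"
  using volume unfolding UVG_def by blast
 have V_pos: "0 < V r" if "0 < r" for r using UVG(1)[OF that] C by (simp add: zero_less_divide_iff)
 have fin: "emeasure m (ball x r) < \<infinity>" for x r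
 proof (cases "0 < r")
  case True
  show ?thesis using UVG(4)[OF True, of x] by (rule le_less_trans) simp
 next
  case False
  then have "ball x r = {}" by simp
  then show ?thesis unfolding \<open>ball x r = {}\<close> by simp
 qed
 have em: "emeasure m (ball x r) = ennreal (measure m (ball x r))" for x r
  using fin[of x r] by (simp add: emeasure_eq_ennreal_measure)
 interpret vol_space \<iota> e "TYPE('a)" \<nu> \<gamma> l m V C
 proof
  show "sets m = sets borel" using radon by (simp add: radon_measure_def)
  show "V r \<le> V R" if "0 < r" "r \<le> R" for r R using mono_onD[OF V_mono, of r R] that by simp
  show "V r / C \<le> measure m (ball x r)" if "0 < r" for x r
   using UVG(3)[OF that, of x] unfolding em by (simp add: ennreal_le_iff)
  show "measure m (ball x r) \<le> C * V r" if "0 < r" for x r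
   using UVG(4)[OF that, of x] V_pos[OF that] C unfolding em by (simp add: ennreal_le_iff)
 qed (fact unbounded proper geodesic tree e length_measure orientation C V_pos UVG(2) fin)+
 have inj: "inj_on \<Psi> {0<..}" and img: "\<Psi> ` {0<..} = {0<..}" and smono: "strict_mono_on {0<..} \<Psi>"
  using scale by (auto simp: scale_function_def bij_betw_def)
 \<comment> \<open>The kernel bounds are given at time t with the radius \<Psi>^-1(t); inserting t =
   \<Psi>(r) expresses them by the radius alone.\<close>
 have inv: "inv_into {0<..} \<Psi> (\<Psi> r) = r" if "0 < r" for r using inv_into_f_f[OF inj, of r] that by simp
 have psi_pos: "0 < \<Psi> r" if "0 < r" for r using img that by blast
 obtain Cs \<beta>1 \<beta>2 where Cs: "1 < Cs" "1 < \<beta>1" "\<And>r R. 0 < r \<Longrightarrow> r \<le> R \<Longrightarrow> (R / r) powr \<beta>1 / Cs \<le> \<Psi> R / \<Psi> r"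
  "\<And>r R. 0 < r \<Longrightarrow> r \<le> R \<Longrightarrow> \<Psi> R / \<Psi> r \<le> Cs * (R / r) powr \<beta>2"
  using scale unfolding scale_function_def by blast
 obtain C1 c2 \<delta> where hk: "0 < C1" "0 < c2" "0 < \<delta>"
  "\<And>t. 0 < t \<Longrightarrow> AE (x, y) in m \<Otimes>\<^sub>M m. p t x y \<le> C1 / measure m (ball x (inv_into {0<..} \<Psi> t)) * exp (- c2 * Phi \<Psi> (dist x y) t)"
  "\<And>t. 0 < t \<Longrightarrow> AE (x, y) in m \<Otimes>\<^sub>M m. dist x y \<le> \<delta> * inv_into {0<..} \<Psi> t \<longrightarrow>
    p t x y \<ge> (1 / C1) / measure m (ball x (inv_into {0<..} \<Psi> t))"
  using hke unfolding HKE_def by blast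
 interpret riesz_space \<iota> e "TYPE('a)" \<nu> \<gamma> l m V C P p \<Psi> C1 c2 \<delta> Cs \<beta>1 \<beta>2 Q R
 proof
  show "\<Psi> r < \<Psi> R" if "0 < r" "r < R" for r R using strict_mono_onD[OF smono, of r R] that by simp
  show "\<exists>r>0. \<Psi> r = t" if "0 < t" for t
  proof -
   have "t \<in> \<Psi> ` {0<..}" using img that by simp
   then show ?thesis by auto
  qed
  show "AE q in m \<Otimes>\<^sub>M m. p (\<Psi> r) (fst q) (snd q) \<le>
    C1 / measure m (ball (fst q) r) * exp (- c2 * Phi \<Psi> (dist (fst q) (snd q)) (\<Psi> r))" if "0 < r" for r
   using hk(4)[OF psi_pos[OF that]] by (simp add: inv[OF that] case_prod_beta)
  show "AE q in m \<Otimes>\<^sub>M m. dist (fst q) (snd q) \<le> \<delta> * r \<longrightarrow>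
    p (\<Psi> r) (fst q) (snd q) \<ge> (1 / C1) / measure m (ball (fst q) r)" if "0 < r" for r
   using hk(5)[OF psi_pos[OF that]] by (simp add: inv[OF that] case_prod_beta)
 qed (fact semigroup heat_kernel hk(1-3) Cs psi_pos sqrt_operator riesz_transform riesz)+
 obtain r1 A where r1: "0 < r1" and A: "0 < A" and scaling:
  "\<And>r. 0 < r \<Longrightarrow> r \<le> r1 \<Longrightarrow> r \<le> A * V r \<and> V r \<le> A * r \<and> r\<^sup>2 \<le> A * \<Psi> r \<and> \<Psi> r \<le> A * r\<^sup>2"
  by (rule volume_scale_small) (rule that)
 interpret linear_volume_space \<iota> e "TYPE('a)" \<nu> \<gamma> l m V C "C * A" r1
 proof
  show "0 < C * A" using A C by simp
  show "ennreal (r / (C * A)) \<le> emeasure m (ball z r)" if "0 < r" "r \<le> r1" for z r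
  proof -
   have "r / (C * A) \<le> V r / C" using scaling[OF that] A C by (simp add: field_simps)
   then show ?thesis using UVG(3)[OF that(1), of z] ennreal_leI order_trans by blast
  qed
  show "emeasure m (ball z r) \<le> ennreal (C * A * r)" if "0 < r" "r \<le> r1" for z r
  proof -
   have "C * V r \<le> C * (A * r)" using scaling[OF that] C by (intro mult_left_mono) auto
   then have "ennreal (C * V r) \<le> ennreal (C * A * r)" by (intro ennreal_leI) (simp add: mult.assoc)
   then show ?thesis using UVG(4)[OF that(1), of z] by (rule order_trans[rotated])
  qed
 qed (fact radon r1)+
 define D where "D = 1 + A + 4 * (C * A)"
 have D: "1 < D" "A \<le> D" "4 * (C * A) \<le> D" using A C by (auto simp: D_def add_pos_pos)
 show ?thesis
 proof (rule exI[of _ r1], rule conjI[OF r1], rule exI[of _ D], intro conjI allI ballI impI D(1))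
  fix r assume "0 < r \<and> r \<le> r1"
  then have r: "0 < r" "r \<le> r1" by auto
  have up: "A * x \<le> D * x" if "0 < x" for x using that D(2) by (intro mult_right_mono) auto
  have "0 < r\<^sup>2" using r by simp
  note up = up[OF V_pos[OF r(1)]] up[OF r(1)] up[OF psi_pos[OF r(1)]] up[OF this]
  have le: "r \<le> D * V r" "V r \<le> D * r" "r\<^sup>2 \<le> D * \<Psi> r" "\<Psi> r \<le> D * r\<^sup>2"
   using scaling[OF r] up by linarith+
  show "r / D \<le> V r" "r\<^sup>2 / D \<le> \<Psi> r" using le(1,3) D(1) by (simp_all add: field_simps)
  show "V r \<le> D * r" "\<Psi> r \<le> D * r\<^sup>2" by (fact le)+
 next
  fix X :: "'a set" assume X: "X \<in> sets borel"
  have le: "ennreal (4 * (C * A)) * x \<le> ennreal D * x" for x by (intro mult_right_mono ennreal_leI D(3)) simp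
  note cmp = measures_comparable[OF X]
  have "ennreal (1 / D) * emeasure \<nu> (X \<inter> S) \<le> ennreal (1 / D) * (ennreal D * emeasure m X)"
   using cmp(1) le by (intro mult_left_mono) (auto intro: order_trans)
  also have "\<dots> = emeasure m X" using D(1) by (simp add: mult.assoc[symmetric] flip: ennreal_mult)
  finally show "ennreal (1 / D) * emeasure \<nu> (X \<inter> S) \<le> emeasure m X" .
  show "emeasure m X \<le> ennreal D * emeasure \<nu> (X \<inter> S)" using cmp(2) le by (rule order_trans)
 qed
qed

end
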